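(* Let $(\mathcal F,\mathcal D,U,\Omega)$ be a (potentially non-unitary) Möbius-covariant Wightman CFT on $S^1$. Then $\mathcal P(I_+)\Omega\subset D(\widetilde V_{i\pi})$. Moreover, if $\varphi_1,\dots,\varphi_k\in\mathcal F$, with $\varphi_j$ of conformal dimension $d_j$, and $f_1,\dots,f_k\in C^\infty(S^1)$ satisfy $\operatorname{supp} f_j\subset I_+$, then $$\widetilde V_{i\pi}\,\varphi_1(f_1)\cdots\varphi_k(f_k)\Omega=(-1)^{\sum_j d_j}\,\varphi_k(f_k\circ z^{-1})\cdots\varphi_1(f_1\circ z^{-1})\Omega,$$ where $f\circ z^{-1}$ denotes the function $z\mapsto f(z^{-1})$ on $S^1$. The same holds with $I_+$ replaced by $I_-$ and $\widetilde V_{i\pi}$ replaced by $\widetilde V_{-i\pi}$.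
   Context: **Wightman CFTs.** $S^1\subset\mathbb C$ is the unit circle and $C^\infty(S^1)$ is the space of complex-valued smooth functions, with the Fréchet topology of the norms $\|f\|_{C^N}=\sum_{j=0}^N\|\frac{d^j}{d\theta^j}f\|_\infty$. An interval is an open, connected, nonempty, non-dense subset of $S^1$. $\mathrm{Mob}=\mathrm{PSU}(1,1)$ is the group of holomorphic automorphisms of the unit disk (acting on $S^1$), and $r_\theta\in\mathrm{Mob}$ is rotation by $\theta$. For $\gamma\in\mathrm{Mob}$ put $X_\gamma(e^{i\theta})=-i\frac{d}{d\theta}\log\gamma(e^{i\theta})$, and for $d\in\mathbb Z_{\ge0}$ put $(\beta_d(\gamma)f)(z)=X_\gamma(\gamma^{-1}(z))^{d-1}f(\gamma^{-1}(z))$. Let $\mathcal D$ be a complex vector space. An operator-valued distribution with domain $\mathcal D$ is a linear map $\varphi$ from $C^\infty(S^1)$ to the linear operators on $\mathcal D$. Let $\mathcal F$ be a set of these. A linear functional $\lambda:\mathcal D\to\mathbb C$ is compatible with $\mathcal F$ if $(f_1,\dots,f_k)\mapsto\lambda(\varphi_1(f_1)\cdots\varphi_k(f_k)\Phi)$ is jointly continuous on $C^\infty(S^1)^k$ for all $k$, $\varphi_j\in\mathcal F$, $\Phi\in\mathcal D$; $\mathcal D_{\mathcal F}^*$ is the space of such functionals. $\mathcal F$ acts regularly if $\mathcal D_{\mathcal F}^*$ separates points of $\mathcal D$. The $\mathcal F$-strong topology on $\mathcal D$ is the finest locally convex topology for which all maps $(f_1,\dots,f_k)\mapsto\varphi_1(f_1)\cdots\varphi_k(f_k)\Phi$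 are jointly continuous; its continuous dual is $\mathcal D_{\mathcal F}^*$. $\mathcal D$ carries this topology, and $\operatorname{End}(\mathcal D)$ denotes the continuous linear operators on $\mathcal D$. A Möbius-covariant Wightman CFT on $S^1$ is $(\mathcal F,\mathcal D,U,\Omega)$ with $\mathcal F$ acting regularly on $\mathcal D$, $U:\mathrm{Mob}\to\operatorname{End}(\mathcal D)$ a representation, $0\ne\Omega\in\mathcal D$, such that: (W1) each $\varphi\in\mathcal F$ has a conformal dimension $d\in\mathbb Z_{\ge0}$ with $U(\gamma)\varphi(f)U(\gamma)^{-1}=\varphi(\beta_d(\gamma)f)$ for all $\gamma,f$; (W2) $\varphi_1(f),\varphi_2(g)$ commute if $f,g$ have disjoint supports, $\varphi_1,\varphi_2\in\mathcal F$; (W3) if $d\in\mathbb Z$, $d<0$ and $U(r_\theta)\Phi=e^{id\theta}\Phi$ for all $\theta$, then $\Phi=0$; (W4) $\Omega$ is $U$-invariant and $\mathcal D$ is algebraically spanned by the vectors $\varphi_1(f_1)\cdots\varphi_k(f_k)\Omega$. For an interval $I$, $\mathcal P(I)\subset\operatorname{End}(\mathcal D)$ is the unital algebra generated by the $\varphi(f)$ with $\varphi\in\mathcal F$, $\operatorname{supp}f\subset I$. Set $I_\pm=\{z\in S^1:\pm\operatorname{Im}z>0\}$. **Analytic continuation.** Let $v_t(z)=\frac{\cosh(t/2)z-\sinh(t/2)}{-\sinh(t/2)z+\cosh(t/2)}\in\mathrm{Mob}$ for $t\in\mathbb R$ and $V_t=U(v_t)$. For $\tau\in\mathbb C$, let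 $\mathbb S_\tau$ be the closed strip bounded by $\mathbb R$ and $\mathbb R+\tau$. The partially defined operator $\widetilde V_\tau$ on $\mathcal D$ has domain $D(\widetilde V_\tau)$ consisting of those $\Phi\in\mathcal D$ for which there is $\Psi\in\mathcal D$ such that for every $\lambda\in\mathcal D_{\mathcal F}^*$ there is a function $G_\lambda:\mathbb S_\tau\to\mathbb C$, continuous on $\mathbb S_\tau$ and holomorphic in its interior, with $G_\lambda(t)=\lambda(V_t\Phi)$ and $G_\lambda(\tau+t)=\lambda(V_t\Psi)$ for all $t\in\mathbb R$. Such $\Psi$ is unique and $\widetilde V_\tau\Phi:=\Psi$. *)

theory Defs
  imports "HOL-Analysis.Analysis"
begin

section \<open>The circle and its Moebius group\<close>

typedef circle = "sphere (0::complex) 1"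
  morphisms of_circle to_circle
  by (rule exI[of _ 1]) simp

setup_lifting type_definition_circle

lift_definition circle_cis :: "real \<Rightarrow> circle" is cis
  by simp

lift_definition circle_inverse :: "circle \<Rightarrow> circle" is inverse
  by (simp add: norm_inverse)

lift_definition rotation :: "real \<Rightarrow> circle \<Rightarrow> circle" is "\<lambda>\<theta> z. cis \<theta> * z"
  by (simp add: norm_mult)

definition moebius :: "complex \<Rightarrow> complex \<Rightarrow> circle \<Rightarrow> circle" where
  "moebius \<alpha> \<beta> z =
     to_circle ((\<alpha> * of_circle z + \<beta>) / (cnj \<beta> * of_circle z + cnj \<alpha>))"

lemma norm_of_circle [simp]: "cmod (of_circle z) = 1"
  using of_circle[of z] by simp

lemma of_circle_moebius:
  assumes "(cmod \<alpha>)\<^sup>2 - (cmod \<beta>)\<^sup>2 = 1"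
  shows "of_circle (moebius \<alpha> \<beta> z) =
    (\<alpha> * of_circle z + \<beta>) / (cnj \<beta> * of_circle z + cnj \<alpha>)"
proof -
  define w where "w = of_circle z"
  have w: "cmod w = 1" by (simp add: w_def)
  then have ww: "w * cnj w = 1" by (simp add: complex_norm_square[symmetric])
  have eq: "w * cnj (\<alpha> * w + \<beta>) = cnj \<beta> * w + cnj \<alpha>"
  proof -
    have "w * cnj (\<alpha> * w + \<beta>) = cnj \<alpha> * (w * cnj w) + cnj \<beta> * w" by (simp add: algebra_simps)
    then show ?thesis by (simp add: ww)
  qed
  then have "cmod (w * cnj (\<alpha> * w + \<beta>)) = cmod (cnj \<beta> * w + cnj \<alpha>)" by simp
  then have n: "cmod (\<alpha> * w + \<beta>) = cmod (cnj \<beta> * w + cnj \<alpha>)"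
    by (simp add: norm_mult w del: complex_cnj_add complex_cnj_mult)
  have "\<alpha> * w + \<beta> \<noteq> 0"
  proof
    assume "\<alpha> * w + \<beta> = 0"
    then have "\<beta> = - (\<alpha> * w)" by (simp add: add_eq_0_iff)
    then have "cmod \<beta> = cmod \<alpha>" by (simp add: norm_mult w)
    with assms show False by simp
  qed
  with n have "(\<alpha> * w + \<beta>) / (cnj \<beta> * w + cnj \<alpha>) \<in> sphere 0 1"
    by (auto simp: norm_divide)
  then show ?thesis
    by (simp add: moebius_def w_def to_circle_inverse)
qed

text \<open>\<open>PSU(1,1)\<close> acts faithfully on the circle, so it is represented as a group of
  self-maps of the circle under composition.\<close>

definition Mob :: "(circle \<Rightarrow> circle) set" where
  "Mob = {moebius \<alpha> \<beta> | \<alpha> \<beta>. (cmod \<alpha>)\<^sup>2 - (cmod \<beta>)\<^sup>2 = 1}"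

definition boost :: "real \<Rightarrow> circle \<Rightarrow> circle" where
  "boost t = moebius (of_real (cosh (t / 2))) (of_real (- sinh (t / 2)))"

text \<open>\<open>X\<^sub>\<gamma>(e\<^sup>i\<^sup>\<theta>) = -i d/d\<theta> log \<gamma>(e\<^sup>i\<^sup>\<theta>)\<close>, with the derivative of the (locally defined) logarithm
  written as a logarithmic derivative; it does not depend on the choice of \<open>\<theta>\<close>.\<close>

definition moebius_X :: "(circle \<Rightarrow> circle) \<Rightarrow> circle \<Rightarrow> complex" where
  "moebius_X \<gamma> z =
     - \<i> * (vector_derivative (\<lambda>\<theta>. of_circle (\<gamma> (circle_cis \<theta>))) (at (Arg (of_circle z)))
            / of_circle (\<gamma> z))"

definition moebius_beta ::
  "nat \<Rightarrow> (circle \<Rightarrow> circle) \<Rightarrow> (circle \<Rightarrow> complex) \<Rightarrow> circle \<Rightarrow> complex" where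
  "moebius_beta d \<gamma> f = (\<lambda>z. moebius_X \<gamma> (inv \<gamma> z) powi (int d - 1) * f (inv \<gamma> z))"


section \<open>Test functions\<close>

definition circle_deriv :: "nat \<Rightarrow> (circle \<Rightarrow> complex) \<Rightarrow> real \<Rightarrow> complex" where
  "circle_deriv n f =
     ((\<lambda>g \<theta>. vector_derivative g (at \<theta>)) ^^ n) (\<lambda>\<theta>. f (circle_cis \<theta>))"

definition smooth_circle :: "(circle \<Rightarrow> complex) set" where
  "smooth_circle = {f. \<forall>n \<theta>. circle_deriv n f differentiable (at \<theta>)}"

definition C_norm :: "nat \<Rightarrow> (circle \<Rightarrow> complex) \<Rightarrow> real" where
  "C_norm N f = (\<Sum>j\<le>N. SUP \<theta>. cmod (circle_deriv j f \<theta>))"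

definition smooth_topology :: "(circle \<Rightarrow> complex) topology" where
  "smooth_topology = topology_generated_by
     {{g \<in> smooth_circle. C_norm N (\<lambda>z. g z - f z) < \<epsilon>} | f N \<epsilon>. f \<in> smooth_circle \<and> \<epsilon> > 0}"

text \<open>The circle is compact, so the closure in the complex plane is the closure in the circle.\<close>

definition circle_supp :: "(circle \<Rightarrow> complex) \<Rightarrow> complex set" where
  "circle_supp f = closure (of_circle ` {z. f z \<noteq> 0})"

definition upper_interval :: "complex set" where
  "upper_interval = {z \<in> sphere 0 1. Im z > 0}"

definition lower_interval :: "complex set" where
  "lower_interval = {z \<in> sphere 0 1. Im z < 0}"


section \<open>Operator-valued distributions\<close>

text \<open>The domain is the whole type \<open>'v\<close>, a complex vector space with scalar multiplication
  \<open>scaleC\<close>. The values of a distribution outside \<^const>\<open>smooth_circle\<close> are irrelevant.\<close>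

type_synonym 'v distribution = "(circle \<Rightarrow> complex) \<Rightarrow> 'v \<Rightarrow> 'v"

definition op_distribution ::
  "(complex \<Rightarrow> 'v::ab_group_add \<Rightarrow> 'v) \<Rightarrow> 'v distribution \<Rightarrow> bool" where
  "op_distribution scaleC \<phi> \<longleftrightarrow>
     (\<forall>f\<in>smooth_circle. Vector_Spaces.linear scaleC scaleC (\<phi> f)) \<and>
     (\<forall>f\<in>smooth_circle. \<forall>g\<in>smooth_circle. \<forall>\<Phi>. \<phi> (\<lambda>z. f z + g z) \<Phi> = \<phi> f \<Phi> + \<phi> g \<Phi>) \<and>
     (\<forall>c. \<forall>f\<in>smooth_circle. \<forall>\<Phi>. \<phi> (\<lambda>z. c * f z) \<Phi> = scaleC c (\<phi> f \<Phi>))"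

text \<open>For \<open>js = [j\<^sub>1, \<dots>, j\<^sub>k]\<close> this is \<open>\<phi>\<^sub>j\<^sub>1(f\<^sub>j\<^sub>1) \<dots> \<phi>\<^sub>j\<^sub>k(f\<^sub>j\<^sub>k) \<Phi>\<close>.\<close>

definition field_product ::
  "(nat \<Rightarrow> 'v distribution) \<Rightarrow> (nat \<Rightarrow> circle \<Rightarrow> complex) \<Rightarrow> nat list \<Rightarrow> 'v \<Rightarrow> 'v" where
  "field_product \<phi> f js \<Phi> = foldr (\<lambda>j. \<phi> j (f j)) js \<Phi>"

definition compatible_dual ::
  "(complex \<Rightarrow> 'v::ab_group_add \<Rightarrow> 'v) \<Rightarrow> 'v distribution set \<Rightarrow> ('v \<Rightarrow> complex) set" where
  "compatible_dual scaleC F = {l. Vector_Spaces.linear scaleC (*) l \<and>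
     (\<forall>k \<phi> \<Phi>. (\<forall>j<k. \<phi> j \<in> F) \<longrightarrow>
        continuous_map (product_topology (\<lambda>_. smooth_topology) {..<k}) euclidean
          (\<lambda>f. l (field_product \<phi> f [0..<k] \<Phi>)))}"

definition acts_regularly ::
  "(complex \<Rightarrow> 'v::ab_group_add \<Rightarrow> 'v) \<Rightarrow> 'v distribution set \<Rightarrow> bool" where
  "acts_regularly scaleC F \<longleftrightarrow>
     (\<forall>\<Phi> \<Psi>. \<Phi> \<noteq> \<Psi> \<longrightarrow> (\<exists>l\<in>compatible_dual scaleC F. l \<Phi> \<noteq> l \<Psi>))"


section \<open>The strong topology\<close>

definition convex_set :: "(complex \<Rightarrow> 'v::ab_group_add \<Rightarrow> 'v) \<Rightarrow> 'v set \<Rightarrow> bool" where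
  "convex_set scaleC C \<longleftrightarrow>
     (\<forall>x\<in>C. \<forall>y\<in>C. \<forall>s\<in>{0..1}. scaleC (of_real (1 - s)) x + scaleC (of_real s) y \<in> C)"

definition locally_convex_topology ::
  "(complex \<Rightarrow> 'v::ab_group_add \<Rightarrow> 'v) \<Rightarrow> 'v topology \<Rightarrow> bool" where
  "locally_convex_topology scaleC T \<longleftrightarrow>
     topspace T = UNIV \<and>
     continuous_map (prod_topology T T) T (\<lambda>(x, y). x + y) \<and>
     continuous_map (prod_topology euclidean T) T (\<lambda>(c, x). scaleC c x) \<and>
     (\<forall>W. openin T W \<and> 0 \<in> W \<longrightarrow> (\<exists>C. convex_set scaleC C \<and> openin T C \<and> 0 \<in> C \<and> C \<subseteq> W))"

definition admissible_topology ::
  "(complex \<Rightarrow> 'v::ab_group_add \<Rightarrow> 'v) \<Rightarrow> 'v distribution set \<Rightarrow> 'v topology \<Rightarrow> bool" where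
  "admissible_topology scaleC F T \<longleftrightarrow>
     locally_convex_topology scaleC T \<and>
     (\<forall>k \<phi> \<Phi>. (\<forall>j<k. \<phi> j \<in> F) \<longrightarrow>
        continuous_map (product_topology (\<lambda>_. smooth_topology) {..<k}) T
          (\<lambda>f. field_product \<phi> f [0..<k] \<Phi>))"

definition strong_topology ::
  "(complex \<Rightarrow> 'v::ab_group_add \<Rightarrow> 'v) \<Rightarrow> 'v distribution set \<Rightarrow> 'v topology" where
  "strong_topology scaleC F =
     topology_generated_by {W. \<exists>T. admissible_topology scaleC F T \<and> openin T W}"

lemma openin_strong_topology:
  "admissible_topology scaleC F T \<Longrightarrow> openin T W \<Longrightarrow> openin (strong_topology scaleC F) W"
  unfolding strong_topology_def by (rule topology_generated_by_Basis) blast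

lemma openin_prod_topology_mono:
  assumes "openin (prod_topology S T) W"
    and "\<And>A. openin S A \<Longrightarrow> openin S' A" "\<And>A. openin T A \<Longrightarrow> openin T' A"
  shows "openin (prod_topology S' T') W"
  unfolding openin_prod_topology_alt
proof (intro allI impI)
  fix x y assume "(x, y) \<in> W"
  with assms(1) obtain A B where "openin S A" "openin T B" "x \<in> A" "y \<in> B" "A \<times> B \<subseteq> W"
    unfolding openin_prod_topology_alt by (elim allE[of _ x] allE[of _ y] impE exE conjE)
  then show "\<exists>A B. openin S' A \<and> openin T' B \<and> x \<in> A \<and> y \<in> B \<and> A \<times> B \<subseteq> W"
    using assms(2)[of A] assms(3)[of B] by (intro exI[of _ A] exI[of _ B] conjI)
qed

lemma indiscrete_admissible:
  fixes scaleC :: "complex \<Rightarrow> 'v::ab_group_add \<Rightarrow> 'v"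
  shows "admissible_topology scaleC F (topology_generated_by {UNIV})"
proof -
  have top: "openin (topology_generated_by {UNIV}) W \<longleftrightarrow> W = {} \<or> W = UNIV" for W :: "'v set"
  proof
    assume "openin (topology_generated_by {UNIV}) W"
    then have "generate_topology_on {UNIV} W" by (simp add: openin_topology_generated_by_iff)
    then show "W = {} \<or> W = UNIV" by induction auto
  next
    assume "W = {} \<or> W = UNIV"
    then show "openin (topology_generated_by {UNIV}) W"
      by (auto intro: topology_generated_by_Basis)
  qed
  have cont: "continuous_map X (topology_generated_by {UNIV::'v set}) g" for X :: "'x topology" and g
    unfolding continuous_map_def top by auto
  have "\<exists>C. convex_set scaleC C \<and> openin (topology_generated_by {UNIV}) C \<and> 0 \<in> C \<and> C \<subseteq> W"
    if "openin (topology_generated_by {UNIV}) W \<and> 0 \<in> W" for W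
  proof -
    have "W = UNIV" using that unfolding top by blast
    then show ?thesis unfolding top by (intro exI[of _ UNIV]) (simp add: convex_set_def)
  qed
  moreover have "topspace (topology_generated_by {UNIV :: 'v set}) = UNIV"
    unfolding topology_generated_by_topspace by simp
  ultimately show ?thesis
    unfolding admissible_topology_def locally_convex_topology_def
    by (intro conjI allI impI cont)
qed

text \<open>\<^const>\<open>strong_topology\<close> is the finest admissible topology.\<close>

lemma strong_topology_admissible:
  fixes scaleC :: "complex \<Rightarrow> 'v::ab_group_add \<Rightarrow> 'v"
  shows "admissible_topology scaleC F (strong_topology scaleC F)"
proof -
  let ?S = "strong_topology scaleC F"
  let ?B = "{W. \<exists>T. admissible_topology scaleC F T \<and> openin T W}"
  have UNIV: "openin T UNIV" if "admissible_topology scaleC F T" for T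
    using that openin_topspace[of T]
    by (simp add: admissible_topology_def locally_convex_topology_def)
  have top: "topspace ?S = UNIV"
    using openin_strong_topology[OF indiscrete_admissible UNIV[OF indiscrete_admissible]]
      openin_subset by blast
  have cont: "continuous_map X ?S g"
    if "\<And>T. admissible_topology scaleC F T \<Longrightarrow> \<exists>Y. continuous_map Y T g \<and> topspace Y = topspace X
          \<and> (\<forall>A. openin Y A \<longrightarrow> openin X A)"
    for X :: "'x topology" and g
    unfolding strong_topology_def
  proof (rule continuous_on_generated_topo)
    fix W assume "W \<in> ?B"
    then obtain T where T: "admissible_topology scaleC F T" "openin T W" by blast
    with that obtain Y where "continuous_map Y T g" "topspace Y = topspace X"
      "\<forall>A. openin Y A \<longrightarrow> openin X A" by blast
    then have "openin X {x \<in> topspace Y. g x \<in> W}"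
      using T(2) openin_continuous_map_preimage by blast
    moreover have "g -` W \<inter> topspace X = {x \<in> topspace Y. g x \<in> W}"
      using \<open>topspace Y = topspace X\<close> by auto
    ultimately show "openin X (g -` W \<inter> topspace X)" by simp
  next
    show "g ` topspace X \<subseteq> \<Union>?B"
      using UNIV[OF indiscrete_admissible] indiscrete_admissible by blast
  qed
  have add: "continuous_map (prod_topology ?S ?S) ?S (\<lambda>(x, y). x + y)"
  proof (rule cont)
    fix T assume T: "admissible_topology scaleC F T"
    have "topspace T = UNIV" "continuous_map (prod_topology T T) T (\<lambda>(x, y). x + y)"
      using T by (auto simp: admissible_topology_def locally_convex_topology_def)
    then show "\<exists>Y. continuous_map Y T (\<lambda>(x, y). x + y) \<and> topspace Y = topspace (prod_topology ?S ?S)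
        \<and> (\<forall>A. openin Y A \<longrightarrow> openin (prod_topology ?S ?S) A)"
      using openin_prod_topology_mono[of T T _ ?S ?S] openin_strong_topology[OF T]
      by (intro exI[of _ "prod_topology T T"]) (simp add: top)
  qed
  have mul: "continuous_map (prod_topology euclidean ?S) ?S (\<lambda>(c, x). scaleC c x)"
  proof (rule cont)
    fix T assume T: "admissible_topology scaleC F T"
    have "topspace T = UNIV" "continuous_map (prod_topology euclidean T) T (\<lambda>(c, x). scaleC c x)"
      using T by (auto simp: admissible_topology_def locally_convex_topology_def)
    then show "\<exists>Y. continuous_map Y T (\<lambda>(c, x). scaleC c x)
        \<and> topspace Y = topspace (prod_topology euclidean ?S)
        \<and> (\<forall>A. openin Y A \<longrightarrow> openin (prod_topology euclidean ?S) A)"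
      using openin_prod_topology_mono[of euclidean T _ euclidean ?S] openin_strong_topology[OF T]
      by (intro exI[of _ "prod_topology euclidean T"]) (simp add: top, blast)
  qed
  have "0 \<in> W \<longrightarrow> (\<exists>C. convex_set scaleC C \<and> openin ?S C \<and> 0 \<in> C \<and> C \<subseteq> W)"
    if "generate_topology_on ?B W" for W
    using that
  proof induction
    case Empty
    then show ?case by simp
  next
    case (Int a b)
    show ?case
    proof
      assume "0 \<in> a \<inter> b"
      then obtain C D where "convex_set scaleC C" "openin ?S C" "0 \<in> C" "C \<subseteq> a"
        "convex_set scaleC D" "openin ?S D" "0 \<in> D" "D \<subseteq> b"
        using Int.IH by auto
      then show "\<exists>C. convex_set scaleC C \<and> openin ?S C \<and> 0 \<in> C \<and> C \<subseteq> a \<inter> b"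
        by (intro exI[of _ "C \<inter> D"]) (auto simp: convex_set_def)
    qed
  next
    case (UN K)
    show ?case
    proof
      assume "0 \<in> \<Union>K"
      then obtain k where k: "k \<in> K" "0 \<in> k" by blast
      with UN.IH obtain C where "convex_set scaleC C" "openin ?S C" "0 \<in> C" "C \<subseteq> k" by blast
      with k(1) show "\<exists>C. convex_set scaleC C \<and> openin ?S C \<and> 0 \<in> C \<and> C \<subseteq> \<Union>K" by blast
    qed
  next
    case (Basis s)
    then obtain T where T: "admissible_topology scaleC F T" "openin T s" by blast
    have "0 \<in> s \<longrightarrow> (\<exists>C. convex_set scaleC C \<and> openin T C \<and> 0 \<in> C \<and> C \<subseteq> s)"
      using T by (simp add: admissible_topology_def locally_convex_topology_def)
    then show ?case
      using openin_strong_topology[OF T(1)] by blast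
  qed
  then have "locally_convex_topology scaleC ?S"
    using top add mul unfolding locally_convex_topology_def
    by (simp add: strong_topology_def openin_topology_generated_by_iff)
  moreover have "continuous_map (product_topology (\<lambda>_. smooth_topology) {..<k}) ?S
          (\<lambda>f. field_product \<phi> f [0..<k] \<Phi>)" if "\<forall>j<k. \<phi> j \<in> F" for k \<phi> \<Phi>
    
  proof (rule cont)
    fix T assume T: "admissible_topology scaleC F T"
    let ?P = "product_topology (\<lambda>_. smooth_topology) {..<k}"
    have "continuous_map ?P T (\<lambda>f. field_product \<phi> f [0..<k] \<Phi>)"
      using T that by (simp add: admissible_topology_def)
    then show "\<exists>Y. continuous_map Y T (\<lambda>f. field_product \<phi> f [0..<k] \<Phi>)
        \<and> topspace Y = topspace ?P \<and> (\<forall>A. openin Y A \<longrightarrow> openin ?P A)"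
      by blast
  qed
  ultimately show ?thesis
    by (simp add: admissible_topology_def)
qed

definition End_D ::
  "(complex \<Rightarrow> 'v::ab_group_add \<Rightarrow> 'v) \<Rightarrow> 'v distribution set \<Rightarrow> ('v \<Rightarrow> 'v) set" where
  "End_D scaleC F = {A. Vector_Spaces.linear scaleC scaleC A \<and>
     continuous_map (strong_topology scaleC F) (strong_topology scaleC F) A}"


section \<open>Moebius-covariant Wightman conformal field theories\<close>

definition conformal_dimension ::
  "((circle \<Rightarrow> circle) \<Rightarrow> 'v \<Rightarrow> 'v) \<Rightarrow> 'v distribution \<Rightarrow> nat \<Rightarrow> bool" where
  "conformal_dimension U \<phi> d \<longleftrightarrow>
     (\<forall>\<gamma>\<in>Mob. \<forall>f\<in>smooth_circle. U \<gamma> \<circ> \<phi> f \<circ> inv (U \<gamma>) = \<phi> (moebius_beta d \<gamma> f))"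

locale wightman_CFT = vector_space scaleC
  for scaleC :: "complex \<Rightarrow> 'v::ab_group_add \<Rightarrow> 'v" +
  fixes F :: "'v distribution set"
    and U :: "(circle \<Rightarrow> circle) \<Rightarrow> 'v \<Rightarrow> 'v"
    and \<Omega> :: 'v
  assumes fields: "\<phi> \<in> F \<Longrightarrow> op_distribution scaleC \<phi>"
    and regular: "acts_regularly scaleC F"
    and U_End: "\<gamma> \<in> Mob \<Longrightarrow> U \<gamma> \<in> End_D scaleC F"
    and U_id: "U id = id"
    and U_comp: "\<gamma> \<in> Mob \<Longrightarrow> \<delta> \<in> Mob \<Longrightarrow> U (\<gamma> \<circ> \<delta>) = U \<gamma> \<circ> U \<delta>"
    and Omega_nonzero: "\<Omega> \<noteq> 0"
    and covariance: "\<phi> \<in> F \<Longrightarrow> \<exists>d. conformal_dimension U \<phi> d"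
    and locality: "\<phi> \<in> F \<Longrightarrow> \<psi> \<in> F \<Longrightarrow> f \<in> smooth_circle \<Longrightarrow> g \<in> smooth_circle \<Longrightarrow>
      circle_supp f \<inter> circle_supp g = {} \<Longrightarrow> \<phi> f \<circ> \<psi> g = \<psi> g \<circ> \<phi> f"
    and spectrum: "(d::int) < 0 \<Longrightarrow>
      (\<And>\<theta>. U (rotation \<theta>) \<Phi> = scaleC (cis (of_int d * \<theta>)) \<Phi>) \<Longrightarrow> \<Phi> = 0"
    and vacuum_invariant: "\<gamma> \<in> Mob \<Longrightarrow> U \<gamma> \<Omega> = \<Omega>"
    and vacuum_cyclic: "span {field_product \<phi> f [0..<k] \<Omega> | k \<phi> f.
      \<forall>j<k. \<phi> j \<in> F \<and> f j \<in> smooth_circle} = UNIV"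

text \<open>Membership in \<^const>\<open>End_D\<close> need not be imposed: pulling the strong topology back along
  \<open>\<phi> f\<close> gives an admissible topology, so the generators are continuous.\<close>

inductive_set local_algebra ::
  "(complex \<Rightarrow> 'v::ab_group_add \<Rightarrow> 'v) \<Rightarrow> 'v distribution set \<Rightarrow> complex set \<Rightarrow> ('v \<Rightarrow> 'v) set"
  for scaleC :: "complex \<Rightarrow> 'v::ab_group_add \<Rightarrow> 'v"
    and F :: "'v distribution set" and I :: "complex set" where
  unit: "id \<in> local_algebra scaleC F I"
| field: "\<phi> \<in> F \<Longrightarrow> f \<in> smooth_circle \<Longrightarrow> circle_supp f \<subseteq> I \<Longrightarrow> \<phi> f \<in> local_algebra scaleC F I"
| sum: "A \<in> local_algebra scaleC F I \<Longrightarrow> B \<in> local_algebra scaleC F I \<Longrightarrow>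
    (\<lambda>\<Phi>. A \<Phi> + B \<Phi>) \<in> local_algebra scaleC F I"
| scalar: "A \<in> local_algebra scaleC F I \<Longrightarrow> (\<lambda>\<Phi>. scaleC c (A \<Phi>)) \<in> local_algebra scaleC F I"
| product: "A \<in> local_algebra scaleC F I \<Longrightarrow> B \<in> local_algebra scaleC F I \<Longrightarrow>
    A \<circ> B \<in> local_algebra scaleC F I"


section \<open>Analytic continuation of the boosts\<close>

definition strip :: "complex \<Rightarrow> complex set" where
  "strip \<tau> = {of_real t + of_real s * \<tau> | t s. 0 \<le> s \<and> s \<le> 1}"

definition boost_continuation ::
  "(complex \<Rightarrow> 'v::ab_group_add \<Rightarrow> 'v) \<Rightarrow> 'v distribution set \<Rightarrow>
   ((circle \<Rightarrow> circle) \<Rightarrow> 'v \<Rightarrow> 'v) \<Rightarrow> complex \<Rightarrow> 'v \<Rightarrow> 'v \<Rightarrow> bool" where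
  "boost_continuation scaleC F U \<tau> \<Phi> \<Psi> \<longleftrightarrow>
     (\<forall>l\<in>compatible_dual scaleC F. \<exists>G. continuous_on (strip \<tau>) G \<and>
        G holomorphic_on interior (strip \<tau>) \<and>
        (\<forall>t::real. G (of_real t) = l (U (boost t) \<Phi>)) \<and>
        (\<forall>t::real. G (\<tau> + of_real t) = l (U (boost t) \<Psi>)))"

definition V_domain ::
  "(complex \<Rightarrow> 'v::ab_group_add \<Rightarrow> 'v) \<Rightarrow> 'v distribution set \<Rightarrow>
   ((circle \<Rightarrow> circle) \<Rightarrow> 'v \<Rightarrow> 'v) \<Rightarrow> complex \<Rightarrow> 'v set" where
  "V_domain scaleC F U \<tau> = {\<Phi>. \<exists>\<Psi>. boost_continuation scaleC F U \<tau> \<Phi> \<Psi>}"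

definition V_tilde ::
  "(complex \<Rightarrow> 'v::ab_group_add \<Rightarrow> 'v) \<Rightarrow> 'v distribution set \<Rightarrow>
   ((circle \<Rightarrow> circle) \<Rightarrow> 'v \<Rightarrow> 'v) \<Rightarrow> complex \<Rightarrow> 'v \<Rightarrow> 'v" where
  "V_tilde scaleC F U \<tau> \<Phi> = (THE \<Psi>. boost_continuation scaleC F U \<tau> \<Phi> \<Psi>)"

end

theory Submission
  imports Defs "HOL-Complex_Analysis.Complex_Analysis" "HOL-Real_Asymp.Real_Asymp"
begin

text \<open>
  In the coordinate \<open>x = ln (tan (\<theta> / 2))\<close> of the upper half circle the boosts are translations.
  Test functions that are the weight factor times a rapidly decaying function, holomorphic in a
  strip of \<open>x\<close>, can therefore be translated by complex \<open>\<tau>\<close>, and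
  \<open>\<tau> \<mapsto> l (\<phi>\<^sub>1(f\<^sub>1\<^sub>,\<^sub>\<tau>) \<dots> \<phi>\<^sub>k(f\<^sub>k\<^sub>,\<^sub>\<tau>) \<Omega>)\<close> is holomorphic and continues the boost orbit.
  At \<open>\<tau> = \<i>\<pi>\<close> the translated function, extended by its values on the upper and the lower half circle,
  is the boundary value of a function holomorphic in the disk; fields smeared with such boundary values
  annihilate the vacuum by covariance and the spectrum condition. Hence a field next to the vacuum can be moved to the lower half circle,
  where locality lets it commute past the remaining fields; iterating reverses the order of the product.
  General test functions are approximated by these, with convergence on the whole strip by the maximum
  principle. The lower interval is reduced to the upper one by the rotation by \<open>\<pi>\<close>.
\<close>

section \<open>Test functions on the circle\<close>

text \<open>The boosts are generated by the vector field sin(\<theta>) d/d\<theta>, so dx/d\<theta>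
  = 1/sin(\<theta>), and sin(\<theta>)^(d-1) is the weight that turns their action in dimension d
  into a pure translation of x. Two obstacles shape the proof. The analytic test functions reach the
  end points of the arc, so locality is needed for supports that touch at 1 and -1, which the axiom
  does not cover. And without unitarity an orbit l(V_t \<Phi>) is only known to grow at most like
  exp(K|t|), so the maximum principle is applied after multiplication by exp(-z^2). The time i\<pi>
  appears because x gains i\<pi> when the disk is crossed from the upper to the lower half circle.
  With imaginary parts of x and \<tau> in [0,\<pi>], x - \<tau> needs a strip of half-width \<pi>;
  room for Cauchy estimates enlarges this to 15\<pi>/8, still below 2\<pi>, up to which exp(\<xi>/4)
  has positive real part. The sign (-1)^d is (-1)^(d-1) from the weight, odd or even in
  sin(\<theta>), times one sign for moving a term across an equation.\<close>

lemma of_circle_cis [simp]: "of_circle (circle_cis \<theta>) = cis \<theta>"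
  by (rule circle_cis.rep_eq)

lemma of_circle_eqI: "of_circle z = of_circle w \<Longrightarrow> z = w"
  by (simp add: of_circle_inject)

lemma circle_cis_Arg [simp]: "circle_cis (Arg (of_circle z)) = z"
proof (rule of_circle_eqI)
  have "of_circle z \<noteq> 0" using norm_of_circle[of z] by force
  then show "of_circle (circle_cis (Arg (of_circle z))) = of_circle z"
    by (simp add: cis_Arg sgn_div_norm)
qed

lemma circle_cis_2pi [simp]: "circle_cis (\<theta> + 2 * pi * of_int k) = circle_cis \<theta>"
  by (rule of_circle_eqI) (simp add: cis_mult[symmetric] cis_multiple_2pi)

lemma circle_deriv_0: "circle_deriv 0 f \<theta> = f (circle_cis \<theta>)"
  by (simp add: circle_deriv_def)

lemma circle_deriv_Suc: "circle_deriv (Suc n) f \<theta> = vector_derivative (circle_deriv n f) (at \<theta>)"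
  by (simp add: circle_deriv_def)

text \<open>The working form of smoothness in this development: a candidate sequence
  \<open>D\<close> closed under differentiation identifies all derivatives at once, and through
  \<open>smooth_circleI\<close> it also proves smoothness.\<close>

lemma circle_deriv_eqI:
  assumes "\<And>\<theta>. D 0 \<theta> = f (circle_cis \<theta>)"
    and "\<And>n \<theta>. (D n has_vector_derivative D (Suc n) \<theta>) (at \<theta>)"
  shows "circle_deriv n f = D n"
proof (induction n)
  case 0
  show ?case using assms(1) by (auto simp: circle_deriv_0)
next
  case (Suc n)
  show ?case
    using assms(2) by (auto simp: circle_deriv_Suc Suc intro!: vector_derivative_at)
qed

lemma smooth_circleI:
  assumes "\<And>\<theta>. D 0 \<theta> = f (circle_cis \<theta>)"
    and "\<And>n \<theta>. (D n has_vector_derivative D (Suc n) \<theta>) (at \<theta>)"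
  shows "f \<in> smooth_circle"
  using assms(2) unfolding smooth_circle_def mem_Collect_eq circle_deriv_eqI[of D, OF assms]
  by (blast intro: differentiableI_vector)

lemma circle_deriv_has_vector_derivative:
  assumes "f \<in> smooth_circle"
  shows "(circle_deriv n f has_vector_derivative circle_deriv (Suc n) f \<theta>) (at \<theta>)"
  using assms unfolding smooth_circle_def circle_deriv_Suc
  by (simp add: vector_derivative_works[symmetric])

lemma circle_deriv_periodic:
  assumes "f \<in> smooth_circle"
  shows "circle_deriv n f (\<theta> + 2 * pi * of_int k) = circle_deriv n f \<theta>"
proof (induction n arbitrary: \<theta>)
  case 0
  show ?case by (simp add: circle_deriv_0)
next
  case (Suc n)
  have "((\<lambda>\<theta>. \<theta> + 2 * pi * of_int k) has_vector_derivative 1) (at \<theta>)"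
    by (simp add: has_real_derivative_iff_has_vector_derivative[symmetric])
      (auto intro!: derivative_eq_intros)
  from vector_diff_chain_at[OF this circle_deriv_has_vector_derivative[OF assms]]
  have "((\<lambda>\<theta>. circle_deriv n f (\<theta> + 2 * pi * of_int k)) has_vector_derivative
      circle_deriv (Suc n) f (\<theta> + 2 * pi * of_int k)) (at \<theta>)"
    by (simp add: o_def)
  then show ?case
    unfolding Suc using circle_deriv_has_vector_derivative[OF assms]
    by (metis vector_derivative_at)
qed

lemma circle_deriv_cong:
  assumes "f \<in> smooth_circle" "cis \<theta> = cis \<theta>'"
  shows "circle_deriv n f \<theta> = circle_deriv n f \<theta>'"
proof -
  have "cos \<theta> = cos \<theta>'" "sin \<theta> = sin \<theta>'" using assms(2) by (auto simp: complex_eq_iff)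
  then obtain k :: int where "\<theta> = \<theta>' + 2 * pi * of_int k"
    using sin_cos_eq_iff[of \<theta> \<theta>'] by auto
  then show ?thesis using circle_deriv_periodic[OF assms(1)] by simp
qed

lemma circle_deriv_bounded:
  assumes "f \<in> smooth_circle"
  shows "\<exists>B. \<forall>\<theta>. cmod (circle_deriv n f \<theta>) \<le> B"
proof -
  have "continuous_on {-pi..pi} (circle_deriv n f)"
    using circle_deriv_has_vector_derivative[OF assms]
    by (meson continuous_at_imp_continuous_on has_vector_derivative_continuous)
  then have "bounded (circle_deriv n f ` {-pi..pi})"
    by (intro compact_imp_bounded compact_continuous_image) auto
  then obtain B where "\<forall>x\<in>circle_deriv n f ` {-pi..pi}. cmod x \<le> B"
    unfolding bounded_iff by blast
  then have B: "cmod (circle_deriv n f \<theta>) \<le> B" if "\<theta> \<in> {-pi..pi}" for \<theta>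
    using that by blast
  have "cmod (circle_deriv n f \<theta>) \<le> B" for \<theta>
  proof -
    have "circle_deriv n f \<theta> = circle_deriv n f (Arg (cis \<theta>))"
      by (rule circle_deriv_cong[OF assms]) (simp add: cis_Arg sgn_div_norm)
    moreover have "Arg (cis \<theta>) \<in> {-pi..pi}"
      using Arg_bounded[of "cis \<theta>"] by auto
    ultimately show ?thesis using B by metis
  qed
  then show ?thesis by blast
qed

lemma circle_deriv_bdd_above:
  assumes "f \<in> smooth_circle"
  shows "bdd_above (range (\<lambda>\<theta>. cmod (circle_deriv n f \<theta>)))"
  using circle_deriv_bounded[OF assms, of n] by (auto simp: bdd_above_def)

lemma circle_deriv_le_SUP:
  assumes "f \<in> smooth_circle"
  shows "cmod (circle_deriv n f \<theta>) \<le> (SUP \<theta>. cmod (circle_deriv n f \<theta>))"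
  by (rule cSUP_upper[OF _ circle_deriv_bdd_above[OF assms]]) simp

lemma SUP_circle_deriv_nonneg:
  assumes "f \<in> smooth_circle"
  shows "0 \<le> (SUP \<theta>. cmod (circle_deriv n f \<theta>))"
  by (rule order_trans[OF norm_ge_zero circle_deriv_le_SUP[OF assms, of n 0]])

lemma circle_deriv_le_C_norm:
  assumes "f \<in> smooth_circle" "j \<le> N"
  shows "cmod (circle_deriv j f \<theta>) \<le> C_norm N f"
proof -
  have "(SUP \<theta>. cmod (circle_deriv j f \<theta>)) \<le> C_norm N f"
    unfolding C_norm_def
    by (rule member_le_sum) (use assms SUP_circle_deriv_nonneg in auto)
  then show ?thesis using circle_deriv_le_SUP[OF assms(1)] order_trans by blast
qed

lemma C_norm_nonneg:
  assumes "f \<in> smooth_circle"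
  shows "0 \<le> C_norm N f"
  unfolding C_norm_def by (intro sum_nonneg SUP_circle_deriv_nonneg assms)

lemma C_norm_mono:
  assumes "f \<in> smooth_circle" "M \<le> N"
  shows "C_norm M f \<le> C_norm N f"
  unfolding C_norm_def
  by (rule sum_mono2) (use assms SUP_circle_deriv_nonneg in auto)

lemma C_norm_le:
  assumes "\<And>j \<theta>. j \<le> N \<Longrightarrow> cmod (circle_deriv j f \<theta>) \<le> B j"
  shows "C_norm N f \<le> (\<Sum>j\<le>N. B j)"
  unfolding C_norm_def
  by (rule sum_mono, rule cSUP_least) (use assms in auto)

lemma assumes f: "f \<in> smooth_circle" and g: "g \<in> smooth_circle"
  shows smooth_circle_add: "(\<lambda>z. f z + g z) \<in> smooth_circle"
    and circle_deriv_add: "circle_deriv n (\<lambda>z. f z + g z) \<theta> = circle_deriv n f \<theta> + circle_deriv n g \<theta>"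
proof -
  let ?D = "\<lambda>n \<theta>. circle_deriv n f \<theta> + circle_deriv n g \<theta>"
  have *: "(?D n has_vector_derivative ?D (Suc n) \<theta>) (at \<theta>)" for n \<theta>
    by (intro has_vector_derivative_add circle_deriv_has_vector_derivative f g)
  show "(\<lambda>z. f z + g z) \<in> smooth_circle"
    by (rule smooth_circleI[of ?D, OF _ *]) (simp add: circle_deriv_0)
  show "circle_deriv n (\<lambda>z. f z + g z) \<theta> = circle_deriv n f \<theta> + circle_deriv n g \<theta>"
    by (subst circle_deriv_eqI[of ?D, OF _ *]) (simp_all add: circle_deriv_0)
qed

lemma assumes f: "f \<in> smooth_circle"
  shows smooth_circle_cmult: "(\<lambda>z. c * f z) \<in> smooth_circle"
    and circle_deriv_cmult: "circle_deriv n (\<lambda>z. c * f z) \<theta> = c * circle_deriv n f \<theta>"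
proof -
  let ?D = "\<lambda>n \<theta>. c * circle_deriv n f \<theta>"
  have *: "(?D n has_vector_derivative ?D (Suc n) \<theta>) (at \<theta>)" for n \<theta>
    by (intro has_vector_derivative_mult_right circle_deriv_has_vector_derivative f)
  show "(\<lambda>z. c * f z) \<in> smooth_circle"
    by (rule smooth_circleI[of ?D, OF _ *]) (simp add: circle_deriv_0)
  show "circle_deriv n (\<lambda>z. c * f z) \<theta> = c * circle_deriv n f \<theta>"
    by (subst circle_deriv_eqI[of ?D, OF _ *]) (simp_all add: circle_deriv_0)
qed

lemma assumes f: "f \<in> smooth_circle" and g: "g \<in> smooth_circle"
  shows smooth_circle_diff: "(\<lambda>z. f z - g z) \<in> smooth_circle"
    and circle_deriv_diff: "circle_deriv n (\<lambda>z. f z - g z) \<theta> = circle_deriv n f \<theta> - circle_deriv n g \<theta>"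
  using smooth_circle_add[OF f smooth_circle_cmult[OF g, of "-1"]]
    circle_deriv_add[OF f smooth_circle_cmult[OF g, of "-1"], of n \<theta>]
    circle_deriv_cmult[OF g, of n "-1" \<theta>] by simp_all

lemma smooth_circle_zero: "(\<lambda>z. 0) \<in> smooth_circle"
  by (rule smooth_circleI[of "\<lambda>n \<theta>. 0"]) auto

lemma C_norm_zero: "C_norm N (\<lambda>z. 0) = 0"
proof -
  have "circle_deriv n (\<lambda>z. 0) = (\<lambda>\<theta>. 0)" for n
    by (rule circle_deriv_eqI[of "\<lambda>n \<theta>. 0"]) auto
  then show ?thesis by (simp add: C_norm_def)
qed

lemma C_norm_triangle:
  assumes f: "f \<in> smooth_circle" and g: "g \<in> smooth_circle"
  shows "C_norm N (\<lambda>z. f z + g z) \<le> C_norm N f + C_norm N g"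
proof -
  have "C_norm N (\<lambda>z. f z + g z) \<le>
      (\<Sum>j\<le>N. (SUP \<theta>. cmod (circle_deriv j f \<theta>)) + (SUP \<theta>. cmod (circle_deriv j g \<theta>)))"
    by (rule C_norm_le, subst circle_deriv_add[OF f g])
      (intro norm_triangle_mono circle_deriv_le_SUP f g)
  then show ?thesis by (simp add: C_norm_def sum.distrib)
qed

lemma C_norm_cmult_le:
  assumes f: "f \<in> smooth_circle"
  shows "C_norm N (\<lambda>z. c * f z) \<le> cmod c * C_norm N f"
proof -
  have "C_norm N (\<lambda>z. c * f z) \<le> (\<Sum>j\<le>N. cmod c * (SUP \<theta>. cmod (circle_deriv j f \<theta>)))"
    by (rule C_norm_le, subst circle_deriv_cmult[OF f])
      (auto simp: norm_mult intro!: mult_left_mono circle_deriv_le_SUP f)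
  then show ?thesis by (simp add: C_norm_def sum_distrib_left)
qed

lemma C_norm_diff_triangle:
  assumes f: "f \<in> smooth_circle" and g: "g \<in> smooth_circle"
  shows "C_norm N f \<le> C_norm N g + C_norm N (\<lambda>z. f z - g z)"
  using C_norm_triangle[OF g smooth_circle_diff[OF f g], of N] by simp

subsection \<open>The topology of test functions\<close>

text \<open>The balls are given only as a subbase. In the induction over generated open sets a ball
  is recentred at the given point by the triangle inequality, and finite intersections are handled
  by \<open>max N1 N2\<close> because the norms increase with their order.\<close>

lemma openin_smooth_topologyD:
  assumes "openin smooth_topology W" "f \<in> W"
  shows "f \<in> smooth_circle \<and>
    (\<exists>N \<epsilon>. \<epsilon> > 0 \<and> {g \<in> smooth_circle. C_norm N (\<lambda>z. g z - f z) < \<epsilon>} \<subseteq> W)"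
proof -
  let ?B = "{{g \<in> smooth_circle. C_norm N (\<lambda>z. g z - f z) < \<epsilon>} | f N \<epsilon>. f \<in> smooth_circle \<and> \<epsilon> > 0}"
  have "generate_topology_on ?B W"
    using assms(1) unfolding smooth_topology_def openin_topology_generated_by_iff .
  then show ?thesis using assms(2)
  proof (induction arbitrary: f)
    case Empty
    then show ?case by simp
  next
    case (Int A B)
    then have fA: "f \<in> A" and fB: "f \<in> B" by auto
    from Int.IH(1)[OF fA] obtain N1 e1 where f: "f \<in> smooth_circle" and
      1: "e1 > 0" "{g \<in> smooth_circle. C_norm N1 (\<lambda>z. g z - f z) < e1} \<subseteq> A"
      by (elim conjE exE)
    from Int.IH(2)[OF fB] obtain N2 e2 where
      2: "e2 > 0" "{g \<in> smooth_circle. C_norm N2 (\<lambda>z. g z - f z) < e2} \<subseteq> B"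
      by (elim conjE exE)
    have "{g \<in> smooth_circle. C_norm (max N1 N2) (\<lambda>z. g z - f z) < min e1 e2} \<subseteq> A \<inter> B"
    proof
      fix g assume "g \<in> {g \<in> smooth_circle. C_norm (max N1 N2) (\<lambda>z. g z - f z) < min e1 e2}"
      then have g: "g \<in> smooth_circle" "C_norm (max N1 N2) (\<lambda>z. g z - f z) < min e1 e2" by auto
      have "C_norm N1 (\<lambda>z. g z - f z) < e1" "C_norm N2 (\<lambda>z. g z - f z) < e2"
        using C_norm_mono[OF smooth_circle_diff[OF g(1) f], of N1 "max N1 N2"]
          C_norm_mono[OF smooth_circle_diff[OF g(1) f], of N2 "max N1 N2"] g(2) by auto
      then show "g \<in> A \<inter> B" using 1(2) 2(2) g(1) by (auto simp: subset_iff)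
    qed
    moreover have "min e1 e2 > 0" using 1(1) 2(1) by simp
    ultimately show ?case using f by (intro conjI exI)
  next
    case (UN K)
    then obtain k where k: "k \<in> K" "f \<in> k" by auto
    from UN.IH[OF this] obtain N e where "f \<in> smooth_circle" "e > 0"
      "{g \<in> smooth_circle. C_norm N (\<lambda>z. g z - f z) < e} \<subseteq> k" by (elim conjE exE)
    moreover have "k \<subseteq> \<Union>K" using k(1) by blast
    ultimately show ?case by (intro conjI exI) (assumption | rule subset_trans)+
  next
    case (Basis s)
    then obtain h N e where s: "s = {g \<in> smooth_circle. C_norm N (\<lambda>z. g z - h z) < e}"
      and h: "h \<in> smooth_circle" by auto
    with Basis have f: "f \<in> smooth_circle" "C_norm N (\<lambda>z. f z - h z) < e" by auto
    have "{g \<in> smooth_circle. C_norm N (\<lambda>z. g z - f z) < e - C_norm N (\<lambda>z. f z - h z)} \<subseteq> s"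
    proof
      fix g assume "g \<in> {g \<in> smooth_circle. C_norm N (\<lambda>z. g z - f z) < e - C_norm N (\<lambda>z. f z - h z)}"
      then show "g \<in> s"
        using C_norm_triangle[OF smooth_circle_diff[OF _ f(1)] smooth_circle_diff[OF f(1) h], of g N]
        unfolding s by simp
    qed
    moreover have "e - C_norm N (\<lambda>z. f z - h z) > 0" using f by simp
    ultimately show ?case using f by (intro conjI exI)
  qed
qed

lemma openin_smooth_ball:
  assumes "f \<in> smooth_circle" "\<epsilon> > 0"
  shows "openin smooth_topology {g \<in> smooth_circle. C_norm N (\<lambda>z. g z - f z) < \<epsilon>}"
  unfolding smooth_topology_def using assms by (intro topology_generated_by_Basis) blast

lemma topspace_smooth_topology [simp]: "topspace smooth_topology = smooth_circle"
proof
  show "topspace smooth_topology \<subseteq> smooth_circle"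
    using openin_smooth_topologyD[OF openin_topspace] by blast
  show "smooth_circle \<subseteq> topspace smooth_topology"
  proof
    fix f assume f: "f \<in> smooth_circle"
    have "f \<in> {g \<in> smooth_circle. C_norm 0 (\<lambda>z. g z - f z) < 1}"
      using f C_norm_zero[of 0] by simp
    then show "f \<in> topspace smooth_topology"
      using openin_subset[OF openin_smooth_ball[OF f, of 1 0]] by (simp add: subset_iff)
  qed
qed

section \<open>Products of fields\<close>

lemma field_product_append:
  "field_product \<phi> f (xs @ ys) \<Phi> = field_product \<phi> f xs (field_product \<phi> f ys \<Phi>)"
  by (simp add: field_product_def)

lemma field_product_Nil [simp]: "field_product \<phi> f [] \<Phi> = \<Phi>"
  by (simp add: field_product_def)

lemma field_product_Cons [simp]:
  "field_product \<phi> f (j # js) \<Phi> = \<phi> j (f j) (field_product \<phi> f js \<Phi>)"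
  by (simp add: field_product_def)

lemma field_product_cong:
  "(\<And>j. j \<in> set js \<Longrightarrow> \<phi> j (f j) = \<psi> j (g j)) \<Longrightarrow> field_product \<phi> f js \<Phi> = field_product \<psi> g js \<Phi>"
  by (induction js) auto

lemma upt_split: "j < k \<Longrightarrow> [0..<k] = [0..<j] @ j # [Suc j..<k]"
  using upt_add_eq_append[of 0 j "k - j"] upt_conv_Cons[of j k] by simp

context wightman_CFT
begin

lemma linear_add: "Vector_Spaces.linear s1 s2 A \<Longrightarrow> A (x + y) = A x + A y"
  by (simp add: linear_iff_module_hom module_hom.add)

lemma linear_scale: "Vector_Spaces.linear s1 s2 A \<Longrightarrow> A (s1 c x) = s2 c (A x)"
  by (simp add: linear_iff_module_hom module_hom.scale)

lemma linear_diff: "Vector_Spaces.linear s1 s2 A \<Longrightarrow> A (x - y) = A x - A y"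
  by (simp add: linear_iff_module_hom module_hom.diff)

lemma linear_zero: "Vector_Spaces.linear s1 s2 A \<Longrightarrow> A 0 = 0"
  by (simp add: linear_iff_module_hom module_hom.zero)

lemma field_linear:
  "\<phi> \<in> F \<Longrightarrow> f \<in> smooth_circle \<Longrightarrow> Vector_Spaces.linear scaleC scaleC (\<phi> f)"
  using fields unfolding op_distribution_def by blast

lemma field_add:
  "\<phi> \<in> F \<Longrightarrow> f \<in> smooth_circle \<Longrightarrow> g \<in> smooth_circle \<Longrightarrow>
    \<phi> (\<lambda>z. f z + g z) \<Phi> = \<phi> f \<Phi> + \<phi> g \<Phi>"
  using fields unfolding op_distribution_def by blast

lemma field_cmult:
  "\<phi> \<in> F \<Longrightarrow> f \<in> smooth_circle \<Longrightarrow> \<phi> (\<lambda>z. c * f z) \<Phi> = scaleC c (\<phi> f \<Phi>)"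
  using fields unfolding op_distribution_def by blast

lemma field_diff:
  "\<phi> \<in> F \<Longrightarrow> f \<in> smooth_circle \<Longrightarrow> g \<in> smooth_circle \<Longrightarrow>
    \<phi> (\<lambda>z. f z - g z) \<Phi> = \<phi> f \<Phi> - \<phi> g \<Phi>"
  using field_add[of \<phi> f "\<lambda>z. -1 * g z"] field_cmult[of \<phi> g "-1"] smooth_circle_cmult[of g "-1"]
  by simp

lemma field_product_scale:
  assumes "\<And>j. j \<in> set js \<Longrightarrow> \<phi> j \<in> F \<and> f j \<in> smooth_circle"
  shows "field_product \<phi> f js (scaleC c x) = scaleC c (field_product \<phi> f js x)"
  using assms by (induction js) (auto simp: linear_scale[OF field_linear])

lemma field_product_diff:
  assumes "\<And>j. j \<in> set js \<Longrightarrow> \<phi> j \<in> F \<and> f j \<in> smooth_circle"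
  shows "field_product \<phi> f js (x - y) = field_product \<phi> f js x - field_product \<phi> f js y"
  using assms by (induction js) (auto simp: linear_diff[OF field_linear])

lemma field_product_slot_diff:
  assumes "\<And>j. j < k \<Longrightarrow> \<phi> j \<in> F \<and> f j \<in> smooth_circle" "i < k" "g \<in> smooth_circle" "h \<in> smooth_circle"
  shows "field_product \<phi> (f(i := (\<lambda>z. g z - h z))) [0..<k] \<Phi> =
    field_product \<phi> (f(i := g)) [0..<k] \<Phi> - field_product \<phi> (f(i := h)) [0..<k] \<Phi>"
proof -
  have 1: "field_product \<phi> (f(i := u)) [0..<k] \<Phi> =
      field_product \<phi> f [0..<i] (\<phi> i u (field_product \<phi> f [Suc i..<k] \<Phi>))" for u
  proof -
    have "field_product \<phi> (f(i := u)) [Suc i..<k] \<Phi> = field_product \<phi> f [Suc i..<k] \<Phi>"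
      by (rule field_product_cong) auto
    moreover have "field_product \<phi> (f(i := u)) [0..<i] \<Psi> = field_product \<phi> f [0..<i] \<Psi>" for \<Psi>
      by (rule field_product_cong) auto
    ultimately show ?thesis
      by (simp add: upt_split[OF assms(2)] field_product_append)
  qed
  show ?thesis
    unfolding 1 using assms by (subst field_product_diff[symmetric]) (auto simp: field_diff)
qed

lemma field_product_cmult:
  assumes "\<And>j. j \<in> set js \<Longrightarrow> \<phi> j \<in> F \<and> f j \<in> smooth_circle"
  shows "field_product \<phi> (\<lambda>j z. c j * f j z) js \<Phi> =
    scaleC (prod_list (map c js)) (field_product \<phi> f js \<Phi>)"
  using assms
  by (induction js) (auto simp: field_cmult linear_scale[OF field_linear])

section \<open>Quantitative continuity of compatible functionals\<close>

lemma dual_linear: "l \<in> compatible_dual scaleC F \<Longrightarrow> Vector_Spaces.linear scaleC (*) l"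
  by (simp add: compatible_dual_def)

text \<open>The multilinear version of "continuous at 0 implies bounded": joint continuity bounds
  the expression for all small arguments, and rescaling every slot separately turns this into a
  product of norms of one common order \<open>N\<close>.\<close>

lemma dual_field_product_bound:
  assumes l: "l \<in> compatible_dual scaleC F" and \<phi>: "\<And>j. j < k \<Longrightarrow> \<phi> j \<in> F"
  shows "\<exists>N C. 0 < C \<and> (\<forall>f. (\<forall>j<k. f j \<in> smooth_circle) \<longrightarrow>
    cmod (l (field_product \<phi> f [0..<k] \<Phi>)) \<le> C * (\<Prod>j<k. C_norm N (f j)))"
proof -
  let ?M = "\<lambda>f. l (field_product \<phi> f [0..<k] \<Phi>)"
  let ?T = "product_topology (\<lambda>_. smooth_topology) {..<k}"
  let ?z = "\<lambda>j\<in>{..<k}. (\<lambda>z::circle. 0::complex)"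
  have lin: "Vector_Spaces.linear scaleC (*) l" by (rule dual_linear[OF l])
  have "continuous_map ?T euclidean ?M"
    using l \<phi> by (simp add: compatible_dual_def)
  then have op: "openin ?T {f \<in> topspace ?T. ?M f \<in> ball (?M ?z) 1}"
    by (rule openin_continuous_map_preimage) simp
  have z: "?z \<in> {f \<in> topspace ?T. ?M f \<in> ball (?M ?z) 1}"
    by (auto simp: smooth_circle_zero)
  obtain W where W: "\<And>j. j \<in> {..<k} \<Longrightarrow> openin smooth_topology (W j)"
      "?z \<in> Pi\<^sub>E {..<k} W" "Pi\<^sub>E {..<k} W \<subseteq> {f \<in> topspace ?T. ?M f \<in> ball (?M ?z) 1}"
    using bspec[OF op[unfolded openin_product_topology_alt] z] by (elim exE conjE) blast
  have "\<exists>N \<epsilon>. \<epsilon> > 0 \<and> {g \<in> smooth_circle. C_norm N g < \<epsilon>} \<subseteq> W j" if "j < k" for j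
  proof -
    have "(\<lambda>z. 0) \<in> W j" using PiE_mem[OF W(2), of j] that by simp
    from openin_smooth_topologyD[OF W(1) this] that show ?thesis by simp
  qed
  then obtain N \<epsilon> where N: "\<And>j. j < k \<Longrightarrow> \<epsilon> j > (0::real)"
      "\<And>j. j < k \<Longrightarrow> {g \<in> smooth_circle. C_norm (N j) g < \<epsilon> j} \<subseteq> W j" by metis
  define N' where "N' = Max (insert 0 (N ` {..<k}))"
  define e where "e = Min (insert 1 (\<epsilon> ` {..<k}))"
  have e: "e > 0" "\<And>j. j < k \<Longrightarrow> e \<le> \<epsilon> j" unfolding e_def using N(1) by auto
  have N': "\<And>j. j < k \<Longrightarrow> N j \<le> N'" unfolding N'_def by auto
  \<comment> \<open>For \<open>k = 0\<close> the value at the zero tuple is \<open>l \<Phi>\<close>,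
    which need not be 0, so it is kept in the bound.\<close>
  define B where "B = 1 + cmod (?M ?z)"
  have B: "B > 0" unfolding B_def by (rule add_pos_nonneg) auto
  have small: "cmod (?M f) \<le> B" if f: "\<And>j. j < k \<Longrightarrow> f j \<in> smooth_circle \<and> C_norm N' (f j) < e" for f
  proof -
    have "(\<lambda>j\<in>{..<k}. f j) \<in> Pi\<^sub>E {..<k} W"
    proof (rule restrict_PiE_iff[THEN iffD2], rule ballI)
      fix j assume "j \<in> {..<k}"
      then have j: "j < k" by simp
      have "C_norm (N j) (f j) < \<epsilon> j"
        using C_norm_mono[of "f j" "N j" N'] f[OF j] e(2)[OF j] N'[OF j] by linarith
      then show "f j \<in> W j" using N(2)[OF j] f[OF j] by blast
    qed
    then have "?M (\<lambda>j\<in>{..<k}. f j) \<in> ball (?M ?z) 1" using W(3) by blast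
    moreover have "?M (\<lambda>j\<in>{..<k}. f j) = ?M f"
      by (rule arg_cong[of _ _ l], rule field_product_cong) auto
    ultimately have "cmod (?M ?z - ?M f) < 1" by (simp add: dist_norm)
    then show ?thesis
      using norm_triangle_sub[of "?M f" "?M ?z"] by (simp add: B_def norm_minus_commute)
  qed
  define C where "C = B * (2 / e) ^ k"
  have C: "C > 0" unfolding C_def using B e by simp
  have "cmod (?M f) \<le> C * (\<Prod>j<k. C_norm N' (f j))" if f: "\<forall>j<k. f j \<in> smooth_circle" for f
  proof -
    have nn: "0 \<le> C_norm N' (f j)" if "j < k" for j using C_norm_nonneg f that by blast
    \<comment> \<open>A slot may have norm 0, so it cannot be divided by its norm. The slots are
      scaled by \<open>c j\<close> to norm at most e/2 with \<eta> added to the denominator; each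
      contributes the factor 2/e of \<open>C\<close>, and \<eta> tends to 0 afterwards.\<close>
    have bd: "cmod (?M f) \<le> C * (\<Prod>j<k. C_norm N' (f j) + \<eta>)" if \<eta>: "\<eta> > 0" for \<eta>
    proof -
      define c where "c j = e / (2 * (C_norm N' (f j) + \<eta>))" for j
      have cpos: "c j > 0" if "j < k" for j unfolding c_def using nn[OF that] \<eta> e by simp
      have "cmod (?M (\<lambda>j z. complex_of_real (c j) * f j z)) \<le> B"
      proof (rule small)
        fix j assume j: "j < k"
        have "C_norm N' (\<lambda>z. complex_of_real (c j) * f j z) \<le> c j * C_norm N' (f j)"
          using C_norm_cmult_le[of "f j" N' "complex_of_real (c j)"] f j cpos[OF j] by simp
        also have "c j * C_norm N' (f j) \<le> c j * (C_norm N' (f j) + \<eta>)"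
          using cpos[OF j] \<eta> by simp
        also have "\<dots> = e / 2"
          unfolding c_def using nn[OF j] \<eta> by (simp add: field_simps)
        finally show "(\<lambda>z. complex_of_real (c j) * f j z) \<in> smooth_circle \<and>
          C_norm N' (\<lambda>z. complex_of_real (c j) * f j z) < e"
          using e f j smooth_circle_cmult by auto
      qed
      moreover have "?M (\<lambda>j z. complex_of_real (c j) * f j z) =
          (\<Prod>j<k. complex_of_real (c j)) * ?M f"
        using \<phi> f by (subst field_product_cmult)
          (auto simp: linear_scale[OF lin] prod.distinct_set_conv_list[symmetric] lessThan_atLeast0)
      ultimately have "(\<Prod>j<k. c j) * cmod (?M f) \<le> B"
        using cpos by (simp add: norm_mult prod_norm[symmetric] abs_of_pos)
      note cM = this
      have cP: "(e / 2) ^ k = (\<Prod>j<k. c j) * (\<Prod>j<k. C_norm N' (f j) + \<eta>)"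
      proof -
        have "(\<Prod>j<k. c j * (C_norm N' (f j) + \<eta>)) = (\<Prod>j<k. e / 2)"
          by (rule prod.cong) (use nn \<eta> in \<open>auto simp: c_def field_simps add_nonneg_eq_0_iff\<close>)
        then show ?thesis by (simp add: prod.distrib)
      qed
      have pos: "(\<Prod>j<k. C_norm N' (f j) + \<eta>) > 0"
        by (rule prod_pos) (use nn \<eta> in \<open>auto intro: add_nonneg_pos\<close>)
      have "(e / 2) ^ k * cmod (?M f) \<le> B * (\<Prod>j<k. C_norm N' (f j) + \<eta>)"
        unfolding cP using mult_right_mono[OF cM less_imp_le[OF pos]] by (simp only: mult_ac)
      then show ?thesis
        unfolding C_def using e by (simp add: field_simps power_divide)
    qed
    have lim: "((\<lambda>\<eta>. C * (\<Prod>j<k. C_norm N' (f j) + \<eta>)) \<longlongrightarrow> C * (\<Prod>j<k. C_norm N' (f j) + 0)) (at_right 0)"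
      by (intro tendsto_intros)
    have "\<forall>\<^sub>F \<eta> in at_right 0. cmod (?M f) \<le> C * (\<Prod>j<k. C_norm N' (f j) + \<eta>)"
      by (rule eventually_mono[OF eventually_at_right_less bd])
    from tendsto_lowerbound[OF lim this] show ?thesis by simp
  qed
  then show ?thesis using C by blast
qed

lemma field_product_telescope:
  assumes \<phi>: "\<And>j. j < k \<Longrightarrow> \<phi> j \<in> F" and f: "\<And>j. j < k \<Longrightarrow> f j \<in> smooth_circle"
    and g: "\<And>j. j < k \<Longrightarrow> g j \<in> smooth_circle"
  shows "field_product \<phi> f [0..<k] \<Phi> - field_product \<phi> g [0..<k] \<Phi> =
    (\<Sum>i<k. field_product \<phi> (\<lambda>j. if j < i then f j else if j = i then (\<lambda>z. f i z - g i z) else g j) [0..<k] \<Phi>)"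
proof -
  define P where "P i = field_product \<phi> (\<lambda>j. if j < i then f j else g j) [0..<k] \<Phi>" for i
  have step: "field_product \<phi> (\<lambda>j. if j < i then f j else if j = i then (\<lambda>z. f i z - g i z) else g j) [0..<k] \<Phi>
      = P (Suc i) - P i" if "i < k" for i
  proof -
    let ?h = "\<lambda>j. if j < i then f j else g j"
    have "(\<lambda>j. if j < i then f j else if j = i then (\<lambda>z. f i z - g i z) else g j)
        = ?h(i := (\<lambda>z. f i z - g i z))" by auto
    moreover have "(\<lambda>j. if j < Suc i then f j else g j) = ?h(i := f i)" by auto
    moreover have "?h = ?h(i := g i)" by auto
    ultimately show ?thesis
      unfolding P_def using field_product_slot_diff[of k \<phi> ?h i "f i" "g i"] \<phi> f g that by auto
  qed
  have "P k = field_product \<phi> f [0..<k] \<Phi>" unfolding P_def by (rule field_product_cong) auto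
  moreover have "P 0 = field_product \<phi> g [0..<k] \<Phi>" unfolding P_def by (rule field_product_cong) auto
  moreover have "(\<Sum>i<k. P (Suc i) - P i) = P k - P 0" by (rule sum_lessThan_telescope)
  ultimately show ?thesis using step by simp
qed

lemma dual_sum: "l \<in> compatible_dual scaleC F \<Longrightarrow> l (sum f A) = (\<Sum>i\<in>A. l (f i))"
  by (induction A rule: infinite_finite_induct)
    (auto simp: linear_zero[OF dual_linear] linear_add[OF dual_linear])

text \<open>Exchanging one test function at a time leaves, in each of the \<open>k\<close> terms,
  one slot of size \<delta> and \<open>k - 1\<close> slots of size \<open>A\<close>.\<close>

lemma dual_field_product_diff_bound:
  assumes l: "l \<in> compatible_dual scaleC F" and \<phi>: "\<And>j. j < k \<Longrightarrow> \<phi> j \<in> F"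
  shows "\<exists>N C. 0 < C \<and> (\<forall>f g A \<delta>. 0 \<le> \<delta> \<longrightarrow> (\<forall>j<k. f j \<in> smooth_circle \<and> g j \<in> smooth_circle \<and>
      C_norm N (f j) \<le> A \<and> C_norm N (g j) \<le> A \<and> C_norm N (\<lambda>z. f j z - g j z) \<le> \<delta>) \<longrightarrow>
    cmod (l (field_product \<phi> f [0..<k] \<Phi>) - l (field_product \<phi> g [0..<k] \<Phi>)) \<le> C * (A ^ (k - 1) * \<delta>))"
proof -
  obtain N C where C: "0 < C" and bd: "\<And>f. (\<And>j. j < k \<Longrightarrow> f j \<in> smooth_circle) \<Longrightarrow>
      cmod (l (field_product \<phi> f [0..<k] \<Phi>)) \<le> C * (\<Prod>j<k. C_norm N (f j))"
    using dual_field_product_bound[of l k \<phi> \<Phi>, OF l \<phi>] by auto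
  have main: "cmod (l (field_product \<phi> f [0..<k] \<Phi>) - l (field_product \<phi> g [0..<k] \<Phi>)) \<le> (real k * C) * (A ^ (k - 1) * \<delta>)"
    if *: "\<forall>j<k. f j \<in> smooth_circle \<and> g j \<in> smooth_circle \<and>
      C_norm N (f j) \<le> A \<and> C_norm N (g j) \<le> A \<and> C_norm N (\<lambda>z. f j z - g j z) \<le> \<delta>" for f g A \<delta>
  proof -
    let ?h = "\<lambda>i j. if j < i then f j else if j = i then (\<lambda>z. f i z - g i z) else g j"
    have "l (field_product \<phi> f [0..<k] \<Phi>) - l (field_product \<phi> g [0..<k] \<Phi>)
        = (\<Sum>i<k. l (field_product \<phi> (?h i) [0..<k] \<Phi>))"
      using field_product_telescope[of k \<phi> f g \<Phi>] * \<phi>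
      by (simp add: linear_diff[OF dual_linear[OF l], symmetric] dual_sum[OF l, symmetric])
    also have "cmod \<dots> \<le> (\<Sum>i<k. C * (A ^ (k - 1) * \<delta>))"
    proof (rule order_trans[OF norm_sum], rule sum_mono)
      fix i assume "i \<in> {..<k}"
      then have i: "i < k" by simp
      have h: "?h i j \<in> smooth_circle" if "j < k" for j
        using * that i smooth_circle_diff by auto
      have "cmod (l (field_product \<phi> (?h i) [0..<k] \<Phi>)) \<le> C * (\<Prod>j<k. C_norm N (?h i j))"
        by (rule bd) (rule h)
      also have "(\<Prod>j<k. C_norm N (?h i j)) = C_norm N (?h i i) * (\<Prod>j\<in>{..<k}-{i}. C_norm N (?h i j))"
        by (rule prod.remove) (use i in auto)
      also have "\<dots> \<le> \<delta> * (\<Prod>j\<in>{..<k}-{i}. A)"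
      proof (rule mult_mono)
        show "C_norm N (?h i i) \<le> \<delta>" using * i by auto
        show "0 \<le> \<delta>" using * i C_norm_nonneg[OF smooth_circle_diff[of "f i" "g i"], of N] by force
        show "(\<Prod>j\<in>{..<k}-{i}. C_norm N (?h i j)) \<le> (\<Prod>j\<in>{..<k}-{i}. A)"
          by (rule prod_mono) (use * C_norm_nonneg in auto)
        show "0 \<le> (\<Prod>j\<in>{..<k}-{i}. C_norm N (?h i j))"
          by (rule prod_nonneg) (use * C_norm_nonneg in auto)
      qed
      finally show "cmod (l (field_product \<phi> (?h i) [0..<k] \<Phi>)) \<le> C * (A ^ (k - 1) * \<delta>)"
        using C i by (simp add: mult.commute)
    qed
    finally show ?thesis by simp
  qed
  show ?thesis
  \<comment> \<open>The constant \<open>real k * C\<close> would be 0 for \<open>k = 0\<close>, but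
    a positive one is claimed.\<close>
  proof (cases "k = 0")
    case True
    then show ?thesis using C by (intro exI[of _ N] exI[of _ C]) auto
  next
    case False
    then show ?thesis using C main by (intro exI[of _ N] exI[of _ "real k * C"]) auto
  qed
qed

text \<open>Stated for an arbitrary filter, since it serves for sequences of approximants, for
  complex difference quotients at 0 and for radial limits at the boundary of the disk.\<close>

lemma dual_field_product_tendsto:
  assumes l: "l \<in> compatible_dual scaleC F" and \<phi>: "\<And>j. j < k \<Longrightarrow> \<phi> j \<in> F"
    and f: "\<And>j. j < k \<Longrightarrow> f j \<in> smooth_circle"
    and g: "\<And>j. j < k \<Longrightarrow> \<forall>\<^sub>F x in X. g x j \<in> smooth_circle"
    and lim: "\<And>j N. j < k \<Longrightarrow> ((\<lambda>x. C_norm N (\<lambda>z. g x j z - f j z)) \<longlongrightarrow> 0) X"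
  shows "((\<lambda>x. l (field_product \<phi> (g x) [0..<k] \<Phi>)) \<longlongrightarrow> l (field_product \<phi> f [0..<k] \<Phi>)) X"
proof -
  obtain N C where bd: "\<And>f g A \<delta>. 0 \<le> \<delta> \<Longrightarrow> (\<forall>j<k. f j \<in> smooth_circle \<and> g j \<in> smooth_circle \<and>
      C_norm N (f j) \<le> A \<and> C_norm N (g j) \<le> A \<and> C_norm N (\<lambda>z. f j z - g j z) \<le> \<delta>) \<Longrightarrow>
    cmod (l (field_product \<phi> f [0..<k] \<Phi>) - l (field_product \<phi> g [0..<k] \<Phi>)) \<le> C * (A ^ (k - 1) * \<delta>)"
    using dual_field_product_diff_bound[of l k \<phi> \<Phi>, OF l \<phi>] by blast
  define \<delta> where "\<delta> x = (\<Sum>j<k. C_norm N (\<lambda>z. g x j z - f j z))" for x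
  define A where "A = 1 + (\<Sum>j<k. C_norm N (f j))"
  have \<delta>: "(\<delta> \<longlongrightarrow> 0) X"
    unfolding \<delta>_def using tendsto_sum[of "{..<k}" "\<lambda>j x. C_norm N (\<lambda>z. g x j z - f j z)" "\<lambda>_. 0" X] lim by simp
  then have "\<forall>\<^sub>F x in X. \<delta> x < 1" by (rule order_tendstoD) simp
  moreover have "\<forall>\<^sub>F x in X. \<forall>j\<in>{..<k}. g x j \<in> smooth_circle"
    by (rule eventually_ball_finite) (use g in auto)
  ultimately have ev: "\<forall>\<^sub>F x in X. norm (l (field_product \<phi> (g x) [0..<k] \<Phi>) - l (field_product \<phi> f [0..<k] \<Phi>))
      \<le> C * (A ^ (k - 1) * \<delta> x)"
  proof eventually_elim
    case (elim x)
    have gs: "g x i \<in> smooth_circle" if "i < k" for i using elim that by simp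
    have "0 \<le> \<delta> x" unfolding \<delta>_def
      by (rule sum_nonneg) (use gs f in \<open>auto intro!: C_norm_nonneg smooth_circle_diff\<close>)
    then show ?case
    proof (rule bd, intro allI impI)
      fix j assume j: "j < k"
      have 1: "C_norm N (\<lambda>z. g x j z - f j z) \<le> \<delta> x" unfolding \<delta>_def
        by (rule member_le_sum[of j "{..<k}" "\<lambda>j. C_norm N (\<lambda>z. g x j z - f j z)"])
          (use j gs f in \<open>auto intro!: C_norm_nonneg smooth_circle_diff\<close>)
      have 2: "C_norm N (f j) \<le> A - 1" unfolding A_def
        using member_le_sum[of j "{..<k}" "\<lambda>j. C_norm N (f j)"] j C_norm_nonneg f by auto
      have 3: "C_norm N (g x j) \<le> C_norm N (f j) + C_norm N (\<lambda>z. g x j z - f j z)"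
        by (rule C_norm_diff_triangle) (use j gs f in auto)
      show "g x j \<in> smooth_circle \<and> f j \<in> smooth_circle \<and> C_norm N (g x j) \<le> A \<and>
          C_norm N (f j) \<le> A \<and> C_norm N (\<lambda>z. g x j z - f j z) \<le> \<delta> x"
        using 1 2 3 elim gs[OF j] f[OF j] by auto
    qed
  qed
  have "((\<lambda>x. C * (A ^ (k - 1) * \<delta> x)) \<longlongrightarrow> C * (A ^ (k - 1) * 0)) X"
    by (intro tendsto_intros \<delta>)
  then have "((\<lambda>x. l (field_product \<phi> (g x) [0..<k] \<Phi>) - l (field_product \<phi> f [0..<k] \<Phi>)) \<longlongrightarrow> 0) X"
    using Lim_null_comparison[OF ev] by simp
  then show ?thesis by (simp add: LIM_zero_iff)
qed

end

section \<open>Derivatives of composite families\<close>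

text \<open>The coefficients \<open>c n j\<close> of the chain rule do not depend on the functions \<open>r j\<close>
  (\<open>j\<close>-th derivatives of some function, evaluated along a map with derivative \<open>w i\<close>);
  this is what makes the resulting bounds uniform.\<close>

lemma chain_coefficients:
  fixes w :: "'i \<Rightarrow> real \<Rightarrow> complex" and cls :: "('i \<Rightarrow> real \<Rightarrow> complex) set"
  assumes zero: "(\<lambda>_ _. 0) \<in> cls"
    and add: "\<forall>a\<in>cls. \<forall>b\<in>cls. (\<lambda>i \<theta>. a i \<theta> + b i \<theta>) \<in> cls"
    and mult: "\<forall>a\<in>cls. (\<lambda>i \<theta>. w i \<theta> * a i \<theta>) \<in> cls"
    and deriv: "\<forall>a\<in>cls. \<exists>a'\<in>cls. \<forall>i. \<forall>\<theta>\<in>S. (a i has_vector_derivative a' i \<theta>) (at \<theta>)"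
    and a: "a \<in> cls"
  shows "\<exists>c. (\<forall>n j. c n j \<in> cls) \<and> c 0 0 = a \<and>
    (\<forall>i r. (\<forall>j. \<forall>\<theta>\<in>S. (r j has_vector_derivative w i \<theta> * r (Suc j) \<theta>) (at \<theta>)) \<longrightarrow>
      (\<forall>n. \<forall>\<theta>\<in>S. ((\<lambda>\<theta>. \<Sum>j\<le>n. c n j i \<theta> * r j \<theta>) has_vector_derivative
          (\<Sum>j\<le>Suc n. c (Suc n) j i \<theta> * r j \<theta>)) (at \<theta>)))"
proof -
  obtain dv where dv: "\<And>a. a \<in> cls \<Longrightarrow> dv a \<in> cls"
    "\<And>a i \<theta>. a \<in> cls \<Longrightarrow> \<theta> \<in> S \<Longrightarrow> (a i has_vector_derivative dv a i \<theta>) (at \<theta>)"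
    using deriv by metis
  \<comment> \<open>Differentiating \<open>c n j * r j\<close> gives
    \<open>dv (c n j) * r j + w * c n j * r (Suc j)\<close>; collecting the factor of each
    \<open>r j\<close> yields this recursion. The guard \<open>j \<le> n\<close> matches the range
    of the sum.\<close>
  define c where "c = rec_nat (\<lambda>j. if j = 0 then a else (\<lambda>_ _. 0))
    (\<lambda>n cn j i \<theta>. (if j \<le> n then dv (cn j) else (\<lambda>_ _. 0)) i \<theta> +
      (if j = 0 then (\<lambda>_ _. 0) else (\<lambda>i \<theta>. w i \<theta> * cn (j - 1) i \<theta>)) i \<theta>)"
  have c0: "c 0 = (\<lambda>j. if j = 0 then a else (\<lambda>_ _. 0))" by (simp add: c_def)
  have cS: "c (Suc n) = (\<lambda>j i \<theta>. (if j \<le> n then dv (c n j) else (\<lambda>_ _. 0)) i \<theta> +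
      (if j = 0 then (\<lambda>_ _. 0) else (\<lambda>i \<theta>. w i \<theta> * c n (j - 1) i \<theta>)) i \<theta>)" for n
    unfolding c_def by simp
  have cls: "c n j \<in> cls" for n j
  proof (induction n arbitrary: j)
    case 0
    then show ?case using a zero by (simp add: c0)
  next
    case (Suc n)
    show ?case unfolding cS using Suc zero dv(1) mult by (intro add[rule_format]) auto
  qed
  have "((\<lambda>\<theta>. \<Sum>j\<le>n. c n j i \<theta> * r j \<theta>) has_vector_derivative
          (\<Sum>j\<le>Suc n. c (Suc n) j i \<theta> * r j \<theta>)) (at \<theta>)"
    if r: "\<forall>j. \<forall>\<theta>\<in>S. (r j has_vector_derivative w i \<theta> * r (Suc j) \<theta>) (at \<theta>)" and \<theta>: "\<theta> \<in> S" for i r n \<theta>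
  proof -
    have "((\<lambda>\<theta>. \<Sum>j\<le>n. c n j i \<theta> * r j \<theta>) has_vector_derivative
        (\<Sum>j\<le>n. c n j i \<theta> * (w i \<theta> * r (Suc j) \<theta>) + dv (c n j) i \<theta> * r j \<theta>)) (at \<theta>)"
      by (intro has_vector_derivative_sum has_vector_derivative_mult dv(2) cls \<theta>)
        (use r \<theta> in auto)
    moreover have "(\<Sum>j\<le>Suc n. c (Suc n) j i \<theta> * r j \<theta>) =
      (\<Sum>j\<le>Suc n. (if j \<le> n then dv (c n j) i \<theta> * r j \<theta> else 0)) +
      (\<Sum>j\<le>Suc n. (if j = 0 then 0 else w i \<theta> * c n (j - 1) i \<theta> * r j \<theta>))"
      unfolding sum.distrib[symmetric] by (rule sum.cong) (auto simp: cS algebra_simps)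
    moreover have "(\<Sum>j\<le>Suc n. (if j \<le> n then dv (c n j) i \<theta> * r j \<theta> else 0)) =
      (\<Sum>j\<le>n. dv (c n j) i \<theta> * r j \<theta>)" by simp
    moreover have "(\<Sum>j\<le>Suc n. (if j = 0 then 0 else w i \<theta> * c n (j - 1) i \<theta> * r j \<theta>)) =
      (\<Sum>j\<le>n. w i \<theta> * c n j i \<theta> * r (Suc j) \<theta>)"
      by (subst sum.atMost_Suc_shift) simp
    ultimately show ?thesis by (simp add: sum.distrib mult_ac add.commute)
  qed
  then show ?thesis using cls c0 by (intro exI[of _ c]) auto
qed

section \<open>The action of boosts and rotations on test functions\<close>

text \<open>This is the factor X of \<open>boost t\<close> at the preimage of the point with angle
  \<theta>, see \<open>moebius_X_boost\<close>.\<close>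

definition boost_weight :: "real \<Rightarrow> real \<Rightarrow> real" where
  "boost_weight t \<theta> = cosh t + sinh t * cos \<theta>"

text \<open>A global lift of \<open>boost (-t)\<close> to the real line.\<close>

definition boost_lift :: "real \<Rightarrow> real \<Rightarrow> real" where
  "boost_lift t \<theta> = \<theta> - 2 * arctan (sinh (t / 2) * sin \<theta> / (cosh (t / 2) + sinh (t / 2) * cos \<theta>))"

lemma abs_sinh_less_cosh: "\<bar>sinh x\<bar> < cosh (x::real)"
  using sinh_less_cosh_real[of x] sinh_less_cosh_real[of "-x"] by (simp add: abs_less_iff)

lemma sinh_cos_bound: "\<bar>sinh x * cos \<theta>\<bar> \<le> \<bar>sinh x :: real\<bar>"
  by (simp add: abs_mult mult_left_le)

lemma lift_denominator_pos: "0 < cosh (x::real) + sinh x * cos \<theta>"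
  using abs_sinh_less_cosh[of x] sinh_cos_bound[of x \<theta>] by linarith

lemma boost_weight_pos: "boost_weight t \<theta> > 0"
  unfolding boost_weight_def by (rule lift_denominator_pos)

lemma cosh_minus_abs_sinh: "cosh t - \<bar>sinh t\<bar> = exp (- \<bar>t::real\<bar>)"
  by (cases "t \<ge> 0") (auto simp: cosh_def sinh_def abs_if field_simps)

lemma boost_weight_lower: "exp (- \<bar>t\<bar>) \<le> boost_weight t \<theta>"
  using sinh_cos_bound[of t \<theta>] by (simp add: boost_weight_def cosh_minus_abs_sinh[symmetric])

text \<open>The weight is |w|^2 for w = cosh(t/2) + sinh(t/2) exp(i\<theta>), the denominator of the
  boosted point.\<close>

lemma boost_weight_eq:
  "boost_weight t \<theta> = (cosh (t/2) + sinh (t/2) * cos \<theta>)\<^sup>2 + (sinh (t/2) * sin \<theta>)\<^sup>2"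
proof -
  have 1: "cosh t = (cosh (t/2))\<^sup>2 + (sinh (t/2))\<^sup>2" "sinh t = 2 * sinh (t/2) * cosh (t/2)"
    using cosh_double[of "t/2"] sinh_double[of "t/2"] by auto
  have 2: "(sin \<theta>)\<^sup>2 = 1 - (cos \<theta>)\<^sup>2" by (simp add: sin_squared_eq)
  show ?thesis
    unfolding boost_weight_def 1 power_mult_distrib 2 by (simp add: algebra_simps power2_eq_square)
qed

lemma cis_double_arctan: "cis (2 * arctan r) = (1 + \<i> * r) / (1 - \<i> * r)"
proof -
  have r: "1 + r\<^sup>2 > 0" using zero_le_power2[of r] by linarith
  have 1: "cis (arctan r) = (1 + \<i> * r) / sqrt (1 + r\<^sup>2)"
    by (simp add: complex_eq_iff cos_arctan sin_arctan)
  have nz: "1 - \<i> * r \<noteq> 0" by (simp add: complex_eq_iff)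
  have "cis (2 * arctan r) = (cis (arctan r))\<^sup>2"
    by (simp add: power2_eq_square cis_mult)
  also have "\<dots> = (1 + \<i> * r)\<^sup>2 / complex_of_real (1 + r\<^sup>2)"
    unfolding 1 using r by (simp add: power_divide of_real_power[symmetric] del: of_real_power of_real_add)
  also have "complex_of_real (1 + r\<^sup>2) = (1 + \<i> * r) * (1 - \<i> * r)"
    by (simp add: complex_eq_iff power2_eq_square)
  finally show ?thesis
    using nz r by (simp add: power2_eq_square complex_eq_iff)
qed

text \<open>With w = cosh(t/2) + sinh(t/2) exp(i\<theta>) the right-hand side is exp(i\<theta>)
  cnj(w) / w. As Re w > 0, the argument of w is an arctangent, and it is subtracted twice in
  \<open>boost_lift\<close>.\<close>

lemma cis_boost_lift:
  "cis (boost_lift t \<theta>) = (complex_of_real (cosh (t/2)) * cis \<theta> + complex_of_real (sinh (t/2))) /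
    (complex_of_real (sinh (t/2)) * cis \<theta> + complex_of_real (cosh (t/2)))"
proof -
  define a b where "a = sinh (t/2) * sin \<theta>" and "b = cosh (t/2) + sinh (t/2) * cos \<theta>"
  have b: "b > 0" unfolding b_def by (rule lift_denominator_pos)
  have "cis (boost_lift t \<theta>) = cis \<theta> / cis (2 * arctan (a / b))"
    by (simp add: boost_lift_def a_def b_def cis_divide)
  also have "\<dots> = cis \<theta> * ((b - \<i> * a) / (b + \<i> * a))"
  proof -
    have "1 + \<i> * (a / b) = (b + \<i> * a) / b" "1 - \<i> * (a / b) = (b - \<i> * a) / b"
      using b by (simp_all add: field_simps)
    then show ?thesis unfolding cis_double_arctan using b by simp
  qed
  also have "cis \<theta> * ((b - \<i> * a) / (b + \<i> * a)) = (cis \<theta> * (b - \<i> * a)) / (b + \<i> * a)" by simp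
  also have "cis \<theta> * (b - \<i> * a) = complex_of_real (cosh (t/2)) * cis \<theta> +
      complex_of_real (sinh (t/2) * ((cos \<theta>)\<^sup>2 + (sin \<theta>)\<^sup>2))"
    unfolding a_def b_def power2_eq_square complex_eq_iff
    by (simp add: algebra_simps del: sin_cos_squared_add sin_cos_squared_add2 sin_cos_squared_add3)
  also have "b + \<i> * a = complex_of_real (sinh (t/2)) * cis \<theta> + complex_of_real (cosh (t/2))"
    by (simp add: complex_eq_iff a_def b_def algebra_simps)
  finally show ?thesis by simp
qed

lemma boost_lift_cos_sin:
  "cos (boost_lift t \<theta>) = (sinh t + cosh t * cos \<theta>) / boost_weight t \<theta>"
  "sin (boost_lift t \<theta>) = sin \<theta> / boost_weight t \<theta>"
proof -
  let ?c = "cosh (t/2)" and ?s = "sinh (t/2)" and ?Y = "boost_weight t \<theta>"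
  have t: "cosh t = ?c\<^sup>2 + ?s\<^sup>2" "sinh t = 2 * ?s * ?c"
    using cosh_double[of "t/2"] sinh_double[of "t/2"] by auto
  have cs: "?c\<^sup>2 - ?s\<^sup>2 = 1" by (rule hyperbolic_pythagoras)
  have Y: "?Y > 0" by (rule boost_weight_pos)
  define D where "D = ?s * cis \<theta> + ?c"
  have DD: "D * cnj D = ?Y"
    unfolding boost_weight_eq D_def by (simp add: complex_eq_iff algebra_simps power2_eq_square)
  then have D: "D \<noteq> 0" using Y by auto
  have "cis (boost_lift t \<theta>) = ((?c * cis \<theta> + ?s) * cnj D) / (D * cnj D)"
    unfolding cis_boost_lift D_def[symmetric] using D by simp
  also have "\<dots> = ((?c * cis \<theta> + ?s) * cnj D) / ?Y" by (simp add: DD)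
  finally have eq: "cis (boost_lift t \<theta>) = ((?c * cis \<theta> + ?s) * cnj D) / ?Y" .
  have "Re ((?c * cis \<theta> + ?s) * cnj D) = (?c\<^sup>2 + ?s\<^sup>2) * cos \<theta> + ?s * ?c * ((cos \<theta>)\<^sup>2 + (sin \<theta>)\<^sup>2) + ?s * ?c"
    unfolding D_def power2_eq_square
    by (simp add: algebra_simps del: sin_cos_squared_add sin_cos_squared_add2 sin_cos_squared_add3)
  then have Re: "Re ((?c * cis \<theta> + ?s) * cnj D) = sinh t + cosh t * cos \<theta>"
    by (simp add: t)
  have "Im ((?c * cis \<theta> + ?s) * cnj D) = (?c\<^sup>2 - ?s\<^sup>2) * sin \<theta>"
    unfolding D_def by (simp add: algebra_simps power2_eq_square)
  then have Im: "Im ((?c * cis \<theta> + ?s) * cnj D) = sin \<theta>" by (simp add: cs)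
  show "cos (boost_lift t \<theta>) = (sinh t + cosh t * cos \<theta>) / ?Y"
    using arg_cong[OF eq, of Re] unfolding Re_divide_of_real Re by simp
  show "sin (boost_lift t \<theta>) = sin \<theta> / ?Y"
    using arg_cong[OF eq, of Im] unfolding Im_divide_of_real Im by simp
qed

lemma boost_lift_deriv:
  "(boost_lift t has_real_derivative 1 / boost_weight t \<theta>) (at \<theta>)"
proof -
  let ?c = "cosh (t/2)" and ?s = "sinh (t/2)" and ?Y = "boost_weight t \<theta>"
  let ?a = "?s * sin \<theta>" and ?b = "?c + ?s * cos \<theta>"
  have b: "?b > 0" by (rule lift_denominator_pos)
  have Y: "?Y > 0" by (rule boost_weight_pos)
  have Yab: "?Y = ?b\<^sup>2 + ?a\<^sup>2" by (rule boost_weight_eq)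
  have cs: "?c\<^sup>2 - ?s\<^sup>2 = 1" by (rule hyperbolic_pythagoras)
  have "((\<lambda>\<theta>. ?s * sin \<theta> / (?c + ?s * cos \<theta>)) has_real_derivative
      ((?s * cos \<theta>) * ?b - ?a * (- ?s * sin \<theta>)) / (?b * ?b)) (at \<theta>)"
    using b by (auto intro!: derivative_eq_intros)
  from DERIV_diff[OF DERIV_ident DERIV_cmult[OF DERIV_chain2[OF DERIV_arctan this], of 2]]
  have 1: "(boost_lift t has_real_derivative
      1 - 2 * (inverse (1 + (?a / ?b)\<^sup>2) * (((?s * cos \<theta>) * ?b - ?a * (- ?s * sin \<theta>)) / (?b * ?b)))) (at \<theta>)"
    unfolding boost_lift_def[abs_def] .
  have "?Y = (1 + (?a / ?b)\<^sup>2) * (?b * ?b)"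
  proof -
    have "(?a / ?b)\<^sup>2 * (?b * ?b) = ?a\<^sup>2" using b by (simp add: power2_eq_square)
    then show ?thesis unfolding Yab by (simp only: distrib_right mult_1 power2_eq_square[of ?b])
  qed
  then have 2: "inverse (1 + (?a / ?b)\<^sup>2) * (x / (?b * ?b)) = x / ?Y" for x
    by (simp only: divide_inverse inverse_mult_distrib mult_ac)
  have "(?s * cos \<theta>) * ?b - ?a * (- ?s * sin \<theta>) = ?s * ?c * cos \<theta> + ?s\<^sup>2 * ((cos \<theta>)\<^sup>2 + (sin \<theta>)\<^sup>2)"
    unfolding power2_eq_square by (simp add: algebra_simps del: sin_cos_squared_add sin_cos_squared_add2 sin_cos_squared_add3)
  also have "\<dots> = ?s * ?c * cos \<theta> + ?s\<^sup>2" by simp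
  finally have 3: "(?s * cos \<theta>) * ?b - ?a * (- ?s * sin \<theta>) = ?s * ?c * cos \<theta> + ?s\<^sup>2" .
  have "?Y = ?c\<^sup>2 + 2 * ?s * ?c * cos \<theta> + ?s\<^sup>2 * ((cos \<theta>)\<^sup>2 + (sin \<theta>)\<^sup>2)"
    unfolding Yab power2_eq_square by (simp add: algebra_simps del: sin_cos_squared_add sin_cos_squared_add2 sin_cos_squared_add3)
  then have "?Y - 2 * (?s * ?c * cos \<theta> + ?s\<^sup>2) = 1" using cs by simp
  then have "1 - 2 * ((?s * ?c * cos \<theta> + ?s\<^sup>2) / ?Y) = 1 / ?Y"
    using Y by (simp add: field_simps)
  with 1 show ?thesis unfolding 2 3 by simp
qed

section \<open>Boosts and rotations as one-parameter groups acting on test functions\<close>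

lemma of_circle_boost:
  "of_circle (boost t z) = (complex_of_real (cosh (t/2)) * of_circle z - complex_of_real (sinh (t/2))) /
    (- complex_of_real (sinh (t/2)) * of_circle z + complex_of_real (cosh (t/2)))"
  unfolding boost_def
  by (subst of_circle_moebius) (simp_all add: hyperbolic_pythagoras)

lemma boost_circle_cis: "boost (-t) (circle_cis \<theta>) = circle_cis (boost_lift t \<theta>)"
  by (rule of_circle_eqI) (simp add: of_circle_boost cis_boost_lift)

lemma has_vector_derivative_cis: "(cis has_vector_derivative \<i> * cis x) (at x)"
proof -
  have *: "cis = (\<lambda>x. exp (x *\<^sub>R \<i>))"
    by (rule ext) (simp add: cis_conv_exp scaleR_conv_of_real mult.commute)
  show ?thesis
    unfolding * using exp_scaleR_has_vector_derivative_right[of \<i> x] by (simp only: mult.commute)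
qed

lemma boost_denominator_nonzero:
  "- complex_of_real (sinh x) * of_circle z + complex_of_real (cosh x) \<noteq> 0"
proof
  assume "- complex_of_real (sinh x) * of_circle z + complex_of_real (cosh x) = 0"
  then have "complex_of_real (cosh x) = complex_of_real (sinh x) * of_circle z" by simp
  then have "cmod (complex_of_real (cosh x)) = cmod (complex_of_real (sinh x) * of_circle z)" by (rule arg_cong)
  then have "\<bar>cosh x\<bar> = \<bar>sinh x\<bar>" by (simp add: norm_mult)
  then show False using abs_sinh_less_cosh[of x] by simp
qed

lemma boost_comp: "boost s (boost t z) = boost (s + t) z"
proof (rule of_circle_eqI)
  let ?z = "of_circle z"
  let ?c = "complex_of_real (cosh (t/2))" and ?s = "complex_of_real (sinh (t/2))"
    and ?C = "complex_of_real (cosh (s/2))" and ?S = "complex_of_real (sinh (s/2))"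
  define D where "D = - ?s * ?z + ?c"
  have D: "D \<noteq> 0" unfolding D_def by (rule boost_denominator_nonzero)
  have st: "cosh ((s+t)/2) = cosh (s/2) * cosh (t/2) + sinh (s/2) * sinh (t/2)"
      "sinh ((s+t)/2) = sinh (s/2) * cosh (t/2) + cosh (s/2) * sinh (t/2)"
    by (simp_all add: add_divide_distrib cosh_add sinh_add)
  have "of_circle (boost s (boost t z)) = (?C * ((?c * ?z - ?s) / D) - ?S) / (- ?S * ((?c * ?z - ?s) / D) + ?C)"
    by (simp only: of_circle_boost D_def)
  also have "?C * ((?c * ?z - ?s) / D) - ?S = (?C * (?c * ?z - ?s) - ?S * D) / D"
    using D by (simp add: field_simps)
  also have "- ?S * ((?c * ?z - ?s) / D) + ?C = (- ?S * (?c * ?z - ?s) + ?C * D) / D"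
    using D by (simp add: field_simps)
  also have "(?C * (?c * ?z - ?s) - ?S * D) / D / ((- ?S * (?c * ?z - ?s) + ?C * D) / D) =
     (?C * (?c * ?z - ?s) - ?S * D) / (- ?S * (?c * ?z - ?s) + ?C * D)"
    using D by simp
  also have "\<dots> = of_circle (boost (s + t) z)"
    unfolding of_circle_boost st D_def of_real_add of_real_mult by (simp add: algebra_simps)
  finally show "of_circle (boost s (boost t z)) = of_circle (boost (s + t) z)" .
qed

lemma boost_0: "boost 0 z = z"
  by (rule of_circle_eqI) (simp add: of_circle_boost)

lemma inv_boost: "inv (boost t) = boost (- t)"
  by (rule inv_equality) (simp_all add: boost_comp boost_0)

lemma boost_Mob: "boost t \<in> Mob"
  unfolding Mob_def boost_def
  by (rule CollectI, rule exI, rule exI, rule conjI[OF refl]) (simp add: hyperbolic_pythagoras)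

lemma moebius_X_boost:
  "moebius_X (boost t) (boost (-t) (circle_cis \<theta>)) = boost_weight t \<theta>"
proof -
  define z where "z = boost (-t) (circle_cis \<theta>)"
  define \<phi> where "\<phi> = Arg (of_circle z)"
  have z: "z = circle_cis \<phi>" by (simp add: \<phi>_def)
  have lift: "boost t (circle_cis \<psi>) = circle_cis (boost_lift (-t) \<psi>)" for \<psi>
    using boost_circle_cis[of "-t" \<psi>] by simp
  have "((\<lambda>\<psi>. cis (boost_lift (-t) \<psi>)) has_vector_derivative
      (1 / boost_weight (-t) \<phi>) *\<^sub>R (\<i> * cis (boost_lift (-t) \<phi>))) (at \<phi>)"
  proof -
    have "(cis has_vector_derivative \<i> * cis (boost_lift (-t) \<phi>)) (at (boost_lift (-t) \<phi>))"
      by (rule has_vector_derivative_cis)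
    from vector_diff_chain_at[of "boost_lift (-t)" "1 / boost_weight (-t) \<phi>" \<phi> cis, OF _ this] boost_lift_deriv
    show ?thesis by (simp add: o_def has_real_derivative_iff_has_vector_derivative)
  qed
  then have vd: "vector_derivative (\<lambda>\<psi>. of_circle (boost t (circle_cis \<psi>))) (at \<phi>) =
      (1 / boost_weight (-t) \<phi>) *\<^sub>R (\<i> * cis (boost_lift (-t) \<phi>))"
    unfolding lift of_circle_cis by (rule vector_derivative_at)
  have "moebius_X (boost t) z = 1 / boost_weight (-t) \<phi>"
    unfolding moebius_X_def \<phi>_def[symmetric] vd
    by (simp add: z lift scaleR_conv_of_real)
  moreover have "cos \<phi> = cos (boost_lift t \<theta>)"
  proof -
    have "cis \<phi> = cis (boost_lift t \<theta>)"
      using z unfolding z_def boost_circle_cis by (metis of_circle_cis)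
    then show ?thesis by (simp add: complex_eq_iff)
  qed
  moreover have "boost_weight (-t) \<phi> = 1 / boost_weight t \<theta>"
  proof -
    have Y: "boost_weight t \<theta> > 0" by (rule boost_weight_pos)
    have "(cosh t)\<^sup>2 - (sinh t)\<^sup>2 = 1" by (rule hyperbolic_pythagoras)
    moreover have "boost_weight (-t) \<phi> = cosh t - sinh t * ((sinh t + cosh t * cos \<theta>) / boost_weight t \<theta>)"
      unfolding boost_weight_def[of "-t"] using \<open>cos \<phi> = _\<close> by (simp add: boost_lift_cos_sin)
    moreover have "cosh t * boost_weight t \<theta> - sinh t * (sinh t + cosh t * cos \<theta>) = (cosh t)\<^sup>2 - (sinh t)\<^sup>2"
      by (simp add: boost_weight_def algebra_simps power2_eq_square)
    ultimately show ?thesis using Y by (simp add: field_simps)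
  qed
  ultimately show ?thesis by (simp add: z_def)
qed

lemma moebius_beta_boost:
  "moebius_beta d (boost t) f (circle_cis \<theta>) =
    complex_of_real (boost_weight t \<theta>) powi (int d - 1) * f (circle_cis (boost_lift t \<theta>))"
  unfolding moebius_beta_def inv_boost moebius_X_boost by (simp add: boost_circle_cis)

lemma rotation_circle_cis: "rotation a (circle_cis \<theta>) = circle_cis (a + \<theta>)"
  by (rule of_circle_eqI) (simp add: rotation.rep_eq cis_mult)

lemma rotation_comp: "rotation a (rotation b z) = rotation (a + b) z"
  by (rule of_circle_eqI) (simp add: rotation.rep_eq cis_mult mult.assoc[symmetric])

lemma rotation_0: "rotation 0 z = z"
  by (rule of_circle_eqI) (simp add: rotation.rep_eq)

lemma inv_rotation: "inv (rotation a) = rotation (- a)"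
  by (rule inv_equality) (simp_all add: rotation_comp rotation_0)

lemma rotation_Mob: "rotation a \<in> Mob"
proof -
  have n: "(cmod (cis (a / 2)))\<^sup>2 - (cmod 0)\<^sup>2 = 1" by simp
  have "rotation a = moebius (cis (a / 2)) 0"
  proof (rule ext, rule of_circle_eqI)
    fix z
    have "cis a = cis (a / 2) / cnj (cis (a / 2))" by (simp add: cis_cnj cis_divide)
    then show "of_circle (rotation a z) = of_circle (moebius (cis (a / 2)) 0 z)"
      using of_circle_moebius[OF n] by (simp add: rotation.rep_eq)
  qed
  then show ?thesis using n unfolding Mob_def by blast
qed

lemma moebius_beta_rotation: "moebius_beta d (rotation a) f z = f (rotation (- a) z)"
proof -
  have "moebius_X (rotation a) w = 1" for w
  proof -
    have "((\<lambda>\<psi>. cis a * cis \<psi>) has_vector_derivative cis a * (\<i> * cis (Arg (of_circle w)))) (at (Arg (of_circle w)))"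
      by (intro has_vector_derivative_mult_right has_vector_derivative_cis)
    then have "((\<lambda>\<psi>. cis (a + \<psi>)) has_vector_derivative \<i> * cis (a + Arg (of_circle w))) (at (Arg (of_circle w)))"
      by (simp add: cis_mult[symmetric] mult_ac)
    then have "vector_derivative (\<lambda>\<psi>. of_circle (rotation a (circle_cis \<psi>))) (at (Arg (of_circle w))) =
      \<i> * cis (a + Arg (of_circle w))"
      unfolding rotation_circle_cis of_circle_cis by (rule vector_derivative_at)
    moreover have "of_circle (rotation a w) = cis (a + Arg (of_circle w))"
      using rotation_circle_cis[of a "Arg (of_circle w)"] by simp
    ultimately show ?thesis by (simp add: moebius_X_def)
  qed
  then show ?thesis by (simp add: moebius_beta_def inv_rotation)
qed

subsection \<open>Bounds for the action of boosts\<close>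

text \<open>A class of coefficients for \<open>chain_coefficients\<close>: it contains the powers of
  the weight, is closed under sums, products and \<theta>-derivatives, and each member is bounded by
  an exponential in |t| uniformly in \<theta>.\<close>

inductive_set boost_coeffs :: "(real \<Rightarrow> real \<Rightarrow> complex) set" where
  const: "(\<lambda>_ _. c) \<in> boost_coeffs"
| cosh: "(\<lambda>t _. of_real (cosh t)) \<in> boost_coeffs"
| sinh: "(\<lambda>t _. of_real (sinh t)) \<in> boost_coeffs"
| cos: "(\<lambda>_ \<theta>. of_real (cos \<theta>)) \<in> boost_coeffs"
| sin: "(\<lambda>_ \<theta>. of_real (sin \<theta>)) \<in> boost_coeffs"
| weight: "(\<lambda>t \<theta>. of_real (1 / boost_weight t \<theta>)) \<in> boost_coeffs"
| add: "a \<in> boost_coeffs \<Longrightarrow> b \<in> boost_coeffs \<Longrightarrow> (\<lambda>t \<theta>. a t \<theta> + b t \<theta>) \<in> boost_coeffs"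
| mult: "a \<in> boost_coeffs \<Longrightarrow> b \<in> boost_coeffs \<Longrightarrow> (\<lambda>t \<theta>. a t \<theta> * b t \<theta>) \<in> boost_coeffs"

lemma has_vector_derivative_of_real_fun:
  "(f has_real_derivative d) (at x) \<Longrightarrow> ((\<lambda>x. complex_of_real (f x)) has_vector_derivative of_real d) (at x)"
  by (simp add: has_real_derivative_iff_has_vector_derivative has_vector_derivative_of_real)

lemma boost_coeffs_deriv:
  assumes "a \<in> boost_coeffs"
  shows "\<exists>a'\<in>boost_coeffs. \<forall>t \<theta>. (a t has_vector_derivative a' t \<theta>) (at \<theta>)"
  using assms
proof induction
  case (cos)
  show ?case
    by (rule bexI[OF _ boost_coeffs.mult[OF boost_coeffs.const[of "-1"] boost_coeffs.sin]])
      (use has_vector_derivative_of_real_fun[OF DERIV_cos] in simp)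
next
  case (sin)
  show ?case
    by (rule bexI[OF _ boost_coeffs.cos])
      (use has_vector_derivative_of_real_fun[OF DERIV_sin] in simp)
next
  case (weight)
  have "((\<lambda>\<theta>. 1 / boost_weight t \<theta>) has_real_derivative
      sinh t * sin \<theta> * (1 / boost_weight t \<theta> * (1 / boost_weight t \<theta>))) (at \<theta>)" for t \<theta>
    using boost_weight_pos[of t \<theta>] unfolding boost_weight_def
    by (auto intro!: derivative_eq_intros simp: power2_eq_square)
  then show ?case
    by (intro bexI[OF _ boost_coeffs.mult[OF boost_coeffs.mult[OF boost_coeffs.sinh boost_coeffs.sin]
      boost_coeffs.mult[OF boost_coeffs.weight boost_coeffs.weight]]] allI)
      (metis (mono_tags) has_vector_derivative_of_real_fun of_real_mult)
next
  case (add a b)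
  then obtain a' b' where a: "a' \<in> boost_coeffs" "\<And>t \<theta>. (a t has_vector_derivative a' t \<theta>) (at \<theta>)"
    and b: "b' \<in> boost_coeffs" "\<And>t \<theta>. (b t has_vector_derivative b' t \<theta>) (at \<theta>)" by blast
  show ?case
    by (rule bexI[OF _ boost_coeffs.add[OF a(1) b(1)]]) (auto intro!: has_vector_derivative_add a b)
next
  case (mult a b)
  then obtain a' b' where a: "a' \<in> boost_coeffs" "\<And>t \<theta>. (a t has_vector_derivative a' t \<theta>) (at \<theta>)"
    and b: "b' \<in> boost_coeffs" "\<And>t \<theta>. (b t has_vector_derivative b' t \<theta>) (at \<theta>)" by blast
  show ?case
    by (rule bexI[OF _ boost_coeffs.add[OF boost_coeffs.mult[OF mult.hyps(1) b(1)] boost_coeffs.mult[OF a(1) mult.hyps(2)]]])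
      (auto intro!: has_vector_derivative_mult a b)
qed (auto intro!: bexI[OF _ boost_coeffs.const[of 0]])

lemma boost_coeffs_bound:
  assumes "a \<in> boost_coeffs"
  shows "\<exists>C K. 0 \<le> C \<and> 0 \<le> K \<and> (\<forall>t \<theta>. cmod (a t \<theta>) \<le> C * exp (K * \<bar>t\<bar>))"
  using assms
proof induction
  case (const c)
  show ?case by (intro exI[of _ "cmod c"] exI[of _ 0]) auto
next
  case cosh
  have "\<bar>cosh t\<bar> \<le> 1 * exp (1 * \<bar>t\<bar>)" for t :: real
  proof -
    have *: "\<bar>(a + b) / 2\<bar> \<le> c" if "a \<le> c" "b \<le> c" "0 < a" "0 < b" for a b c :: real
      using that by (simp add: abs_le_iff)
    show ?thesis unfolding cosh_field_def mult_1 by (rule *) auto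
  qed
  then show ?case by (intro exI[of _ 1]) (simp only: norm_of_real, simp)
next
  case sinh
  have "\<bar>sinh t\<bar> \<le> 1 * exp (1 * \<bar>t\<bar>)" for t :: real
  proof -
    have *: "\<bar>(a - b) / 2\<bar> \<le> c" if "a \<le> c" "b \<le> c" "0 < a" "0 < b" for a b c :: real
      using that by (simp add: abs_le_iff)
    show ?thesis unfolding sinh_field_def mult_1 by (rule *) auto
  qed
  then show ?case by (intro exI[of _ 1]) (simp only: norm_of_real, simp)
next
  case cos
  then show ?case by (intro exI[of _ 1] exI[of _ 0]) (simp only: norm_of_real, simp)
next
  case sin
  then show ?case by (intro exI[of _ 1] exI[of _ 0]) (simp only: norm_of_real, simp)
next
  case weight
  have "\<bar>1 / boost_weight t \<theta>\<bar> \<le> 1 * exp (1 * \<bar>t\<bar>)" for t \<theta>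
    using boost_weight_pos[of t \<theta>] boost_weight_lower[of t \<theta>] by (simp add: field_simps exp_minus)
  then show ?case by (intro exI[of _ 1]) (simp only: norm_of_real, simp)
next
  case (add a b)
  then obtain C K C' K' where *: "0 \<le> C" "0 \<le> K" "\<And>t \<theta>. cmod (a t \<theta>) \<le> C * exp (K * \<bar>t\<bar>)"
    "0 \<le> C'" "0 \<le> K'" "\<And>t \<theta>. cmod (b t \<theta>) \<le> C' * exp (K' * \<bar>t\<bar>)" by blast
  have "cmod (a t \<theta> + b t \<theta>) \<le> (C + C') * exp ((K + K') * \<bar>t\<bar>)" for t \<theta>
  proof -
    have "C * exp (K * \<bar>t\<bar>) \<le> C * exp ((K + K') * \<bar>t\<bar>)" "C' * exp (K' * \<bar>t\<bar>) \<le> C' * exp ((K + K') * \<bar>t\<bar>)"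
      using * by (auto intro!: mult_left_mono mult_right_mono)
    then show ?thesis
      using norm_triangle_ineq[of "a t \<theta>" "b t \<theta>"] *(3)[of t \<theta>] *(6)[of t \<theta>] by (simp add: distrib_right)
  qed
  then show ?case using * by (intro exI[of _ "C + C'"] exI[of _ "K + K'"]) auto
next
  case (mult a b)
  then obtain C K C' K' where *: "0 \<le> C" "0 \<le> K" "\<And>t \<theta>. cmod (a t \<theta>) \<le> C * exp (K * \<bar>t\<bar>)"
    "0 \<le> C'" "0 \<le> K'" "\<And>t \<theta>. cmod (b t \<theta>) \<le> C' * exp (K' * \<bar>t\<bar>)" by blast
  have "cmod (a t \<theta> * b t \<theta>) \<le> (C * C') * exp ((K + K') * \<bar>t\<bar>)" for t \<theta>
  proof -
    have "cmod (a t \<theta>) * cmod (b t \<theta>) \<le> (C * exp (K * \<bar>t\<bar>)) * (C' * exp (K' * \<bar>t\<bar>))"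
      using * by (intro mult_mono) auto
    then show ?thesis by (simp add: norm_mult distrib_right distrib_left exp_add mult_ac)
  qed
  then show ?case using * by (intro exI[of _ "C * C'"] exI[of _ "K + K'"]) auto
qed

lemma boost_coeffs_power: "a \<in> boost_coeffs \<Longrightarrow> (\<lambda>t \<theta>. a t \<theta> ^ n) \<in> boost_coeffs"
  by (induction n) (auto intro: boost_coeffs.const boost_coeffs.mult)

lemma boost_weight_powi_coeffs:
  "(\<lambda>t \<theta>. complex_of_real (boost_weight t \<theta>) powi (int d - 1)) \<in> boost_coeffs"
proof (cases d)
  case 0
  have "(\<lambda>t \<theta>. complex_of_real (boost_weight t \<theta>) powi (int d - 1)) = (\<lambda>t \<theta>. of_real (1 / boost_weight t \<theta>))"
    by (simp add: 0 power_int_minus field_simps)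
  then show ?thesis using boost_coeffs.weight by simp
next
  case (Suc n)
  have "(\<lambda>t \<theta>. complex_of_real (boost_weight t \<theta>)) \<in> boost_coeffs"
    unfolding boost_weight_def of_real_add of_real_mult
    by (intro boost_coeffs.intros)
  then have "(\<lambda>t \<theta>. complex_of_real (boost_weight t \<theta>) ^ n) \<in> boost_coeffs"
    by (rule boost_coeffs_power)
  then show ?thesis by (simp add: Suc)
qed

text \<open>This replaces the norm bound that unitarity would provide: every C^N norm grows at most
  exponentially along the boosts. The chain-rule coefficients do not depend on \<open>f\<close>,
  which makes \<open>C\<close> and \<open>K\<close> uniform.\<close>

lemma moebius_beta_boost_bound:
  "\<exists>C K. 0 \<le> C \<and> 0 \<le> K \<and> (\<forall>t. \<forall>f\<in>smooth_circle. moebius_beta d (boost t) f \<in> smooth_circle \<and>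
    C_norm N (moebius_beta d (boost t) f) \<le> C * exp (K * \<bar>t\<bar>) * C_norm N f)"
proof -
  let ?w = "\<lambda>t \<theta>. complex_of_real (1 / boost_weight t \<theta>)"
  have deriv: "\<forall>a\<in>boost_coeffs. \<exists>a'\<in>boost_coeffs. \<forall>i. \<forall>\<theta>\<in>UNIV. (a i has_vector_derivative a' i \<theta>) (at \<theta>)"
    using boost_coeffs_deriv by blast
  have add: "\<forall>a\<in>boost_coeffs. \<forall>b\<in>boost_coeffs. (\<lambda>i \<theta>. a i \<theta> + b i \<theta>) \<in> boost_coeffs"
    by (intro ballI boost_coeffs.add)
  have mult: "\<forall>a\<in>boost_coeffs. (\<lambda>i \<theta>. ?w i \<theta> * a i \<theta>) \<in> boost_coeffs"
    by (intro ballI boost_coeffs.mult boost_coeffs.weight)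
  from chain_coefficients[OF boost_coeffs.const[of 0] add mult deriv boost_weight_powi_coeffs[of d]]
  obtain c where c': "\<forall>n j. c n j \<in> boost_coeffs"
    and c2: "c 0 0 = (\<lambda>t \<theta>. complex_of_real (boost_weight t \<theta>) powi (int d - 1))"
    and c3: "\<forall>i r. (\<forall>j. \<forall>\<theta>\<in>UNIV. (r j has_vector_derivative ?w i \<theta> * r (Suc j) \<theta>) (at \<theta>)) \<longrightarrow>
      (\<forall>n. \<forall>\<theta>\<in>UNIV. ((\<lambda>\<theta>. \<Sum>j\<le>n. c n j i \<theta> * r j \<theta>) has_vector_derivative
          (\<Sum>j\<le>Suc n. c (Suc n) j i \<theta> * r j \<theta>)) (at \<theta>))"
    by (elim exE conjE) (rule that)
  have c1: "c n j \<in> boost_coeffs" for n j using c' by blast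
  have "\<forall>n j. \<exists>C K. 0 \<le> C \<and> 0 \<le> K \<and> (\<forall>t \<theta>. cmod (c n j t \<theta>) \<le> C * exp (K * \<bar>t\<bar>))"
    using boost_coeffs_bound c1 by blast
  then obtain B M where BM: "\<And>n j. 0 \<le> B n j" "\<And>n j. 0 \<le> M n j"
    "\<And>n j t \<theta>. cmod (c n j t \<theta>) \<le> B n j * exp (M n j * \<bar>t\<bar>)" by metis
  define K where "K = (\<Sum>n\<le>N. \<Sum>j\<le>n. M n j)"
  define C where "C = (\<Sum>n\<le>N. \<Sum>j\<le>n. B n j)"
  have MK: "M n j \<le> K" if "n \<le> N" "j \<le> n" for n j
  proof -
    have "M n j \<le> (\<Sum>j\<le>n. M n j)" by (rule member_le_sum) (use that BM in auto)
    also have "\<dots> \<le> K" unfolding K_def by (rule member_le_sum) (use that BM in \<open>auto intro: sum_nonneg\<close>)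
    finally show ?thesis .
  qed
  have main: "moebius_beta d (boost t) f \<in> smooth_circle \<and>
    C_norm N (moebius_beta d (boost t) f) \<le> C * exp (K * \<bar>t\<bar>) * C_norm N f" if f: "f \<in> smooth_circle" for t f
  proof -
    define r where "r j \<theta> = circle_deriv j f (boost_lift t \<theta>)" for j \<theta>
    have r: "(r j has_vector_derivative ?w t \<theta> * r (Suc j) \<theta>) (at \<theta>)" for j \<theta>
      using vector_diff_chain_at[OF _ circle_deriv_has_vector_derivative[OF f], of "boost_lift t" "1 / boost_weight t \<theta>" \<theta> j]
        boost_lift_deriv[of t \<theta>]
      by (simp add: r_def[abs_def] o_def has_real_derivative_iff_has_vector_derivative scaleR_conv_of_real)
    define D where "D n \<theta> = (\<Sum>j\<le>n. c n j t \<theta> * r j \<theta>)" for n \<theta>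
    have D: "(D n has_vector_derivative D (Suc n) \<theta>) (at \<theta>)" for n \<theta>
      unfolding D_def[abs_def] by (rule c3[rule_format]) (use r in auto)
    have D0: "D 0 \<theta> = moebius_beta d (boost t) f (circle_cis \<theta>)" for \<theta>
      by (simp add: D_def c2 moebius_beta_boost r_def circle_deriv_0)
    have "C_norm N (moebius_beta d (boost t) f) \<le> (\<Sum>n\<le>N. (\<Sum>j\<le>n. B n j) * exp (K * \<bar>t\<bar>) * C_norm N f)"
    proof (rule C_norm_le, subst circle_deriv_eqI[OF D0 D])
      fix n \<theta> assume n: "n \<le> N"
      have "cmod (D n \<theta>) \<le> (\<Sum>j\<le>n. B n j * exp (K * \<bar>t\<bar>) * C_norm N f)"
        unfolding D_def
      proof (rule order_trans[OF norm_sum], rule sum_mono)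
        fix j assume "j \<in> {..n}"
        then have j: "j \<le> n" by simp
        have "cmod (c n j t \<theta>) \<le> B n j * exp (M n j * \<bar>t\<bar>)" by (rule BM)
        also have "\<dots> \<le> B n j * exp (K * \<bar>t\<bar>)"
          using MK[OF n j] BM by (intro mult_left_mono) (auto intro: mult_right_mono)
        finally have "cmod (c n j t \<theta>) \<le> B n j * exp (K * \<bar>t\<bar>)" .
        moreover have "cmod (r j \<theta>) \<le> C_norm N f"
          unfolding r_def by (rule circle_deriv_le_C_norm[OF f]) (use n j in simp)
        ultimately show "cmod (c n j t \<theta> * r j \<theta>) \<le> B n j * exp (K * \<bar>t\<bar>) * C_norm N f"
          unfolding norm_mult using BM by (intro mult_mono) auto
      qed
      then show "cmod (D n \<theta>) \<le> (\<Sum>j\<le>n. B n j) * exp (K * \<bar>t\<bar>) * C_norm N f"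
        by (simp add: sum_distrib_right)
    qed
    then show ?thesis
      using smooth_circleI[OF D0 D] by (simp add: C_def sum_distrib_right)
  qed
  have "0 \<le> C" unfolding C_def by (intro sum_nonneg BM)
  moreover have "0 \<le> K" unfolding K_def by (intro sum_nonneg BM)
  ultimately show ?thesis using main by blast
qed

section \<open>Functions supported in an arc\<close>

lemma abs_sin_diff_le: "\<bar>sin x - sin y\<bar> \<le> \<bar>x - y :: real\<bar>"
  using field_differentiable_bound[of UNIV sin cos 1 x y] by (auto intro: DERIV_sin)

text \<open>At a boundary point sin(\<theta>) = 0, so a bound by sin^2 gives difference quotients of
  size O(|x - \<theta>|) and hence derivative 0. As every \<open>D n\<close> has such a bound, the
  zero extensions differentiate into one another.\<close>

lemma flat_extension:
  fixes D :: "nat \<Rightarrow> real \<Rightarrow> complex"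
  assumes S: "open S" and out: "\<And>\<theta>. \<theta> \<notin> S \<Longrightarrow> sin \<theta> = 0 \<or> (\<forall>\<^sub>F x in nhds \<theta>. x \<notin> S)"
    and f: "\<And>\<theta>. f (circle_cis \<theta>) = (if \<theta> \<in> S then D 0 \<theta> else 0)"
    and D: "\<And>n \<theta>. \<theta> \<in> S \<Longrightarrow> (D n has_vector_derivative D (Suc n) \<theta>) (at \<theta>)"
    and flat: "\<And>n. \<exists>K. \<forall>\<theta>\<in>S. cmod (D n \<theta>) \<le> K * (sin \<theta>)\<^sup>2"
  shows "f \<in> smooth_circle" and "circle_deriv n f \<theta> = (if \<theta> \<in> S then D n \<theta> else 0)"
proof -
  let ?E = "\<lambda>n \<theta>. if \<theta> \<in> S then D n \<theta> else 0"
  have E: "(?E n has_vector_derivative ?E (Suc n) \<theta>) (at \<theta>)" for n \<theta>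
  proof (cases "\<theta> \<in> S")
    case True
    have "(D n has_vector_derivative ?E (Suc n) \<theta>) (at \<theta>)" using D True by simp
    then show ?thesis
      by (rule has_vector_derivative_transform_within_open[OF _ S True]) simp
  next
    case False
    from out[OF False] have "(?E n has_vector_derivative 0) (at \<theta>)"
    proof
      assume "\<forall>\<^sub>F x in nhds \<theta>. x \<notin> S"
      then obtain T where T: "open T" "\<theta> \<in> T" "\<And>x. x \<in> T \<Longrightarrow> x \<notin> S"
        unfolding eventually_nhds by blast
      have "((\<lambda>_. 0) has_vector_derivative 0) (at \<theta>)" by simp
      then show ?thesis
        by (rule has_vector_derivative_transform_within_open[OF _ T(1,2)]) (use T(3) in auto)
    next
      assume s: "sin \<theta> = 0"
      obtain K where K: "\<And>x. x \<in> S \<Longrightarrow> cmod (D n x) \<le> K * (sin x)\<^sup>2" using flat[of n] by blast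
      have bd: "norm (?E n x - ?E n \<theta> - (x - \<theta>) *\<^sub>R 0) / norm (x - \<theta>) \<le> \<bar>K\<bar> * \<bar>x - \<theta>\<bar>" for x
      proof -
        have "cmod (?E n x) \<le> \<bar>K\<bar> * (sin x)\<^sup>2"
          using K[of x] order_trans[OF _ mult_right_mono[of K "\<bar>K\<bar>" "(sin x)\<^sup>2"]] by auto
        also have "(sin x)\<^sup>2 = \<bar>sin x - sin \<theta>\<bar>\<^sup>2" by (simp add: s)
        also have "\<bar>K\<bar> * \<bar>sin x - sin \<theta>\<bar>\<^sup>2 \<le> \<bar>K\<bar> * \<bar>x - \<theta>\<bar>\<^sup>2"
          by (intro mult_left_mono power_mono) (auto simp: abs_sin_diff_le)
        finally have "cmod (?E n x) \<le> \<bar>K\<bar> * \<bar>x - \<theta>\<bar> * \<bar>x - \<theta>\<bar>"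
          by (simp add: power2_eq_square mult.assoc)
        then show ?thesis using False
          by (cases "x = \<theta>") (simp_all add: divide_le_eq)
      qed
      have lim: "((\<lambda>x. \<bar>K\<bar> * \<bar>x - \<theta>\<bar>) \<longlongrightarrow> 0) (at \<theta>)"
        by (auto intro!: tendsto_eq_intros)
      have "((\<lambda>x. norm (?E n x - ?E n \<theta> - (x - \<theta>) *\<^sub>R 0) / norm (x - \<theta>)) \<longlongrightarrow> 0) (at \<theta>)"
        by (rule tendsto_sandwich[OF _ _ tendsto_const lim]) (use bd in \<open>auto intro!: always_eventually\<close>)
      then show ?thesis
        unfolding has_vector_derivative_def has_derivative_iff_norm
        by (simp add: bounded_linear_zero)
    qed
    then show ?thesis using False by simp
  qed
  show "f \<in> smooth_circle"
    by (rule smooth_circleI[of ?E, OF _ E]) (simp add: f)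
  show "circle_deriv n f \<theta> = ?E n \<theta>"
    by (subst circle_deriv_eqI[of ?E, OF _ E]) (simp_all add: f)
qed

lemma open_sin_pos: "open {\<theta>::real. sin \<theta> > 0}"
  by (intro open_Collect_less continuous_intros)

lemma not_sin_pos:
  assumes "\<not> sin \<theta> > 0"
  shows "sin \<theta> = 0 \<or> (\<forall>\<^sub>F x in nhds (\<theta>::real). x \<notin> {\<theta>. sin \<theta> > 0})"
proof (cases "sin \<theta> = 0")
  case False
  have "open {\<theta>::real. sin \<theta> < 0}" by (intro open_Collect_less continuous_intros)
  then have "\<forall>\<^sub>F x in nhds \<theta>. x \<in> {\<theta>. sin \<theta> < 0}"
    by (rule eventually_nhds_in_open) (use False assms in simp)
  then have "\<forall>\<^sub>F x in nhds \<theta>. x \<notin> {\<theta>. sin \<theta> > 0}"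
    by (rule eventually_mono) auto
  then show ?thesis ..
qed simp

text \<open>\<open>D\<close> lives on (0,\<pi>) and need not be periodic;
  \<open>arccos (cos \<theta>)\<close> folds an angle of the upper half circle back into that
  interval and has derivative 1 there.\<close>

lemma arc_extension:
  fixes D :: "nat \<Rightarrow> real \<Rightarrow> complex"
  assumes f: "\<And>\<theta>. 0 < \<theta> \<Longrightarrow> \<theta> < pi \<Longrightarrow> f (circle_cis \<theta>) = D 0 \<theta>"
    and f0: "\<And>z. Im (of_circle z) \<le> 0 \<Longrightarrow> f z = 0"
    and D: "\<And>n \<theta>. 0 < \<theta> \<Longrightarrow> \<theta> < pi \<Longrightarrow> (D n has_vector_derivative D (Suc n) \<theta>) (at \<theta>)"
    and flat: "\<And>n. \<exists>K. \<forall>\<theta>\<in>{0<..<pi}. cmod (D n \<theta>) \<le> K * (sin \<theta>)\<^sup>2"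
  shows "f \<in> smooth_circle"
    and "circle_deriv n f \<theta> = (if sin \<theta> > 0 then D n (arccos (cos \<theta>)) else 0)"
proof -
  let ?S = "{\<theta>::real. sin \<theta> > 0}" and ?a = "\<lambda>\<theta>::real. arccos (cos \<theta>)"
  have cos: "-1 < cos \<theta>" "cos \<theta> < 1" if "sin \<theta> > 0" for \<theta> :: real
  proof -
    have "(sin \<theta>)\<^sup>2 > 0" using that by simp
    then have "(cos \<theta>)\<^sup>2 < 1" using sin_cos_squared_add[of \<theta>] by linarith
    then show "-1 < cos \<theta>" "cos \<theta> < 1" by (auto simp: abs_square_less_1 abs_less_iff)
  qed
  have a: "0 < ?a \<theta>" "?a \<theta> < pi" if "sin \<theta> > 0" for \<theta> :: real
    using arccos_lt_bounded[OF cos[OF that]] by auto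
  have sa: "sin (?a \<theta>) = sin \<theta>" if "sin \<theta> > 0" for \<theta> :: real
    using that cos[OF that] by (simp add: sin_arccos_abs cos_squared_eq)
  have ca: "circle_cis (?a \<theta>) = circle_cis \<theta>" if "sin \<theta> > 0" for \<theta> :: real
    using sa[OF that] by (intro of_circle_eqI) (simp add: complex_eq_iff cos_arccos_abs)
  have da: "(?a has_vector_derivative 1) (at \<theta>)" if "sin \<theta> > 0" for \<theta> :: real
  proof -
    have "(?a has_real_derivative inverse (- sqrt (1 - (cos \<theta>)\<^sup>2)) * (- sin \<theta>)) (at \<theta>)"
      by (rule DERIV_chain2[OF DERIV_arccos[OF cos[OF that]] DERIV_cos])
    moreover have "sqrt (1 - (cos \<theta>)\<^sup>2) = sin \<theta>"
      using that by (simp add: sin_squared_eq[symmetric])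
    ultimately show ?thesis
      using that by (simp add: has_real_derivative_iff_has_vector_derivative)
  qed
  have 1: "f (circle_cis \<theta>) = (if \<theta> \<in> ?S then (D 0 \<circ> ?a) \<theta> else 0)" for \<theta>
  proof (cases "sin \<theta> > 0")
    case True
    then show ?thesis using f[OF a[OF True]] by (simp add: ca)
  next
    case False
    then show ?thesis using f0[of "circle_cis \<theta>"] by simp
  qed
  have 2: "((D n \<circ> ?a) has_vector_derivative (D (Suc n) \<circ> ?a) \<theta>) (at \<theta>)" if "\<theta> \<in> ?S" for n \<theta>
    using vector_diff_chain_at[OF da D[OF a]] that by simp
  have 3: "\<exists>K. \<forall>\<theta>\<in>?S. cmod ((D n \<circ> ?a) \<theta>) \<le> K * (sin \<theta>)\<^sup>2" for n
  proof -
    obtain K where K: "\<And>\<theta>. \<theta> \<in> {0<..<pi} \<Longrightarrow> cmod (D n \<theta>) \<le> K * (sin \<theta>)\<^sup>2" using flat by blast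
    show ?thesis
    proof (intro exI ballI)
      fix \<theta> assume "\<theta> \<in> ?S"
      then show "cmod ((D n \<circ> ?a) \<theta>) \<le> K * (sin \<theta>)\<^sup>2"
        using K[of "?a \<theta>"] a[of \<theta>] by (simp add: sa)
    qed
  qed
  note flat_ext = flat_extension[of ?S f "\<lambda>n. D n \<circ> ?a", OF open_sin_pos not_sin_pos 1 2 3, simplified]
  show "f \<in> smooth_circle" by (rule flat_ext)
  show "circle_deriv n f \<theta> = (if sin \<theta> > 0 then D n (?a \<theta>) else 0)" using flat_ext(2)[of n \<theta>] by simp
qed

section \<open>Holomorphic functions vanishing rapidly at the end points\<close>

text \<open>\<open>\<zeta>\<close> is a complexified angle: \<open>exp (\<i> * \<zeta>)\<close> ranges over the complex plane without
  the real points outside of the unit disk.\<close>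

definition arc_dom :: "complex set" where
  "arc_dom = {\<zeta>. Im \<zeta> > 0 \<or> sin (Re \<zeta>) \<noteq> 0}"

text \<open>The holomorphic continuation of x = ln tan(\<theta>/2). On the upper half circle the
  quotient is -i tan(\<theta>/2), and the added i\<pi>/2 makes the value real; on the lower half
  circle the imaginary part is \<pi>.\<close>

definition log_coord :: "complex \<Rightarrow> complex" where
  "log_coord \<zeta> = Ln ((1 - exp (\<i> * \<zeta>)) / (1 + exp (\<i> * \<zeta>))) + \<i> * (pi / 2)"

lemma open_arc_dom: "open arc_dom"
  unfolding arc_dom_def
  by (intro open_Collect_disj open_Collect_less open_Collect_neq continuous_intros)

text \<open>A value r \<le> 0 of the quotient forces z = (1 - r)/(1 + r), a real point with |z|
  \<ge> 1, and \<open>arc_dom\<close> avoids exactly these points.\<close>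

lemma arc_dom_ratio:
  assumes "\<zeta> \<in> arc_dom"
  shows "1 + exp (\<i> * \<zeta>) \<noteq> 0" and "(1 - exp (\<i> * \<zeta>)) / (1 + exp (\<i> * \<zeta>)) \<notin> \<real>\<^sub>\<le>\<^sub>0"
proof -
  define z where "z = exp (\<i> * \<zeta>)"
  have z: "Im z \<noteq> 0 \<or> cmod z < 1"
    using assms unfolding arc_dom_def z_def by (auto simp: Im_exp)
  show nz: "1 + exp (\<i> * \<zeta>) \<noteq> 0"
    using z unfolding z_def[symmetric] by (auto simp: add_eq_0_iff)
  show "(1 - exp (\<i> * \<zeta>)) / (1 + exp (\<i> * \<zeta>)) \<notin> \<real>\<^sub>\<le>\<^sub>0"
  proof
    assume "(1 - exp (\<i> * \<zeta>)) / (1 + exp (\<i> * \<zeta>)) \<in> \<real>\<^sub>\<le>\<^sub>0"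
    then obtain r where r: "(1 - z) / (1 + z) = complex_of_real r" "r \<le> 0"
      unfolding z_def[symmetric] nonpos_Reals_def by auto
    then have "1 - z = complex_of_real r * (1 + z)" using nz unfolding z_def[symmetric] by (simp add: field_simps)
    then have eq: "z * complex_of_real (1 + r) = complex_of_real (1 - r)"
      by (simp add: algebra_simps)
    have "1 + r \<noteq> 0"
    proof
      assume "1 + r = 0"
      then have "r = -1" by simp
      with eq show False by simp
    qed
    then have "complex_of_real (1 + r) \<noteq> 0" by (simp only: of_real_eq_0_iff not_False_eq_True)
    with eq have zr: "z = complex_of_real ((1 - r) / (1 + r))"
      by (simp only: of_real_divide eq_divide_eq if_True not_False_eq_True)
    then have "cmod z = \<bar>1 - r\<bar> / \<bar>1 + r\<bar>" by (simp only: norm_of_real abs_divide)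
    then have "cmod z \<ge> 1" using r(2) \<open>1 + r \<noteq> 0\<close> by (simp add: le_divide_eq abs_if)
    then show False using z zr by (metis Im_complex_of_real not_less)
  qed
qed

lemma holomorphic_log_coord: "log_coord holomorphic_on arc_dom"
  unfolding log_coord_def[abs_def]
  by (intro holomorphic_intros) (use arc_dom_ratio in auto)

lemma Im_log_coord:
  assumes "\<zeta> \<in> arc_dom"
  shows "- (pi / 2) < Im (log_coord \<zeta>)" "Im (log_coord \<zeta>) \<le> 3 * pi / 2"
proof -
  have "(1 - exp (\<i> * \<zeta>)) / (1 + exp (\<i> * \<zeta>)) \<noteq> 0" using arc_dom_ratio(2)[OF assms] by force
  then have "- pi < Im (Ln ((1 - exp (\<i> * \<zeta>)) / (1 + exp (\<i> * \<zeta>))))"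
    "Im (Ln ((1 - exp (\<i> * \<zeta>)) / (1 + exp (\<i> * \<zeta>)))) \<le> pi"
    by (rule mpi_less_Im_Ln, rule Im_Ln_le_pi)
  then show "- (pi / 2) < Im (log_coord \<zeta>)" "Im (log_coord \<zeta>) \<le> 3 * pi / 2"
    by (simp_all add: log_coord_def)
qed

text \<open>Exponential decay in x is thereby converted into vanishing at the end points of the arc.
  With v = (1 - z)/(1 + z) one has |sin \<zeta>| |1 - v^2| = 2|v|, where |1 - v^2| \<le> 1 + |v|^2
  and Re x = ln |v|.\<close>

lemma exp_log_coord_le_sin:
  assumes "\<zeta> \<in> arc_dom"
  shows "exp (- \<bar>Re (log_coord \<zeta>)\<bar>) \<le> cmod (sin \<zeta>)"
proof -
  define z v where "z = exp (\<i> * \<zeta>)" and "v = (1 - z) / (1 + z)"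
  have nz: "1 + z \<noteq> 0" "z \<noteq> 0" unfolding z_def using arc_dom_ratio(1)[OF assms] by auto
  have v: "v \<noteq> 0" using arc_dom_ratio(2)[OF assms] unfolding v_def z_def by force
  have 1: "1 - z = v * (1 + z)" unfolding v_def using nz by simp
  have sin: "2 * \<i> * z * sin \<zeta> = z * z - 1"
    unfolding sin_exp_eq z_def by (simp add: field_simps exp_minus)
  have "(1 + z)\<^sup>2 * (1 - v\<^sup>2) = (1 + z)\<^sup>2 - (v * (1 + z))\<^sup>2" by (simp add: algebra_simps power2_eq_square)
  also have "\<dots> = 4 * z" unfolding 1[symmetric] by (simp add: algebra_simps power2_eq_square)
  finally have 2: "(1 + z)\<^sup>2 * (1 - v\<^sup>2) = 4 * z" .
  have "z * z - 1 = - (1 - z) * (1 + z)" by (simp add: algebra_simps)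
  also have "\<dots> = - v * (1 + z)\<^sup>2" unfolding 1 by (simp add: power2_eq_square)
  finally have "2 * \<i> * z * sin \<zeta> * (1 - v\<^sup>2) = - v * ((1 + z)\<^sup>2 * (1 - v\<^sup>2))"
    using sin by (simp add: mult.assoc)
  then have "(2 * z) * (\<i> * sin \<zeta> * (1 - v\<^sup>2)) = (2 * z) * (- 2 * v)" unfolding 2 by (simp add: algebra_simps)
  moreover have "2 * z \<noteq> 0" using nz by simp
  ultimately have "\<i> * sin \<zeta> * (1 - v\<^sup>2) = - 2 * v" by (metis mult_cancel_left)
  then have "cmod (\<i> * sin \<zeta> * (1 - v\<^sup>2)) = cmod (- 2 * v)" by (rule arg_cong)
  then have eq: "cmod (sin \<zeta>) * cmod (1 - v\<^sup>2) = 2 * cmod v" by (simp add: norm_mult)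
  have le: "cmod (1 - v\<^sup>2) \<le> 1 + (cmod v)\<^sup>2"
    using norm_triangle_ineq4[of 1 "v\<^sup>2"] by (simp add: norm_power)
  have Re: "Re (log_coord \<zeta>) = ln (cmod v)"
    unfolding log_coord_def z_def[symmetric] v_def[symmetric] using v by simp
  have a: "cmod v > 0" using v by simp
  have "2 * cmod v \<le> cmod (sin \<zeta>) * (1 + (cmod v)\<^sup>2)"
    unfolding eq[symmetric] by (intro mult_left_mono le) auto
  moreover have "exp (- \<bar>ln (cmod v)\<bar>) * (1 + (cmod v)\<^sup>2) \<le> 2 * cmod v"
  proof (cases "cmod v \<le> 1")
    case True
    then have "exp (- \<bar>ln (cmod v)\<bar>) = cmod v" using a by simp
    moreover have "1 + (cmod v)\<^sup>2 \<le> 2" using True by (simp add: power_le_one)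
    ultimately show ?thesis using mult_left_mono[of "1 + (cmod v)\<^sup>2" 2 "cmod v"] by simp
  next
    case False
    then have "exp (- \<bar>ln (cmod v)\<bar>) = inverse (cmod v)" using a by (simp add: exp_minus)
    moreover have "1 \<le> (cmod v)\<^sup>2" using False by (simp add: one_le_power)
    ultimately have "exp (- \<bar>ln (cmod v)\<bar>) * (1 + (cmod v)\<^sup>2) \<le> inverse (cmod v) * (2 * (cmod v)\<^sup>2)"
      using a by (simp only:, intro mult_left_mono) auto
    also have "\<dots> = 2 * cmod v" using a by (simp add: power2_eq_square)
    finally show ?thesis .
  qed
  ultimately have "exp (- \<bar>ln (cmod v)\<bar>) * (1 + (cmod v)\<^sup>2) \<le> cmod (sin \<zeta>) * (1 + (cmod v)\<^sup>2)" by linarith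
  then show ?thesis unfolding Re
    by (rule mult_right_le_imp_le) (simp add: add_pos_nonneg)
qed

lemma sin_nonzero_arc_dom: "\<zeta> \<in> arc_dom \<Longrightarrow> sin \<zeta> \<noteq> 0"
  using exp_log_coord_le_sin[of \<zeta>] exp_gt_zero[of "- \<bar>Re (log_coord \<zeta>)\<bar>"] by auto

text \<open>|cos w|^2 = cos^2(Re w) + sinh^2(Im w) \<le> 1 + 81/4 < 25, using the crude estimate
  exp(2) \<le> 9.\<close>

lemma norm_cos_le_5:
  fixes w :: complex
  assumes "\<bar>Im w\<bar> \<le> 2"
  shows "cmod (cos w) \<le> 5"
proof -
  have e2: "exp (2::real) \<le> 9"
    using power_mono[OF exp_le, of 2] by (simp add: exp_double[symmetric])
  have e: "0 < exp (Im w)" "exp (Im w) \<le> 9" "0 < inverse (exp (Im w))" "inverse (exp (Im w)) \<le> 9"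
    using assms e2 exp_le_cancel_iff[of "Im w" 2] exp_le_cancel_iff[of "- Im w" 2]
    unfolding exp_minus[symmetric] by (auto simp: abs_le_iff simp del: exp_le_cancel_iff intro: order_trans)
  then have "\<bar>exp (Im w) - inverse (exp (Im w))\<bar> \<le> 9" by linarith
  then have "(exp (Im w) - inverse (exp (Im w)))\<^sup>2 \<le> 9\<^sup>2" 
    using abs_le_square_iff[of "exp (Im w) - inverse (exp (Im w))" 9] by simp
  moreover have "(cos (Re w))\<^sup>2 \<le> 1" by (simp add: abs_square_le_1)
  ultimately have "(cmod (cos w))\<^sup>2 \<le> 5\<^sup>2"
    unfolding norm_cos_squared by simp
  then show "cmod (cos w) \<le> 5"
    by (rule power2_le_imp_le) simp
qed

lemma norm_sin_le_5: "\<bar>Im w\<bar> \<le> 2 \<Longrightarrow> cmod (sin w) \<le> 5"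
  unfolding sin_cos_eq by (rule norm_cos_le_5) simp

lemma sin_diff_le:
  fixes a b :: complex
  assumes "\<bar>Im a\<bar> \<le> 2" "\<bar>Im b\<bar> \<le> 2"
  shows "cmod (sin a - sin b) \<le> 5 * cmod (a - b)"
proof (rule field_differentiable_bound[of "{w. \<bar>Im w\<bar> \<le> 2}" sin cos])
  have "{w. \<bar>Im w\<bar> \<le> 2} = {w. Im w \<le> 2} \<inter> {w. Im w \<ge> -2}" by auto
  then show "convex {w. \<bar>Im w\<bar> \<le> 2}"
    by (simp add: convex_Int convex_halfspace_Im_le convex_halfspace_Im_ge)
qed (use assms norm_cos_le_5 in \<open>auto intro: DERIV_subset DERIV_sin\<close>)

text \<open>The Cauchy disk has radius |sin \<zeta>|/16, comparable to the distance from the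
  boundary points. Since sin has Lipschitz constant 5 in the band |Im| \<le> 2 and 5/16 < 1, the
  disk stays in \<open>arc_dom\<close> and |sin| at most doubles on it. Each derivative costs one
  power of sin.\<close>

lemma arc_dom_Cauchy:
  assumes p: "p holomorphic_on arc_dom"
    and bd: "\<And>\<zeta>. \<zeta> \<in> arc_dom \<Longrightarrow> cmod (p \<zeta>) \<le> B * cmod (sin \<zeta>) ^ e"
    and \<zeta>: "\<zeta> \<in> arc_dom" "0 \<le> Im \<zeta>" "Im \<zeta> \<le> 1" and n: "n \<le> e"
  shows "cmod ((deriv ^^ n) p \<zeta>) \<le> (fact n * 2 ^ e * 16 ^ n) * B * cmod (sin \<zeta>) ^ (e - n)"
proof -
  define r where "r = cmod (sin \<zeta>) / 16"
  have s: "cmod (sin \<zeta>) > 0" using sin_nonzero_arc_dom[OF \<zeta>(1)] by simp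
  then have r: "r > 0" by (simp add: r_def)
  have r1: "r \<le> 1/2" unfolding r_def using norm_sin_le_5[of \<zeta>] \<zeta> by simp
  have B: "0 \<le> B" using bd[OF \<zeta>(1)] s order_trans[OF norm_ge_zero]
    by (metis zero_le_mult_iff zero_less_power not_less)
  have Im: "\<bar>Im w\<bar> \<le> 2" if "cmod (\<zeta> - w) \<le> r" for w
    using abs_Im_le_cmod[of "\<zeta> - w"] that r1 \<zeta> by auto
  have sub: "cball \<zeta> r \<subseteq> arc_dom"
  proof
    fix w assume "w \<in> cball \<zeta> r"
    then have w: "cmod (\<zeta> - w) \<le> r" by (simp add: dist_norm)
    show "w \<in> arc_dom"
    \<comment> \<open>A point \<open>w\<close> outside \<open>arc_dom\<close> lies on or below a
      real zero of sin, and moving it up to that zero \<open>Re w\<close> does not increase its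
      distance from \<open>\<zeta>\<close>, as Im w \<le> 0 \<le> Im \<zeta>.\<close>
    proof (rule ccontr)
      assume "w \<notin> arc_dom"
      then have *: "Im w \<le> 0" "sin (Re w) = 0" by (auto simp: arc_dom_def)
      then have "sin (complex_of_real (Re w)) = 0" by (metis of_real_0 sin_of_real)
      then have "cmod (sin \<zeta>) \<le> 5 * cmod (\<zeta> - of_real (Re w))"
        using sin_diff_le[of \<zeta> "of_real (Re w)"] \<zeta> by simp
      also have "cmod (\<zeta> - of_real (Re w)) \<le> cmod (\<zeta> - w)"
        using * \<zeta> unfolding cmod_def by (auto intro!: power_mono)
      finally show False using w s unfolding r_def by linarith
    qed
  qed
  have "cmod ((deriv ^^ n) p \<zeta>) \<le> fact n * (B * (2 * cmod (sin \<zeta>)) ^ e) / r ^ n"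
  proof (rule Cauchy_inequality)
    show "p holomorphic_on ball \<zeta> r" using p sub by (meson ball_subset_cball holomorphic_on_subset subset_trans)
    show "continuous_on (cball \<zeta> r) p" using p sub by (meson holomorphic_on_imp_continuous_on holomorphic_on_subset)
    show "0 < r" by (rule r)
    fix w assume w: "cmod (\<zeta> - w) = r"
    then have "w \<in> arc_dom" using sub by (auto simp: dist_norm)
    then have "cmod (p w) \<le> B * cmod (sin w) ^ e" by (rule bd)
    also have "cmod (sin w) \<le> cmod (sin \<zeta>) + 5 * cmod (\<zeta> - w)"
      using sin_diff_le[of \<zeta> w] Im[of w] Im[of \<zeta>] r w norm_triangle_ineq2[of "sin w" "sin \<zeta>"]
      by (simp add: norm_minus_commute)
    then have "cmod (sin w) \<le> 2 * cmod (sin \<zeta>)" 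
      using norm_ge_zero[of "sin \<zeta>"] unfolding w r_def by linarith
    then have "B * cmod (sin w) ^ e \<le> B * (2 * cmod (sin \<zeta>)) ^ e"
      by (intro mult_left_mono power_mono B) auto
    finally show "cmod (p w) \<le> B * (2 * cmod (sin \<zeta>)) ^ e" .
  qed
  also have "\<dots> = (fact n * 2 ^ e * 16 ^ n) * B * (cmod (sin \<zeta>) ^ e / cmod (sin \<zeta>) ^ n)"
    unfolding r_def by (simp add: power_mult_distrib power_divide field_simps)
  also have "cmod (sin \<zeta>) ^ e / cmod (sin \<zeta>) ^ n = cmod (sin \<zeta>) ^ (e - n)"
    using s n by (simp add: power_diff)
  finally show ?thesis .
qed

lemma higher_deriv_has_vector_derivative:
  assumes "p holomorphic_on S" "open S" "complex_of_real \<theta> + c \<in> S"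
  shows "((\<lambda>\<theta>. (deriv ^^ n) p (of_real \<theta> + c)) has_vector_derivative (deriv ^^ Suc n) p (of_real \<theta> + c)) (at \<theta>)"
proof -
  have "(deriv ^^ n) p holomorphic_on S" by (rule holomorphic_higher_deriv[OF assms(1,2)])
  then have "((deriv ^^ n) p has_field_derivative (deriv ^^ Suc n) p (of_real \<theta> + c)) (at (of_real \<theta> + c))"
    using holomorphic_derivI[OF _ assms(2,3)] by simp
  moreover have "((\<lambda>\<theta>. complex_of_real \<theta> + c) has_vector_derivative 1) (at \<theta>)"
    by (auto intro!: derivative_eq_intros)
  ultimately show ?thesis
    using field_vector_diff_chain_at[of "\<lambda>\<theta>. complex_of_real \<theta> + c" 1 \<theta>] by (simp add: o_def)
qed

text \<open>The image of \<^const>\<open>log_coord\<close> has a neighbourhood in this strip.\<close>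

definition log_strip :: "complex set" where
  "log_strip = {\<xi>. \<bar>Im \<xi> - pi / 2\<bar> < 9 * pi / 8}"

text \<open>\<open>Im z / (1 + Re z)\<close> is tan(\<theta>/2), so \<open>h\<close> is evaluated at
  the boost coordinate x. The prefactor is (d\<theta>/dx)^(d-1), chosen to absorb the weight in
  \<open>moebius_beta\<close>.\<close>

definition arc_bump :: "nat \<Rightarrow> (complex \<Rightarrow> complex) \<Rightarrow> circle \<Rightarrow> complex" where
  "arc_bump d h z = (if Im (of_circle z) > 0 then
     of_real (Im (of_circle z)) powi (int d - 1) *
       h (of_real (ln (Im (of_circle z) / (1 + Re (of_circle z))))) else 0)"

definition arc_hol :: "nat \<Rightarrow> (complex \<Rightarrow> complex) \<Rightarrow> complex \<Rightarrow> complex" where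
  "arc_hol d h \<zeta> = sin \<zeta> powi (int d - 1) * h (log_coord \<zeta>)"

lemma log_coord_in_strip: "\<zeta> \<in> arc_dom \<Longrightarrow> log_coord \<zeta> \<in> log_strip"
  using Im_log_coord[of \<zeta>] pi_gt_zero unfolding log_strip_def mem_Collect_eq abs_less_iff
  by (intro conjI) linarith+

lemma arc_hol_holomorphic:
  assumes "h holomorphic_on log_strip"
  shows "arc_hol d h holomorphic_on arc_dom"
proof -
  have "(h \<circ> log_coord) holomorphic_on arc_dom"
    by (rule holomorphic_on_compose_gen[OF holomorphic_log_coord assms]) (use log_coord_in_strip in auto)
  then show ?thesis
    unfolding arc_hol_def[abs_def] o_def
    by (intro holomorphic_intros) (use sin_nonzero_arc_dom in auto)
qed

text \<open>The prefactor has exponent d - 1, which is -1 for d = 0; the extra order in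
  \<open>Suc m\<close> pays for it.\<close>

lemma arc_hol_bound:
  assumes B: "\<And>\<xi>. \<xi> \<in> log_strip \<Longrightarrow> cmod (h \<xi>) \<le> B * exp (- (real (Suc m) * \<bar>Re \<xi>\<bar>))" and \<zeta>: "\<zeta> \<in> arc_dom"
  shows "cmod (arc_hol d h \<zeta>) \<le> B * cmod (sin \<zeta>) ^ (m + d)"
proof -
  have s: "sin \<zeta> \<noteq> 0" by (rule sin_nonzero_arc_dom[OF \<zeta>])
  have "0 \<le> B * exp (- (real (Suc m) * \<bar>Re (log_coord \<zeta>)\<bar>))"
    using B[OF log_coord_in_strip[OF \<zeta>]] by (rule order_trans[OF norm_ge_zero])
  then have "0 \<le> B" by (simp add: zero_le_mult_iff)
  have "exp (- (real (Suc m) * \<bar>Re (log_coord \<zeta>)\<bar>)) = exp (- \<bar>Re (log_coord \<zeta>)\<bar>) ^ Suc m"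
    by (subst exp_of_nat_mult[symmetric]) simp
  also have "\<dots> \<le> cmod (sin \<zeta>) ^ Suc m"
    by (intro power_mono exp_log_coord_le_sin[OF \<zeta>]) simp
  finally have "cmod (h (log_coord \<zeta>)) \<le> B * cmod (sin \<zeta>) ^ Suc m"
    using B[OF log_coord_in_strip[OF \<zeta>]] \<open>0 \<le> B\<close> by (meson mult_left_mono order_trans)
  then have "cmod (arc_hol d h \<zeta>) \<le> cmod (sin \<zeta>) powi (int d - 1) * (B * cmod (sin \<zeta>) ^ Suc m)"
    unfolding arc_hol_def norm_mult norm_power_int by (intro mult_left_mono) simp_all
  also have "\<dots> = B * (cmod (sin \<zeta>) powi (int d - 1) * cmod (sin \<zeta>) powi int (Suc m))"
    by (simp only: power_int_of_nat mult_ac)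
  also have "cmod (sin \<zeta>) powi (int d - 1) * cmod (sin \<zeta>) powi int (Suc m) = cmod (sin \<zeta>) powi int (m + d)"
    using s by (subst power_int_add[symmetric]) (auto simp: algebra_simps)
  finally show ?thesis by (simp only: power_int_of_nat)
qed

section \<open>Values of the coordinate on the two half circles\<close>

lemma one_plus_cos_pos:
  assumes "sin \<theta> \<noteq> 0"
  shows "1 + cos \<theta> > (0::real)"
proof -
  have "cos \<theta> \<noteq> -1"
  proof
    assume "cos \<theta> = -1"
    then have "(sin \<theta>)\<^sup>2 = 0" using sin_cos_squared_add[of \<theta>] by simp
    then show False using assms by simp
  qed
  then show ?thesis using cos_ge_minus_one[of \<theta>] by linarith
qed

lemma cis_ratio:
  assumes "sin \<theta> \<noteq> 0"
  shows "(1 - cis \<theta>) / (1 + cis \<theta>) = - \<i> * of_real (sin \<theta> / (1 + cos \<theta>))"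
proof -
  have c: "1 + cos \<theta> > 0" by (rule one_plus_cos_pos[OF assms])
  define y where "y = sin \<theta> / (1 + cos \<theta>)"
  have nz: "1 + cis \<theta> \<noteq> 0" using c by (auto simp: complex_eq_iff)
  have "(1 - cis \<theta>) = - \<i> * y * (1 + cis \<theta>)"
  proof -
    have "y * (1 + cos \<theta>) = sin \<theta>" unfolding y_def using c by simp
    moreover have "y * sin \<theta> = 1 - cos \<theta>"
    proof -
      have "(sin \<theta>)\<^sup>2 = (1 - cos \<theta>) * (1 + cos \<theta>)"
        using sin_squared_eq[of \<theta>] by (simp add: algebra_simps power2_eq_square)
      then show ?thesis unfolding y_def using c by (simp add: power2_eq_square)
    qed
    ultimately show ?thesis by (simp add: complex_eq_iff algebra_simps)
  qed
  then show ?thesis unfolding y_def[symmetric] using nz by (simp add: field_simps)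
qed

lemma log_coord_of_real:
  assumes "sin \<theta> > 0"
  shows "log_coord (of_real \<theta>) = of_real (ln (sin \<theta> / (1 + cos \<theta>)))"
proof -
  have e: "exp (\<i> * complex_of_real \<theta>) = cis \<theta>" by (simp add: cis_conv_exp)
  define y where "y = sin \<theta> / (1 + cos \<theta>)"
  have y: "y > 0" unfolding y_def using assms one_plus_cos_pos[of \<theta>] by simp
  have "log_coord (of_real \<theta>) = Ln (of_real y * (- \<i>)) + \<i> * (pi / 2)"
    unfolding log_coord_def e y_def using assms by (subst cis_ratio) (auto simp: mult.commute)
  also have "Ln (of_real y * (- \<i>)) = of_real (ln y) + Ln (- \<i>)"
    using y by (subst Ln_times_of_real) (auto simp: Ln_of_real)
  also have "Ln (- \<i>) = - (\<i> * (pi / 2))" by simp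
  finally show ?thesis unfolding y_def by simp
qed

text \<open>The summand i\<pi> is the geometric origin of the time i\<pi>: a point and its complex
  conjugate have coordinates that differ by it.\<close>

lemma log_coord_of_real_neg:
  assumes "sin \<theta> < 0"
  shows "log_coord (of_real \<theta>) = of_real (ln (- sin \<theta> / (1 + cos \<theta>))) + \<i> * pi"
proof -
  have e: "exp (\<i> * complex_of_real \<theta>) = cis \<theta>" by (simp add: cis_conv_exp)
  define y where "y = - sin \<theta> / (1 + cos \<theta>)"
  have y: "y > 0" unfolding y_def by (rule divide_pos_pos) (use assms one_plus_cos_pos[of \<theta>] in auto)
  have "log_coord (of_real \<theta>) = Ln (of_real y * \<i>) + \<i> * (pi / 2)"
    unfolding log_coord_def e y_def using assms by (subst cis_ratio) (auto simp: mult.commute)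
  also have "Ln (of_real y * \<i>) = of_real (ln y) + Ln \<i>"
    using y by (subst Ln_times_of_real) (auto simp: Ln_of_real)
  also have "Ln \<i> = \<i> * (pi / 2)" by simp
  finally show ?thesis unfolding y_def by (simp add: complex_eq_iff)
qed

lemma arc_bump_circle_cis:
  "arc_bump d h (circle_cis \<theta>) = (if sin \<theta> > 0 then arc_hol d h (of_real \<theta>) else 0)"
  by (auto simp: arc_bump_def arc_hol_def log_coord_of_real sin_of_real)

lemma of_real_arc_dom: "sin \<theta> \<noteq> 0 \<Longrightarrow> complex_of_real \<theta> \<in> arc_dom"
  by (simp add: arc_dom_def)

text \<open>Supplies the bound by sin^2 that \<open>flat_extension\<close> asks for. It covers a
  band above the real axis and not just the axis, because the circle is later approached from inside
  the disk.\<close>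

lemma arc_hol_deriv_flat:
  assumes h: "h holomorphic_on log_strip"
    and B: "\<And>m. \<exists>B. \<forall>\<xi>\<in>log_strip. cmod (h \<xi>) \<le> B * exp (- (real m * \<bar>Re \<xi>\<bar>))"
  shows "\<exists>K\<ge>0. \<forall>\<zeta>\<in>arc_dom. 0 \<le> Im \<zeta> \<and> Im \<zeta> \<le> 1 \<longrightarrow>
    cmod ((deriv ^^ n) (arc_hol d h) \<zeta>) \<le> K * (cmod (sin \<zeta>))\<^sup>2"
proof -
  \<comment> \<open>\<open>n\<close> derivatives cost \<open>n\<close> powers of sin and two must
    remain; the other \<open>d\<close> come from the weight and are bounded by 5^d.\<close>
  let ?e = "(n + 2) + d"
  obtain B where B': "\<And>\<xi>. \<xi> \<in> log_strip \<Longrightarrow> cmod (h \<xi>) \<le> B * exp (- (real (Suc (n + 2)) * \<bar>Re \<xi>\<bar>))"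
    using B[of "Suc (n + 2)"] by blast
  have "cmod (h (\<i> * (pi / 2))) \<le> B"
    using B'[of "\<i> * (pi / 2)"] pi_gt_zero by (simp add: log_strip_def)
  then have B0: "0 \<le> B" by (rule order_trans[OF norm_ge_zero])
  define K where "K = (fact n * 2 ^ ?e * 16 ^ n) * B * 5 ^ d"
  have "cmod ((deriv ^^ n) (arc_hol d h) \<zeta>) \<le> K * (cmod (sin \<zeta>))\<^sup>2"
    if \<zeta>: "\<zeta> \<in> arc_dom" "0 \<le> Im \<zeta>" "Im \<zeta> \<le> 1" for \<zeta>
  proof -
    have "cmod ((deriv ^^ n) (arc_hol d h) \<zeta>) \<le> (fact n * 2 ^ ?e * 16 ^ n) * B * cmod (sin \<zeta>) ^ (?e - n)"
      by (rule arc_dom_Cauchy[OF arc_hol_holomorphic[OF h] arc_hol_bound[OF B'] \<zeta>]) simp_all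
    also have "cmod (sin \<zeta>) ^ (?e - n) = cmod (sin \<zeta>) ^ d * (cmod (sin \<zeta>))\<^sup>2"
      by (simp add: power_add power2_eq_square mult.commute)
    also have "\<dots> \<le> 5 ^ d * (cmod (sin \<zeta>))\<^sup>2"
      by (intro mult_right_mono power_mono norm_sin_le_5) (use \<zeta> in auto)
    finally show ?thesis using B0 unfolding K_def by (simp add: mult.assoc mult_left_mono)
  qed
  moreover have "0 \<le> K" unfolding K_def using B0 by simp
  ultimately show ?thesis by blast
qed

lemma assumes h: "h holomorphic_on log_strip"
    and B: "\<And>m. \<exists>B. \<forall>\<xi>\<in>log_strip. cmod (h \<xi>) \<le> B * exp (- (real m * \<bar>Re \<xi>\<bar>))"
  shows arc_bump_smooth: "arc_bump d h \<in> smooth_circle"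
    and circle_deriv_arc_bump: "circle_deriv n (arc_bump d h) \<theta> =
      (if sin \<theta> > 0 then (deriv ^^ n) (arc_hol d h) (of_real \<theta>) else 0)"
proof -
  let ?D = "\<lambda>n \<theta>. (deriv ^^ n) (arc_hol d h) (of_real \<theta>)"
  have 1: "arc_bump d h (circle_cis \<theta>) = (if \<theta> \<in> {\<theta>. sin \<theta> > 0} then ?D 0 \<theta> else 0)" for \<theta>
    by (simp add: arc_bump_circle_cis)
  have 2: "(?D n has_vector_derivative ?D (Suc n) \<theta>) (at \<theta>)" if "\<theta> \<in> {\<theta>. sin \<theta> > 0}" for n \<theta>
    using higher_deriv_has_vector_derivative[OF arc_hol_holomorphic[where d = d, OF h] open_arc_dom, where \<theta> = \<theta> and c = 0 and n = n] that of_real_arc_dom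
    by simp
  have 3: "\<exists>K. \<forall>\<theta>\<in>{\<theta>. sin \<theta> > 0}. cmod (?D n \<theta>) \<le> K * (sin \<theta>)\<^sup>2" for n
  proof -
    obtain K where K: "\<And>\<zeta>. \<zeta> \<in> arc_dom \<Longrightarrow> 0 \<le> Im \<zeta> \<Longrightarrow> Im \<zeta> \<le> 1 \<Longrightarrow>
        cmod ((deriv ^^ n) (arc_hol d h) \<zeta>) \<le> K * (cmod (sin \<zeta>))\<^sup>2"
      using arc_hol_deriv_flat[OF h B, of n d] by blast
    show ?thesis
    proof (intro exI ballI)
      fix \<theta> :: real assume "\<theta> \<in> {\<theta>. sin \<theta> > 0}"
      then show "cmod (?D n \<theta>) \<le> K * (sin \<theta>)\<^sup>2"
        using K[of "of_real \<theta>"] of_real_arc_dom[of \<theta>] by (simp add: sin_of_real)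
    qed
  qed
  note flat_ext = flat_extension[of "{\<theta>. sin \<theta> > 0}" _ ?D, OF open_sin_pos not_sin_pos 1 2 3, simplified]
  show "arc_bump d h \<in> smooth_circle" by (rule flat_ext)
  show "circle_deriv n (arc_bump d h) \<theta> = (if sin \<theta> > 0 then ?D n \<theta> else 0)" using flat_ext(2)[of n \<theta>] by simp
qed

text \<open>\<open>K\<close> depends only on \<open>N\<close> and \<open>d\<close>. Decay of all
  orders enters qualitatively, for smoothness; the size of the norm is governed by the decay bound
  of order N + 1 alone.\<close>

lemma C_norm_arc_bump:
  "\<exists>K\<ge>0. \<forall>h B. h holomorphic_on log_strip \<longrightarrow>
    (\<forall>m. \<exists>B. \<forall>\<xi>\<in>log_strip. cmod (h \<xi>) \<le> B * exp (- (real m * \<bar>Re \<xi>\<bar>))) \<longrightarrow>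
    (\<forall>\<xi>\<in>log_strip. cmod (h \<xi>) \<le> B * exp (- (real (Suc N) * \<bar>Re \<xi>\<bar>))) \<longrightarrow>
    C_norm N (arc_bump d h) \<le> K * B"
proof -
  define K where "K = (\<Sum>n\<le>N. fact n * 2 ^ (N + d) * 16 ^ n :: real)"
  have "C_norm N (arc_bump d h) \<le> K * B" if h: "h holomorphic_on log_strip"
    and h': "\<And>m. \<exists>B. \<forall>\<xi>\<in>log_strip. cmod (h \<xi>) \<le> B * exp (- (real m * \<bar>Re \<xi>\<bar>))"
    and B: "\<And>\<xi>. \<xi> \<in> log_strip \<Longrightarrow> cmod (h \<xi>) \<le> B * exp (- (real (Suc N) * \<bar>Re \<xi>\<bar>))" for h B
  proof -
    have "cmod (h (\<i> * (pi / 2))) \<le> B"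
      using B[of "\<i> * (pi / 2)"] pi_gt_zero by (simp add: log_strip_def)
    then have B0: "0 \<le> B" by (rule order_trans[OF norm_ge_zero])
    have "C_norm N (arc_bump d h) \<le> (\<Sum>n\<le>N. fact n * 2 ^ (N + d) * 16 ^ n * B)"
    proof (rule C_norm_le, subst circle_deriv_arc_bump[OF h h'])
      fix n \<theta> assume n: "n \<le> N"
      show "cmod (if 0 < sin \<theta> then (deriv ^^ n) (arc_hol d h) (complex_of_real \<theta>) else 0)
          \<le> fact n * 2 ^ (N + d) * 16 ^ n * B"
      proof (cases "0 < sin \<theta>")
        case True
        have "cmod ((deriv ^^ n) (arc_hol d h) (complex_of_real \<theta>)) \<le>
            (fact n * 2 ^ (N + d) * 16 ^ n) * B * cmod (sin (complex_of_real \<theta>)) ^ (N + d - n)"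
          by (rule arc_dom_Cauchy[OF arc_hol_holomorphic[OF h] arc_hol_bound[OF B]])
            (use True n in \<open>auto intro!: of_real_arc_dom\<close>)
        also have "\<dots> \<le> (fact n * 2 ^ (N + d) * 16 ^ n) * B * 1"
          using B0 by (intro mult_left_mono power_le_one) (auto simp: sin_of_real)
        finally show ?thesis using True by simp
      qed (use B0 in simp)
    qed
    then show ?thesis by (simp add: K_def sum_distrib_right)
  qed
  moreover have "K \<ge> 0" unfolding K_def by (simp add: sum_nonneg)
  ultimately show ?thesis by blast
qed

section \<open>Test functions that are analytic for the boosts\<close>

text \<open>Under the lift tan(\<theta>/2) is multiplied by exp(-t) and sin(\<theta>) is divided by
  the boost weight, so the powers of the weight cancel and only the translation of x by t
  remains.\<close>

lemma moebius_beta_arc_bump: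
  "moebius_beta d (boost t) (arc_bump d h) = arc_bump d (\<lambda>\<xi>. h (\<xi> - of_real t))"
proof
  fix z
  define \<theta> where "\<theta> = Arg (of_circle z)"
  have z: "z = circle_cis \<theta>" by (simp add: \<theta>_def)
  have Y: "boost_weight t \<theta> > 0" by (rule boost_weight_pos)
  show "moebius_beta d (boost t) (arc_bump d h) z = arc_bump d (\<lambda>\<xi>. h (\<xi> - of_real t)) z"
  proof (cases "sin \<theta> > 0")
    case False
    then have "\<not> sin (boost_lift t \<theta>) > 0"
      using Y by (simp add: boost_lift_cos_sin zero_less_divide_iff)
    then show ?thesis using False unfolding z moebius_beta_boost by (simp add: arc_bump_def)
  next
    case True
    have c: "1 + cos \<theta> > 0" by (rule one_plus_cos_pos) (use True in simp)
    have s: "sin (boost_lift t \<theta>) > 0" using True Y by (simp add: boost_lift_cos_sin)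
    have e: "cosh t + sinh t = exp t" by (simp add: cosh_plus_sinh)
    have "1 + cos (boost_lift t \<theta>) = (boost_weight t \<theta> + (sinh t + cosh t * cos \<theta>)) / boost_weight t \<theta>"
      using Y by (simp add: boost_lift_cos_sin field_simps)
    also have "boost_weight t \<theta> + (sinh t + cosh t * cos \<theta>) = exp t * (1 + cos \<theta>)"
      unfolding e[symmetric] boost_weight_def by (simp add: algebra_simps)
    finally have "sin (boost_lift t \<theta>) / (1 + cos (boost_lift t \<theta>)) = sin \<theta> / (1 + cos \<theta>) / exp t"
      using Y by (simp add: boost_lift_cos_sin)
    then have "ln (sin (boost_lift t \<theta>) / (1 + cos (boost_lift t \<theta>))) = ln (sin \<theta> / (1 + cos \<theta>)) - t"
      using True c by (simp only:) (subst ln_div, auto)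
    moreover have "complex_of_real (boost_weight t \<theta>) powi (int d - 1) *
        complex_of_real (sin (boost_lift t \<theta>)) powi (int d - 1) = complex_of_real (sin \<theta>) powi (int d - 1)"
      using Y by (simp add: power_int_mult_distrib[symmetric] boost_lift_cos_sin)
    ultimately show ?thesis
      using True s unfolding z moebius_beta_boost by (simp add: arc_bump_def mult.assoc[symmetric])
  qed
qed

section \<open>Rapidly decaying functions on strips and their complex translates\<close>

definition rapid :: "real \<Rightarrow> (complex \<Rightarrow> complex) \<Rightarrow> bool" where
  "rapid \<sigma> h \<longleftrightarrow> h holomorphic_on {\<xi>. \<bar>Im \<xi>\<bar> < \<sigma>} \<and>
    (\<forall>m. \<exists>C\<ge>0. \<forall>\<xi>. \<bar>Im \<xi>\<bar> < \<sigma> \<longrightarrow> cmod (h \<xi>) \<le> C * exp (- (real m * \<bar>Re \<xi>\<bar>)))"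

text \<open>The double exponential decays faster than any exponential, and 1/(1 + exp(\<xi>/4)) maps
  the real line onto (0,1), so that polynomials in it are dense by Weierstrass. Dividing \<xi> by 4
  keeps Re exp(\<xi>/4) and Re exp(-\<xi>/4) positive for |Im \<xi>| < 2\<pi>, which preserves the
  decay and keeps the denominator away from 0.\<close>

definition profile :: "complex poly \<Rightarrow> complex \<Rightarrow> complex" where
  "profile q \<xi> = exp (- (exp (\<xi> / 4) + exp (- \<xi> / 4))) * poly q (1 / (1 + exp (\<xi> / 4)))"

lemma Re_exp_quarter_pos:
  assumes "\<bar>Im \<xi>\<bar> < 2 * pi"
  shows "Re (exp (\<xi> / 4)) > 0"
  using assms by (auto simp: Re_exp cos_gt_zero_pi)

lemma rapid_profile: "rapid (15 * pi / 8) (profile q)"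
  unfolding rapid_def
proof (intro conjI allI)
  have strip: "\<bar>Im \<xi>\<bar> < 2 * pi" if "\<bar>Im \<xi>\<bar> < 15 * pi / 8" for \<xi>
    using that pi_gt_zero by linarith
  have nz: "1 + exp (\<xi> / 4) \<noteq> 0" if "\<bar>Im \<xi>\<bar> < 15 * pi / 8" for \<xi> :: complex
    using Re_exp_quarter_pos[OF strip[OF that]] by (auto simp: complex_eq_iff)
  show "profile q holomorphic_on {\<xi>. \<bar>Im \<xi>\<bar> < 15 * pi / 8}"
    unfolding profile_def[abs_def]
    by (intro holomorphic_intros) (use nz in auto)
  fix m
  have "bounded (poly q ` cball 0 1)"
    by (intro compact_imp_bounded compact_continuous_image continuous_intros) auto
  then obtain B where "\<forall>x\<in>poly q ` cball 0 1. cmod x \<le> B" unfolding bounded_iff by blast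
  then have B: "cmod (poly q w) \<le> B" if "cmod w \<le> 1" for w using that by simp
  have B0: "B \<ge> 0" using order_trans[OF norm_ge_zero B[of 0]] by simp
  \<comment> \<open>A lower bound for cos(Im \<xi> / 4) on the strip, positive because 15\<pi>/32 <
    \<pi>/2.\<close>
  define c where "c = cos (15 * pi / 32)"
  have c: "c > 0" unfolding c_def by (rule cos_gt_zero) auto
  \<comment> \<open>The exponential exp(c y) with y = exp(|Re \<xi>|/4) dominates (c y / n)^n, and
    this n makes y^n equal to exp((m + 1) |Re \<xi>|).\<close>
  define n :: nat where "n = 4 * (m + 1)"
  have n: "n > 0" by (simp add: n_def)
  define C where "C = B * (real n / c) ^ n"
  show "\<exists>C\<ge>0. \<forall>\<xi>. \<bar>Im \<xi>\<bar> < 15 * pi / 8 \<longrightarrow> cmod (profile q \<xi>) \<le> C * exp (- (real m * \<bar>Re \<xi>\<bar>))"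
  proof (intro exI[of _ C] conjI allI impI)
    show "0 \<le> C" unfolding C_def using B0 c by simp
    fix \<xi> :: complex assume \<xi>: "\<bar>Im \<xi>\<bar> < 15 * pi / 8"
    have "cos \<bar>Im \<xi> / 4\<bar> \<ge> c"
      unfolding c_def by (rule cos_monotone_0_pi_le) (use \<xi> pi_gt_zero in auto)
    then have cc: "cos (Im \<xi> / 4) \<ge> c" by (simp add: abs_if split: if_splits)
    define y where "y = exp (\<bar>Re \<xi>\<bar> / 4)"
    have y: "y > 0" by (simp add: y_def)
    have "Re (exp (\<xi> / 4) + exp (- \<xi> / 4)) = (exp (Re \<xi> / 4) + exp (- Re \<xi> / 4)) * cos (Im \<xi> / 4)"
      by (simp add: Re_exp algebra_simps)
    also have "\<dots> \<ge> y * c"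
      by (intro mult_mono cc) (use c in \<open>auto simp: y_def abs_if add_nonneg_nonneg\<close>)
    finally have Re: "Re (exp (\<xi> / 4) + exp (- \<xi> / 4)) \<ge> c * y" by (simp add: mult.commute)
    have "(c * y / real n) ^ n \<le> (1 + c * y / real n) ^ n"
      by (rule power_mono) (use c y n in auto)
    also have "\<dots> \<le> exp (c * y)"
      by (rule exp_ge_one_plus_x_over_n_power_n) (use c y n in \<open>auto intro: order_trans[of _ 0]\<close>)
    finally have le: "(c * y / real n) ^ n \<le> exp (c * y)" .
    have "cmod (exp (- (exp (\<xi> / 4) + exp (- \<xi> / 4)))) \<le> exp (- (c * y))"
      using Re by (simp add: norm_exp_eq_Re)
    also have "\<dots> = 1 / exp (c * y)" by (simp add: exp_minus field_simps)
    also have "\<dots> \<le> 1 / (c * y / real n) ^ n"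
      by (rule divide_left_mono[OF le]) (use c y n in auto)
    also have "\<dots> = (real n / c) ^ n * (1 / y ^ n)" using c y n by (simp add: power_divide power_mult_distrib)
    also have "1 / y ^ n = exp (- (real (m + 1) * \<bar>Re \<xi>\<bar>))"
    proof -
      have "y ^ n = exp (real n * (\<bar>Re \<xi>\<bar> / 4))" by (simp only: y_def exp_of_nat_mult)
      also have "real n * (\<bar>Re \<xi>\<bar> / 4) = real (m + 1) * \<bar>Re \<xi>\<bar>" by (simp add: n_def)
      finally show ?thesis by (simp only: exp_minus inverse_eq_divide)
    qed
    also have "(real n / c) ^ n * exp (- (real (m + 1) * \<bar>Re \<xi>\<bar>)) \<le> (real n / c) ^ n * exp (- (real m * \<bar>Re \<xi>\<bar>))"
      using c by (intro mult_left_mono) (auto simp: distrib_right)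
    finally have 1: "cmod (exp (- (exp (\<xi> / 4) + exp (- \<xi> / 4)))) \<le> (real n / c) ^ n * exp (- (real m * \<bar>Re \<xi>\<bar>))" .
    have "Re (1 + exp (\<xi> / 4)) \<ge> 1" using Re_exp_quarter_pos[OF strip[OF \<xi>]] by simp
    then have "cmod (1 + exp (\<xi> / 4)) \<ge> 1" using complex_Re_le_cmod order_trans by blast
    then have "cmod (1 / (1 + exp (\<xi> / 4))) \<le> 1"
      unfolding norm_divide using divide_le_eq_1_pos by (simp add: divide_le_eq)
    then have 2: "cmod (poly q (1 / (1 + exp (\<xi> / 4)))) \<le> B" by (rule B)
    have "cmod (profile q \<xi>) \<le> ((real n / c) ^ n * exp (- (real m * \<bar>Re \<xi>\<bar>))) * B"
      unfolding profile_def norm_mult by (rule mult_mono[OF 1 2]) (use c in auto)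
    then show "cmod (profile q \<xi>) \<le> C * exp (- (real m * \<bar>Re \<xi>\<bar>))" by (simp add: C_def mult_ac)
  qed
qed

lemma open_strip: "open {\<xi>. \<bar>Im \<xi>\<bar> < \<sigma>}"
  by (intro open_Collect_less continuous_intros)

lemma exp_abs_shift:
  assumes "cmod (\<xi> - \<zeta>) \<le> r"
  shows "exp (- (real m * \<bar>Re \<zeta>\<bar>)) \<le> exp (real m * r) * exp (- (real m * \<bar>Re \<xi>\<bar>))"
proof -
  have "\<bar>Re \<xi>\<bar> - \<bar>Re \<zeta>\<bar> \<le> r" using abs_Re_le_cmod[of "\<xi> - \<zeta>"] assms by simp
  then have "real m * (\<bar>Re \<xi>\<bar> - \<bar>Re \<zeta>\<bar>) \<le> real m * r" by (intro mult_left_mono) auto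
  then show ?thesis unfolding exp_add[symmetric] by (simp add: algebra_simps)
qed

lemma rapid_higher_deriv:
  assumes h: "rapid \<sigma> h" and r: "0 < r" "\<rho> + r \<le> \<sigma>"
  shows "rapid \<rho> ((deriv ^^ n) h)"
  unfolding rapid_def
proof (intro conjI allI)
  let ?S = "{\<xi>. \<bar>Im \<xi>\<bar> < \<sigma>}"
  have hol: "h holomorphic_on ?S" using h by (simp add: rapid_def)
  show "(deriv ^^ n) h holomorphic_on {\<xi>. \<bar>Im \<xi>\<bar> < \<rho>}"
    by (rule holomorphic_on_subset[OF holomorphic_higher_deriv[OF hol open_strip]]) (use r in auto)
  fix m
  obtain C where C: "C \<ge> 0" "\<And>\<xi>. \<bar>Im \<xi>\<bar> < \<sigma> \<Longrightarrow> cmod (h \<xi>) \<le> C * exp (- (real m * \<bar>Re \<xi>\<bar>))"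
    using h unfolding rapid_def by blast
  let ?C = "fact n * (C * exp (real m * r)) / r ^ n"
  show "\<exists>C\<ge>0. \<forall>\<xi>. \<bar>Im \<xi>\<bar> < \<rho> \<longrightarrow> cmod ((deriv ^^ n) h \<xi>) \<le> C * exp (- (real m * \<bar>Re \<xi>\<bar>))"
  proof (intro exI[of _ ?C] conjI allI impI)
    show "0 \<le> ?C" using C r by simp
    fix \<xi> :: complex assume \<xi>: "\<bar>Im \<xi>\<bar> < \<rho>"
    have sub: "cball \<xi> r \<subseteq> ?S"
    proof
      fix w assume "w \<in> cball \<xi> r"
      then have "\<bar>Im \<xi> - Im w\<bar> \<le> r" using abs_Im_le_cmod[of "\<xi> - w"] by (simp add: dist_norm)
      then show "w \<in> ?S" using \<xi> r by auto
    qed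
    have "cmod ((deriv ^^ n) h \<xi>) \<le> fact n * (C * exp (real m * r) * exp (- (real m * \<bar>Re \<xi>\<bar>))) / r ^ n"
    proof (rule Cauchy_inequality)
      show "h holomorphic_on ball \<xi> r" using hol sub by (meson ball_subset_cball holomorphic_on_subset subset_trans)
      show "continuous_on (cball \<xi> r) h" using hol sub by (meson holomorphic_on_imp_continuous_on holomorphic_on_subset)
      show "0 < r" by (rule r)
      fix w assume w: "cmod (\<xi> - w) = r"
      then have "w \<in> ?S" using sub by (auto simp: dist_norm)
      then have "cmod (h w) \<le> C * exp (- (real m * \<bar>Re w\<bar>))" using C by simp
      also have "\<dots> \<le> C * (exp (real m * r) * exp (- (real m * \<bar>Re \<xi>\<bar>)))"
        by (intro mult_left_mono exp_abs_shift C) (use w in simp)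
      finally show "cmod (h w) \<le> C * exp (real m * r) * exp (- (real m * \<bar>Re \<xi>\<bar>))" by (simp add: mult_ac)
    qed
    then show "cmod ((deriv ^^ n) h \<xi>) \<le> ?C * exp (- (real m * \<bar>Re \<xi>\<bar>))" by simp
  qed
qed

text \<open>The Taylor remainder of second order, with the decay of the second derivative retained.
  The derivative of \<open>h (\<xi> - \<eta>)\<close> in \<eta> is minus the derivative of
  \<open>h\<close>, hence the plus sign.\<close>

lemma rapid_quotient:
  assumes h: "rapid \<sigma> h" and r: "0 < r" "\<rho> + 2 * r \<le> \<sigma>"
  shows "\<exists>C\<ge>0. \<forall>\<xi> \<eta>. \<bar>Im \<xi>\<bar> < \<rho> \<and> \<eta> \<noteq> 0 \<and> cmod \<eta> < r \<longrightarrow>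
    cmod ((h (\<xi> - \<eta>) - h \<xi>) / \<eta> + deriv h \<xi>) \<le> C * cmod \<eta> * exp (- (real m * \<bar>Re \<xi>\<bar>))"
proof -
  let ?S = "{\<xi>. \<bar>Im \<xi>\<bar> < \<sigma>}"
  have hol: "h holomorphic_on ?S" using h by (simp add: rapid_def)
  have "rapid (\<rho> + r) ((deriv ^^ 2) h)" by (rule rapid_higher_deriv[OF h r(1)]) (use r in simp)
  then obtain C where C: "C \<ge> 0" "\<And>\<xi>. \<bar>Im \<xi>\<bar> < \<rho> + r \<Longrightarrow> cmod ((deriv ^^ 2) h \<xi>) \<le> C * exp (- (real m * \<bar>Re \<xi>\<bar>))"
    unfolding rapid_def by blast
  have "cmod ((h (\<xi> - \<eta>) - h \<xi>) / \<eta> + deriv h \<xi>) \<le> (C * exp (real m * r)) * cmod \<eta> * exp (- (real m * \<bar>Re \<xi>\<bar>))"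
    if \<xi>: "\<bar>Im \<xi>\<bar> < \<rho>" and \<eta>: "\<eta> \<noteq> 0" "cmod \<eta> < r" for \<xi> \<eta>
  proof -
    have in_ball: "\<bar>Im w\<bar> < \<rho> + r" if "w \<in> ball \<xi> r" for w
      using abs_Im_le_cmod[of "\<xi> - w"] that \<xi> by (simp add: dist_norm)
    let ?B = "C * exp (real m * r) * exp (- (real m * \<bar>Re \<xi>\<bar>))"
    have "cmod ((deriv ^^ 0) h (\<xi> - \<eta>) - (\<Sum>i\<le>1. (deriv ^^ i) h \<xi> * ((\<xi> - \<eta>) - \<xi>) ^ i / fact i))
        \<le> ?B * cmod ((\<xi> - \<eta>) - \<xi>) ^ Suc 1 / fact 1"
    proof (rule complex_Taylor[of "ball \<xi> r"])
      show "((deriv ^^ i) h has_field_derivative (deriv ^^ Suc i) h w) (at w within ball \<xi> r)"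
        if "w \<in> ball \<xi> r" for i w
      proof -
        have "w \<in> ?S" using in_ball[OF that] r by simp
        then have "((deriv ^^ i) h has_field_derivative (deriv ^^ Suc i) h w) (at w)"
          using holomorphic_derivI[OF holomorphic_higher_deriv[OF hol open_strip] open_strip] by simp
        then show ?thesis by (rule has_field_derivative_at_within)
      qed
      fix w assume w: "w \<in> ball \<xi> r"
      have "cmod ((deriv ^^ Suc 1) h w) \<le> C * exp (- (real m * \<bar>Re w\<bar>))"
        using C(2)[OF in_ball[OF w]] by (simp add: numeral_2_eq_2)
      also have "\<dots> \<le> C * (exp (real m * r) * exp (- (real m * \<bar>Re \<xi>\<bar>)))"
        by (intro mult_left_mono exp_abs_shift C) (use w in \<open>simp add: dist_norm\<close>)
      finally show "cmod ((deriv ^^ Suc 1) h w) \<le> ?B" by (simp add: mult_ac)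
    qed (use \<eta> r in \<open>auto simp: dist_norm\<close>)
    then have "cmod (h (\<xi> - \<eta>) - h \<xi> + \<eta> * deriv h \<xi>) \<le> ?B * (cmod \<eta> * cmod \<eta>)"
      by (simp add: algebra_simps)
    moreover have "(h (\<xi> - \<eta>) - h \<xi>) / \<eta> + deriv h \<xi> = (h (\<xi> - \<eta>) - h \<xi> + \<eta> * deriv h \<xi>) / \<eta>"
      using \<eta> by (simp add: field_simps)
    ultimately show ?thesis using \<eta> by (simp add: norm_divide divide_le_eq mult_ac)
  qed
  then show ?thesis using C(1) by (intro exI[of _ "C * exp (real m * r)"]) auto
qed

text \<open>An open neighbourhood of the closed strip between 0 and i\<pi>, narrow enough that
  differences with \<open>log_strip\<close> satisfy |Im| < (9/8 + 5/8) \<pi> = 7\<pi>/4.\<close>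

definition tau_strip :: "complex set" where
  "tau_strip = {\<tau>. \<bar>Im \<tau> - pi / 2\<bar> < 5 * pi / 8}"

lemma open_tau_strip: "open tau_strip"
  unfolding tau_strip_def by (intro open_Collect_less continuous_intros)

lemma log_strip_minus_tau:
  "\<xi> \<in> log_strip \<Longrightarrow> \<tau> \<in> tau_strip \<Longrightarrow> \<bar>Im (\<xi> - \<tau>)\<bar> < 7 * pi / 4"
  unfolding log_strip_def tau_strip_def mem_Collect_eq minus_complex.simps by linarith

lemma rapid_shift_holomorphic:
  assumes "rapid (7 * pi / 4) h" "\<tau> \<in> tau_strip"
  shows "(\<lambda>\<xi>. h (\<xi> - \<tau>)) holomorphic_on log_strip"
proof -
  have "(h \<circ> (\<lambda>\<xi>. \<xi> - \<tau>)) holomorphic_on log_strip"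
    by (rule holomorphic_on_compose_gen[of _ _ _ "{\<xi>. \<bar>Im \<xi>\<bar> < 7 * pi / 4}"])
      (use assms log_strip_minus_tau in \<open>auto simp: rapid_def intro!: holomorphic_intros simp del: minus_complex.simps\<close>)
  then show ?thesis by (simp add: o_def)
qed

lemma rapid_shift_bound:
  assumes C: "C \<ge> 0" "\<And>\<xi>. \<bar>Im \<xi>\<bar> < 7 * pi / 4 \<Longrightarrow> cmod (h \<xi>) \<le> C * exp (- (real m * \<bar>Re \<xi>\<bar>))"
    and "\<xi> \<in> log_strip" "\<tau> \<in> tau_strip"
  shows "cmod (h (\<xi> - \<tau>)) \<le> (C * exp (real m * \<bar>Re \<tau>\<bar>)) * exp (- (real m * \<bar>Re \<xi>\<bar>))"
proof -
  have "cmod (h (\<xi> - \<tau>)) \<le> C * exp (- (real m * \<bar>Re (\<xi> - \<tau>)\<bar>))"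
    using C(2)[OF log_strip_minus_tau] assms by blast
  also have "real m * (\<bar>Re \<xi>\<bar> - \<bar>Re \<tau>\<bar>) \<le> real m * \<bar>Re (\<xi> - \<tau>)\<bar>" by (intro mult_left_mono) auto
  then have "C * exp (- (real m * \<bar>Re (\<xi> - \<tau>)\<bar>)) \<le> C * exp (- (real m * (\<bar>Re \<xi>\<bar> - \<bar>Re \<tau>\<bar>)))"
    using C(1) by (intro mult_left_mono) auto
  finally show ?thesis by (simp add: right_diff_distrib exp_add[symmetric] mult.assoc)
qed

lemma rapid_shift_rapid:
  assumes "rapid (7 * pi / 4) h" "\<tau> \<in> tau_strip"
  shows "\<exists>B. \<forall>\<xi>\<in>log_strip. cmod (h (\<xi> - \<tau>)) \<le> B * exp (- (real m * \<bar>Re \<xi>\<bar>))"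
proof -
  obtain C where C: "C \<ge> 0" "\<And>\<xi>. \<bar>Im \<xi>\<bar> < 7 * pi / 4 \<Longrightarrow> cmod (h \<xi>) \<le> C * exp (- (real m * \<bar>Re \<xi>\<bar>))"
    using assms unfolding rapid_def by blast
  show ?thesis using rapid_shift_bound[OF C _ assms(2)] by blast
qed

lemma arc_bump_shift_smooth:
  assumes "rapid (7 * pi / 4) h" "\<tau> \<in> tau_strip"
  shows "arc_bump d (\<lambda>\<xi>. h (\<xi> - \<tau>)) \<in> smooth_circle"
  by (rule arc_bump_smooth[OF rapid_shift_holomorphic[OF assms] rapid_shift_rapid[OF assms]])

lemma C_norm_arc_bump_shift:
  assumes "rapid (7 * pi / 4) h"
  shows "\<exists>C\<ge>0. \<forall>\<tau>\<in>tau_strip. C_norm N (arc_bump d (\<lambda>\<xi>. h (\<xi> - \<tau>))) \<le> C * exp (real (Suc N) * \<bar>Re \<tau>\<bar>)"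
proof -
  obtain C where C: "C \<ge> 0" "\<And>\<xi>. \<bar>Im \<xi>\<bar> < 7 * pi / 4 \<Longrightarrow> cmod (h \<xi>) \<le> C * exp (- (real (Suc N) * \<bar>Re \<xi>\<bar>))"
    using assms unfolding rapid_def by blast
  obtain K where K: "K \<ge> 0" "\<And>h B. h holomorphic_on log_strip \<Longrightarrow>
    (\<And>m. \<exists>B. \<forall>\<xi>\<in>log_strip. cmod (h \<xi>) \<le> B * exp (- (real m * \<bar>Re \<xi>\<bar>))) \<Longrightarrow>
    (\<And>\<xi>. \<xi>\<in>log_strip \<Longrightarrow> cmod (h \<xi>) \<le> B * exp (- (real (Suc N) * \<bar>Re \<xi>\<bar>))) \<Longrightarrow>
    C_norm N (arc_bump d h) \<le> K * B"
    using C_norm_arc_bump[of N d] by blast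
  have "C_norm N (arc_bump d (\<lambda>\<xi>. h (\<xi> - \<tau>))) \<le> K * (C * exp (real (Suc N) * \<bar>Re \<tau>\<bar>))" if "\<tau> \<in> tau_strip" for \<tau>
    by (rule K(2)[OF rapid_shift_holomorphic rapid_shift_rapid rapid_shift_bound[OF C]]) (use assms that in auto)
  then show ?thesis using K(1) C(1) by (intro exI[of _ "K * C"]) (auto simp: mult.assoc)
qed

lemma rapid_mono:
  assumes h: "rapid \<sigma> h" and le: "\<rho> \<le> \<sigma>"
  shows "rapid \<rho> h"
proof -
  have sub: "\<bar>Im \<xi>\<bar> < \<sigma>" if "\<bar>Im \<xi>\<bar> < \<rho>" for \<xi> using that le by simp
  have "h holomorphic_on {\<xi>. \<bar>Im \<xi>\<bar> < \<rho>}"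
    using h sub unfolding rapid_def by (auto elim!: holomorphic_on_subset)
  moreover have "\<exists>C\<ge>0. \<forall>\<xi>. \<bar>Im \<xi>\<bar> < \<rho> \<longrightarrow> cmod (h \<xi>) \<le> C * exp (- (real m * \<bar>Re \<xi>\<bar>))" for m
  proof -
    obtain C where "C \<ge> 0" "\<And>\<xi>. \<bar>Im \<xi>\<bar> < \<sigma> \<Longrightarrow> cmod (h \<xi>) \<le> C * exp (- (real m * \<bar>Re \<xi>\<bar>))"
      using h unfolding rapid_def by blast
    then show ?thesis using sub by blast
  qed
  ultimately show ?thesis unfolding rapid_def by blast
qed

text \<open>Complex differentiability in \<tau> with respect to every C^N norm. The error is itself
  a bump, built from the remainder \<open>Q\<close>, whose decay bound carries the factor |\<eta>|.
  The strip of \<open>h\<close> exceeds 7\<pi>/4 by \<pi>/8, twice the radius \<pi>/16 allowed for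
  \<eta>.\<close>

lemma arc_bump_shift_differentiable:
  assumes h: "rapid (15 * pi / 8) h" and \<tau>: "\<tau> \<in> tau_strip"
  shows "((\<lambda>\<eta>. C_norm N (\<lambda>z. 1 / \<eta> * (arc_bump d (\<lambda>\<xi>. h (\<xi> - (\<tau> + \<eta>))) z - arc_bump d (\<lambda>\<xi>. h (\<xi> - \<tau>)) z)
      - arc_bump d (\<lambda>\<xi>. - deriv h (\<xi> - \<tau>)) z)) \<longlongrightarrow> 0) (at 0)"
proof -
  let ?r = "pi / 16"
  define Q where "Q \<eta> \<xi> = (h (\<xi> - \<eta>) - h \<xi>) / \<eta> + deriv h \<xi>" for \<eta> \<xi>
  have h7: "rapid (7 * pi / 4) h" by (rule rapid_mono[OF h]) simp
  have hd: "rapid (7 * pi / 4) (deriv h)"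
    using rapid_higher_deriv[OF h, of "pi/8" "7 * pi / 4" 1] by simp
  have Qb: "\<exists>C\<ge>0. \<forall>\<xi> \<eta>. \<bar>Im \<xi>\<bar> < 7 * pi / 4 \<and> \<eta> \<noteq> 0 \<and> cmod \<eta> < ?r \<longrightarrow>
      cmod (Q \<eta> \<xi>) \<le> C * cmod \<eta> * exp (- (real m * \<bar>Re \<xi>\<bar>))" for m
    unfolding Q_def by (rule rapid_quotient[OF h]) auto
  have Qr: "rapid (7 * pi / 4) (Q \<eta>)" if "\<eta> \<noteq> 0" "cmod \<eta> < ?r" for \<eta>
    unfolding rapid_def
  proof (intro conjI allI)
    have "\<bar>Im (\<xi> - \<eta>)\<bar> < 15 * pi / 8" if "\<bar>Im \<xi>\<bar> < 7 * pi / 4" for \<xi>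
      using abs_Im_le_cmod[of \<eta>] \<open>cmod \<eta> < ?r\<close> that unfolding minus_complex.simps by linarith
    then have "(h \<circ> (\<lambda>\<xi>. \<xi> - \<eta>)) holomorphic_on {\<xi>. \<bar>Im \<xi>\<bar> < 7 * pi / 4}"
      by (intro holomorphic_on_compose_gen[of _ _ _ "{\<xi>. \<bar>Im \<xi>\<bar> < 15 * pi / 8}"])
        (use h in \<open>auto simp: rapid_def intro!: holomorphic_intros simp del: minus_complex.simps\<close>)
    then show "Q \<eta> holomorphic_on {\<xi>. \<bar>Im \<xi>\<bar> < 7 * pi / 4}"
      unfolding Q_def[abs_def] using h7 hd that by (auto simp: rapid_def o_def intro!: holomorphic_intros)
    fix m
    obtain C where "C \<ge> 0" "\<And>\<xi> \<eta>. \<bar>Im \<xi>\<bar> < 7 * pi / 4 \<Longrightarrow> \<eta> \<noteq> 0 \<Longrightarrow> cmod \<eta> < ?r \<Longrightarrow>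
      cmod (Q \<eta> \<xi>) \<le> C * cmod \<eta> * exp (- (real m * \<bar>Re \<xi>\<bar>))" using Qb[of m] by blast
    then show "\<exists>C\<ge>0. \<forall>\<xi>. \<bar>Im \<xi>\<bar> < 7 * pi / 4 \<longrightarrow> cmod (Q \<eta> \<xi>) \<le> C * exp (- (real m * \<bar>Re \<xi>\<bar>))"
      using that by (intro exI[of _ "C * cmod \<eta>"]) auto
  qed
  obtain K where K: "K \<ge> 0" "\<And>h B. h holomorphic_on log_strip \<Longrightarrow>
    (\<And>m. \<exists>B. \<forall>\<xi>\<in>log_strip. cmod (h \<xi>) \<le> B * exp (- (real m * \<bar>Re \<xi>\<bar>))) \<Longrightarrow>
    (\<And>\<xi>. \<xi>\<in>log_strip \<Longrightarrow> cmod (h \<xi>) \<le> B * exp (- (real (Suc N) * \<bar>Re \<xi>\<bar>))) \<Longrightarrow>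
    C_norm N (arc_bump d h) \<le> K * B"
    using C_norm_arc_bump[of N d] by blast
  obtain C where C: "C \<ge> 0" "\<And>\<xi> \<eta>. \<bar>Im \<xi>\<bar> < 7 * pi / 4 \<Longrightarrow> \<eta> \<noteq> 0 \<Longrightarrow> cmod \<eta> < ?r \<Longrightarrow>
      cmod (Q \<eta> \<xi>) \<le> C * cmod \<eta> * exp (- (real (Suc N) * \<bar>Re \<xi>\<bar>))" using Qb[of "Suc N"] by blast
  define M where "M = K * (C * exp (real (Suc N) * \<bar>Re \<tau>\<bar>))"
  have eq: "(\<lambda>z. 1 / \<eta> * (arc_bump d (\<lambda>\<xi>. h (\<xi> - (\<tau> + \<eta>))) z - arc_bump d (\<lambda>\<xi>. h (\<xi> - \<tau>)) z)
      - arc_bump d (\<lambda>\<xi>. - deriv h (\<xi> - \<tau>)) z) = arc_bump d (\<lambda>\<xi>. Q \<eta> (\<xi> - \<tau>))" if "\<eta> \<noteq> 0" for \<eta>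
    using that by (auto simp: arc_bump_def Q_def field_simps)
  have bd: "C_norm N (arc_bump d (\<lambda>\<xi>. Q \<eta> (\<xi> - \<tau>))) \<le> M * cmod \<eta>" "0 \<le> C_norm N (arc_bump d (\<lambda>\<xi>. Q \<eta> (\<xi> - \<tau>)))"
    if \<eta>: "\<eta> \<noteq> 0" "cmod \<eta> < ?r" for \<eta>
  proof -
    show "0 \<le> C_norm N (arc_bump d (\<lambda>\<xi>. Q \<eta> (\<xi> - \<tau>)))"
      by (rule C_norm_nonneg[OF arc_bump_shift_smooth[OF Qr \<tau>]]) (use \<eta> in auto)
    have "C_norm N (arc_bump d (\<lambda>\<xi>. Q \<eta> (\<xi> - \<tau>))) \<le> K * ((C * cmod \<eta>) * exp (real (Suc N) * \<bar>Re \<tau>\<bar>))"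
    proof (rule K(2))
      show "(\<lambda>\<xi>. Q \<eta> (\<xi> - \<tau>)) holomorphic_on log_strip"
        by (rule rapid_shift_holomorphic[OF Qr[OF \<eta>] \<tau>])
      show "\<exists>B. \<forall>\<xi>\<in>log_strip. cmod (Q \<eta> (\<xi> - \<tau>)) \<le> B * exp (- (real m * \<bar>Re \<xi>\<bar>))" for m
        by (rule rapid_shift_rapid[OF Qr[OF \<eta>] \<tau>])
      show "cmod (Q \<eta> (\<xi> - \<tau>)) \<le> C * cmod \<eta> * exp (real (Suc N) * \<bar>Re \<tau>\<bar>) * exp (- (real (Suc N) * \<bar>Re \<xi>\<bar>))"
        if "\<xi> \<in> log_strip" for \<xi>
        by (rule rapid_shift_bound[OF _ _ that \<tau>]) (use C \<eta> in auto)
    qed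
    then show "C_norm N (arc_bump d (\<lambda>\<xi>. Q \<eta> (\<xi> - \<tau>))) \<le> M * cmod \<eta>" by (simp add: M_def mult_ac)
  qed
  have ev: "\<forall>\<^sub>F \<eta> in at 0. \<eta> \<noteq> 0 \<and> cmod \<eta> < ?r"
    unfolding eventually_at by (intro exI[of _ ?r]) auto
  have lim: "((\<lambda>\<eta>. M * cmod \<eta>) \<longlongrightarrow> 0) (at 0)" by (auto intro!: tendsto_eq_intros)
  show ?thesis
  proof (rule tendsto_sandwich[OF _ _ tendsto_const lim])
    show "\<forall>\<^sub>F \<eta> in at 0. 0 \<le> C_norm N (\<lambda>z. 1 / \<eta> * (arc_bump d (\<lambda>\<xi>. h (\<xi> - (\<tau> + \<eta>))) z - arc_bump d (\<lambda>\<xi>. h (\<xi> - \<tau>)) z)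
      - arc_bump d (\<lambda>\<xi>. - deriv h (\<xi> - \<tau>)) z)"
      using ev by eventually_elim (subst eq, blast, rule bd, auto)
    show "\<forall>\<^sub>F \<eta> in at 0. C_norm N (\<lambda>z. 1 / \<eta> * (arc_bump d (\<lambda>\<xi>. h (\<xi> - (\<tau> + \<eta>))) z - arc_bump d (\<lambda>\<xi>. h (\<xi> - \<tau>)) z)
      - arc_bump d (\<lambda>\<xi>. - deriv h (\<xi> - \<tau>)) z) \<le> M * cmod \<eta>"
      using ev by eventually_elim (subst eq, blast, rule bd, auto)
  qed
qed

section \<open>The analytic test functions and their dependence on \<tau>\<close>

definition nice :: "nat \<Rightarrow> complex poly \<Rightarrow> complex \<Rightarrow> circle \<Rightarrow> complex" where
  "nice d q \<tau> = arc_bump d (\<lambda>\<xi>. profile q (\<xi> - \<tau>))"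

lemma rapid_profile_7: "rapid (7 * pi / 4) (profile q)"
  by (rule rapid_mono[OF rapid_profile]) simp

lemma nice_smooth: "\<tau> \<in> tau_strip \<Longrightarrow> nice d q \<tau> \<in> smooth_circle"
  unfolding nice_def by (rule arc_bump_shift_smooth[OF rapid_profile_7])

lemma moebius_beta_nice: "moebius_beta d (boost t) (nice d q \<tau>) = nice d q (\<tau> + of_real t)"
  unfolding nice_def moebius_beta_arc_bump by (simp add: algebra_simps)

definition nice_deriv :: "nat \<Rightarrow> complex poly \<Rightarrow> complex \<Rightarrow> circle \<Rightarrow> complex" where
  "nice_deriv d q \<tau> = arc_bump d (\<lambda>\<xi>. - deriv (profile q) (\<xi> - \<tau>))"

lemma nice_deriv_smooth:
  assumes "\<tau> \<in> tau_strip"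
  shows "nice_deriv d q \<tau> \<in> smooth_circle"
proof -
  have "rapid (7 * pi / 4) (deriv (profile q))"
    using rapid_higher_deriv[OF rapid_profile, of "pi/8" "7 * pi / 4" 1 q] by simp
  from smooth_circle_cmult[OF arc_bump_shift_smooth[OF this assms], of "-1" d]
  have "(\<lambda>z. -1 * arc_bump d (\<lambda>\<xi>. deriv (profile q) (\<xi> - \<tau>)) z) \<in> smooth_circle" .
  moreover have "nice_deriv d q \<tau> = (\<lambda>z. -1 * arc_bump d (\<lambda>\<xi>. deriv (profile q) (\<xi> - \<tau>)) z)"
    by (rule ext) (simp add: nice_deriv_def arc_bump_def)
  ultimately show ?thesis by simp
qed

lemma nice_growth:
  "\<exists>C\<ge>0. \<forall>\<tau>\<in>tau_strip. C_norm N (nice d q \<tau>) \<le> C * exp (real (Suc N) * \<bar>Re \<tau>\<bar>)"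
  unfolding nice_def by (rule C_norm_arc_bump_shift[OF rapid_profile_7])

lemma eventually_tau_strip:
  assumes "\<tau> \<in> tau_strip"
  shows "\<forall>\<^sub>F \<eta> in at 0. \<tau> + \<eta> \<in> tau_strip"
proof -
  have "((\<lambda>\<eta>. \<tau> + \<eta>) \<longlongrightarrow> \<tau> + 0) (at 0)" by (intro tendsto_intros)
  then show ?thesis using topological_tendstoD[OF _ open_tau_strip] assms by fastforce
qed

lemma nice_quotient_tendsto:
  assumes "\<tau> \<in> tau_strip"
  shows "((\<lambda>\<eta>. C_norm N (\<lambda>z. 1 / \<eta> * (nice d q (\<tau> + \<eta>) z - nice d q \<tau> z) - nice_deriv d q \<tau> z)) \<longlongrightarrow> 0) (at 0)"
  unfolding nice_def nice_deriv_def by (rule arc_bump_shift_differentiable[OF rapid_profile assms])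

lemma nice_tendsto:
  assumes \<tau>: "\<tau> \<in> tau_strip"
  shows "((\<lambda>\<eta>. C_norm N (\<lambda>z. nice d q (\<tau> + \<eta>) z - nice d q \<tau> z)) \<longlongrightarrow> 0) (at 0)"
proof -
  let ?Q = "\<lambda>\<eta> z. 1 / \<eta> * (nice d q (\<tau> + \<eta>) z - nice d q \<tau> z) - nice_deriv d q \<tau> z"
  have g: "nice_deriv d q \<tau> \<in> smooth_circle" by (rule nice_deriv_smooth[OF \<tau>])
  have n: "nice d q \<tau> \<in> smooth_circle" by (rule nice_smooth[OF \<tau>])
  have lim: "((\<lambda>\<eta>. cmod \<eta> * (C_norm N (?Q \<eta>) + C_norm N (nice_deriv d q \<tau>))) \<longlongrightarrow> 0) (at 0)"
    using tendsto_mult[OF tendsto_norm[OF tendsto_ident_at] tendsto_add[OF nice_quotient_tendsto[OF \<tau>, of N d q] tendsto_const]]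
    by simp
  have ev: "\<forall>\<^sub>F \<eta> in at 0. \<tau> + \<eta> \<in> tau_strip \<and> \<eta> \<noteq> 0"
    by (rule eventually_conj[OF eventually_tau_strip[OF \<tau>]]) (auto simp: eventually_at intro: exI[of _ 1])
  show ?thesis
  proof (rule tendsto_sandwich[OF _ _ tendsto_const lim])
    show "\<forall>\<^sub>F \<eta> in at 0. 0 \<le> C_norm N (\<lambda>z. nice d q (\<tau> + \<eta>) z - nice d q \<tau> z)"
      using ev by eventually_elim (use n nice_smooth in \<open>auto intro!: C_norm_nonneg smooth_circle_diff\<close>)
    show "\<forall>\<^sub>F \<eta> in at 0. C_norm N (\<lambda>z. nice d q (\<tau> + \<eta>) z - nice d q \<tau> z)
        \<le> cmod \<eta> * (C_norm N (?Q \<eta>) + C_norm N (nice_deriv d q \<tau>))"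
      using ev
    proof eventually_elim
      case (elim \<eta>)
      have Q: "?Q \<eta> \<in> smooth_circle"
        by (intro smooth_circle_diff smooth_circle_cmult g n nice_smooth) (use elim in auto)
      have eq: "(\<lambda>z. nice d q (\<tau> + \<eta>) z - nice d q \<tau> z) = (\<lambda>z. \<eta> * (?Q \<eta> z + nice_deriv d q \<tau> z))"
        using elim by auto
      have "C_norm N (\<lambda>z. \<eta> * (?Q \<eta> z + nice_deriv d q \<tau> z)) \<le> cmod \<eta> * C_norm N (\<lambda>z. ?Q \<eta> z + nice_deriv d q \<tau> z)"
        by (rule C_norm_cmult_le[OF smooth_circle_add[OF Q g]])
      also have "\<dots> \<le> cmod \<eta> * (C_norm N (?Q \<eta>) + C_norm N (nice_deriv d q \<tau>))"
        by (intro mult_left_mono C_norm_triangle Q g) simp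
      finally show ?case unfolding eq .
    qed
  qed
qed

context wightman_CFT
begin

lemma field_product_slot_scale:
  assumes "\<And>j. j < k \<Longrightarrow> \<phi> j \<in> F \<and> f j \<in> smooth_circle" "i < k"
  shows "field_product \<phi> (f(i := (\<lambda>z. c * f i z))) [0..<k] \<Phi> = scaleC c (field_product \<phi> f [0..<k] \<Phi>)"
proof -
  have "field_product \<phi> (f(i := (\<lambda>z. c * f i z))) [0..<k] \<Phi> =
    field_product \<phi> (\<lambda>j z. (if j = i then c else 1) * f j z) [0..<k] \<Phi>"
    by (rule field_product_cong) auto
  also have "\<dots> = scaleC (prod_list (map (\<lambda>j. if j = i then c else 1) [0..<k])) (field_product \<phi> f [0..<k] \<Phi>)"
    by (rule field_product_cmult) (use assms in auto)
  also have "prod_list (map (\<lambda>j. if j = i then c else 1) [0..<k]) = c"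
    using assms(2) by (subst prod.distinct_set_conv_list[symmetric]) (auto simp: prod.delta)
  finally show ?thesis .
qed

text \<open>A product rule: the telescoped difference has one difference quotient per term, with
  factors at \<tau> + \<eta> before it and at \<tau> after it, and joint continuity of the
  functional gives the limit of each term.\<close>

lemma nice_product_holomorphic:
  assumes l: "l \<in> compatible_dual scaleC F" and \<phi>: "\<And>j. j < k \<Longrightarrow> \<phi> j \<in> F"
  shows "(\<lambda>\<tau>. l (field_product \<phi> (\<lambda>j. nice (d j) (q j) \<tau>) [0..<k] \<Phi>)) holomorphic_on tau_strip"
proof -
  let ?n = "\<lambda>\<tau> j. nice (d j) (q j) \<tau>"
  let ?G = "\<lambda>\<tau>. l (field_product \<phi> (?n \<tau>) [0..<k] \<Phi>)"
  have "\<exists>D. (?G has_field_derivative D) (at \<tau>)" if \<tau>: "\<tau> \<in> tau_strip" for \<tau>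
  proof -
    let ?Q = "\<lambda>i \<eta> z. 1 / \<eta> * (?n (\<tau> + \<eta>) i z - ?n \<tau> i z)"
    let ?g = "\<lambda>i \<eta> j. if j < i then ?n (\<tau> + \<eta>) j else if j = i then ?Q i \<eta> else ?n \<tau> j"
    let ?f = "\<lambda>i j. if j < i then ?n \<tau> j else if j = i then nice_deriv (d i) (q i) \<tau> else ?n \<tau> j"
    have n: "?n \<tau> j \<in> smooth_circle" for j by (rule nice_smooth[OF \<tau>])
    have nd: "nice_deriv (d i) (q i) \<tau> \<in> smooth_circle" for i by (rule nice_deriv_smooth[OF \<tau>])
    have ev: "\<forall>\<^sub>F \<eta> in at 0. \<tau> + \<eta> \<in> tau_strip" by (rule eventually_tau_strip[OF \<tau>])
    have lim: "((\<lambda>\<eta>. l (field_product \<phi> (?g i \<eta>) [0..<k] \<Phi>)) \<longlongrightarrow> l (field_product \<phi> (?f i) [0..<k] \<Phi>)) (at 0)" for i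
    proof (rule dual_field_product_tendsto[OF l \<phi>])
      show "?f i j \<in> smooth_circle" for j using n nd by simp
      show "\<forall>\<^sub>F \<eta> in at 0. ?g i \<eta> j \<in> smooth_circle" for j
        using ev
      proof eventually_elim
        case (elim \<eta>)
        have n': "?n (\<tau> + \<eta>) i \<in> smooth_circle" for i by (rule nice_smooth[OF elim])
        have "?Q i \<eta> \<in> smooth_circle" by (intro smooth_circle_cmult smooth_circle_diff n n')
        then show ?case using n n' by simp
      qed
      show "((\<lambda>\<eta>. C_norm N (\<lambda>z. ?g i \<eta> j z - ?f i j z)) \<longlongrightarrow> 0) (at 0)" for j N
      proof -
        consider "j < i" | "j = i" | "j > i" by linarith
        then show ?thesis
        proof cases
          case 1
          then show ?thesis using nice_tendsto[OF \<tau>, of N "d j" "q j"] by simp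
        next
          case 2
          then show ?thesis using nice_quotient_tendsto[OF \<tau>, of N "d i" "q i"] by simp
        next
          case 3
          then show ?thesis by (simp add: C_norm_zero)
        qed
      qed
    qed auto
    have "((\<lambda>\<eta>. \<Sum>i<k. l (field_product \<phi> (?g i \<eta>) [0..<k] \<Phi>)) \<longlongrightarrow> (\<Sum>i<k. l (field_product \<phi> (?f i) [0..<k] \<Phi>))) (at 0)"
      by (intro tendsto_sum lim)
    moreover have "\<forall>\<^sub>F \<eta> in at 0. (?G (\<tau> + \<eta>) - ?G \<tau>) / \<eta> = (\<Sum>i<k. l (field_product \<phi> (?g i \<eta>) [0..<k] \<Phi>))"
      using ev
    proof eventually_elim
      case (elim \<eta>)
      have n': "?n (\<tau> + \<eta>) j \<in> smooth_circle" for j by (rule nice_smooth[OF elim])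
      let ?h = "\<lambda>i j. if j < i then ?n (\<tau> + \<eta>) j else if j = i then (\<lambda>z. ?n (\<tau> + \<eta>) i z - ?n \<tau> i z) else ?n \<tau> j"
      have "?G (\<tau> + \<eta>) - ?G \<tau> = (\<Sum>i<k. l (field_product \<phi> (?h i) [0..<k] \<Phi>))"
        using field_product_telescope[of k \<phi> "?n (\<tau> + \<eta>)" "?n \<tau>" \<Phi>, OF \<phi> n' n]
        by (simp add: linear_diff[OF dual_linear[OF l], symmetric] dual_sum[OF l, symmetric])
      moreover have "l (field_product \<phi> (?g i \<eta>) [0..<k] \<Phi>) = 1 / \<eta> * l (field_product \<phi> (?h i) [0..<k] \<Phi>)"
        if "i < k" for i
      proof -
        have "?g i \<eta> = (?h i)(i := (\<lambda>z. 1 / \<eta> * ?h i i z))" by auto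
        moreover have "?h i j \<in> smooth_circle" for j using n n' smooth_circle_diff by auto
        ultimately show ?thesis
          using field_product_slot_scale[of k \<phi> "?h i" i "1 / \<eta>" \<Phi>] that \<phi>
          by (simp only: linear_scale[OF dual_linear[OF l]] simp_thms)
      qed
      ultimately show ?case by (simp add: sum_divide_distrib)
    qed
    ultimately have "((\<lambda>\<eta>. (?G (\<tau> + \<eta>) - ?G \<tau>) / \<eta>) \<longlongrightarrow> (\<Sum>i<k. l (field_product \<phi> (?f i) [0..<k] \<Phi>))) (at 0)"
      by (subst tendsto_cong)
    then show ?thesis unfolding DERIV_def by blast
  qed
  then show ?thesis
    using holomorphic_on_open[OF open_tau_strip] by blast
qed

text \<open>\<open>conformal_dimension\<close> conjugates with HOL's \<open>inv\<close>; it cancels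
  \<open>U \<gamma>\<close> because the group inverse \<delta> makes \<open>U \<gamma>\<close>
  injective.\<close>

lemma U_covariant:
  assumes "\<gamma> \<in> Mob" "\<delta> \<in> Mob" "\<delta> \<circ> \<gamma> = id" "conformal_dimension U \<phi> d" "f \<in> smooth_circle"
  shows "U \<gamma> (\<phi> f \<Phi>) = \<phi> (moebius_beta d \<gamma> f) (U \<gamma> \<Phi>)"
proof -
  have "U \<delta> \<circ> U \<gamma> = id" using U_comp[OF assms(2,1)] assms(3) U_id by simp
  then have "inv (U \<gamma>) (U \<gamma> \<Phi>) = \<Phi>" by (metis inj_on_id inj_on_imageI2 inv_f_f)
  then show ?thesis
    using assms unfolding conformal_dimension_def by (metis comp_apply)
qed

lemma U_boost_covariant:
  assumes "conformal_dimension U \<phi> d" "f \<in> smooth_circle"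
  shows "U (boost t) (\<phi> f \<Phi>) = \<phi> (moebius_beta d (boost t) f) (U (boost t) \<Phi>)"
  by (rule U_covariant[OF boost_Mob boost_Mob[of "-t"] _ assms]) (auto simp: boost_comp boost_0)

lemma U_rotation_covariant:
  assumes "conformal_dimension U \<phi> d" "f \<in> smooth_circle"
  shows "U (rotation a) (\<phi> f \<Phi>) = \<phi> (\<lambda>z. f (rotation (- a) z)) (U (rotation a) \<Phi>)"
  using U_covariant[OF rotation_Mob rotation_Mob[of "-a"] _ assms, of a]
  by (auto simp: rotation_comp rotation_0 moebius_beta_rotation[abs_def] o_def id_def)

lemma U_boost_product:
  assumes "\<And>j. j \<in> set js \<Longrightarrow> conformal_dimension U (\<phi> j) (d j) \<and> f j \<in> smooth_circle"
  shows "U (boost t) (field_product \<phi> f js \<Omega>) =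
    field_product \<phi> (\<lambda>j. moebius_beta (d j) (boost t) (f j)) js \<Omega>"
  using assms
proof (induction js)
  case Nil
  then show ?case by (simp add: vacuum_invariant[OF boost_Mob])
next
  case (Cons a js)
  then show ?case using U_boost_covariant[of "\<phi> a" "d a" "f a" t] by simp
qed

lemma U_linear: "\<gamma> \<in> Mob \<Longrightarrow> Vector_Spaces.linear scaleC scaleC (U \<gamma>)"
  using U_End unfolding End_D_def by blast

lemma dual_separates:
  assumes "\<And>l. l \<in> compatible_dual scaleC F \<Longrightarrow> l \<Phi> = l \<Psi>"
  shows "\<Phi> = \<Psi>"
  using regular assms unfolding acts_regularly_def by blast

end

section \<open>Modes of the fields acting on the vacuum\<close>

definition mode :: "int \<Rightarrow> circle \<Rightarrow> complex" where
  "mode n z = of_circle z powi n"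

lemma mode_circle_cis: "mode n (circle_cis \<theta>) = exp (\<i> * of_int n * of_real \<theta>)"
  unfolding mode_def of_circle_cis cis_power_int by (simp add: cis_conv_exp mult_ac)

text \<open>Cauchy's estimate on disks of radius \<epsilon>/2 around real points bounds all C^N
  norms by the supremum on the strip.\<close>

lemma entire_strip_smooth:
  assumes p: "p holomorphic_on {\<zeta>. \<bar>Im \<zeta>\<bar> < \<epsilon>}" and \<epsilon>: "\<epsilon> > 0"
    and B: "\<And>\<zeta>. \<bar>Im \<zeta>\<bar> < \<epsilon> \<Longrightarrow> cmod (p \<zeta>) \<le> B"
    and f: "\<And>\<theta>. f (circle_cis \<theta>) = p (of_real \<theta>)"
  shows "f \<in> smooth_circle" and "C_norm N f \<le> (\<Sum>n\<le>N. fact n / (\<epsilon> / 2) ^ n) * B"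
proof -
  let ?S = "{\<zeta>. \<bar>Im \<zeta>\<bar> < \<epsilon>}"
  let ?D = "\<lambda>n \<theta>. (deriv ^^ n) p (of_real \<theta>)"
  have D: "(?D n has_vector_derivative ?D (Suc n) \<theta>) (at \<theta>)" for n \<theta>
    using higher_deriv_has_vector_derivative[OF p open_strip, where \<theta> = \<theta> and c = 0 and n = n] \<epsilon> by simp
  have D0: "?D 0 \<theta> = f (circle_cis \<theta>)" for \<theta> by (simp add: f)
  show "f \<in> smooth_circle" by (rule smooth_circleI[of ?D, OF D0 D])
  have "C_norm N f \<le> (\<Sum>n\<le>N. fact n / (\<epsilon> / 2) ^ n * B)"
  proof (rule C_norm_le, subst circle_deriv_eqI[of ?D, OF D0 D])
    fix n \<theta>
    have sub: "cball (complex_of_real \<theta>) (\<epsilon> / 2) \<subseteq> ?S"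
    proof
      fix w assume "w \<in> cball (complex_of_real \<theta>) (\<epsilon> / 2)"
      then have "\<bar>Im w\<bar> \<le> \<epsilon> / 2" using abs_Im_le_cmod[of "of_real \<theta> - w"] by (simp add: dist_norm)
      then show "w \<in> ?S" using \<epsilon> by simp
    qed
    have "cmod (?D n \<theta>) \<le> fact n * B / (\<epsilon> / 2) ^ n"
    proof (rule Cauchy_inequality)
      show "p holomorphic_on ball (of_real \<theta>) (\<epsilon> / 2)"
        using p sub by (meson ball_subset_cball holomorphic_on_subset subset_trans)
      show "continuous_on (cball (of_real \<theta>) (\<epsilon> / 2)) p"
        using p sub by (meson holomorphic_on_imp_continuous_on holomorphic_on_subset)
      show "0 < \<epsilon> / 2" using \<epsilon> by simp
      show "cmod (p w) \<le> B" if "cmod (of_real \<theta> - w) = \<epsilon> / 2" for w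
      proof -
        have "w \<in> ?S" using that sub by (auto simp: dist_norm)
        then show ?thesis using B by simp
      qed
    qed
    then show "cmod (?D n \<theta>) \<le> fact n / (\<epsilon> / 2) ^ n * B" by simp
  qed
  then show "C_norm N f \<le> (\<Sum>n\<le>N. fact n / (\<epsilon> / 2) ^ n) * B" by (simp add: sum_distrib_right)
qed

lemma mode_smooth: "mode n \<in> smooth_circle"
proof (rule entire_strip_smooth(1)[of "\<lambda>\<zeta>. exp (\<i> * of_int n * \<zeta>)" 1 "exp \<bar>real_of_int n\<bar>"])
  show "(\<lambda>\<zeta>. exp (\<i> * of_int n * \<zeta>)) holomorphic_on {\<zeta>. \<bar>Im \<zeta>\<bar> < 1}" by (intro holomorphic_intros)
  show "cmod (exp (\<i> * of_int n * \<zeta>)) \<le> exp \<bar>real_of_int n\<bar>" if "\<bar>Im \<zeta>\<bar> < 1" for \<zeta>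
  proof -
    have "- (real_of_int n * Im \<zeta>) \<le> \<bar>real_of_int n\<bar> * \<bar>Im \<zeta>\<bar>" by (simp add: abs_mult[symmetric])
    also have "\<dots> \<le> \<bar>real_of_int n\<bar> * 1" using that by (intro mult_left_mono) auto
    finally show ?thesis by (simp add: norm_exp_eq_Re)
  qed
qed (auto simp: mode_circle_cis)

lemma taylor_tail_bound:
  assumes P: "P holomorphic_on ball 0 R" and r: "0 < r" "r < \<rho>" "\<rho> < R"
  shows "\<exists>B. \<forall>K w. cmod w \<le> r \<longrightarrow>
    cmod (P w - (\<Sum>j<K. (deriv ^^ j) P 0 / fact j * w ^ j)) \<le> B * (r / \<rho>) ^ K"
proof -
  have sub: "cball 0 \<rho> \<subseteq> ball (0::complex) R" using r by auto
  have cont: "continuous_on (cball 0 \<rho>) P"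
    by (rule holomorphic_on_imp_continuous_on[OF holomorphic_on_subset[OF P sub]])
  then have "bounded (P ` cball 0 \<rho>)" by (intro compact_imp_bounded compact_continuous_image) auto
  then obtain B where "\<forall>x\<in>P ` cball 0 \<rho>. cmod x \<le> B" unfolding bounded_iff by blast
  then have B: "cmod (P w) \<le> B" if "cmod w \<le> \<rho>" for w using that by simp
  let ?c = "\<lambda>j. (deriv ^^ j) P 0 / fact j"
  have c: "cmod (?c j) \<le> B / \<rho> ^ j" for j
  proof -
    have "cmod ((deriv ^^ j) P 0) \<le> fact j * B / \<rho> ^ j"
      by (rule Cauchy_inequality[OF holomorphic_on_subset[OF P] cont]) (use r B in auto)
    then show ?thesis by (simp add: norm_divide field_simps)
  qed
  have q: "0 < r / \<rho>" "r / \<rho> < 1" using r by auto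
  have "cmod (P w - (\<Sum>j<K. ?c j * w ^ j)) \<le> B / (1 - r / \<rho>) * (r / \<rho>) ^ K" if w: "cmod w \<le> r" for K w
  proof -
    have tm: "cmod (?c j * w ^ j) \<le> B * (r / \<rho>) ^ j" for j
    proof -
      have "cmod (?c j * w ^ j) \<le> B / \<rho> ^ j * r ^ j"
        unfolding norm_mult norm_power using c[of j] w by (intro mult_mono power_mono) (auto intro: order_trans[OF norm_ge_zero])
      then show ?thesis by (simp add: power_divide)
    qed
    have "(\<lambda>n. (deriv ^^ n) P 0 / fact n * (w - 0) ^ n) sums P w"
      by (rule holomorphic_power_series[OF P]) (use w r in auto)
    then have "(\<lambda>n. ?c n * w ^ n) sums P w" by simp
    then have tail: "(\<lambda>n. ?c (n + K) * w ^ (n + K)) sums (P w - (\<Sum>j<K. ?c j * w ^ j))"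
      by (rule sums_split_initial_segment)
    have geo: "(\<lambda>n. B * (r / \<rho>) ^ K * (r / \<rho>) ^ n) sums (B * (r / \<rho>) ^ K * (1 / (1 - r / \<rho>)))"
      by (intro sums_mult geometric_sums) (use q in auto)
    have "cmod (\<Sum>n. ?c (n + K) * w ^ (n + K)) \<le> (\<Sum>n. B * (r / \<rho>) ^ K * (r / \<rho>) ^ n)"
    proof (rule norm_suminf_le[OF _ sums_summable[OF geo]])
      show "cmod (?c (n + K) * w ^ (n + K)) \<le> B * (r / \<rho>) ^ K * (r / \<rho>) ^ n" for n
        using tm[of "n + K"] by (simp only: power_add mult_ac)
    qed
    then show ?thesis using sums_unique[OF tail] sums_unique[OF geo] by simp
  qed
  then show ?thesis by blast
qed

text \<open>The map \<zeta> \<mapsto> exp(i\<zeta>) sends the strip |Im \<zeta>| < ln r into the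
  disk of radius r, so a bound for \<open>Q\<close> on that disk controls all derivatives on the
  circle.\<close>

lemma mode_times_holomorphic:
  assumes Q: "Q holomorphic_on ball 0 R" and r: "1 < r" "r < R"
    and B: "\<And>w. cmod w \<le> r \<Longrightarrow> cmod (Q w) \<le> B"
  shows "(\<lambda>z. mode m z * Q (of_circle z)) \<in> smooth_circle"
    and "C_norm N (\<lambda>z. mode m z * Q (of_circle z)) \<le>
      (\<Sum>n\<le>N. fact n / (ln r / 2) ^ n) * (exp (\<bar>real_of_int m\<bar> * ln r) * B)"
proof -
  let ?p = "\<lambda>\<zeta>. exp (\<i> * of_int m * \<zeta>) * Q (exp (\<i> * \<zeta>))"
  have \<epsilon>: "ln r > 0" using r by simp
  have e: "cmod (exp (\<i> * \<zeta>)) < r" if "\<bar>Im \<zeta>\<bar> < ln r" for \<zeta>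
  proof -
    have "- Im \<zeta> < ln r" using that by simp
    then have "exp (- Im \<zeta>) < exp (ln r)" by simp
    then show ?thesis using r by (simp add: norm_exp_eq_Re)
  qed
  have hol: "?p holomorphic_on {\<zeta>. \<bar>Im \<zeta>\<bar> < ln r}"
  proof -
    have "(Q \<circ> (\<lambda>\<zeta>. exp (\<i> * \<zeta>))) holomorphic_on {\<zeta>. \<bar>Im \<zeta>\<bar> < ln r}"
      by (rule holomorphic_on_compose_gen[OF _ Q]) (use e r in \<open>force intro!: holomorphic_intros\<close>)+
    then show ?thesis by (auto simp: o_def intro!: holomorphic_intros)
  qed
  have bd: "cmod (?p \<zeta>) \<le> exp (\<bar>real_of_int m\<bar> * ln r) * B" if \<zeta>: "\<bar>Im \<zeta>\<bar> < ln r" for \<zeta>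
  proof -
    have "- (real_of_int m * Im \<zeta>) \<le> \<bar>real_of_int m\<bar> * \<bar>Im \<zeta>\<bar>" by (simp add: abs_mult[symmetric])
    also have "\<dots> \<le> \<bar>real_of_int m\<bar> * ln r" using \<zeta> by (intro mult_left_mono) auto
    finally have "cmod (exp (\<i> * of_int m * \<zeta>)) \<le> exp (\<bar>real_of_int m\<bar> * ln r)" by (simp add: norm_exp_eq_Re)
    moreover have "cmod (Q (exp (\<i> * \<zeta>))) \<le> B" using e[OF \<zeta>] by (intro B) simp
    ultimately show ?thesis unfolding norm_mult by (intro mult_mono) auto
  qed
  have f: "mode m (circle_cis \<theta>) * Q (of_circle (circle_cis \<theta>)) = ?p (of_real \<theta>)" for \<theta>
    by (simp add: mode_circle_cis cis_conv_exp)
  show "(\<lambda>z. mode m z * Q (of_circle z)) \<in> smooth_circle"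
    by (rule entire_strip_smooth(1)[OF hol \<epsilon> bd f])
  show "C_norm N (\<lambda>z. mode m z * Q (of_circle z)) \<le>
      (\<Sum>n\<le>N. fact n / (ln r / 2) ^ n) * (exp (\<bar>real_of_int m\<bar> * ln r) * B)"
    by (rule entire_strip_smooth(2)[OF hol \<epsilon> bd f])
qed

lemma of_circle_nonzero [simp]: "of_circle z \<noteq> 0"
  using norm_of_circle[of z] by (metis norm_zero zero_neq_one)

lemma mode_add: "mode (m + int j) z = mode m z * of_circle z ^ j"
  unfolding mode_def by (simp add: power_int_add)

context wightman_CFT
begin

lemma field_zero: "\<phi> \<in> F \<Longrightarrow> \<phi> (\<lambda>z. 0) \<Phi> = 0"
  using field_cmult[OF _ smooth_circle_zero, of \<phi> 0 \<Phi>] by simp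

lemma smooth_circle_sum:
  "finite A \<Longrightarrow> (\<And>j. j \<in> A \<Longrightarrow> f j \<in> smooth_circle) \<Longrightarrow> (\<lambda>z. \<Sum>j\<in>A. c j * f j z) \<in> smooth_circle"
  by (induction A rule: finite_induct) (auto intro!: smooth_circle_zero smooth_circle_add smooth_circle_cmult)

lemma field_sum:
  assumes \<phi>: "\<phi> \<in> F"
  shows "finite A \<Longrightarrow> (\<And>j. j \<in> A \<Longrightarrow> f j \<in> smooth_circle) \<Longrightarrow>
    \<phi> (\<lambda>z. \<Sum>j\<in>A. c j * f j z) \<Phi> = (\<Sum>j\<in>A. scaleC (c j) (\<phi> (f j) \<Phi>))"
proof (induction A rule: finite_induct)
  case empty
  then show ?case using field_zero[OF \<phi>] by simp
next
  case (insert x A)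
  then show ?case
    using field_add[OF \<phi> smooth_circle_cmult[of "f x" "c x"] smooth_circle_sum[of A f c], of \<Phi>]
      field_cmult[OF \<phi>, of "f x" "c x" \<Phi>] by simp
qed

text \<open>\<open>P\<close> extends beyond the unit circle, so its Taylor series converges
  geometrically in every C^N norm and can be inserted term by term. Once K reaches J the values on
  the partial sums no longer change.\<close>

lemma vacuum_power_series:
  assumes \<phi>: "\<phi> \<in> F" and P: "P holomorphic_on ball 0 R" and R: "R > 1"
    and J: "\<And>j. j \<ge> J \<Longrightarrow> \<phi> (mode (m + int j)) \<Omega> = 0" and l: "l \<in> compatible_dual scaleC F"
  shows "l (\<phi> (\<lambda>z. mode m z * P (of_circle z)) \<Omega>) =
    (\<Sum>j<J. (deriv ^^ j) P 0 / fact j * l (\<phi> (mode (m + int j)) \<Omega>))"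
proof -
  define \<rho> where "\<rho> = (1 + R) / 2"
  define r where "r = (1 + \<rho>) / 2"
  have r: "1 < r" "r < \<rho>" "\<rho> < R" using R by (auto simp: r_def \<rho>_def field_simps)
  define c where "c j = (deriv ^^ j) P 0 / fact j" for j
  define T where "T K w = (\<Sum>j<K. c j * w ^ j)" for K w
  obtain B where B: "\<And>K w. cmod w \<le> r \<Longrightarrow> cmod (P w - T K w) \<le> B * (r / \<rho>) ^ K"
    using taylor_tail_bound[OF P _ r(2,3)] r unfolding T_def c_def by auto
  have TP: "(\<lambda>w. T K w - P w) holomorphic_on ball 0 R" for K
    unfolding T_def by (intro holomorphic_intros P)
  have Th: "T K holomorphic_on ball 0 R" for K
    unfolding T_def[abs_def] by (intro holomorphic_intros)
  have smooth: "(\<lambda>z. mode m z * Q (of_circle z)) \<in> smooth_circle" if "Q holomorphic_on ball 0 R" for Q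
  proof -
    have "bounded (Q ` cball 0 r)"
      by (intro compact_imp_bounded compact_continuous_image holomorphic_on_imp_continuous_on
        holomorphic_on_subset[OF that]) (use r in auto)
    then obtain B where "\<forall>x\<in>Q ` cball 0 r. cmod x \<le> B" unfolding bounded_iff by blast
    then show ?thesis using mode_times_holomorphic(1)[OF that r(1), of B m] r by force
  qed
  let ?f = "\<lambda>z. mode m z * P (of_circle z)" and ?g = "\<lambda>K z. mode m z * T K (of_circle z)"
  have lim: "((\<lambda>K. l (field_product (\<lambda>_. \<phi>) (\<lambda>_. ?g K) [0..<1] \<Omega>)) \<longlongrightarrow> l (field_product (\<lambda>_. \<phi>) (\<lambda>_. ?f) [0..<1] \<Omega>)) sequentially"
  proof (rule dual_field_product_tendsto[OF l \<phi>])
    show "?f \<in> smooth_circle" by (rule smooth[OF P])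
    show "\<forall>\<^sub>F K in sequentially. ?g K \<in> smooth_circle"
      using smooth[OF Th] by simp
    fix N
    let ?M = "\<lambda>K. (\<Sum>n\<le>N. fact n / (ln r / 2) ^ n) * (exp (\<bar>real_of_int m\<bar> * ln r) * (B * (r / \<rho>) ^ K))"
    have q: "(\<lambda>K. (r / \<rho>) ^ K) \<longlonglongrightarrow> 0" by (rule LIMSEQ_realpow_zero) (use r in auto)
    have M: "?M \<longlonglongrightarrow> 0"
      using tendsto_mult_right_zero[OF tendsto_mult_right_zero[OF tendsto_mult_right_zero[OF q, of B], of "exp (\<bar>real_of_int m\<bar> * ln r)"]] .
    have eq: "(\<lambda>z. ?g K z - ?f z) = (\<lambda>z. mode m z * (T K (of_circle z) - P (of_circle z)))" for K
      by (simp add: right_diff_distrib)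
    have bd: "cmod (T K w - P w) \<le> B * (r / \<rho>) ^ K" if "cmod w \<le> r" for K w
      using B[OF that, of K] by (simp add: norm_minus_commute)
    show "(\<lambda>K. C_norm N (\<lambda>z. ?g K z - ?f z)) \<longlonglongrightarrow> 0"
      unfolding eq
    proof (rule tendsto_sandwich[OF _ _ tendsto_const M])
      show "\<forall>\<^sub>F K in sequentially. 0 \<le> C_norm N (\<lambda>z. mode m z * (T K (of_circle z) - P (of_circle z)))"
        by (intro always_eventually allI C_norm_nonneg smooth[OF TP])
      show "\<forall>\<^sub>F K in sequentially. C_norm N (\<lambda>z. mode m z * (T K (of_circle z) - P (of_circle z))) \<le> ?M K"
        using r by (intro always_eventually allI mode_times_holomorphic(2)[OF TP _ _ bd]) auto
    qed
  qed
  have val: "l (field_product (\<lambda>_. \<phi>) (\<lambda>_. ?g K) [0..<1] \<Omega>) = (\<Sum>j<J. c j * l (\<phi> (mode (m + int j)) \<Omega>))" if "K \<ge> J" for K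
  proof -
    have "?g K = (\<lambda>z. \<Sum>j<K. c j * mode (m + int j) z)"
      by (rule ext) (simp add: T_def mode_add sum_distrib_left mult_ac)
    then have "\<phi> (?g K) \<Omega> = (\<Sum>j<K. scaleC (c j) (\<phi> (mode (m + int j)) \<Omega>))"
      using field_sum[OF \<phi>, of "{..<K}" "\<lambda>j. mode (m + int j)" c] mode_smooth by simp
    then have "l (\<phi> (?g K) \<Omega>) = (\<Sum>j<K. c j * l (\<phi> (mode (m + int j)) \<Omega>))"
      by (simp add: dual_sum[OF l] linear_scale[OF dual_linear[OF l]])
    also have "\<dots> = (\<Sum>j<J. c j * l (\<phi> (mode (m + int j)) \<Omega>))"
      by (rule sum.mono_neutral_right) (use that J linear_zero[OF dual_linear[OF l]] in auto)
    finally show ?thesis by simp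
  qed
  have "((\<lambda>K. l (field_product (\<lambda>_. \<phi>) (\<lambda>_. ?g K) [0..<1] \<Omega>)) \<longlongrightarrow> (\<Sum>j<J. c j * l (\<phi> (mode (m + int j)) \<Omega>))) sequentially"
    by (rule tendsto_eventually) (use val in \<open>auto simp: eventually_sequentially\<close>)
  from LIMSEQ_unique[OF lim this] show ?thesis by (simp add: c_def)
qed

lemma U_rotation_mode:
  assumes "conformal_dimension U \<phi> d" "\<phi> \<in> F"
  shows "U (rotation \<theta>) (\<phi> (mode n) \<Omega>) = scaleC (cis (- (of_int n * \<theta>))) (\<phi> (mode n) \<Omega>)"
proof -
  have "(\<lambda>z. mode n (rotation (- \<theta>) z)) = (\<lambda>z. cis (- (of_int n * \<theta>)) * mode n z)"
    by (rule ext) (simp add: mode_def rotation.rep_eq power_int_mult_distrib cis_power_int)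
  then show ?thesis
    using U_rotation_covariant[OF assms(1) mode_smooth, of \<theta> n \<Omega>] field_cmult[OF assms(2) mode_smooth]
    by (simp add: vacuum_invariant[OF rotation_Mob])
qed

lemma vacuum_positive_mode:
  assumes "\<phi> \<in> F" "n > 0"
  shows "\<phi> (mode n) \<Omega> = 0"
proof -
  obtain d where d: "conformal_dimension U \<phi> d" using covariance[OF assms(1)] by blast
  show ?thesis
    by (rule spectrum[of "- n"]) (use assms U_rotation_mode[OF d assms(1)] in auto)
qed

section \<open>Modes that annihilate the vacuum\<close>

text \<open>With A and D the numerator and the denominator of the boosted point, the weight is A D /
  z on the circle; the formula is (A D / z)^(d-1) A / D.\<close>

lemma boost_mode_one:
  "moebius_beta d (boost t) (mode 1) (circle_cis \<theta>) =
    cis \<theta> powi (1 - int d) * (complex_of_real (cosh (t/2)) * cis \<theta> + complex_of_real (sinh (t/2))) powi int d *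
      (complex_of_real (sinh (t/2)) * cis \<theta> + complex_of_real (cosh (t/2))) powi (int d - 2)"
proof -
  let ?c = "complex_of_real (cosh (t/2))" and ?s = "complex_of_real (sinh (t/2))"
  define z where "z = cis \<theta>"
  have z: "z \<noteq> 0" by (simp add: z_def)
  define A D where "A = ?c * z + ?s" and "D = ?s * z + ?c"
  have lift: "cis (boost_lift t \<theta>) = A / D" by (simp add: cis_boost_lift A_def D_def z_def)
  have nz: "A \<noteq> 0" "D \<noteq> 0" using lift by (metis cis_neq_zero divide_eq_0_iff)+
  have t: "cosh t = (cosh (t/2))\<^sup>2 + (sinh (t/2))\<^sup>2" "sinh t = 2 * sinh (t/2) * cosh (t/2)"
    using cosh_double[of "t/2"] sinh_double[of "t/2"] by auto
  have "z * cnj z = 1" unfolding z_def by (simp add: cis_cnj cis_mult)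
  moreover have "2 * complex_of_real (cos \<theta>) = z + cnj z" unfolding z_def by (simp add: complex_eq_iff)
  ultimately have zz: "z * (2 * complex_of_real (cos \<theta>)) = z * z + 1" by (simp add: distrib_left)
  have "z * complex_of_real (boost_weight t \<theta>) = z * (?c\<^sup>2 + ?s\<^sup>2) + ?s * ?c * (z * (2 * complex_of_real (cos \<theta>)))"
    unfolding boost_weight_def t of_real_add of_real_mult of_real_power of_real_numeral by (simp only: distrib_left mult_ac)
  also have "\<dots> = A * D"
    unfolding zz A_def D_def by (simp add: algebra_simps power2_eq_square)
  finally have "z * complex_of_real (boost_weight t \<theta>) = A * D" .
  then have Y: "complex_of_real (boost_weight t \<theta>) = A * D / z" using z by (simp add: field_simps)
  have "moebius_beta d (boost t) (mode 1) (circle_cis \<theta>) = (A * D / z) powi (int d - 1) * (A / D)"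
    by (simp add: moebius_beta_boost mode_def lift Y)
  also have "\<dots> = z powi (- (int d - 1)) * (A powi (int d - 1) * A) * (D powi (int d - 1) * inverse D)"
    by (simp only: power_int_divide_distrib power_int_mult_distrib power_int_minus power_int_inverse divide_inverse mult_ac)
  also have "A powi (int d - 1) * A = A powi int d"
    using nz by (simp add: power_int_diff)
  also have "D powi (int d - 1) * inverse D = D powi (int d - 2)"
    using nz by (simp add: power_int_diff field_simps power2_eq_square)
  finally show ?thesis by (simp add: A_def D_def z_def)
qed

lemma infinite_unit_circle: "infinite (sphere (0::complex) 1)"
proof
  assume "finite (sphere (0::complex) 1)"
  moreover have "connected (sphere (0::complex) 1)" by (rule connected_sphere) simp
  ultimately obtain a where "sphere (0::complex) 1 \<subseteq> {a}" using connected_finite_iff_sing by fastforce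
  moreover have "1 \<in> sphere (0::complex) 1" "-1 \<in> sphere (0::complex) 1" by auto
  ultimately have "(1::complex) = -1" by blast
  then show False by simp
qed

text \<open>Serves to show that no coefficient of (s + c w)^d (c + s w)^(d-2) vanishes. Being
  non-zero is not stable under products of polynomials, whereas positivity of all coefficients
  is.\<close>

definition pos_coeffs :: "nat \<Rightarrow> complex poly \<Rightarrow> bool" where
  "pos_coeffs n p \<longleftrightarrow> degree p \<le> n \<and> (\<forall>m\<le>n. Re (coeff p m) > 0) \<and> (\<forall>m. Im (coeff p m) = 0)"

lemma pos_coeffs_linear_mult:
  assumes p: "pos_coeffs n p" and ab: "a > 0" "b > 0"
  shows "pos_coeffs (Suc n) ([:complex_of_real a, complex_of_real b:] * p)"
  unfolding pos_coeffs_def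
proof (intro conjI allI impI)
  let ?l = "[:complex_of_real a, complex_of_real b:]"
  have nn: "0 \<le> Re (coeff p k)" for k
    using p coeff_eq_0[of p k] unfolding pos_coeffs_def by (cases "k \<le> n") (auto intro: less_imp_le)
  have c: "coeff (?l * p) m = complex_of_real a * coeff p m + (case m of 0 \<Rightarrow> 0 | Suc k \<Rightarrow> complex_of_real b * coeff p k)" for m
    by (simp add: coeff_pCons split: nat.splits)
  have "degree (?l * p) \<le> degree ?l + degree p" by (rule degree_mult_le)
  also have "\<dots> \<le> 1 + n" using p by (intro add_mono) (auto simp: pos_coeffs_def)
  finally show "degree (?l * p) \<le> Suc n" by simp
  show "0 < Re (coeff (?l * p) m)" if "m \<le> Suc n" for m
  proof (cases m)
    case 0
    then show ?thesis unfolding c using p ab by (simp add: pos_coeffs_def)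
  next
    case (Suc k)
    then have "b * Re (coeff p k) > 0" using p ab that by (simp add: pos_coeffs_def)
    moreover have "a * Re (coeff p m) \<ge> 0" using nn ab by simp
    ultimately show ?thesis unfolding c using Suc by simp
  qed
  show "Im (coeff (?l * p) m) = 0" for m
    unfolding c using p by (cases m) (simp_all add: pos_coeffs_def)
qed

lemma pos_coeffs_linear_power:
  assumes "pos_coeffs n p" "a > 0" "b > 0"
  shows "pos_coeffs (k + n) ([:complex_of_real a, complex_of_real b:] ^ k * p)"
proof (induction k)
  case 0
  then show ?case using assms by simp
next
  case (Suc k)
  from pos_coeffs_linear_mult[OF this assms(2,3)] show ?case
    by (simp only: power_Suc mult.assoc add_Suc)
qed

text \<open>Boosting \<open>\<phi>(z)\<Omega> = 0\<close> produces a combination of the modes in question with non-zero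
  coefficients, and the rotations separate the modes.\<close>

lemma vacuum_mode:
  assumes \<phi>: "\<phi> \<in> F" and d: "conformal_dimension U \<phi> d" and n: "n \<ge> 1 - int d"
  shows "\<phi> (mode n) \<Omega> = 0"
proof (cases "n > 0")
  case True
  then show ?thesis by (rule vacuum_positive_mode[OF \<phi>])
next
  case False
  define c s where "c = cosh (1/2::real)" and "s = sinh (1/2::real)"
  have cs: "0 < s" "s < c" "0 < c" unfolding c_def s_def using sinh_less_cosh_real by auto
  have zero: "\<phi> (moebius_beta d (boost 1) (mode 1)) \<Omega> = 0"
    using U_boost_covariant[OF d mode_smooth[of 1], of 1 \<Omega>] vacuum_positive_mode[OF \<phi>, of 1]
    by (simp add: vacuum_invariant[OF boost_Mob] linear_zero[OF U_linear[OF boost_Mob]])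
  have beta: "moebius_beta d (boost 1) (mode 1) z = mode (1 - int d) z * (complex_of_real c * of_circle z + complex_of_real s) powi int d *
      (complex_of_real s * of_circle z + complex_of_real c) powi (int d - 2)" for z
    using boost_mode_one[of d 1 "Arg (of_circle z)"] of_circle_cis[of "Arg (of_circle z)"]
    unfolding circle_cis_Arg by (simp add: c_def s_def mode_def)
  show ?thesis
  \<comment> \<open>The exponent d - 2 is negative for d = 1, so a power series is used there: the
    positive modes vanish already, and only the constant coefficient s/c remains. The value d = 0
    does not occur in this branch, as it would force n > 0.\<close>
  proof (cases "d = 1")
    case True
    then have n0: "n = 0" using n False by simp
    let ?P = "\<lambda>w. (complex_of_real c * w + complex_of_real s) / (complex_of_real s * w + complex_of_real c)"
    have P: "?P holomorphic_on ball 0 (c / s)"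
    proof (intro holomorphic_intros)
      fix w assume "w \<in> ball (0::complex) (c / s)"
      then have "s * cmod w < c" using cs by (simp add: field_simps)
      then have "cmod (complex_of_real s * w) < cmod (complex_of_real c)" using cs by (simp add: norm_mult)
      then show "complex_of_real s * w + complex_of_real c \<noteq> 0"
        by (metis add_eq_0_iff less_irrefl norm_minus_cancel)
    qed
    have "l (\<phi> (mode 0) \<Omega>) = l 0" if l: "l \<in> compatible_dual scaleC F" for l
    proof -
      have "l (\<phi> (\<lambda>z. mode 0 z * ?P (of_circle z)) \<Omega>) =
          (\<Sum>j<1. (deriv ^^ j) ?P 0 / fact j * l (\<phi> (mode (0 + int j)) \<Omega>))"
        by (rule vacuum_power_series[OF \<phi> P _ _ l]) (use cs vacuum_positive_mode[OF \<phi>] in auto)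
      moreover have "(\<lambda>z. mode 0 z * ?P (of_circle z)) = moebius_beta d (boost 1) (mode 1)"
        by (rule ext, subst beta) (simp add: True power_int_minus divide_inverse)
      ultimately have "s / c * l (\<phi> (mode 0) \<Omega>) = 0"
        using zero linear_zero[OF dual_linear[OF l]] by simp
      then show ?thesis using cs linear_zero[OF dual_linear[OF l]] by simp
    qed
    then show ?thesis unfolding n0 by (rule dual_separates[where \<Psi> = 0])
  next
    case d1: False
    then have d2: "d \<ge> 2" using n False by simp
    define q where "q = [:complex_of_real s, complex_of_real c:] ^ d *
      ([:complex_of_real c, complex_of_real s:] ^ (d - 2) * 1)"
    define M where "M = d + ((d - 2) + 0)"
    have "pos_coeffs 0 1" by (simp add: pos_coeffs_def)
    then have q: "pos_coeffs M q"
      unfolding q_def M_def using cs by (intro pos_coeffs_linear_power) auto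
    have pq: "poly q w = (complex_of_real c * w + complex_of_real s) ^ d * (complex_of_real s * w + complex_of_real c) ^ (d - 2)" for w
      unfolding q_def by (simp add: algebra_simps)
    have pq': "poly q w = (\<Sum>m\<le>M. coeff q m * w ^ m)" for w
      unfolding poly_altdef
      by (rule sum.mono_neutral_left) (use q in \<open>auto simp: pos_coeffs_def coeff_eq_0\<close>)
    have beta': "moebius_beta d (boost 1) (mode 1) = (\<lambda>z. \<Sum>m\<le>M. coeff q m * mode (1 - int d + int m) z)"
    proof
      fix z
      have "int d - 2 = int (d - 2)" using d2 by simp
      then have "moebius_beta d (boost 1) (mode 1) z = mode (1 - int d) z * poly q (of_circle z)"
        unfolding beta pq by (simp only: power_int_of_nat mult.assoc)
      then show "moebius_beta d (boost 1) (mode 1) z = (\<Sum>m\<le>M. coeff q m * mode (1 - int d + int m) z)"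
        unfolding pq' by (simp add: mode_add sum_distrib_left mult_ac)
    qed
    let ?v = "\<lambda>m. \<phi> (mode (1 - int d + int m)) \<Omega>"
    have sum0: "(\<Sum>m\<le>M. scaleC (coeff q m) (?v m)) = 0"
      using zero field_sum[OF \<phi>, of "{..M}" "\<lambda>m. mode (1 - int d + int m)" "coeff q"] mode_smooth
      unfolding beta' by simp
    have "l (?v m) = l 0" if l: "l \<in> compatible_dual scaleC F" and m: "m \<le> M" for l m
    proof -
      note ls = linear_scale[OF dual_linear[OF l]]
      \<comment> \<open>A rotation multiplies the m-th term of the vanishing sum by w^m, up to a
        common phase. The polynomial \<open>R\<close> therefore vanishes on the whole unit circle
        and is zero.\<close>
      define R where "R = (\<Sum>m\<le>M. monom (coeff q m * l (?v m)) m)"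
      have "poly R w = 0" if w: "cmod w = 1" for w
      proof -
        define \<theta> where "\<theta> = - Arg w"
        have "w \<noteq> 0" using w by auto
        then have w\<theta>: "w = cis (- \<theta>)" unfolding \<theta>_def using w by (simp add: cis_Arg sgn_div_norm)
        have "0 = U (rotation \<theta>) (\<Sum>m\<le>M. scaleC (coeff q m) (?v m))"
          unfolding sum0 by (simp add: linear_zero[OF U_linear[OF rotation_Mob]])
        also have "\<dots> = (\<Sum>m\<le>M. scaleC (coeff q m) (U (rotation \<theta>) (?v m)))"
          using U_linear[OF rotation_Mob, of \<theta>]
          by (simp add: linear_iff_module_hom module_hom.sum module_hom.scale)
        finally have "0 = (\<Sum>m\<le>M. scaleC (coeff q m) (scaleC (cis (- (of_int (1 - int d + int m) * \<theta>))) (?v m)))"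
          by (simp only: U_rotation_mode[OF d \<phi>])
        then have "0 = (\<Sum>m\<le>M. coeff q m * (cis (- (of_int (1 - int d + int m) * \<theta>)) * l (?v m)))"
          using linear_zero[OF dual_linear[OF l]] by (metis (no_types, lifting) dual_sum[OF l] ls sum.cong)
        also have "\<dots> = cis (- (of_int (1 - int d) * \<theta>)) * (\<Sum>m\<le>M. coeff q m * l (?v m) * w ^ m)"
          unfolding sum_distrib_left
        proof (rule sum.cong[OF refl])
          fix m
          have "cis (- (of_int (1 - int d + int m) * \<theta>)) = cis (- (of_int (1 - int d) * \<theta>)) * w ^ m"
            unfolding w\<theta> Complex.DeMoivre cis_mult by (rule arg_cong[of _ _ cis]) (simp add: algebra_simps)
          then show "coeff q m * (cis (- (of_int (1 - int d + int m) * \<theta>)) * l (?v m)) =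
            cis (- (of_int (1 - int d) * \<theta>)) * (coeff q m * l (?v m) * w ^ m)"
            by (simp only: mult_ac)
        qed
        finally show ?thesis unfolding R_def by (simp add: poly_sum poly_monom)
      qed
      then have "sphere 0 1 \<subseteq> {w. poly R w = 0}" by auto
      then have "R = 0" using infinite_unit_circle poly_roots_finite[of R] finite_subset by blast
      then have "coeff R m = 0" by simp
      moreover have "coeff R m = coeff q m * l (?v m)"
        unfolding R_def coeff_sum using m by (simp add: sum.delta)
      moreover have "coeff q m \<noteq> 0"
      proof -
        have "Re (coeff q m) > 0" using q m by (simp add: pos_coeffs_def)
        then show ?thesis by auto
      qed
      ultimately show ?thesis using linear_zero[OF dual_linear[OF l]] by simp
    qed
    note vm = this
    define m where "m = nat (n + int d - 1)"
    have "m \<le> M" "n = 1 - int d + int m" unfolding m_def M_def using n False d2 by auto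
    then show ?thesis using dual_separates[of "?v m" 0] vm by simp
  qed
qed

end

section \<open>Reflection of analytic test functions\<close>

lemma circle_inverse_circle_cis: "circle_inverse (circle_cis \<theta>) = circle_cis (- \<theta>)"
  by (rule of_circle_eqI) (simp add: circle_inverse.rep_eq)

lemma assumes f: "f \<in> smooth_circle"
  shows smooth_circle_inverse: "(f \<circ> circle_inverse) \<in> smooth_circle"
    and circle_deriv_inverse: "circle_deriv n (f \<circ> circle_inverse) \<theta> = (- 1) ^ n * circle_deriv n f (- \<theta>)"
proof -
  let ?D = "\<lambda>n \<theta>. (- 1) ^ n * circle_deriv n f (- \<theta>)"
  have D0: "?D 0 \<theta> = (f \<circ> circle_inverse) (circle_cis \<theta>)" for \<theta>
    by (simp add: circle_deriv_0 circle_inverse_circle_cis)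
  have D: "(?D n has_vector_derivative ?D (Suc n) \<theta>) (at \<theta>)" for n \<theta>
  proof -
    have "((\<lambda>x::real. - x) has_vector_derivative - 1) (at \<theta>)"
      by (auto intro!: derivative_eq_intros)
    from vector_diff_chain_at[OF this circle_deriv_has_vector_derivative[OF f, of n]]
    have "((\<lambda>\<theta>. circle_deriv n f (- \<theta>)) has_vector_derivative (- 1) * circle_deriv (Suc n) f (- \<theta>)) (at \<theta>)"
      by (simp add: o_def)
    from has_vector_derivative_mult_right[OF this, of "(- 1) ^ n"] show ?thesis by simp
  qed
  show "(f \<circ> circle_inverse) \<in> smooth_circle" by (rule smooth_circleI[of ?D, OF D0 D])
  show "circle_deriv n (f \<circ> circle_inverse) \<theta> = ?D n \<theta>" by (subst circle_deriv_eqI[of ?D, OF D0 D]) simp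
qed

lemma C_norm_inverse_le:
  assumes f: "f \<in> smooth_circle"
  shows "C_norm N (f \<circ> circle_inverse) \<le> C_norm N f"
proof -
  have "C_norm N (f \<circ> circle_inverse) \<le> (\<Sum>j\<le>N. SUP \<theta>. cmod (circle_deriv j f \<theta>))"
    by (rule C_norm_le, subst circle_deriv_inverse[OF f])
      (simp add: norm_mult norm_power circle_deriv_le_SUP[OF f])
  then show ?thesis by (simp add: C_norm_def)
qed

lemma boost_lift_minus: "boost_lift t (- \<theta>) = - boost_lift t \<theta>"
  by (simp add: boost_lift_def arctan_minus)

text \<open>Boosts commute with complex conjugation: the lift is odd in \<theta> and the weight is
  even.\<close>

lemma moebius_beta_boost_inverse:
  "moebius_beta d (boost t) (f \<circ> circle_inverse) = moebius_beta d (boost t) f \<circ> circle_inverse"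
proof
  fix z
  obtain \<theta> where z: "z = circle_cis \<theta>" by (metis circle_cis_Arg)
  show "moebius_beta d (boost t) (f \<circ> circle_inverse) z = (moebius_beta d (boost t) f \<circ> circle_inverse) z"
    unfolding z o_apply circle_inverse_circle_cis moebius_beta_boost boost_lift_minus
    by (simp add: boost_weight_def)
qed

text \<open>The boundary value on both half circles of one function that is holomorphic in the disk
  up to the factor z^(1-d). \<open>arc_bump\<close> is its upper part alone.\<close>

definition full_bump :: "nat \<Rightarrow> (complex \<Rightarrow> complex) \<Rightarrow> circle \<Rightarrow> complex" where
  "full_bump d h z = (if Im (of_circle z) \<noteq> 0 then arc_hol d h (of_real (Arg (of_circle z))) else 0)"

text \<open>The right-hand side depends on \<theta> only through \<open>cis \<theta>\<close>; thus
  \<open>arc_hol\<close> descends to the circles of radius exp(-s), whatever branch of the angle is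
  taken.\<close>

lemma arc_hol_of_real:
  "arc_hol d h (of_real \<theta> + \<i> * of_real s) = (let w = of_real (exp (- s)) * cis \<theta> in
     ((w - inverse w) / (2 * \<i>)) powi (int d - 1) * h (Ln ((1 - w) / (1 + w)) + \<i> * (pi / 2)))"
proof -
  have "exp (\<i> * (complex_of_real \<theta> + \<i> * complex_of_real s)) = of_real (exp (- s)) * cis \<theta>"
    by (simp add: distrib_left exp_add[symmetric] cis_conv_exp exp_of_real[symmetric] exp_diff exp_minus field_simps)
  then show ?thesis
    unfolding arc_hol_def log_coord_def sin_exp_eq by (simp add: Let_def exp_minus)
qed

lemma arc_hol_cong: "cis \<theta> = cis \<theta>' \<Longrightarrow> arc_hol d h (of_real \<theta>) = arc_hol d h (of_real \<theta>')"
  using arc_hol_of_real[of d h \<theta> 0] arc_hol_of_real[of d h \<theta>' 0] by simp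

lemma full_bump_circle_cis:
  "full_bump d h (circle_cis \<theta>) = (if sin \<theta> \<noteq> 0 then arc_hol d h (of_real \<theta>) else 0)"
proof -
  have "cis (Arg (cis \<theta>)) = cis \<theta>" by (simp add: cis_Arg sgn_div_norm)
  then show ?thesis unfolding full_bump_def by (auto intro: arc_hol_cong)
qed

lemma assumes h: "h holomorphic_on log_strip"
    and B: "\<And>m. \<exists>B. \<forall>\<xi>\<in>log_strip. cmod (h \<xi>) \<le> B * exp (- (real m * \<bar>Re \<xi>\<bar>))"
  shows full_bump_smooth: "full_bump d h \<in> smooth_circle"
    and circle_deriv_full_bump: "circle_deriv n (full_bump d h) \<theta> =
      (if sin \<theta> \<noteq> 0 then (deriv ^^ n) (arc_hol d h) (of_real \<theta>) else 0)"
proof -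
  let ?S = "{\<theta>::real. sin \<theta> \<noteq> 0}" and ?D = "\<lambda>n \<theta>. (deriv ^^ n) (arc_hol d h) (of_real \<theta>)"
  have 0: "open ?S" by (intro open_Collect_neq continuous_intros)
  have 1: "full_bump d h (circle_cis \<theta>) = (if \<theta> \<in> ?S then ?D 0 \<theta> else 0)" for \<theta>
    by (simp add: full_bump_circle_cis)
  have 2: "(?D n has_vector_derivative ?D (Suc n) \<theta>) (at \<theta>)" if "\<theta> \<in> ?S" for n \<theta>
    using higher_deriv_has_vector_derivative[OF arc_hol_holomorphic[where d = d, OF h] open_arc_dom, where \<theta> = \<theta> and c = 0 and n = n]
      that of_real_arc_dom by simp
  have 3: "\<exists>K. \<forall>\<theta>\<in>?S. cmod (?D n \<theta>) \<le> K * (sin \<theta>)\<^sup>2" for n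
  proof -
    obtain K where K: "\<And>\<zeta>. \<zeta> \<in> arc_dom \<Longrightarrow> 0 \<le> Im \<zeta> \<Longrightarrow> Im \<zeta> \<le> 1 \<Longrightarrow>
        cmod ((deriv ^^ n) (arc_hol d h) \<zeta>) \<le> K * (cmod (sin \<zeta>))\<^sup>2"
      using arc_hol_deriv_flat[OF h B, of n d] by blast
    show ?thesis
    proof (intro exI ballI)
      fix \<theta> :: real assume "\<theta> \<in> ?S"
      then show "cmod (?D n \<theta>) \<le> K * (sin \<theta>)\<^sup>2"
        using K[of "of_real \<theta>"] of_real_arc_dom[of \<theta>] by (simp add: sin_of_real)
    qed
  qed
  have 4: "sin \<theta> = 0 \<or> (\<forall>\<^sub>F x in nhds \<theta>. x \<notin> ?S)" if "\<theta> \<notin> ?S" for \<theta>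
    using that by simp
  note flat_ext = flat_extension[of ?S _ ?D, OF 0 4 1 2 3, simplified]
  show "full_bump d h \<in> smooth_circle" by (rule flat_ext)
  show "circle_deriv n (full_bump d h) \<theta> = (if sin \<theta> \<noteq> 0 then ?D n \<theta> else 0)"
    using flat_ext(2)[of n \<theta>] by simp
qed

lemma minus_one_powi: "(- 1) powi (int d - 1) = (- 1 :: complex) ^ Suc d"
  by (cases d) (simp_all add: power_int_minus)

text \<open>On the lower half circle sin(\<theta>) = - sin(-\<theta>) contributes (-1)^(d-1), and
  the coordinate at \<theta> is the one at -\<theta> plus i\<pi>.\<close>

lemma full_bump_eq:
  "full_bump d h z = arc_bump d h z +
    (- 1) ^ Suc d * arc_bump d (\<lambda>\<xi>. h (\<xi> + \<i> * pi)) (circle_inverse z)"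
proof -
  obtain \<theta> where z: "z = circle_cis \<theta>" by (metis circle_cis_Arg)
  show ?thesis
  proof (cases "sin \<theta> < 0")
    case False
    then show ?thesis unfolding z circle_inverse_circle_cis
      by (auto simp: full_bump_circle_cis arc_bump_circle_cis)
  next
    case True
    have "complex_of_real (sin \<theta>) powi (int d - 1) = ((- 1) * complex_of_real (- sin \<theta>)) powi (int d - 1)"
      by simp
    also have "\<dots> = (- 1) powi (int d - 1) * complex_of_real (- sin \<theta>) powi (int d - 1)"
      by (rule power_int_mult_distrib)
    finally have "complex_of_real (sin \<theta>) powi (int d - 1) = (- 1) ^ Suc d * complex_of_real (- sin \<theta>) powi (int d - 1)"
      unfolding minus_one_powi .
    moreover have "log_coord (of_real \<theta>) = log_coord (of_real (- \<theta>)) + \<i> * pi"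
      using True by (subst log_coord_of_real_neg, simp, subst log_coord_of_real) auto
    moreover have "sin (complex_of_real (- \<theta>)) = complex_of_real (- sin \<theta>)"
      by (simp only: sin_of_real sin_minus)
    ultimately show ?thesis unfolding z circle_inverse_circle_cis using True
      by (simp add: full_bump_circle_cis arc_bump_circle_cis arc_hol_def sin_of_real del: of_real_minus)
  qed
qed

lemma disc_ratio:
  assumes "cmod w < 1"
  shows "1 + w \<noteq> 0" "(1 - w) / (1 + w) \<notin> \<real>\<^sub>\<le>\<^sub>0" "Ln ((1 - w) / (1 + w)) + \<i> * (pi / 2) \<in> log_strip"
proof -
  have "1 + w \<noteq> 0 \<and> (1 - w) / (1 + w) \<notin> \<real>\<^sub>\<le>\<^sub>0 \<and> Ln ((1 - w) / (1 + w)) + \<i> * (pi / 2) \<in> log_strip"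
  proof (cases "w = 0")
    case True
    then show ?thesis using pi_gt_zero by (simp add: log_strip_def)
  next
    case False
    define \<zeta> where "\<zeta> = - \<i> * Ln w"
    have w: "exp (\<i> * \<zeta>) = w" using False by (simp add: \<zeta>_def exp_Ln)
    have "Im \<zeta> > 0" unfolding \<zeta>_def using False assms by simp
    then have "\<zeta> \<in> arc_dom" by (simp add: arc_dom_def)
    then show ?thesis using arc_dom_ratio[of \<zeta>] log_coord_in_strip[of \<zeta>] by (simp add: w log_coord_def)
  qed
  then show "1 + w \<noteq> 0" "(1 - w) / (1 + w) \<notin> \<real>\<^sub>\<le>\<^sub>0" "Ln ((1 - w) / (1 + w)) + \<i> * (pi / 2) \<in> log_strip"
    by auto
qed

text \<open>For w = exp(i\<zeta>) one has sin \<zeta> = (w^2 - 1)/(2 i w); splitting off w^(1-d)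
  leaves this function, which is holomorphic at w = 0 as well.\<close>

definition disc_hol :: "nat \<Rightarrow> (complex \<Rightarrow> complex) \<Rightarrow> complex \<Rightarrow> complex" where
  "disc_hol d h w = ((w * w - 1) / (2 * \<i>)) powi (int d - 1) * h (Ln ((1 - w) / (1 + w)) + \<i> * (pi / 2))"

lemma disc_hol_holomorphic:
  assumes h: "h holomorphic_on log_strip"
  shows "disc_hol d h holomorphic_on ball 0 1"
proof -
  have nz: "w * w \<noteq> 1" if "cmod w < 1" for w :: complex
  proof
    assume "w * w = 1"
    then have "cmod (w * w) = 1" by simp
    then show False using that mult_strict_mono[of "cmod w" 1 "cmod w" 1] by (simp add: norm_mult)
  qed
  have "(h \<circ> (\<lambda>w. Ln ((1 - w) / (1 + w)) + \<i> * (pi / 2))) holomorphic_on ball 0 1"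
    by (rule holomorphic_on_compose_gen[OF _ h]) (use disc_ratio in \<open>auto intro!: holomorphic_intros\<close>)
  then show ?thesis
    unfolding disc_hol_def[abs_def] by (auto simp: o_def nz intro!: holomorphic_intros)
qed

lemma arc_hol_disc_hol:
  assumes "s > 0"
  shows "arc_hol d h (of_real \<theta> + \<i> * of_real s) =
    of_real (exp (- s)) powi (1 - int d) * (cis \<theta> powi (1 - int d) * disc_hol d h (of_real (exp (- s)) * cis \<theta>))"
proof -
  define w where "w = of_real (exp (- s)) * cis \<theta>"
  have w: "w \<noteq> 0" by (simp add: w_def)
  have "(w - inverse w) / (2 * \<i>) = ((w * w - 1) / (2 * \<i>)) * inverse w"
    using w by (simp add: field_simps)
  then have "((w - inverse w) / (2 * \<i>)) powi (int d - 1) =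
      ((w * w - 1) / (2 * \<i>)) powi (int d - 1) * w powi (- (int d - 1))"
    by (simp only: power_int_mult_distrib power_int_inverse power_int_minus)
  moreover have "w powi (- (int d - 1)) = of_real (exp (- s)) powi (1 - int d) * cis \<theta> powi (1 - int d)"
    by (simp add: w_def power_int_mult_distrib)
  ultimately show ?thesis
    unfolding arc_hol_of_real Let_def w_def[symmetric] disc_hol_def by (simp add: mult_ac)
qed

section \<open>Boundary values of holomorphic functions annihilate the vacuum\<close>

context wightman_CFT
begin

text \<open>On the circle of radius exp(-s) the function is mode 1 - d times a power series that
  converges beyond the unit circle after rescaling, and all modes from 1 - d on annihilate the
  vacuum. Letting s tend to 0 in every C^N norm reaches the boundary value.\<close>

lemma full_bump_vacuum:
  assumes \<phi>: "\<phi> \<in> F" "conformal_dimension U \<phi> d"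
    and h: "h holomorphic_on log_strip"
    and B: "\<And>m. \<exists>B. \<forall>\<xi>\<in>log_strip. cmod (h \<xi>) \<le> B * exp (- (real m * \<bar>Re \<xi>\<bar>))"
  shows "\<phi> (full_bump d h) \<Omega> = 0"
proof (rule dual_separates)
  fix l assume l: "l \<in> compatible_dual scaleC F"
  let ?p = "arc_hol d h"
  define f where "f s z = ?p (of_real (Arg (of_circle z)) + \<i> * of_real s)" for s z
  have hol: "?p holomorphic_on arc_dom" by (rule arc_hol_holomorphic[OF h])
  have up: "of_real \<theta> + \<i> * of_real s \<in> arc_dom" if "s > 0" for \<theta> s using that by (simp add: arc_dom_def)
  have f: "f s (circle_cis \<theta>) = ?p (of_real \<theta> + \<i> * of_real s)" for s \<theta>
  proof -
    have "cis (Arg (cis \<theta>)) = cis \<theta>" by (simp add: cis_Arg sgn_div_norm)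
    then show ?thesis by (simp add: f_def arc_hol_of_real)
  qed
  have D0: "(deriv ^^ 0) ?p (of_real \<theta> + \<i> * of_real s) = f s (circle_cis \<theta>)" for s \<theta> by (simp add: f)
  have D: "((\<lambda>\<theta>. (deriv ^^ n) ?p (of_real \<theta> + \<i> * of_real s)) has_vector_derivative
      (deriv ^^ Suc n) ?p (of_real \<theta> + \<i> * of_real s)) (at \<theta>)" if "s > 0" for n s \<theta>
    by (rule higher_deriv_has_vector_derivative[OF hol open_arc_dom up[OF that]])
  have fs: "f s \<in> smooth_circle" if "s > 0" for s
    by (rule smooth_circleI[of "\<lambda>n \<theta>. (deriv ^^ n) ?p (of_real \<theta> + \<i> * of_real s)", OF D0 D[OF that]])
  have fd: "circle_deriv n (f s) \<theta> = (deriv ^^ n) ?p (of_real \<theta> + \<i> * of_real s)" if "s > 0" for n s \<theta>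
    by (subst circle_deriv_eqI[of "\<lambda>n \<theta>. (deriv ^^ n) ?p (of_real \<theta> + \<i> * of_real s)", OF D0 D[OF that]]) simp
  have zero: "l (\<phi> (f s) \<Omega>) = 0" if s: "s > 0" for s
  proof -
    let ?e = "complex_of_real (exp (- s))"
    let ?P = "\<lambda>w. disc_hol d h (?e * w)"
    have P: "?P holomorphic_on ball 0 (exp s)"
    proof -
      have "cmod (?e * w) < 1" if "cmod w < exp s" for w
      proof -
        have "exp (- s) * cmod w < exp (- s) * exp s" using that by simp
        then show ?thesis by (simp only: norm_mult norm_of_real abs_exp_cancel exp_add[symmetric] add.left_inverse exp_zero)
      qed
      then have "(disc_hol d h \<circ> (\<lambda>w. ?e * w)) holomorphic_on ball 0 (exp s)"
        by (intro holomorphic_on_compose_gen[OF _ disc_hol_holomorphic[OF h]])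
          (auto intro!: holomorphic_intros simp del: of_real_exp)
      then show ?thesis by (simp add: o_def)
    qed
    have "f s = (\<lambda>z. ?e powi (1 - int d) * (mode (1 - int d) z * ?P (of_circle z)))"
    proof
      fix z
      obtain \<theta> where z: "z = circle_cis \<theta>" by (metis circle_cis_Arg)
      show "f s z = ?e powi (1 - int d) * (mode (1 - int d) z * ?P (of_circle z))"
        unfolding z f arc_hol_disc_hol[OF s] by (simp add: mode_def)
    qed
    moreover have sm: "(\<lambda>z. mode (1 - int d) z * ?P (of_circle z)) \<in> smooth_circle"
    proof -
      define r where "r = exp (s / 2)"
      have r: "1 < r" "r < exp s" unfolding r_def using s by auto
      have "bounded (?P ` cball 0 r)"
        by (intro compact_imp_bounded compact_continuous_image holomorphic_on_imp_continuous_on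
          holomorphic_on_subset[OF P]) (use r in auto)
      then obtain B where "\<forall>x\<in>?P ` cball 0 r. cmod x \<le> B" unfolding bounded_iff by blast
      then have "cmod (?P w) \<le> B" if "cmod w \<le> r" for w using that by simp
      then show ?thesis by (rule mode_times_holomorphic(1)[OF P r])
    qed
    \<comment> \<open>The sum is empty: \<open>J = 0\<close> is admissible because
      \<open>vacuum_mode\<close> covers every mode of the series.\<close>
    moreover have "l (\<phi> (\<lambda>z. mode (1 - int d) z * ?P (of_circle z)) \<Omega>) =
        (\<Sum>j<0. (deriv ^^ j) ?P 0 / fact j * l (\<phi> (mode (1 - int d + int j)) \<Omega>))"
      by (rule vacuum_power_series[OF \<phi>(1) P _ _ l]) (use s vacuum_mode[OF \<phi>] in auto)
    ultimately show ?thesis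
      using field_cmult[OF \<phi>(1) sm] linear_scale[OF dual_linear[OF l]] by simp
  qed
  have lim: "((\<lambda>s. l (field_product (\<lambda>_. \<phi>) (\<lambda>_. f s) [0..<1] \<Omega>)) \<longlongrightarrow>
      l (field_product (\<lambda>_. \<phi>) (\<lambda>_. full_bump d h) [0..<1] \<Omega>)) (at_right 0)"
  proof (rule dual_field_product_tendsto[OF l \<phi>(1)])
    show full: "full_bump d h \<in> smooth_circle" by (rule full_bump_smooth[OF h B])
    show "\<forall>\<^sub>F s in at_right 0. f s \<in> smooth_circle"
      using eventually_at_right_less[of 0] by eventually_elim (rule fs)
    fix N
    have "\<exists>K\<ge>0. \<forall>\<zeta>\<in>arc_dom. 0 \<le> Im \<zeta> \<and> Im \<zeta> \<le> 1 \<longrightarrow> cmod ((deriv ^^ n) ?p \<zeta>) \<le> K * (cmod (sin \<zeta>))\<^sup>2" for n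
      by (rule arc_hol_deriv_flat[OF h B])
    then obtain K where K: "\<And>n. K n \<ge> 0" "\<And>n \<zeta>. \<zeta> \<in> arc_dom \<Longrightarrow> 0 \<le> Im \<zeta> \<Longrightarrow> Im \<zeta> \<le> 1 \<Longrightarrow>
        cmod ((deriv ^^ n) ?p \<zeta>) \<le> K n * (cmod (sin \<zeta>))\<^sup>2" by metis
    have sin5: "(cmod (sin \<zeta>))\<^sup>2 \<le> 25" if "0 \<le> Im \<zeta>" "Im \<zeta> \<le> 1" for \<zeta>
      using power_mono[OF norm_sin_le_5[of \<zeta>], of 2] that by simp
    have bd: "C_norm N (\<lambda>z. f s z - full_bump d h z) \<le> (\<Sum>n\<le>N. 25 * (K n + K (Suc n))) * s" if s: "0 < s" "s < 1" for s
    proof -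
      have "C_norm N (\<lambda>z. f s z - full_bump d h z) \<le> (\<Sum>n\<le>N. 25 * (K n + K (Suc n)) * s)"
      proof (rule C_norm_le, subst circle_deriv_diff[OF fs[OF s(1)] full], subst fd[OF s(1)], subst circle_deriv_full_bump[OF h B])
        fix n \<theta>
        let ?w = "complex_of_real \<theta> + \<i> * complex_of_real s"
        show "cmod ((deriv ^^ n) ?p ?w - (if sin \<theta> \<noteq> 0 then (deriv ^^ n) ?p (of_real \<theta>) else 0)) \<le> 25 * (K n + K (Suc n)) * s"
        proof (cases "sin \<theta> = 0")
          case True
          \<comment> \<open>At the points 1 and -1 the lower end of the vertical segment lies
            outside \<open>arc_dom\<close>, so the mean value bound is replaced by flatness: the
            limit is 0 and |sin ?w|^2 \<le> (5s)^2 \<le> 25 s for s < 1.\<close>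
          have "cmod (sin ?w - sin (of_real \<theta>)) \<le> 5 * cmod (?w - of_real \<theta>)"
            by (rule sin_diff_le) (use s in auto)
          then have "cmod (sin ?w) \<le> 5 * s" using True s by (simp add: sin_of_real norm_mult)
          then have "(cmod (sin ?w))\<^sup>2 \<le> (5 * s)\<^sup>2" by (intro power_mono) auto
          also have "\<dots> \<le> 25 * s" using s by (simp add: power2_eq_square)
          finally have sq: "(cmod (sin ?w))\<^sup>2 \<le> 25 * s" .
          have "cmod ((deriv ^^ n) ?p ?w) \<le> K n * (cmod (sin ?w))\<^sup>2"
            by (rule K(2)[OF up[OF s(1)]]) (use s in auto)
          also have "\<dots> \<le> K n * (25 * s)" by (rule mult_left_mono[OF sq K(1)])
          also have "\<dots> \<le> 25 * (K n + K (Suc n)) * s"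
            using K(1)[of "Suc n"] s by (simp add: algebra_simps)
          finally show ?thesis using True by simp
        next
          case False
          let ?S = "closed_segment (of_real \<theta>) ?w"
          have S: "x \<in> arc_dom \<and> 0 \<le> Im x \<and> Im x \<le> 1" if x: "x \<in> ?S" for x
          proof -
            obtain u where u: "0 \<le> u" "u \<le> 1" and "x = (1 - u) *\<^sub>R complex_of_real \<theta> + u *\<^sub>R ?w"
              using x by (auto simp: in_segment)
            then have "Re x = \<theta>" "Im x = u * s" by (auto simp: algebra_simps)
            then show ?thesis using False u s mult_mono[of u 1 s 1] by (auto simp: arc_dom_def)
          qed
          have "cmod ((deriv ^^ n) ?p ?w - (deriv ^^ n) ?p (of_real \<theta>)) \<le> (K (Suc n) * 25) * cmod (?w - of_real \<theta>)"
          proof (rule field_differentiable_bound[of ?S])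
            fix x assume x: "x \<in> ?S"
            have "((deriv ^^ n) ?p has_field_derivative (deriv ^^ Suc n) ?p x) (at x)"
              using holomorphic_derivI[OF holomorphic_higher_deriv[OF hol open_arc_dom] open_arc_dom] S[OF x] by simp
            then show "((deriv ^^ n) ?p has_field_derivative (deriv ^^ Suc n) ?p x) (at x within ?S)"
              by (rule has_field_derivative_at_within)
            have "cmod ((deriv ^^ Suc n) ?p x) \<le> K (Suc n) * (cmod (sin x))\<^sup>2"
              by (rule K(2)) (use S[OF x] in auto)
            also have "\<dots> \<le> K (Suc n) * 25" by (intro mult_left_mono sin5 K) (use S[OF x] in auto)
            finally show "cmod ((deriv ^^ Suc n) ?p x) \<le> K (Suc n) * 25" .
          qed auto
          also have "\<dots> = 25 * K (Suc n) * s" using s by (simp add: norm_mult)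
          also have "\<dots> \<le> 25 * (K n + K (Suc n)) * s" using K(1)[of n] s by (simp add: algebra_simps)
          finally show ?thesis using False by simp
        qed
      qed
      then show ?thesis by (simp add: sum_distrib_right)
    qed
    have lim0: "((\<lambda>s. (\<Sum>n\<le>N. 25 * (K n + K (Suc n))) * s) \<longlongrightarrow> 0) (at_right 0)"
      by (auto intro!: tendsto_eq_intros)
    have ev: "\<forall>\<^sub>F s in at_right (0::real). 0 < s \<and> s < 1"
      unfolding eventually_at_right_field by (intro exI[of _ 1]) auto
    show "((\<lambda>s. C_norm N (\<lambda>z. f s z - full_bump d h z)) \<longlongrightarrow> 0) (at_right 0)"
    proof (rule tendsto_sandwich[OF _ _ tendsto_const lim0])
      show "\<forall>\<^sub>F s in at_right 0. 0 \<le> C_norm N (\<lambda>z. f s z - full_bump d h z)"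
        using ev by eventually_elim (auto intro!: C_norm_nonneg smooth_circle_diff fs full)
      show "\<forall>\<^sub>F s in at_right 0. C_norm N (\<lambda>z. f s z - full_bump d h z) \<le> (\<Sum>n\<le>N. 25 * (K n + K (Suc n))) * s"
        using ev by eventually_elim (elim conjE, rule bd)
    qed
  qed
  have "((\<lambda>s. l (field_product (\<lambda>_. \<phi>) (\<lambda>_. f s) [0..<1] \<Omega>)) \<longlongrightarrow> 0) (at_right 0)"
  proof (rule tendsto_eventually)
    show "\<forall>\<^sub>F s in at_right 0. l (field_product (\<lambda>_. \<phi>) (\<lambda>_. f s) [0..<1] \<Omega>) = 0"
      using eventually_at_right_less[of 0] by eventually_elim (simp add: zero)
  qed
  from tendsto_unique[OF _ lim this] show "l (\<phi> (full_bump d h) \<Omega>) = l 0"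
    using linear_zero[OF dual_linear[OF l]] by simp
qed

text \<open>For the profile translated by i\<pi> + t the i\<pi> gained on the lower half circle
  cancels the translation, so the lower part of the boundary value is the reflected real translate.
  The vanishing of the sum on the vacuum is the claim.\<close>

lemma nice_vacuum_reflection:
  assumes \<phi>: "\<phi> \<in> F" "conformal_dimension U \<phi> d"
  shows "\<phi> (nice d q (\<i> * pi + of_real t)) \<Omega> = scaleC ((- 1) ^ d) (\<phi> (nice d q (of_real t) \<circ> circle_inverse) \<Omega>)"
proof -
  have \<tau>: "\<i> * pi + of_real t \<in> tau_strip" "complex_of_real t \<in> tau_strip"
    using pi_gt_zero by (simp_all add: tau_strip_def)
  define h where "h = (\<lambda>\<xi>. profile q (\<xi> - (\<i> * pi + of_real t)))"
  have h: "h holomorphic_on log_strip"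
    unfolding h_def by (rule rapid_shift_holomorphic[OF rapid_profile_7 \<tau>(1)])
  have B: "\<exists>B. \<forall>\<xi>\<in>log_strip. cmod (h \<xi>) \<le> B * exp (- (real m * \<bar>Re \<xi>\<bar>))" for m
    unfolding h_def by (rule rapid_shift_rapid[OF rapid_profile_7 \<tau>(1)])
  let ?f = "nice d q (\<i> * pi + of_real t)" and ?g = "nice d q (of_real t) \<circ> circle_inverse"
  have f: "?f \<in> smooth_circle" and g: "?g \<in> smooth_circle"
    by (intro nice_smooth smooth_circle_inverse \<tau>)+
  have "full_bump d h = (\<lambda>z. ?f z + (- 1) ^ Suc d * ?g z)"
    unfolding full_bump_eq[abs_def] nice_def by (simp add: h_def)
  then have "0 = \<phi> (\<lambda>z. ?f z + (- 1) ^ Suc d * ?g z) \<Omega>"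
    using full_bump_vacuum[OF \<phi> h B] by (simp only:)
  also have "\<dots> = \<phi> ?f \<Omega> + \<phi> (\<lambda>z. (- 1) ^ Suc d * ?g z) \<Omega>"
    by (rule field_add[OF \<phi>(1) f smooth_circle_cmult[OF g]])
  also have "\<phi> (\<lambda>z. (- 1) ^ Suc d * ?g z) \<Omega> = scaleC ((- 1) ^ Suc d) (\<phi> ?g \<Omega>)"
    by (rule field_cmult[OF \<phi>(1) g])
  also have "\<dots> = - scaleC ((- 1) ^ d) (\<phi> ?g \<Omega>)" by simp
  finally show ?thesis by simp
qed

end

section \<open>Locality for complementary closed arcs\<close>

lemma circle_deriv_Lipschitz:
  assumes f: "f \<in> smooth_circle"
  shows "cmod (circle_deriv n f x - circle_deriv n f y) \<le> C_norm (Suc n) f * \<bar>x - y\<bar>"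
proof -
  have "norm (circle_deriv n f x - circle_deriv n f y) \<le> C_norm (Suc n) f * norm (x - y)"
  proof (rule differentiable_bound[of UNIV])
    show "(circle_deriv n f has_derivative (\<lambda>h. h *\<^sub>R circle_deriv (Suc n) f u)) (at u within UNIV)" for u
      using circle_deriv_has_vector_derivative[OF f] by (simp add: has_vector_derivative_def)
    show "onorm (\<lambda>h::real. h *\<^sub>R circle_deriv (Suc n) f u) \<le> C_norm (Suc n) f" for u
    proof (rule onorm_le)
      show "norm (h *\<^sub>R circle_deriv (Suc n) f u) \<le> C_norm (Suc n) f * norm h" for h :: real
        using mult_left_mono[OF circle_deriv_le_C_norm[OF f, of "Suc n" "Suc n" u], of "\<bar>h\<bar>"]
        by (simp add: mult.commute)
    qed
  qed auto
  then show ?thesis by simp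
qed

lemma circle_deriv_eq_0:
  assumes f: "f \<in> smooth_circle" and z: "\<And>z. Im (of_circle z) < 0 \<Longrightarrow> f z = 0" and \<theta>: "sin \<theta> \<le> 0"
  shows "circle_deriv n f \<theta> = 0"
proof -
  have neg: "circle_deriv n f \<theta> = 0" if "sin \<theta> < 0" for \<theta>
    using that
  proof (induction n arbitrary: \<theta>)
    case 0
    then show ?case by (simp add: circle_deriv_0 z)
  next
    case (Suc n)
    have "open {\<theta>::real. sin \<theta> < 0}" by (intro open_Collect_less continuous_intros)
    then have "((\<lambda>_. 0) has_vector_derivative circle_deriv (Suc n) f \<theta>) (at \<theta>)"
      by (rule has_vector_derivative_transform_within_open[OF circle_deriv_has_vector_derivative[OF f, of n]])
        (use Suc in auto)
    moreover have "((\<lambda>_. 0 :: complex) has_vector_derivative 0) (at \<theta>)" by simp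
    ultimately show ?case by (rule vector_derivative_unique_at)
  qed
  show ?thesis
  proof (cases "sin \<theta> < 0")
    case False
    then have s: "sin \<theta> = 0" using \<theta> by simp
    then have c: "cos \<theta> = 1 \<or> cos \<theta> = -1" using sin_cos_squared_add[of \<theta>] by (simp add: power2_eq_1_iff)
    \<comment> \<open>Subtracting cos(\<theta>) \<epsilon> enters the lower half circle from either
      end point: downwards from angle 0, upwards from angle \<pi>.\<close>
    have "circle_deriv n f (\<theta> - cos \<theta> * \<epsilon>) = 0" if "0 < \<epsilon>" "\<epsilon> < pi" for \<epsilon>
      by (rule neg) (use c s that sin_gt_zero in \<open>auto simp: sin_diff sin_add\<close>)
    then have "\<forall>\<^sub>F \<epsilon> in at_right 0. circle_deriv n f (\<theta> - cos \<theta> * \<epsilon>) = 0"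
      unfolding eventually_at_right_field by (intro exI[of _ pi]) auto
    then have "((\<lambda>\<epsilon>. circle_deriv n f (\<theta> - cos \<theta> * \<epsilon>)) \<longlongrightarrow> 0) (at_right 0)"
      by (rule tendsto_eventually)
    moreover have "((\<lambda>\<epsilon>. circle_deriv n f (\<theta> - cos \<theta> * \<epsilon>)) \<longlongrightarrow> circle_deriv n f (\<theta> - cos \<theta> * 0)) (at_right 0)"
    proof (rule isCont_tendsto_compose[of _ "circle_deriv n f"])
      show "isCont (circle_deriv n f) (\<theta> - cos \<theta> * 0)"
        using has_vector_derivative_continuous[OF circle_deriv_has_vector_derivative[OF f]] by blast
      show "((\<lambda>\<epsilon>. \<theta> - cos \<theta> * \<epsilon>) \<longlongrightarrow> \<theta> - cos \<theta> * 0) (at_right 0)" by (intro tendsto_intros)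
    qed
    ultimately show ?thesis using tendsto_unique[of "at_right (0::real)"] by fastforce
  qed (rule neg)
qed

lemma sin_ge_sin:
  assumes "0 \<le> a" "a \<le> x" "x \<le> pi - a"
  shows "sin a \<le> sin (x::real)"
proof -
  have "cos (pi / 2 - a) \<le> cos \<bar>x - pi / 2\<bar>"
    by (rule cos_monotone_0_pi_le) (use assms in \<open>auto simp: abs_if\<close>)
  then show ?thesis by (simp add: cos_diff)
qed

lemma arccos_upper:
  assumes "sin \<theta> > 0"
  shows "0 < arccos (cos \<theta>)" "arccos (cos \<theta>) < pi" "cis (arccos (cos \<theta>)) = cis \<theta>"
proof -
  have "cos \<theta> \<noteq> 1"
  proof
    assume "cos \<theta> = 1"
    then have "(sin \<theta>)\<^sup>2 = 0" using sin_cos_squared_add[of \<theta>] by simp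
    then show False using assms by simp
  qed
  then have c: "-1 < cos \<theta>" "cos \<theta> < 1" using one_plus_cos_pos[of \<theta>] assms cos_le_one[of \<theta>] by linarith+
  then show "0 < arccos (cos \<theta>)" "arccos (cos \<theta>) < pi" using arccos_lt_bounded by auto
  have "sin (arccos (cos \<theta>)) = sin \<theta>"
    using assms c by (simp add: sin_arccos_abs cos_squared_eq)
  then show "cis (arccos (cos \<theta>)) = cis \<theta>" by (simp add: complex_eq_iff cos_arccos_abs)
qed

text \<open>Squeezing the angle towards \<open>pi / 2\<close> moves the support into the open arc.\<close>

lemma arc_shrink:
  assumes f: "f \<in> smooth_circle" and z: "\<And>z. Im (of_circle z) \<le> 0 \<Longrightarrow> f z = 0" and \<delta>: "0 < \<delta>" "\<delta> \<le> 1"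
  shows "\<exists>g\<in>smooth_circle. circle_supp g \<subseteq> upper_interval \<and>
    (\<forall>N. C_norm N (\<lambda>z. g z - f z) \<le> (\<Sum>j\<le>N. ((1 + \<delta>) ^ j - 1) * C_norm N f + (1 + \<delta>) ^ j * (C_norm (Suc N) f * (2 * \<delta>))))"
proof -
  define \<kappa> where "\<kappa> \<alpha> = (\<alpha> - pi / 2) * (1 + \<delta>) + pi / 2" for \<alpha>
  \<comment> \<open>The solution of \<kappa>(a) = 0; by symmetry \<kappa>(\<pi> - a) = \<pi>, so the
    squeezed function lives on [a, \<pi> - a].\<close>
  define a where "a = pi / 2 * (\<delta> / (1 + \<delta>))"
  have a: "0 < a" "a < pi / 2" unfolding a_def using \<delta> by (auto simp: field_simps)
  have sa: "sin a > 0" using a by (intro sin_gt_zero) auto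
  define D where "D j \<alpha> = complex_of_real (1 + \<delta>) ^ j * circle_deriv j f (\<kappa> \<alpha>)" for j \<alpha>
  define g where "g w = (if Im (of_circle w) > 0 then D 0 (arccos (Re (of_circle w))) else 0)" for w
  have F0: "circle_deriv j f \<theta> = 0" if "sin \<theta> \<le> 0" for j \<theta>
    by (rule circle_deriv_eq_0[OF f _ that]) (use z in simp)
  have \<kappa>d: "\<bar>\<kappa> \<alpha> - \<alpha>\<bar> \<le> 2 * \<delta>" if "0 < \<alpha>" "\<alpha> < pi" for \<alpha>
  proof -
    have "\<kappa> \<alpha> - \<alpha> = \<delta> * (\<alpha> - pi / 2)" by (simp add: \<kappa>_def algebra_simps)
    moreover have "\<bar>\<alpha> - pi / 2\<bar> \<le> 2" using that pi_less_4 by (simp add: abs_le_iff)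
    ultimately show ?thesis using \<delta> by (simp add: abs_mult)
  qed
  have Da: "sin a \<le> sin \<alpha>" if nz: "D j \<alpha> \<noteq> 0" and \<alpha>: "0 < \<alpha>" "\<alpha> < pi" for j \<alpha>
  proof -
    have s: "sin (\<kappa> \<alpha>) > 0" using nz F0[of "\<kappa> \<alpha>" j] unfolding D_def by force
    \<comment> \<open>Here \<delta> \<le> 1 enters: in this range sin is positive only between 0 and
      \<pi>, so periodicity of \<open>f\<close> brings in no further part of its support.\<close>
    have r: "- (pi / 2) \<le> \<kappa> \<alpha>" "\<kappa> \<alpha> \<le> 3 * pi / 2"
    proof -
      have "\<bar>\<kappa> \<alpha> - pi / 2\<bar> \<le> pi / 2 * 2"
      proof -
        have "\<bar>\<alpha> - pi / 2\<bar> \<le> pi / 2" using \<alpha> by linarith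
        moreover have "\<bar>1 + \<delta>\<bar> \<le> 2" using \<delta> by simp
        ultimately show ?thesis
          unfolding \<kappa>_def by (simp only: add_diff_cancel_right' abs_mult, intro mult_mono) auto
      qed
      then show "- (pi / 2) \<le> \<kappa> \<alpha>" "\<kappa> \<alpha> \<le> 3 * pi / 2" by linarith+
    qed
    have pos: "0 < \<kappa> \<alpha>"
    proof (rule ccontr)
      assume "\<not> 0 < \<kappa> \<alpha>"
      then have "sin (- \<kappa> \<alpha>) \<ge> 0" using r pi_gt_zero by (intro sin_ge_zero) auto
      then show False using s by simp
    qed
    have lt: "\<kappa> \<alpha> < pi"
    proof (rule ccontr)
      assume "\<not> \<kappa> \<alpha> < pi"
      then have "sin (\<kappa> \<alpha> - pi) \<ge> 0" using r pi_gt_zero by (intro sin_ge_zero) auto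
      then show False using s by (simp add: sin_diff)
    qed
    have "\<delta> / (1 + \<delta>) * (1 + \<delta>) = \<delta>" using \<delta> by simp
    then have "a * (1 + \<delta>) = pi / 2 * \<delta>" by (simp only: a_def mult.assoc)
    note ad = this
    \<comment> \<open>Linear arithmetic with the products as atoms: x = a (1 + \<delta>), A =
      \<alpha> (1 + \<delta>), P = (\<pi> - a)(1 + \<delta>), h = \<pi>\<delta>/2, c =
      \<pi>/2.\<close>
    have gen: "x \<le> A \<and> A \<le> P"
      if "x = h" "L = A - c - h" "P = 2 * c + 2 * h - x" "0 < L + c" "L + c < 2 * c" for x A P h L c :: real
      using that by linarith
    have "a * (1 + \<delta>) \<le> \<alpha> * (1 + \<delta>) \<and> \<alpha> * (1 + \<delta>) \<le> (pi - a) * (1 + \<delta>)"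
      by (rule gen[OF ad, of "(\<alpha> - pi / 2) * (1 + \<delta>)" _ "pi / 2"])
        (use pos lt in \<open>simp_all add: \<kappa>_def algebra_simps\<close>)
    then have "a \<le> \<alpha>" "\<alpha> \<le> pi - a" using \<delta> mult_le_cancel_right[of _ "1 + \<delta>"] by auto
    then show ?thesis using a by (intro sin_ge_sin) auto
  qed
  have 1: "g (circle_cis \<theta>) = D 0 \<theta>" if "0 < \<theta>" "\<theta> < pi" for \<theta>
    using that sin_gt_zero[of \<theta>] by (simp add: g_def arccos_cos)
  have 2: "g w = 0" if "Im (of_circle w) \<le> 0" for w using that by (simp add: g_def)
  have 3: "(D j has_vector_derivative D (Suc j) \<theta>) (at \<theta>)" for j \<theta>
  proof -
    have "(\<kappa> has_vector_derivative 1 + \<delta>) (at \<theta>)"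
      unfolding \<kappa>_def[abs_def] has_real_derivative_iff_has_vector_derivative[symmetric]
      by (auto intro!: derivative_eq_intros)
    from vector_diff_chain_at[OF this circle_deriv_has_vector_derivative[OF f, of j]]
    have "((\<lambda>\<theta>. circle_deriv j f (\<kappa> \<theta>)) has_vector_derivative complex_of_real (1 + \<delta>) * circle_deriv (Suc j) f (\<kappa> \<theta>)) (at \<theta>)"
      by (simp add: o_def scaleR_conv_of_real)
    from has_vector_derivative_mult_right[OF this, of "complex_of_real (1 + \<delta>) ^ j"]
    show ?thesis unfolding D_def[abs_def] by (simp add: mult_ac)
  qed
  have Db: "cmod (D j \<theta>) \<le> (1 + \<delta>) ^ j * C_norm j f" for j \<theta>
    unfolding D_def norm_mult norm_power norm_of_real using \<delta>
    by (intro mult_mono) (auto intro: circle_deriv_le_C_norm[OF f])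
  have 4: "\<exists>K. \<forall>\<theta>\<in>{0<..<pi}. cmod (D j \<theta>) \<le> K * (sin \<theta>)\<^sup>2" for j
  proof (intro exI ballI)
    let ?K = "(1 + \<delta>) ^ j * C_norm j f / (sin a)\<^sup>2"
    fix \<theta> :: real assume \<theta>: "\<theta> \<in> {0<..<pi}"
    have K0: "?K \<ge> 0" using \<delta> C_norm_nonneg[OF f, of j] by simp
    show "cmod (D j \<theta>) \<le> ?K * (sin \<theta>)\<^sup>2"
    proof (cases "D j \<theta> = 0")
      case True
      then show ?thesis using K0 by (simp add: mult_nonneg_nonneg del: divide_eq_0_iff times_divide_eq_left)
    next
      case False
      then have "sin a \<le> sin \<theta>" using Da \<theta> by auto
      then have "(sin a)\<^sup>2 \<le> (sin \<theta>)\<^sup>2" using sa by (intro power_mono) auto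
      then have "?K * (sin a)\<^sup>2 \<le> ?K * (sin \<theta>)\<^sup>2" by (rule mult_left_mono[OF _ K0])
      moreover have "?K * (sin a)\<^sup>2 = (1 + \<delta>) ^ j * C_norm j f" using sa by simp
      ultimately show ?thesis using Db[of j \<theta>] by linarith
    qed
  qed
  note ext = arc_extension[of g D, OF 1 2 3 4]
  have g: "g \<in> smooth_circle" by (rule ext)
  have "of_circle ` {w. g w \<noteq> 0} \<subseteq> {w. Im w \<ge> sin a} \<inter> sphere 0 1"
  proof
    fix u assume "u \<in> of_circle ` {w. g w \<noteq> 0}"
    then obtain w where w: "u = of_circle w" "g w \<noteq> 0" by auto
    obtain \<theta> where \<theta>: "w = circle_cis \<theta>" by (metis circle_cis_Arg)
    have s: "sin \<theta> > 0" using w 2[of w] \<theta> by force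
    have "D 0 (arccos (cos \<theta>)) \<noteq> 0" using w s by (simp add: g_def \<theta>)
    then have "sin a \<le> sin (arccos (cos \<theta>))" using Da arccos_upper[OF s] by blast
    also have "sin (arccos (cos \<theta>)) = sin \<theta>" using arg_cong[OF arccos_upper(3)[OF s], of Im] by simp
    finally show "u \<in> {w. Im w \<ge> sin a} \<inter> sphere 0 1" by (simp add: w \<theta>)
  qed
  then have "circle_supp g \<subseteq> {w. Im w \<ge> sin a} \<inter> sphere 0 1"
    unfolding circle_supp_def by (rule closure_minimal) (intro closed_Int closed_sphere closed_halfspace_Im_ge)
  then have supp: "circle_supp g \<subseteq> upper_interval" using sa by (force simp: upper_interval_def)
  have "C_norm N (\<lambda>z. g z - f z) \<le> (\<Sum>j\<le>N. ((1 + \<delta>) ^ j - 1) * C_norm N f + (1 + \<delta>) ^ j * (C_norm (Suc N) f * (2 * \<delta>)))" for N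
  proof (rule C_norm_le, subst circle_deriv_diff[OF g f], subst ext(2), assumption+)
    fix j \<theta> assume j: "j \<le> N"
    have p1: "(1 + \<delta>) ^ j \<ge> 1" using \<delta> by (simp add: one_le_power)
    have nn: "0 \<le> ((1 + \<delta>) ^ j - 1) * C_norm N f + (1 + \<delta>) ^ j * (C_norm (Suc N) f * (2 * \<delta>))"
      using p1 \<delta> C_norm_nonneg[OF f] by simp
    show "cmod ((if 0 < sin \<theta> then D j (arccos (cos \<theta>)) else 0) - circle_deriv j f \<theta>)
      \<le> ((1 + \<delta>) ^ j - 1) * C_norm N f + (1 + \<delta>) ^ j * (C_norm (Suc N) f * (2 * \<delta>))"
    proof (cases "0 < sin \<theta>")
      case False
      then show ?thesis using nn F0[of \<theta> j] by simp
    next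
      case True
      define \<alpha> where "\<alpha> = arccos (cos \<theta>)"
      have \<alpha>: "0 < \<alpha>" "\<alpha> < pi" "cis \<alpha> = cis \<theta>" unfolding \<alpha>_def using arccos_upper[OF True] by auto
      have "circle_deriv j f \<theta> = circle_deriv j f \<alpha>" by (rule circle_deriv_cong[OF f]) (simp add: \<alpha>)
      then have "D j \<alpha> - circle_deriv j f \<theta> = complex_of_real ((1 + \<delta>) ^ j - 1) * circle_deriv j f \<alpha> +
          complex_of_real ((1 + \<delta>) ^ j) * (circle_deriv j f (\<kappa> \<alpha>) - circle_deriv j f \<alpha>)"
        by (simp add: D_def algebra_simps)
      also have "cmod \<dots> \<le> ((1 + \<delta>) ^ j - 1) * cmod (circle_deriv j f \<alpha>) +
          (1 + \<delta>) ^ j * cmod (circle_deriv j f (\<kappa> \<alpha>) - circle_deriv j f \<alpha>)"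
      proof -
        have "\<bar>(1 + \<delta>) ^ j - 1\<bar> = (1 + \<delta>) ^ j - 1" "\<bar>(1 + \<delta>) ^ j\<bar> = (1 + \<delta>) ^ j" using p1 by auto
        then show ?thesis
          by (intro order_trans[OF norm_triangle_ineq]) (simp only: norm_mult norm_of_real order_refl)
      qed
      also have "\<dots> \<le> ((1 + \<delta>) ^ j - 1) * C_norm N f + (1 + \<delta>) ^ j * (C_norm (Suc N) f * (2 * \<delta>))"
      proof (intro add_mono mult_left_mono)
        show "cmod (circle_deriv j f \<alpha>) \<le> C_norm N f" by (rule circle_deriv_le_C_norm[OF f j])
        have "cmod (circle_deriv j f (\<kappa> \<alpha>) - circle_deriv j f \<alpha>) \<le> C_norm (Suc j) f * \<bar>\<kappa> \<alpha> - \<alpha>\<bar>"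
          by (rule circle_deriv_Lipschitz[OF f])
        also have "\<dots> \<le> C_norm (Suc N) f * (2 * \<delta>)"
          by (intro mult_mono C_norm_mono[OF f] \<kappa>d[OF \<alpha>(1,2)] C_norm_nonneg[OF f]) (use j in auto)
        finally show "cmod (circle_deriv j f (\<kappa> \<alpha>) - circle_deriv j f \<alpha>) \<le> C_norm (Suc N) f * (2 * \<delta>)" .
      qed (use p1 \<delta> in auto)
      finally show ?thesis using True by (simp add: \<alpha>_def)
    qed
  qed
  then show ?thesis using g supp by blast
qed

lemma circle_supp_lower:
  assumes "\<And>z. Im (of_circle z) \<ge> 0 \<Longrightarrow> g z = 0"
  shows "circle_supp g \<subseteq> {w. Im w \<le> 0}"
  unfolding circle_supp_def
  by (rule closure_minimal[OF _ closed_halfspace_Im_le]) (use assms in \<open>force simp: not_le\<close>)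

lemma nice_zero: "Im (of_circle z) \<le> 0 \<Longrightarrow> nice d q \<tau> z = 0"
  by (simp add: nice_def arc_bump_def)

context wightman_CFT
begin

text \<open>The supports may meet at 1 and -1, where the locality axiom says nothing. Squeezing
  \<open>f\<close> separates them from one side, and compatible functionals carry the commutation
  over to the limit.\<close>

lemma closed_arc_locality:
  assumes \<phi>: "\<phi> \<in> F" and \<psi>: "\<psi> \<in> F" and f: "f \<in> smooth_circle" and g: "g \<in> smooth_circle"
    and f0: "\<And>z. Im (of_circle z) \<le> 0 \<Longrightarrow> f z = 0" and g0: "\<And>z. Im (of_circle z) \<ge> 0 \<Longrightarrow> g z = 0"
  shows "\<phi> f (\<psi> g \<Phi>) = \<psi> g (\<phi> f \<Phi>)"
proof (rule dual_separates)
  fix l assume l: "l \<in> compatible_dual scaleC F"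
  let ?\<delta> = "\<lambda>n. 1 / real (Suc n)"
  have "\<forall>n. \<exists>h. h \<in> smooth_circle \<and> circle_supp h \<subseteq> upper_interval \<and>
    (\<forall>N. C_norm N (\<lambda>z. h z - f z) \<le> (\<Sum>j\<le>N. ((1 + ?\<delta> n) ^ j - 1) * C_norm N f + (1 + ?\<delta> n) ^ j * (C_norm (Suc N) f * (2 * ?\<delta> n))))"
  proof
    fix n
    have "0 < ?\<delta> n" "?\<delta> n \<le> 1" by simp_all
    from arc_shrink[OF f f0 this] show "\<exists>h. h \<in> smooth_circle \<and> circle_supp h \<subseteq> upper_interval \<and>
      (\<forall>N. C_norm N (\<lambda>z. h z - f z) \<le> (\<Sum>j\<le>N. ((1 + ?\<delta> n) ^ j - 1) * C_norm N f + (1 + ?\<delta> n) ^ j * (C_norm (Suc N) f * (2 * ?\<delta> n))))"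
      unfolding Bex_def .
  qed
  from choice[OF this] obtain h where hh: "\<forall>n. h n \<in> smooth_circle \<and> circle_supp (h n) \<subseteq> upper_interval \<and>
    (\<forall>N. C_norm N (\<lambda>z. h n z - f z) \<le> (\<Sum>j\<le>N. ((1 + ?\<delta> n) ^ j - 1) * C_norm N f + (1 + ?\<delta> n) ^ j * (C_norm (Suc N) f * (2 * ?\<delta> n))))"
    by (rule exE)
  have h: "h n \<in> smooth_circle" "circle_supp (h n) \<subseteq> upper_interval"
    "C_norm N (\<lambda>z. h n z - f z) \<le> (\<Sum>j\<le>N. ((1 + ?\<delta> n) ^ j - 1) * C_norm N f + (1 + ?\<delta> n) ^ j * (C_norm (Suc N) f * (2 * ?\<delta> n)))" for n N
    using hh by blast+
  have lim: "(\<lambda>n. C_norm N (\<lambda>z. h n z - f z)) \<longlonglongrightarrow> 0" for N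
  proof (rule tendsto_sandwich[OF _ _ tendsto_const])
    show "\<forall>\<^sub>F n in sequentially. 0 \<le> C_norm N (\<lambda>z. h n z - f z)"
      by (intro always_eventually allI C_norm_nonneg smooth_circle_diff h f)
    show "\<forall>\<^sub>F n in sequentially. C_norm N (\<lambda>z. h n z - f z) \<le>
        (\<Sum>j\<le>N. ((1 + ?\<delta> n) ^ j - 1) * C_norm N f + (1 + ?\<delta> n) ^ j * (C_norm (Suc N) f * (2 * ?\<delta> n)))"
      by (intro always_eventually allI h(3))
    have d: "?\<delta> \<longlonglongrightarrow> 0" using LIMSEQ_inverse_real_of_nat by (simp add: inverse_eq_divide)
    have "(\<lambda>n. \<Sum>j\<le>N. ((1 + ?\<delta> n) ^ j - 1) * C_norm N f + (1 + ?\<delta> n) ^ j * (C_norm (Suc N) f * (2 * ?\<delta> n)))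
      \<longlonglongrightarrow> (\<Sum>j\<le>N. ((1 + 0) ^ j - 1) * C_norm N f + (1 + 0) ^ j * (C_norm (Suc N) f * (2 * 0)))"
      by (intro tendsto_intros d)
    then show "(\<lambda>n. \<Sum>j\<le>N. ((1 + ?\<delta> n) ^ j - 1) * C_norm N f + (1 + ?\<delta> n) ^ j * (C_norm (Suc N) f * (2 * ?\<delta> n))) \<longlonglongrightarrow> 0"
      by simp
  qed
  have 1: "(\<lambda>n. l (field_product (\<lambda>_. \<phi>) (\<lambda>_. h n) [0..<1] (\<psi> g \<Phi>))) \<longlonglongrightarrow> l (field_product (\<lambda>_. \<phi>) (\<lambda>_. f) [0..<1] (\<psi> g \<Phi>))"
    by (rule dual_field_product_tendsto[OF l \<phi> f _ lim]) (simp add: h)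
  have 2: "(\<lambda>n. l (field_product (\<lambda>j. if j = 0 then \<psi> else \<phi>) (\<lambda>j. if j = 0 then g else h n) [0..<2] \<Phi>))
      \<longlonglongrightarrow> l (field_product (\<lambda>j. if j = 0 then \<psi> else \<phi>) (\<lambda>j. if j = 0 then g else f) [0..<2] \<Phi>)"
  proof (rule dual_field_product_tendsto[OF l])
    show "(\<lambda>n. C_norm N (\<lambda>z. (if j = 0 then g else h n) z - (if j = 0 then g else f) z)) \<longlonglongrightarrow> 0" for j N
      using lim[of N] by (cases "j = 0") (simp_all add: C_norm_zero)
  qed (use \<phi> \<psi> f g h in auto)
  have two: "[0..<2] = [0, 1]" by (simp add: numeral_2_eq_2)
  have "\<phi> (h n) (\<psi> g \<Phi>) = \<psi> g (\<phi> (h n) \<Phi>)" for n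
  proof -
    have "circle_supp (h n) \<inter> circle_supp g = {}"
      using h(2)[of n] circle_supp_lower[of g, OF g0] unfolding upper_interval_def by fastforce
    from locality[OF \<phi> \<psi> h(1) g this] show ?thesis by (metis comp_apply)
  qed
  then show "l (\<phi> f (\<psi> g \<Phi>)) = l (\<psi> g (\<phi> f \<Phi>))"
    using LIMSEQ_unique[OF 1] 2 unfolding two by simp
qed

text \<open>When the leftmost field is treated, the others have already been reflected to the lower
  arc, so it commutes through all of them to the vacuum, is reflected there, and stays at the right
  end. This is why the order reverses.\<close>

lemma reversed_product:
  assumes "\<And>j. j \<in> set js \<Longrightarrow> \<phi> j \<in> F \<and> f j \<in> smooth_circle \<and> g j \<in> smooth_circle \<and>
      \<phi> j (f j) \<Omega> = scaleC (s j) (\<phi> j (g j) \<Omega>) \<and>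
      (\<forall>z. Im (of_circle z) \<le> 0 \<longrightarrow> f j z = 0) \<and> (\<forall>z. Im (of_circle z) \<ge> 0 \<longrightarrow> g j z = 0)"
  shows "field_product \<phi> f js \<Omega> = scaleC (prod_list (map s js)) (field_product \<phi> g (rev js) \<Omega>)"
  using assms
proof (induction js)
  case Nil
  then show ?case by simp
next
  case (Cons i js)
  have commute: "\<phi> i (f i) (field_product \<phi> g is \<Phi>) = field_product \<phi> g is (\<phi> i (f i) \<Phi>)"
    if "set is \<subseteq> set (i # js)" for "is" \<Phi>
    using that
  proof (induction "is")
    case (Cons j "is")
    have "\<phi> i (f i) (\<phi> j (g j) \<Psi>) = \<phi> j (g j) (\<phi> i (f i) \<Psi>)" for \<Psi>
      by (rule closed_arc_locality) (use Cons.prems \<open>\<And>j. j \<in> set (i # js) \<Longrightarrow> _ j\<close> in auto)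
    then show ?case using Cons by simp
  qed simp
  have lin: "Vector_Spaces.linear scaleC scaleC (\<phi> i (f i))"
    using Cons.prems by (intro field_linear) auto
  have "field_product \<phi> f (i # js) \<Omega> = \<phi> i (f i) (scaleC (prod_list (map s js)) (field_product \<phi> g (rev js) \<Omega>))"
    using Cons by simp
  also have "\<dots> = scaleC (prod_list (map s js)) (field_product \<phi> g (rev js) (\<phi> i (f i) \<Omega>))"
  proof -
    have "\<phi> i (f i) (field_product \<phi> g (rev js) \<Omega>) = field_product \<phi> g (rev js) (\<phi> i (f i) \<Omega>)"
      by (rule commute) auto
    then show ?thesis by (simp only: linear_scale[OF lin])
  qed
  also have "\<phi> i (f i) \<Omega> = scaleC (s i) (\<phi> i (g i) \<Omega>)" using Cons.prems by simp
  also have "field_product \<phi> g (rev js) \<dots> = scaleC (s i) (field_product \<phi> g (rev js) (\<phi> i (g i) \<Omega>))"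
    by (rule field_product_scale) (use Cons.prems in auto)
  finally show ?case by (simp add: field_product_append mult.commute)
qed

lemma nice_product_reflection:
  assumes \<phi>: "\<And>j. j < k \<Longrightarrow> \<phi> j \<in> F \<and> conformal_dimension U (\<phi> j) (d j)"
  shows "field_product \<phi> (\<lambda>j. nice (d j) (q j) (\<i> * pi + of_real t)) [0..<k] \<Omega> =
    scaleC ((- 1) ^ (\<Sum>j<k. d j)) (field_product \<phi> (\<lambda>j. nice (d j) (q j) (of_real t) \<circ> circle_inverse) (rev [0..<k]) \<Omega>)"
proof -
  have \<tau>: "\<i> * pi + of_real t \<in> tau_strip" "complex_of_real t \<in> tau_strip"
    using pi_gt_zero by (simp_all add: tau_strip_def)
  have Im: "Im (of_circle (circle_inverse z)) = - Im (of_circle z)" for z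
  proof -
    obtain \<theta> where "z = circle_cis \<theta>" by (metis circle_cis_Arg)
    then show ?thesis by (simp add: circle_inverse_circle_cis)
  qed
  have "field_product \<phi> (\<lambda>j. nice (d j) (q j) (\<i> * pi + of_real t)) [0..<k] \<Omega> =
    scaleC (prod_list (map (\<lambda>j. (- 1) ^ d j) [0..<k])) (field_product \<phi> (\<lambda>j. nice (d j) (q j) (of_real t) \<circ> circle_inverse) (rev [0..<k]) \<Omega>)"
    by (rule reversed_product)
      (use \<phi> \<tau> in \<open>auto simp: nice_smooth smooth_circle_inverse nice_vacuum_reflection nice_zero Im\<close>)
  also have "prod_list (map (\<lambda>j. (- 1) ^ d j) [0..<k]) = (- 1 :: complex) ^ (\<Sum>j<k. d j)"
    by (simp add: prod.distinct_set_conv_list[symmetric] power_sum atLeast0LessThan)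
  finally show ?thesis .
qed

end

section \<open>Approximation by analytic test functions\<close>

definition arc_coord :: "real \<Rightarrow> real" where
  "arc_coord \<theta> = ln (sin \<theta> / (1 + cos \<theta>))"

text \<open>The compactified coordinate \<omega> in which \<open>profile\<close> is polynomial up to
  its weight. It decreases from 1 at angle 0 to 0 at angle \<pi>.\<close>

definition arc_unit :: "real \<Rightarrow> real" where
  "arc_unit \<theta> = 1 / (1 + exp (arc_coord \<theta> / 4))"

definition arc_weight :: "real \<Rightarrow> complex" where
  "arc_weight \<theta> = of_real (exp (- (exp (arc_coord \<theta> / 4) + exp (- arc_coord \<theta> / 4))))"

lemma nice_circle_cis:
  "sin \<theta> > 0 \<Longrightarrow> nice d q 0 (circle_cis \<theta>) =
    arc_weight \<theta> * of_real (sin \<theta>) powi (int d - 1) * poly q (of_real (arc_unit \<theta>))"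
  by (simp add: nice_def arc_bump_def profile_def arc_weight_def arc_unit_def arc_coord_def exp_of_real[symmetric])

lemma exp_abs_arc_coord:
  assumes "sin \<theta> > 0"
  shows "exp \<bar>arc_coord \<theta>\<bar> \<le> 2 * (1 / sin \<theta>)" "exp (- \<bar>arc_coord \<theta>\<bar>) \<le> sin \<theta>"
proof -
  have c: "1 + cos \<theta> > 0" by (rule one_plus_cos_pos) (use assms in simp)
  define y where "y = sin \<theta> / (1 + cos \<theta>)"
  have y: "y > 0" unfolding y_def using assms c by simp
  have "(sin \<theta>)\<^sup>2 = (1 - cos \<theta>) * (1 + cos \<theta>)"
    using sin_squared_eq[of \<theta>] by (simp add: algebra_simps power2_eq_square)
  also have "\<dots> \<le> 2 * (1 + cos \<theta>)"
    using c cos_ge_minus_one[of \<theta>] by (intro mult_right_mono) auto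
  finally have 1: "y \<le> 2 * (1 / sin \<theta>)"
    unfolding y_def using assms c by (simp add: field_simps power2_eq_square)
  have 2: "1 / y \<le> 2 * (1 / sin \<theta>)"
    unfolding y_def using assms c cos_le_one[of \<theta>] by (simp add: field_simps)
  show "exp \<bar>arc_coord \<theta>\<bar> \<le> 2 * (1 / sin \<theta>)"
    using 1 2 y unfolding arc_coord_def y_def[symmetric] by (auto simp: abs_if exp_minus inverse_eq_divide)
  show "exp (- \<bar>arc_coord \<theta>\<bar>) \<le> sin \<theta>"
    using exp_log_coord_le_sin[of "of_real \<theta>"] of_real_arc_dom[of \<theta>] assms
    by (simp add: log_coord_of_real arc_coord_def sin_of_real)
qed

lemma arc_coord_deriv:
  assumes "sin \<theta> > 0"
  shows "(arc_coord has_real_derivative 1 / sin \<theta>) (at \<theta>)"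
proof -
  have c: "1 + cos \<theta> > 0" by (rule one_plus_cos_pos) (use assms in simp)
  have q: "((\<lambda>\<theta>. sin \<theta> / (1 + cos \<theta>)) has_real_derivative
      (cos \<theta> * (1 + cos \<theta>) - sin \<theta> * (- sin \<theta>)) / ((1 + cos \<theta>) * (1 + cos \<theta>))) (at \<theta>)"
    using c by (auto intro!: derivative_eq_intros)
  have "cos \<theta> * (1 + cos \<theta>) - sin \<theta> * (- sin \<theta>) = cos \<theta> + ((cos \<theta>)\<^sup>2 + (sin \<theta>)\<^sup>2)"
    unfolding power2_eq_square
    by (simp add: algebra_simps del: sin_cos_squared_add sin_cos_squared_add2 sin_cos_squared_add3)
  then have "cos \<theta> * (1 + cos \<theta>) - sin \<theta> * (- sin \<theta>) = 1 + cos \<theta>" by simp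
  with q have q': "((\<lambda>\<theta>. sin \<theta> / (1 + cos \<theta>)) has_real_derivative 1 / (1 + cos \<theta>)) (at \<theta>)"
    using c by simp
  have "(ln has_real_derivative 1 / (sin \<theta> / (1 + cos \<theta>))) (at (sin \<theta> / (1 + cos \<theta>)))"
    by (rule DERIV_ln_divide) (use assms c in simp)
  from DERIV_chain2[OF this q'] show ?thesis
    unfolding arc_coord_def[abs_def] using assms c by simp
qed

lemma exp_quarter_coord_deriv:
  assumes "sin \<theta> > 0"
  shows "((\<lambda>\<theta>. exp (c * arc_coord \<theta>)) has_real_derivative c * exp (c * arc_coord \<theta>) * (1 / sin \<theta>)) (at \<theta>)"
  by (rule derivative_eq_intros arc_coord_deriv[OF assms] refl)+ simp

text \<open>Closed under products and \<theta>-derivatives, with members that blow up at the end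
  points at most like a power of 1/sin(\<theta>); multiplication by \<open>arc_weight\<close> makes
  each of them bounded.\<close>

inductive_set arc_coeffs :: "(real \<Rightarrow> complex) set" where
  const: "(\<lambda>_. c) \<in> arc_coeffs"
| cos: "(\<lambda>\<theta>. of_real (cos \<theta>)) \<in> arc_coeffs"
| sin: "(\<lambda>\<theta>. of_real (sin \<theta>)) \<in> arc_coeffs"
| inv_sin: "(\<lambda>\<theta>. of_real (1 / sin \<theta>)) \<in> arc_coeffs"
| exp: "\<bar>c\<bar> \<le> 1 \<Longrightarrow> (\<lambda>\<theta>. of_real (exp (c * arc_coord \<theta>))) \<in> arc_coeffs"
| unit: "(\<lambda>\<theta>. of_real (arc_unit \<theta>)) \<in> arc_coeffs"
| add: "a \<in> arc_coeffs \<Longrightarrow> b \<in> arc_coeffs \<Longrightarrow> (\<lambda>\<theta>. a \<theta> + b \<theta>) \<in> arc_coeffs"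
| mult: "a \<in> arc_coeffs \<Longrightarrow> b \<in> arc_coeffs \<Longrightarrow> (\<lambda>\<theta>. a \<theta> * b \<theta>) \<in> arc_coeffs"

definition arc_unit_deriv :: "real \<Rightarrow> real" where
  "arc_unit_deriv \<theta> = - 1 / 4 * exp (1 / 4 * arc_coord \<theta>) * (1 / sin \<theta>) * (arc_unit \<theta> * arc_unit \<theta>)"

lemma arc_unit_has_deriv:
  assumes "sin \<theta> > 0"
  shows "(arc_unit has_real_derivative arc_unit_deriv \<theta>) (at \<theta>)"
proof -
  have nz: "1 + exp (1 / 4 * arc_coord \<theta>) > 0" by (simp add: add_pos_pos)
  have eq: "arc_unit = (\<lambda>\<theta>. 1 / (1 + exp (1 / 4 * arc_coord \<theta>)))"
    by (rule ext) (simp add: arc_unit_def)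
  have "((\<lambda>\<theta>. 1 + exp (1 / 4 * arc_coord \<theta>)) has_real_derivative
      0 + 1 / 4 * exp (1 / 4 * arc_coord \<theta>) * (1 / sin \<theta>)) (at \<theta>)"
    by (intro DERIV_add DERIV_const exp_quarter_coord_deriv assms)
  from DERIV_divide[OF DERIV_const[of 1] this] nz
  have "(arc_unit has_real_derivative (0 * (1 + exp (1 / 4 * arc_coord \<theta>)) - 1 * (0 + 1 / 4 * exp (1 / 4 * arc_coord \<theta>) * (1 / sin \<theta>))) /
      ((1 + exp (1 / 4 * arc_coord \<theta>)) * (1 + exp (1 / 4 * arc_coord \<theta>)))) (at \<theta>)"
    unfolding eq by simp
  moreover have "(0 * (1 + exp (1 / 4 * arc_coord \<theta>)) - 1 * (0 + 1 / 4 * exp (1 / 4 * arc_coord \<theta>) * (1 / sin \<theta>))) /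
      ((1 + exp (1 / 4 * arc_coord \<theta>)) * (1 + exp (1 / 4 * arc_coord \<theta>))) = arc_unit_deriv \<theta>"
    unfolding arc_unit_deriv_def eq by simp
  ultimately show ?thesis by (simp only:)
qed

lemma arc_unit_bounds: "0 < arc_unit \<theta>" "arc_unit \<theta> < 1"
  by (simp_all add: arc_unit_def add_pos_pos)

lemma arc_unit_deriv_coeffs: "(\<lambda>\<theta>. of_real (arc_unit_deriv \<theta>)) \<in> arc_coeffs"
proof -
  have "(\<lambda>\<theta>. complex_of_real (arc_unit_deriv \<theta>)) = (\<lambda>\<theta>. complex_of_real (- 1 / 4) * of_real (exp (1 / 4 * arc_coord \<theta>)) *
      of_real (1 / sin \<theta>) * (of_real (arc_unit \<theta>) * of_real (arc_unit \<theta>)))"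
    by (simp only: arc_unit_deriv_def of_real_mult)
  then show ?thesis by (simp only:) (intro arc_coeffs.intros, simp)
qed

lemma arc_coeffs_deriv:
  assumes "b \<in> arc_coeffs"
  shows "\<exists>b'\<in>arc_coeffs. \<forall>\<theta>. sin \<theta> > 0 \<longrightarrow> (b has_vector_derivative b' \<theta>) (at \<theta>)"
  using assms
proof induction
  case (const c)
  show ?case by (rule bexI[OF _ arc_coeffs.const[of 0]]) auto
next
  case cos
  show ?case
    by (rule bexI[OF _ arc_coeffs.mult[OF arc_coeffs.const[of "-1"] arc_coeffs.sin]])
      (use has_vector_derivative_of_real_fun[OF DERIV_cos] in simp)
next
  case sin
  show ?case
    by (rule bexI[OF _ arc_coeffs.cos]) (use has_vector_derivative_of_real_fun[OF DERIV_sin] in simp)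
next
  case inv_sin
  have "((\<lambda>\<theta>. 1 / sin \<theta>) has_real_derivative - 1 * cos \<theta> * (1 / sin \<theta> * (1 / sin \<theta>))) (at \<theta>)" if "sin \<theta> > 0" for \<theta> :: real
    using that by (auto intro!: derivative_eq_intros)
  from has_vector_derivative_of_real_fun[OF this]
  show ?case
    by (intro bexI[OF _ arc_coeffs.mult[OF arc_coeffs.mult[OF arc_coeffs.const[of "-1"] arc_coeffs.cos]
      arc_coeffs.mult[OF arc_coeffs.inv_sin arc_coeffs.inv_sin]]] allI impI) simp
next
  case (exp c)
  have "((\<lambda>\<theta>. complex_of_real (exp (c * arc_coord \<theta>))) has_vector_derivative
      of_real c * of_real (exp (c * arc_coord \<theta>)) * of_real (1 / sin \<theta>)) (at \<theta>)" if "sin \<theta> > 0" for \<theta>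
    using has_vector_derivative_of_real_fun[OF exp_quarter_coord_deriv[OF that, of c]] by (simp only: of_real_mult)
  then show ?case
    by (intro bexI[OF _ arc_coeffs.mult[OF arc_coeffs.mult[OF arc_coeffs.const arc_coeffs.exp[OF exp]] arc_coeffs.inv_sin]]) auto
next
  case unit
  show ?case
    by (rule bexI[OF _ arc_unit_deriv_coeffs]) (auto intro: has_vector_derivative_of_real_fun arc_unit_has_deriv)
next
  case (add a b)
  then obtain a' b' where a: "a' \<in> arc_coeffs" "\<And>\<theta>. sin \<theta> > 0 \<Longrightarrow> (a has_vector_derivative a' \<theta>) (at \<theta>)"
    and b: "b' \<in> arc_coeffs" "\<And>\<theta>. sin \<theta> > 0 \<Longrightarrow> (b has_vector_derivative b' \<theta>) (at \<theta>)" by blast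
  show ?case
    by (rule bexI[OF _ arc_coeffs.add[OF a(1) b(1)]]) (auto intro!: has_vector_derivative_add a b)
next
  case (mult a b)
  then obtain a' b' where a: "a' \<in> arc_coeffs" "\<And>\<theta>. sin \<theta> > 0 \<Longrightarrow> (a has_vector_derivative a' \<theta>) (at \<theta>)"
    and b: "b' \<in> arc_coeffs" "\<And>\<theta>. sin \<theta> > 0 \<Longrightarrow> (b has_vector_derivative b' \<theta>) (at \<theta>)" by blast
  show ?case
    by (rule bexI[OF _ arc_coeffs.add[OF arc_coeffs.mult[OF mult.hyps(1) b(1)] arc_coeffs.mult[OF a(1) mult.hyps(2)]]])
      (auto intro!: has_vector_derivative_mult a b)
qed

lemma one_le_inv_sin: "sin \<theta> > 0 \<Longrightarrow> 1 \<le> 1 / sin (\<theta>::real)"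
  by (simp add: le_divide_eq)

lemma arc_coeffs_bound:
  assumes "b \<in> arc_coeffs"
  shows "\<exists>C k. 0 \<le> C \<and> (\<forall>\<theta>. sin \<theta> > 0 \<longrightarrow> cmod (b \<theta>) \<le> C * (1 / sin \<theta>) ^ k)"
  using assms
proof induction
  case (const c)
  show ?case by (intro exI[of _ "cmod c"] exI[of _ 0]) auto
next
  case cos
  show ?case by (intro exI[of _ 1] exI[of _ 0]) (simp only: norm_of_real, simp)
next
  case sin
  show ?case by (intro exI[of _ 1] exI[of _ 0]) (simp only: norm_of_real, simp)
next
  case inv_sin
  show ?case by (intro exI[of _ 1]) (simp only: norm_of_real, simp)
next
  case (exp c)
  have "exp (c * arc_coord \<theta>) \<le> 2 * (1 / sin \<theta>) ^ 1" if "sin \<theta> > 0" for \<theta>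
  proof -
    have "c * arc_coord \<theta> \<le> \<bar>c\<bar> * \<bar>arc_coord \<theta>\<bar>" by (simp add: abs_mult[symmetric])
    also have "\<dots> \<le> 1 * \<bar>arc_coord \<theta>\<bar>" by (intro mult_right_mono exp) simp
    finally have "exp (c * arc_coord \<theta>) \<le> exp \<bar>arc_coord \<theta>\<bar>" by simp
    from order_trans[OF this exp_abs_arc_coord(1)[OF that]] show ?thesis by simp
  qed
  then show ?case by (intro exI[of _ 2] exI[of _ 1]) (simp only: norm_of_real, simp)
next
  case unit
  have "\<bar>arc_unit \<theta>\<bar> \<le> 1 * (1 / sin \<theta>) ^ 0" for \<theta>
    using arc_unit_bounds[of \<theta>] by simp
  then show ?case by (intro exI[of _ 1] exI[of _ 0]) (simp only: norm_of_real, simp)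
next
  case (add a b)
  then obtain C k C' k' where *: "0 \<le> C" "\<And>\<theta>. sin \<theta> > 0 \<Longrightarrow> cmod (a \<theta>) \<le> C * (1 / sin \<theta>) ^ k"
    "0 \<le> C'" "\<And>\<theta>. sin \<theta> > 0 \<Longrightarrow> cmod (b \<theta>) \<le> C' * (1 / sin \<theta>) ^ k'" by blast
  have "cmod (a \<theta> + b \<theta>) \<le> (C + C') * (1 / sin \<theta>) ^ (k + k')" if s: "sin \<theta> > 0" for \<theta>
  proof -
    have "C * (1 / sin \<theta>) ^ k \<le> C * (1 / sin \<theta>) ^ (k + k')" "C' * (1 / sin \<theta>) ^ k' \<le> C' * (1 / sin \<theta>) ^ (k + k')"
      using * one_le_inv_sin[OF s] by (auto intro!: mult_left_mono power_increasing simp del: power_one_over)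
    then show ?thesis
      using norm_triangle_ineq[of "a \<theta>" "b \<theta>"] *(2)[OF s] *(4)[OF s]
      unfolding distrib_right by linarith
  qed
  then show ?case using * by (intro exI[of _ "C + C'"] exI[of _ "k + k'"]) auto
next
  case (mult a b)
  then obtain C k C' k' where *: "0 \<le> C" "\<And>\<theta>. sin \<theta> > 0 \<Longrightarrow> cmod (a \<theta>) \<le> C * (1 / sin \<theta>) ^ k"
    "0 \<le> C'" "\<And>\<theta>. sin \<theta> > 0 \<Longrightarrow> cmod (b \<theta>) \<le> C' * (1 / sin \<theta>) ^ k'" by blast
  have "cmod (a \<theta> * b \<theta>) \<le> (C * C') * (1 / sin \<theta>) ^ (k + k')" if s: "sin \<theta> > 0" for \<theta>
  proof -
    have "cmod (a \<theta>) * cmod (b \<theta>) \<le> (C * (1 / sin \<theta>) ^ k) * (C' * (1 / sin \<theta>) ^ k')"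
      using *(2)[OF s] *(4)[OF s] by (rule mult_mono) (use * s in auto)
    then show ?thesis by (simp only: norm_mult power_add mult_ac)
  qed
  then show ?case using * by (intro exI[of _ "C * C'"] exI[of _ "k + k'"]) auto
qed

lemma arc_coeffs_power: "a \<in> arc_coeffs \<Longrightarrow> (\<lambda>\<theta>. a \<theta> ^ n) \<in> arc_coeffs"
  by (induction n) (auto intro: arc_coeffs.const arc_coeffs.mult)

lemma sin_powi_coeffs: "(\<lambda>\<theta>. complex_of_real (sin \<theta>) powi n) \<in> arc_coeffs"
proof (cases "n \<ge> 0")
  case True
  have "(\<lambda>\<theta>. complex_of_real (sin \<theta>) powi n) = (\<lambda>\<theta>. complex_of_real (sin \<theta>) ^ nat n)"
    using True by (simp add: power_int_def)
  then show ?thesis using arc_coeffs_power[OF arc_coeffs.sin] by simp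
next
  case False
  have "(\<lambda>\<theta>. complex_of_real (sin \<theta>) powi n) = (\<lambda>\<theta>. complex_of_real (1 / sin \<theta>) ^ nat (- n))"
    using False by (simp add: power_int_def inverse_eq_divide)
  then show ?thesis using arc_coeffs_power[OF arc_coeffs.inv_sin] by simp
qed

definition weight_logderiv :: "real \<Rightarrow> complex" where
  "weight_logderiv \<theta> = (of_real (- 1 / 4) * of_real (exp (1 / 4 * arc_coord \<theta>)) + of_real (1 / 4) * of_real (exp (- 1 / 4 * arc_coord \<theta>)))
     * of_real (1 / sin \<theta>)"

lemma weight_logderiv_coeffs: "weight_logderiv \<in> arc_coeffs"
  unfolding weight_logderiv_def[abs_def] by (intro arc_coeffs.intros) auto

text \<open>The constant \<open>c\<close> treats the weight (-1) and its inverse (1)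
  together.\<close>

lemma arc_weight_exp:
  "((\<lambda>\<theta>. complex_of_real (exp (c * (exp (1 / 4 * arc_coord \<theta>) + exp (- 1 / 4 * arc_coord \<theta>))))) has_vector_derivative
     - of_real c * weight_logderiv \<theta> * of_real (exp (c * (exp (1 / 4 * arc_coord \<theta>) + exp (- 1 / 4 * arc_coord \<theta>))))) (at \<theta>)"
  if "sin \<theta> > 0"
proof -
  let ?g = "\<lambda>\<theta>. c * (exp (1 / 4 * arc_coord \<theta>) + exp (- 1 / 4 * arc_coord \<theta>))"
  have "(?g has_real_derivative c * (1 / 4 * exp (1 / 4 * arc_coord \<theta>) * (1 / sin \<theta>) +
      (- 1 / 4) * exp (- 1 / 4 * arc_coord \<theta>) * (1 / sin \<theta>))) (at \<theta>)"
    by (intro DERIV_cmult DERIV_add exp_quarter_coord_deriv that)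
  from has_vector_derivative_of_real_fun[OF DERIV_chain2[OF DERIV_exp this]]
  show ?thesis
    unfolding weight_logderiv_def by (simp add: algebra_simps)
qed

lemma arc_weight_deriv:
  assumes "sin \<theta> > 0"
  shows "(arc_weight has_vector_derivative weight_logderiv \<theta> * arc_weight \<theta>) (at \<theta>)"
  using arc_weight_exp[OF assms, of "-1"] by (simp add: arc_weight_def[abs_def])

lemma inverse_arc_weight_deriv:
  assumes "sin \<theta> > 0"
  shows "((\<lambda>\<theta>. inverse (arc_weight \<theta>)) has_vector_derivative - weight_logderiv \<theta> * inverse (arc_weight \<theta>)) (at \<theta>)"
proof -
  have eq: "(\<lambda>\<theta>. inverse (arc_weight \<theta>)) =
      (\<lambda>\<theta>. complex_of_real (exp (1 * (exp (1 / 4 * arc_coord \<theta>) + exp (- 1 / 4 * arc_coord \<theta>)))))"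
    unfolding arc_weight_def exp_minus[of "exp _ + exp _"] of_real_inverse inverse_inverse_eq by simp
  show ?thesis
    unfolding fun_cong[OF eq, of \<theta>] eq using arc_weight_exp[OF assms, of 1] by simp
qed

lemma arc_weight_flat: "\<exists>C\<ge>0. \<forall>\<theta>. sin \<theta> > 0 \<longrightarrow> cmod (arc_weight \<theta>) \<le> C * sin \<theta> ^ m"
proof -
  obtain C where C: "C \<ge> 0" "\<And>\<xi>. \<bar>Im \<xi>\<bar> < 7 * pi / 4 \<Longrightarrow> cmod (profile 1 \<xi>) \<le> C * exp (- (real m * \<bar>Re \<xi>\<bar>))"
    using rapid_profile_7[of 1] unfolding rapid_def by blast
  have "cmod (arc_weight \<theta>) \<le> C * sin \<theta> ^ m" if "sin \<theta> > 0" for \<theta>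
  proof -
    have "arc_weight \<theta> = profile 1 (of_real (arc_coord \<theta>))"
      by (simp add: arc_weight_def profile_def exp_of_real[symmetric])
    then have "cmod (arc_weight \<theta>) \<le> C * exp (- (real m * \<bar>arc_coord \<theta>\<bar>))"
      using C(2)[of "of_real (arc_coord \<theta>)"] by simp
    also have "exp (- (real m * \<bar>arc_coord \<theta>\<bar>)) = exp (- \<bar>arc_coord \<theta>\<bar>) ^ m"
      by (subst exp_of_nat_mult[symmetric]) simp
    also have "C * exp (- \<bar>arc_coord \<theta>\<bar>) ^ m \<le> C * sin \<theta> ^ m"
      by (intro mult_left_mono power_mono exp_abs_arc_coord that C) simp
    finally show ?thesis .
  qed
  then show ?thesis using C(1) by blast
qed

lemma arc_weight_coeffs_bounded:
  assumes "b \<in> arc_coeffs"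
  shows "\<exists>B\<ge>0. \<forall>\<theta>. sin \<theta> > 0 \<longrightarrow> cmod (arc_weight \<theta> * b \<theta>) \<le> B"
proof -
  obtain C k where C: "0 \<le> C" "\<And>\<theta>. sin \<theta> > 0 \<Longrightarrow> cmod (b \<theta>) \<le> C * (1 / sin \<theta>) ^ k"
    using arc_coeffs_bound[OF assms] by blast
  obtain C' where C': "0 \<le> C'" "\<And>\<theta>. sin \<theta> > 0 \<Longrightarrow> cmod (arc_weight \<theta>) \<le> C' * sin \<theta> ^ k"
    using arc_weight_flat by blast
  have "cmod (arc_weight \<theta> * b \<theta>) \<le> C' * C" if s: "sin \<theta> > 0" for \<theta>
  proof -
    have "cmod (arc_weight \<theta>) * cmod (b \<theta>) \<le> (C' * sin \<theta> ^ k) * (C * (1 / sin \<theta>) ^ k)"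
      by (rule mult_mono[OF C'(2)[OF s] C(2)[OF s]]) (use C' s in auto)
    also have "\<dots> = C' * C" using s by (simp add: power_one_over)
    finally show ?thesis by (simp add: norm_mult)
  qed
  then show ?thesis using C(1) C'(1) by (intro exI[of _ "C' * C"]) auto
qed

text \<open>Expresses the \<theta>-derivatives of weight times \<open>b\<close> times p(\<omega>)
  through the \<omega>-derivatives of p, with coefficients bounded up to the end points. Estimates
  in C^N thus reduce to uniform estimates of finitely many \<omega>-derivatives.\<close>

lemma weighted_chain_coefficients:
  assumes "b \<in> arc_coeffs"
  shows "\<exists>c B. (\<forall>n j. 0 \<le> B n j \<and> (\<forall>\<theta>. sin \<theta> > 0 \<longrightarrow> cmod (c n j \<theta>) \<le> B n j)) \<and>
    (\<forall>\<theta>. c 0 0 \<theta> = arc_weight \<theta> * b \<theta>) \<and>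
    (\<forall>r. (\<forall>j \<theta>. sin \<theta> > 0 \<longrightarrow> (r j has_vector_derivative of_real (arc_unit_deriv \<theta>) * r (Suc j) \<theta>) (at \<theta>)) \<longrightarrow>
      (\<forall>n \<theta>. sin \<theta> > 0 \<longrightarrow> ((\<lambda>\<theta>. \<Sum>j\<le>n. c n j \<theta> * r j \<theta>) has_vector_derivative (\<Sum>j\<le>Suc n. c (Suc n) j \<theta> * r j \<theta>)) (at \<theta>)))"
proof -
  \<comment> \<open>A single map \<omega> occurs here, so the family index of
    \<open>chain_coefficients\<close> is specialised to \<open>unit\<close>.\<close>
  define cls :: "(unit \<Rightarrow> real \<Rightarrow> complex) set" where "cls = {(\<lambda>_ \<theta>. arc_weight \<theta> * b \<theta>) | b. b \<in> arc_coeffs}"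
  let ?w = "\<lambda>(_::unit) \<theta>. complex_of_real (arc_unit_deriv \<theta>)" and ?S = "{\<theta>::real. sin \<theta> > 0}"
  have clsI: "(\<lambda>_ \<theta>. arc_weight \<theta> * b \<theta>) \<in> cls" if "b \<in> arc_coeffs" for b using that by (auto simp: cls_def)
  have zero: "(\<lambda>_ _. 0) \<in> cls" using clsI[OF arc_coeffs.const[of 0]] by simp
  have add: "\<forall>a\<in>cls. \<forall>b\<in>cls. (\<lambda>i \<theta>. a i \<theta> + b i \<theta>) \<in> cls"
  proof (intro ballI)
    fix a b assume "a \<in> cls" "b \<in> cls"
    then obtain a' b' where "a' \<in> arc_coeffs" "b' \<in> arc_coeffs" "a = (\<lambda>_ \<theta>. arc_weight \<theta> * a' \<theta>)" "b = (\<lambda>_ \<theta>. arc_weight \<theta> * b' \<theta>)"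
      by (auto simp: cls_def)
    then show "(\<lambda>i \<theta>. a i \<theta> + b i \<theta>) \<in> cls"
      using clsI[OF arc_coeffs.add[of a' b']] by (simp add: distrib_left)
  qed
  have mult: "\<forall>a\<in>cls. (\<lambda>i \<theta>. ?w i \<theta> * a i \<theta>) \<in> cls"
  proof
    fix a assume "a \<in> cls"
    then obtain a' where "a' \<in> arc_coeffs" "a = (\<lambda>_ \<theta>. arc_weight \<theta> * a' \<theta>)" by (auto simp: cls_def)
    then show "(\<lambda>i \<theta>. ?w i \<theta> * a i \<theta>) \<in> cls"
      using clsI[OF arc_coeffs.mult[OF arc_unit_deriv_coeffs, of a']] by (simp add: mult_ac)
  qed
  have deriv: "\<forall>a\<in>cls. \<exists>a'\<in>cls. \<forall>i. \<forall>\<theta>\<in>?S. (a i has_vector_derivative a' i \<theta>) (at \<theta>)"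
  proof
    fix a assume "a \<in> cls"
    then obtain b where b: "b \<in> arc_coeffs" "a = (\<lambda>_ \<theta>. arc_weight \<theta> * b \<theta>)" by (auto simp: cls_def)
    obtain b' where b': "b' \<in> arc_coeffs" "\<And>\<theta>. sin \<theta> > 0 \<Longrightarrow> (b has_vector_derivative b' \<theta>) (at \<theta>)"
      using arc_coeffs_deriv[OF b(1)] by blast
    have "(a i has_vector_derivative arc_weight \<theta> * (weight_logderiv \<theta> * b \<theta> + b' \<theta>)) (at \<theta>)" if "sin \<theta> > 0" for i \<theta>
      using has_vector_derivative_mult[OF arc_weight_deriv[OF that] b'(2)[OF that]] unfolding b(2)
      by (simp add: algebra_simps)
    then show "\<exists>a'\<in>cls. \<forall>i. \<forall>\<theta>\<in>?S. (a i has_vector_derivative a' i \<theta>) (at \<theta>)"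
      by (intro bexI[OF _ clsI[OF arc_coeffs.add[OF arc_coeffs.mult[OF weight_logderiv_coeffs b(1)] b'(1)]]]) auto
  qed
  from chain_coefficients[OF zero add mult deriv clsI[OF assms]]
  obtain c where c1: "\<forall>n j. c n j \<in> cls"
    and c2: "c 0 0 = (\<lambda>_ \<theta>. arc_weight \<theta> * b \<theta>)"
    and c3: "\<forall>i r. (\<forall>j. \<forall>\<theta>\<in>?S. (r j has_vector_derivative ?w i \<theta> * r (Suc j) \<theta>) (at \<theta>)) \<longrightarrow>
      (\<forall>n. \<forall>\<theta>\<in>?S. ((\<lambda>\<theta>. \<Sum>j\<le>n. c n j i \<theta> * r j \<theta>) has_vector_derivative
          (\<Sum>j\<le>Suc n. c (Suc n) j i \<theta> * r j \<theta>)) (at \<theta>))"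
    by (elim exE conjE) (rule that)
  have "\<exists>B. 0 \<le> B \<and> (\<forall>\<theta>. sin \<theta> > 0 \<longrightarrow> cmod (c n j () \<theta>) \<le> B)" for n j
  proof -
    obtain b' where "b' \<in> arc_coeffs" "c n j = (\<lambda>_ \<theta>. arc_weight \<theta> * b' \<theta>)" using c1 unfolding cls_def by blast
    then show ?thesis using arc_weight_coeffs_bounded by auto
  qed
  then obtain B where B: "\<And>n j. 0 \<le> B n j \<and> (\<forall>\<theta>. sin \<theta> > 0 \<longrightarrow> cmod (c n j () \<theta>) \<le> B n j)" by metis
  show ?thesis
  proof (rule exI[of _ "\<lambda>n j. c n j ()"], rule exI[of _ B], intro conjI allI impI)
    show "c 0 0 () \<theta> = arc_weight \<theta> * b \<theta>" for \<theta> by (simp add: c2)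
    show "0 \<le> B n j" "sin \<theta> > 0 \<Longrightarrow> cmod (c n j () \<theta>) \<le> B n j" for n j \<theta> using B by auto
    fix r :: "nat \<Rightarrow> real \<Rightarrow> complex" and n and \<theta> :: real assume r: "\<forall>j \<theta>. sin \<theta> > 0 \<longrightarrow> (r j has_vector_derivative of_real (arc_unit_deriv \<theta>) * r (Suc j) \<theta>) (at \<theta>)"
      and "sin \<theta> > 0"
    then show "((\<lambda>\<theta>. \<Sum>j\<le>n. c n j () \<theta> * r j \<theta>) has_vector_derivative (\<Sum>j\<le>Suc n. c (Suc n) j () \<theta> * r j \<theta>)) (at \<theta>)"
      by (intro c3[rule_format]) auto
  qed
qed

text \<open>Contains \<open>f\<close> divided by the weight together with its \<theta>-derivatives.
  The inverse weight explodes at the end points, which is harmless for the \<open>f\<close> in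
  question: its derivatives all vanish there, and so do the members
  (\<open>quotients_zero\<close>).\<close>

inductive_set quotients :: "(circle \<Rightarrow> complex) \<Rightarrow> (real \<Rightarrow> complex) set" for f where
  base: "b \<in> arc_coeffs \<Longrightarrow> (\<lambda>\<theta>. inverse (arc_weight \<theta>) * b \<theta> * circle_deriv j f \<theta>) \<in> quotients f"
| add: "r \<in> quotients f \<Longrightarrow> s \<in> quotients f \<Longrightarrow> (\<lambda>\<theta>. r \<theta> + s \<theta>) \<in> quotients f"

lemma quotients_mult:
  assumes "r \<in> quotients f" "b \<in> arc_coeffs"
  shows "(\<lambda>\<theta>. b \<theta> * r \<theta>) \<in> quotients f"
  using assms(1)
proof induction
  case (base b' j)
  have "(\<lambda>\<theta>. b \<theta> * (inverse (arc_weight \<theta>) * b' \<theta> * circle_deriv j f \<theta>)) =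
      (\<lambda>\<theta>. inverse (arc_weight \<theta>) * (b \<theta> * b' \<theta>) * circle_deriv j f \<theta>)" by (simp add: mult_ac)
  then show ?case using quotients.base[OF arc_coeffs.mult[OF assms(2) base]] by simp
next
  case (add r s)
  then show ?case using quotients.add[OF add.IH] by (simp add: distrib_left)
qed

lemma quotients_deriv:
  assumes f: "f \<in> smooth_circle" and "r \<in> quotients f"
  shows "\<exists>r'\<in>quotients f. \<forall>\<theta>. sin \<theta> > 0 \<longrightarrow> (r has_vector_derivative r' \<theta>) (at \<theta>)"
  using assms(2)
proof induction
  case (base b j)
  obtain b' where b': "b' \<in> arc_coeffs" "\<And>\<theta>. sin \<theta> > 0 \<Longrightarrow> (b has_vector_derivative b' \<theta>) (at \<theta>)"
    using arc_coeffs_deriv[OF base] by blast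
  let ?W = "\<lambda>\<theta>. inverse (arc_weight \<theta>)"
  let ?b1 = "\<lambda>\<theta>. (-1) * weight_logderiv \<theta> * b \<theta> + b' \<theta>"
  have b1: "?b1 \<in> arc_coeffs"
    by (intro arc_coeffs.add arc_coeffs.mult arc_coeffs.const weight_logderiv_coeffs base b')
  have "((\<lambda>\<theta>. ?W \<theta> * b \<theta> * circle_deriv j f \<theta>) has_vector_derivative
      ?W \<theta> * ?b1 \<theta> * circle_deriv j f \<theta> + ?W \<theta> * b \<theta> * circle_deriv (Suc j) f \<theta>) (at \<theta>)" if "sin \<theta> > 0" for \<theta>
    using has_vector_derivative_mult[OF has_vector_derivative_mult[OF inverse_arc_weight_deriv[OF that] b'(2)[OF that]]
      circle_deriv_has_vector_derivative[OF f, of j \<theta>]]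
    by (simp add: algebra_simps)
  then show ?case
    by (intro bexI[OF _ quotients.add[OF quotients.base[OF b1, of j] quotients.base[OF base, of "Suc j"]]]) auto
next
  case (add r s)
  then obtain r' s' where r: "r' \<in> quotients f" "\<And>\<theta>. sin \<theta> > 0 \<Longrightarrow> (r has_vector_derivative r' \<theta>) (at \<theta>)"
    and s: "s' \<in> quotients f" "\<And>\<theta>. sin \<theta> > 0 \<Longrightarrow> (s has_vector_derivative s' \<theta>) (at \<theta>)" by blast
  show ?case
    by (rule bexI[OF _ quotients.add[OF r(1) s(1)]]) (auto intro!: has_vector_derivative_add r s)
qed

lemma quotients_zero:
  assumes "r \<in> quotients f" "\<And>j. circle_deriv j f \<theta> = 0"
  shows "r \<theta> = 0"
  using assms(1) by induction (auto simp: assms(2))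

text \<open>The iterated derivatives with respect to \<omega> = \<open>arc_unit \<theta>\<close>.
  The function \<open>?v\<close> is d\<theta>/d\<omega>, which again belongs to
  \<open>arc_coeffs\<close>.\<close>

lemma quotient_sequence:
  assumes f: "f \<in> smooth_circle" and r0: "r0 \<in> quotients f"
  shows "\<exists>r. r 0 = r0 \<and> (\<forall>j. r j \<in> quotients f) \<and>
    (\<forall>j \<theta>. sin \<theta> > 0 \<longrightarrow> (r j has_vector_derivative of_real (arc_unit_deriv \<theta>) * r (Suc j) \<theta>) (at \<theta>))"
proof -
  let ?v = "\<lambda>\<theta>. of_real (- 4) * of_real (sin \<theta>) * of_real (exp (- 1 / 4 * arc_coord \<theta>)) *
    ((1 + of_real (exp (1 / 4 * arc_coord \<theta>))) * (1 + of_real (exp (1 / 4 * arc_coord \<theta>)))) :: complex"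
  have v: "?v \<in> arc_coeffs" by (intro arc_coeffs.intros) auto
  have inv: "of_real (arc_unit_deriv \<theta>) * ?v \<theta> = 1" if "sin \<theta> > 0" for \<theta>
  proof -
    define e where "e = exp (1 / 4 * arc_coord \<theta>)"
    have "e > 0" by (simp add: e_def)
    define p where "p = 1 + e"
    have e: "e \<noteq> 0" "p \<noteq> 0" using \<open>e > 0\<close> by (auto simp: p_def)
    have m: "exp (- 1 / 4 * arc_coord \<theta>) = inverse e" by (simp add: e_def exp_minus)
    have u: "arc_unit \<theta> = 1 / p" by (simp add: arc_unit_def e_def p_def)
    have "arc_unit_deriv \<theta> * (- 4 * sin \<theta> * inverse e * (p * p)) = 1"
      unfolding arc_unit_deriv_def e_def[symmetric] u using e that by (simp add: field_simps)
    then have "arc_unit_deriv \<theta> * (- 4 * sin \<theta> * inverse e * ((1 + e) * (1 + e))) = 1"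
      unfolding p_def .
    then have "complex_of_real (arc_unit_deriv \<theta> * (- 4 * sin \<theta> * inverse e * ((1 + e) * (1 + e)))) = 1" by simp
    then show ?thesis unfolding m e_def[symmetric] of_real_mult of_real_add of_real_1 .
  qed
  have "\<exists>s. s \<in> quotients f \<and> (\<forall>\<theta>. sin \<theta> > 0 \<longrightarrow> (r has_vector_derivative of_real (arc_unit_deriv \<theta>) * s \<theta>) (at \<theta>))"
    if r: "r \<in> quotients f" for r
  proof -
    obtain r' where r': "r' \<in> quotients f" "\<And>\<theta>. sin \<theta> > 0 \<Longrightarrow> (r has_vector_derivative r' \<theta>) (at \<theta>)"
      using quotients_deriv[OF f r] by blast
    show ?thesis
    proof (intro exI[of _ "\<lambda>\<theta>. ?v \<theta> * r' \<theta>"] conjI allI impI)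
      show "(\<lambda>\<theta>. ?v \<theta> * r' \<theta>) \<in> quotients f" by (rule quotients_mult[OF r'(1) v])
      fix \<theta> :: real assume s: "sin \<theta> > 0"
      have "x * (y * z) = z" if "x * y = 1" for x y z :: complex
        using that by (simp add: mult.assoc[symmetric])
      from this[OF inv[OF s]] r'(2)[OF s]
      show "(r has_vector_derivative of_real (arc_unit_deriv \<theta>) * (?v \<theta> * r' \<theta>)) (at \<theta>)"
        by (simp only:)
    qed
  qed
  then have "\<exists>r. \<forall>n. (r n \<in> quotients f \<and> (n = 0 \<longrightarrow> r n = r0)) \<and>
      (\<forall>\<theta>. sin \<theta> > 0 \<longrightarrow> (r n has_vector_derivative of_real (arc_unit_deriv \<theta>) * r (Suc n) \<theta>) (at \<theta>))"
    by (intro dependent_nat_choice) (use r0 in auto)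
  then show ?thesis by blast
qed

section \<open>Simultaneous polynomial approximation of a function and its derivatives\<close>

lemma poly_antiderivative:
  fixes q :: "complex poly"
  shows "\<exists>Q. pderiv Q = q \<and> poly Q 0 = 0"
proof -
  define Q where "Q = (\<Sum>i\<le>degree q. monom (coeff q i / of_nat (Suc i)) (Suc i))"
  have "pderiv (sum g A) = (\<Sum>i\<in>A. pderiv (g i))" for g :: "nat \<Rightarrow> complex poly" and A
    by (induction A rule: infinite_finite_induct) (simp_all add: pderiv_add)
  then have "pderiv Q = (\<Sum>i\<le>degree q. monom (coeff q i) i)"
    unfolding Q_def by (simp only: pderiv_monom) (rule sum.cong, simp_all del: of_nat_Suc)
  also have "\<dots> = q" by (rule poly_as_sum_of_monoms)
  finally show ?thesis by (intro exI[of _ Q]) (simp add: Q_def poly_sum poly_monom)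
qed

text \<open>The zeros at 0 are the initial conditions of the integrations in
  \<open>chain_approximation\<close>: the function approximated there vanishes near \<omega> =
  0.\<close>

lemma poly_iterated_antiderivative:
  fixes q :: "complex poly"
  shows "\<exists>Q. (pderiv ^^ N) Q = q \<and> (\<forall>i<N. poly ((pderiv ^^ i) Q) 0 = 0)"
proof (induction N arbitrary: q)
  case (Suc N)
  obtain q' where q': "pderiv q' = q" "poly q' 0 = 0" using poly_antiderivative by blast
  obtain Q where Q: "(pderiv ^^ N) Q = q'" "\<forall>i<N. poly ((pderiv ^^ i) Q) 0 = 0" using Suc by blast
  then show ?case using q' by (intro exI[of _ Q]) (auto simp: less_Suc_eq)
qed auto

lemma real_Weierstrass:
  fixes g :: "real \<Rightarrow> real"
  assumes "continuous_on {0..1} g" "e > 0"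
  shows "\<exists>q::complex poly. \<forall>x\<in>{0..1}. cmod (poly q (of_real x) - of_real (g x)) < e"
proof -
  obtain p where p: "real_polynomial_function p" "\<And>x. x \<in> {0..1} \<Longrightarrow> \<bar>g x - p x\<bar> < e"
    using Stone_Weierstrass_real_polynomial_function[of "{0..1}" g e] assms by auto
  then obtain a n where pa: "p = (\<lambda>x. \<Sum>i\<le>n. a i * x ^ i)"
    using real_polynomial_function_iff_sum by blast
  define q where "q = (\<Sum>i\<le>n. monom (complex_of_real (a i)) i)"
  have "poly q (of_real x) = of_real (p x)" for x
    unfolding q_def pa by (simp add: poly_sum poly_monom)
  then have "cmod (poly q (of_real x) - of_real (g x)) = \<bar>g x - p x\<bar>" for x
    by (metis abs_minus_commute norm_of_real of_real_diff)
  then show ?thesis using p(2) by (intro exI[of _ q]) auto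
qed

lemma complex_Weierstrass:
  fixes g :: "real \<Rightarrow> complex"
  assumes g: "continuous_on {0..1} g" and e: "e > 0"
  shows "\<exists>q::complex poly. \<forall>x\<in>{0..1}. cmod (poly q (of_real x) - g x) < e"
proof -
  have "continuous_on {0..1} (\<lambda>x. Re (g x))" "continuous_on {0..1} (\<lambda>x. Im (g x))"
    using g by (auto intro: continuous_intros)
  note Re_Im = this
  have e2: "e / 2 > 0" using e by simp
  obtain p where p: "\<And>x. x \<in> {0..1} \<Longrightarrow> cmod (poly p (of_real x) - of_real (Re (g x))) < e / 2"
    using real_Weierstrass[OF Re_Im(1) e2] by blast
  obtain q where q: "\<And>x. x \<in> {0..1} \<Longrightarrow> cmod (poly q (of_real x) - of_real (Im (g x))) < e / 2"
    using real_Weierstrass[OF Re_Im(2) e2] by blast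
  have "cmod (poly (p + smult \<i> q) (of_real x) - g x) < e" if x: "x \<in> {0..1}" for x
  proof -
    have "poly (p + smult \<i> q) (of_real x) - g x =
        (poly p (of_real x) - of_real (Re (g x))) + \<i> * (poly q (of_real x) - of_real (Im (g x)))"
      by (simp add: complex_eq_iff)
    also have "cmod \<dots> \<le> cmod (poly p (of_real x) - of_real (Re (g x))) + cmod (poly q (of_real x) - of_real (Im (g x)))"
      by (rule order_trans[OF norm_triangle_ineq]) (simp add: norm_mult)
    also have "\<dots> < e" using p[OF x] q[OF x] by simp
    finally show ?thesis .
  qed
  then show ?thesis by blast
qed

text \<open>The imaginary part attains a positive minimum on the compact support, so
  \<open>f\<close> vanishes on neighbourhoods of both end points.\<close>

lemma supp_upper_gap:
  assumes f: "f \<in> smooth_circle" and supp: "circle_supp f \<subseteq> upper_interval"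
  shows "\<exists>a>0. a < 1 \<and> (\<forall>\<theta> j. sin \<theta> < a \<longrightarrow> circle_deriv j f \<theta> = 0)"
proof -
  have "bounded (of_circle ` {z. f z \<noteq> 0})"
    by (rule bounded_subset[OF bounded_cball[of 0 1]]) auto
  then have comp: "compact (circle_supp f)" unfolding circle_supp_def by (simp add: compact_closure)
  have "\<exists>a>0. \<forall>w\<in>circle_supp f. a \<le> Im w"
  proof (cases "circle_supp f = {}")
    case False
    then obtain w0 where w0: "w0 \<in> circle_supp f" "\<And>w. w \<in> circle_supp f \<Longrightarrow> Im w0 \<le> Im w"
      using continuous_attains_inf[OF comp False, of Im] continuous_on_Im[OF continuous_on_id] by blast
    then show ?thesis using supp by (intro exI[of _ "Im w0"]) (auto simp: upper_interval_def)
  qed (auto intro: exI[of _ 1])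
  then obtain a where a: "a > 0" "\<And>w. w \<in> circle_supp f \<Longrightarrow> a \<le> Im w" by blast
  define b where "b = min a (1/2)"
  have z: "f z = 0" if "Im (of_circle z) < b" for z
  proof (rule ccontr)
    assume "f z \<noteq> 0"
    then have "of_circle z \<in> circle_supp f" unfolding circle_supp_def by (intro closure_subset[THEN subsetD]) auto
    then show False using a(2) that by (force simp: b_def)
  qed
  have "circle_deriv j f \<theta> = 0" if "sin \<theta> < b" for j \<theta>
    using that
  proof (induction j arbitrary: \<theta>)
    case 0
    then show ?case by (simp add: circle_deriv_0 z)
  next
    case (Suc n)
    have "open {\<theta>::real. sin \<theta> < b}" by (intro open_Collect_less continuous_intros)
    then have "((\<lambda>_. 0) has_vector_derivative circle_deriv (Suc n) f \<theta>) (at \<theta>)"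
      by (rule has_vector_derivative_transform_within_open[OF circle_deriv_has_vector_derivative[OF f, of n]])
        (use Suc in auto)
    moreover have "((\<lambda>_. 0 :: complex) has_vector_derivative 0) (at \<theta>)" by simp
    ultimately show ?case by (rule vector_derivative_unique_at)
  qed
  moreover have "b > 0" "b < 1" using a by (auto simp: b_def)
  ultimately show ?thesis by blast
qed

lemma circle_deriv_local:
  assumes f: "f \<in> smooth_circle" and S: "open S"
    and D0: "\<And>\<theta>. \<theta> \<in> S \<Longrightarrow> f (circle_cis \<theta>) = D 0 \<theta>"
    and D: "\<And>n \<theta>. \<theta> \<in> S \<Longrightarrow> (D n has_vector_derivative D (Suc n) \<theta>) (at \<theta>)"
    and \<theta>: "\<theta> \<in> S"
  shows "circle_deriv n f \<theta> = D n \<theta>"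
  using \<theta>
proof (induction n arbitrary: \<theta>)
  case 0
  then show ?case by (simp add: circle_deriv_0 D0)
next
  case (Suc n)
  have "(D n has_vector_derivative circle_deriv (Suc n) f \<theta>) (at \<theta>)"
    by (rule has_vector_derivative_transform_within_open[OF circle_deriv_has_vector_derivative[OF f, of n] S Suc.prems])
      (use Suc in auto)
  then show ?case using D[OF Suc.prems] by (rule vector_derivative_unique_at)
qed

text \<open>The inverse of \<open>arc_unit\<close>: \<omega> = 1/(1 + exp(x/4)) means exp(x/4) = (1
  - \<omega>)/\<omega>, and exp(x) = tan(\<theta>/2).\<close>

definition arc_angle :: "real \<Rightarrow> real" where
  "arc_angle \<omega> = 2 * arctan (((1 - \<omega>) / \<omega>) ^ 4)"

lemma arc_angle:
  assumes "0 < \<omega>" "\<omega> < 1"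
  shows "0 < arc_angle \<omega>" "arc_angle \<omega> < pi" "arc_unit (arc_angle \<omega>) = \<omega>"
proof -
  define u where "u = (1 - \<omega>) / \<omega>"
  have u: "u > 0" unfolding u_def using assms by simp
  show 1: "0 < arc_angle \<omega>" unfolding arc_angle_def u_def[symmetric] using u by (simp add: zero_less_arctan_iff)
  show 2: "arc_angle \<omega> < pi" unfolding arc_angle_def using arctan_ubound[of "((1 - \<omega>) / \<omega>) ^ 4"] by simp
  have "sin (arc_angle \<omega>) / (1 + cos (arc_angle \<omega>)) = tan (arc_angle \<omega> / 2)"
    by (simp add: tan_half add.commute)
  also have "\<dots> = u ^ 4" by (simp add: arc_angle_def tan_arctan u_def)
  finally have "arc_coord (arc_angle \<omega>) = ln (u ^ 4)" by (simp add: arc_coord_def)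
  also have "\<dots> = 4 * ln u" using u by (simp add: ln_realpow)
  finally have eu: "exp (arc_coord (arc_angle \<omega>) / 4) = u" using u by simp
  have "1 + u = 1 / \<omega>" using assms by (simp add: u_def field_simps)
  then show "arc_unit (arc_angle \<omega>) = \<omega>"
    unfolding arc_unit_def eu by simp
qed

lemma arc_angle_isCont: "0 < \<omega> \<Longrightarrow> isCont arc_angle \<omega>"
  unfolding arc_angle_def[abs_def] by (intro continuous_intros) auto

lemma arc_unit_gap:
  assumes "a > 0" "sin \<theta> \<ge> a"
  shows "1 / (1 + 2 / a) \<le> arc_unit \<theta>" "arc_unit \<theta> \<le> 1 - 1 / (1 + 2 / a)"
proof -
  have s: "sin \<theta> > 0" using assms by simp
  define e where "e = exp (arc_coord \<theta> / 4)"
  have e: "e > 0" by (simp add: e_def)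
  have "exp \<bar>arc_coord \<theta>\<bar> \<le> 2 / a"
    using exp_abs_arc_coord(1)[OF s] assms frac_le[of 2 2 a "sin \<theta>"] by simp
  moreover have "e \<le> exp \<bar>arc_coord \<theta>\<bar>" "1 / e \<le> exp \<bar>arc_coord \<theta>\<bar>"
    unfolding e_def by (auto simp: exp_minus[symmetric] inverse_eq_divide[symmetric])
  ultimately have le: "e \<le> 2 / a" "1 / e \<le> 2 / a" by linarith+
  have u: "arc_unit \<theta> = 1 / (1 + e)" by (simp add: arc_unit_def e_def)
  show "1 / (1 + 2 / a) \<le> arc_unit \<theta>" unfolding u using le e by (intro divide_left_mono) auto
  have pos: "0 < (1 + 2 / a) * (1 + 1 / e)" using e assms by (intro mult_pos_pos add_pos_pos) auto
  have "1 - 1 / (1 + e) = 1 / (1 + 1 / e)" using e by (simp add: field_simps)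
  also have "\<dots> \<ge> 1 / (1 + 2 / a)" using le by (intro divide_left_mono pos) auto
  finally show "arc_unit \<theta> \<le> 1 - 1 / (1 + 2 / a)" unfolding u by simp
qed

text \<open>Only the N-th \<omega>-derivative is approximated by Weierstrass; the lower ones follow
  by integrating from \<omega> = 0. As \<omega> ranges over an interval of length 1, no integration
  increases the error.\<close>

lemma chain_approximation:
  fixes r :: "nat \<Rightarrow> real \<Rightarrow> complex"
  assumes r: "\<And>j \<theta>. sin \<theta> > 0 \<Longrightarrow> (r j has_vector_derivative of_real (arc_unit_deriv \<theta>) * r (Suc j) \<theta>) (at \<theta>)"
    and a: "a > 0" "a < 1" and r0: "\<And>j \<theta>. sin \<theta> < a \<Longrightarrow> r j \<theta> = 0" and e: "e > 0"
  shows "\<exists>Q. \<forall>j\<le>N. \<forall>\<theta>. 0 < \<theta> \<and> \<theta> < pi \<longrightarrow>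
    cmod (poly ((pderiv ^^ j) Q) (of_real (arc_unit \<theta>)) - r j \<theta>) \<le> e"
proof -
  define \<epsilon> where "\<epsilon> = 1 / (1 + 2 / a)"
  have \<epsilon>: "\<epsilon> > 0" unfolding \<epsilon>_def using a by (simp add: add_pos_pos)
  \<comment> \<open>\<open>r N\<close> as a function of \<omega>, extended by 0; it is continuous on
    [0,1] since it vanishes near both ends.\<close>
  define k where "k \<omega> = (if 0 < \<omega> \<and> \<omega> < 1 then r N (arc_angle \<omega>) else 0)" for \<omega>
  have k0: "k \<omega> = 0" if "\<omega> < \<epsilon> \<or> 1 - \<epsilon> < \<omega>" for \<omega>
  proof (rule ccontr)
    assume "k \<omega> \<noteq> 0"
    then have \<omega>: "0 < \<omega>" "\<omega> < 1" "r N (arc_angle \<omega>) \<noteq> 0" by (auto simp: k_def split: if_splits)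
    then have "sin (arc_angle \<omega>) \<ge> a" using r0 not_less by blast
    from arc_unit_gap[OF a(1) this] that show False unfolding arc_angle(3)[OF \<omega>(1,2)] \<epsilon>_def by linarith
  qed
  have zero_cont: "isCont k \<omega>" if "open T" "\<omega> \<in> T" "\<And>x. x \<in> T \<Longrightarrow> k x = 0" for T \<omega>
  proof -
    have "\<forall>\<^sub>F x in nhds \<omega>. k x = 0" using eventually_nhds_in_open[OF that(1,2)] by eventually_elim (rule that(3))
    then have "isCont k \<omega> = isCont (\<lambda>_. 0 :: complex) \<omega>" by (rule isCont_cong)
    then show ?thesis by simp
  qed
  have "isCont k \<omega>" for \<omega>
  proof -
    consider "\<omega> < \<epsilon>" | "1 - \<epsilon> < \<omega>" | "0 < \<omega>" "\<omega> < 1" using \<epsilon> by linarith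
    then show ?thesis
    proof cases
      case 1
      then show ?thesis by (intro zero_cont[of "{..<\<epsilon>}"]) (auto intro: k0)
    next
      case 2
      then show ?thesis by (intro zero_cont[of "{1 - \<epsilon><..}"]) (auto intro: k0)
    next
      case 3
      have "sin (arc_angle \<omega>) > 0" using arc_angle[OF 3] by (intro sin_gt_zero)
      from has_vector_derivative_continuous[OF r[OF this, of N]]
      have "isCont (\<lambda>x. r N (arc_angle x)) \<omega>"
        by (rule isCont_o2[OF arc_angle_isCont[OF 3(1)]])
      moreover have "\<forall>\<^sub>F x in nhds \<omega>. k x = r N (arc_angle x)"
        using eventually_nhds_in_open[of "{0<..<1}" \<omega>] 3 by (auto elim!: eventually_mono simp: k_def)
      ultimately show ?thesis using isCont_cong by fastforce
    qed
  qed
  then have "continuous_on {0..1} k" by (simp add: continuous_at_imp_continuous_on)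
  from complex_Weierstrass[OF this e] obtain q where q: "\<And>x. x \<in> {0..1} \<Longrightarrow> cmod (poly q (of_real x) - k x) < e"
    by blast
  obtain Q where Q: "(pderiv ^^ N) Q = q" "\<And>i. i < N \<Longrightarrow> poly ((pderiv ^^ i) Q) 0 = 0"
    using poly_iterated_antiderivative by blast
  define E where "E j \<theta> = poly ((pderiv ^^ j) Q) (of_real (arc_unit \<theta>)) - r j \<theta>" for j \<theta>
  have Ed: "(E j has_vector_derivative of_real (arc_unit_deriv \<theta>) * E (Suc j) \<theta>) (at \<theta>)" if s: "sin \<theta> > 0" for j \<theta>
  proof -
    have "((\<lambda>\<theta>. poly ((pderiv ^^ j) Q) (of_real (arc_unit \<theta>))) has_vector_derivative
        of_real (arc_unit_deriv \<theta>) * poly (pderiv ((pderiv ^^ j) Q)) (of_real (arc_unit \<theta>))) (at \<theta>)"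
      using field_vector_diff_chain_at[OF has_vector_derivative_of_real_fun[OF arc_unit_has_deriv[OF s]] poly_DERIV]
      by (simp add: o_def)
    from has_vector_derivative_diff[OF this r[OF s, of j]] show ?thesis
      unfolding E_def[abs_def] by (simp add: right_diff_distrib)
  qed
  have angle: "arc_angle (arc_unit \<theta>) = \<theta>" if "0 < \<theta>" "\<theta> < pi" for \<theta>
  proof -
    have s: "sin \<theta> > 0" using that by (intro sin_gt_zero)
    have c: "1 + cos \<theta> > 0" by (rule one_plus_cos_pos) (use s in simp)
    have "1 + exp (arc_coord \<theta> / 4) > 0" by (simp add: add_pos_pos)
    then have "(1 - arc_unit \<theta>) / arc_unit \<theta> = exp (arc_coord \<theta> / 4)"
      unfolding arc_unit_def by (simp add: field_simps)
    then have "((1 - arc_unit \<theta>) / arc_unit \<theta>) ^ 4 = exp (arc_coord \<theta>)"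
      by (simp add: exp_of_nat_mult[symmetric])
    also have "\<dots> = sin \<theta> / (1 + cos \<theta>)" using s c by (simp add: arc_coord_def)
    also have "\<dots> = tan (\<theta> / 2)" by (simp add: tan_half add.commute)
    finally show ?thesis unfolding arc_angle_def using that by (simp add: arctan_tan)
  qed
  have "cmod (E j \<theta>) \<le> e" if "j \<le> N" "0 < \<theta>" "\<theta> < pi" for j \<theta>
    using that
  proof (induction arbitrary: \<theta> rule: inc_induct)
    case base
    have u: "0 < arc_unit \<theta>" "arc_unit \<theta> < 1" by (rule arc_unit_bounds)+
    then have "k (arc_unit \<theta>) = r N \<theta>" using angle base by (simp add: k_def)
    then show ?case using q[of "arc_unit \<theta>"] u by (simp add: E_def Q(1) less_imp_le)
  next
    case (step j)
    \<comment> \<open>The integration runs from \<theta> up to the angle of a small x > 0. There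
      \<open>r j\<close> is 0, so the error is the polynomial itself, which tends to its value 0 as
      x tends to 0. Since \<open>arc_unit\<close> decreases, \<open>- e * arc_unit\<close> is the
      majorant.\<close>
    have bd: "cmod (E j \<theta>) \<le> e * (1 - x) + cmod (poly ((pderiv ^^ j) Q) (of_real x))"
      if x: "0 < x" "x < 1" "arc_angle x > \<theta>" "sin (arc_angle x) < a" for x
    proof -
      let ?t = "arc_angle x"
      have ss: "sin s > 0" if "\<theta> \<le> s" "s \<le> ?t" for s
        using that step.prems arc_angle[OF x(1,2)] by (intro sin_gt_zero) auto
      have "norm (E j ?t - E j \<theta>) \<le> (- e * arc_unit ?t) - (- e * arc_unit \<theta>)"
      proof (rule differentiable_bound_general[OF x(3)])
        show "continuous_on {\<theta>..?t} (E j)"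
          by (intro continuous_at_imp_continuous_on ballI has_vector_derivative_continuous[OF Ed] ss) auto
        show "continuous_on {\<theta>..?t} (\<lambda>s. - e * arc_unit s)"
          by (intro continuous_intros continuous_at_imp_continuous_on ballI DERIV_isCont[OF arc_unit_has_deriv] ss) auto
        fix s assume s: "\<theta> < s" "s < ?t"
        then have sp: "sin s > 0" by (intro ss) auto
        show "(E j has_vector_derivative of_real (arc_unit_deriv s) * E (Suc j) s) (at s)" by (rule Ed[OF sp])
        show "((\<lambda>s. - e * arc_unit s) has_vector_derivative - e * arc_unit_deriv s) (at s)"
          using DERIV_cmult[OF arc_unit_has_deriv[OF sp], of "- e"] by (simp add: has_real_derivative_iff_has_vector_derivative)
        have "arc_unit_deriv s \<le> 0"
          unfolding arc_unit_deriv_def using sp arc_unit_bounds(1)[of s] by simp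
        moreover have "cmod (E (Suc j) s) \<le> e"
          by (rule step.IH) (use s step.prems arc_angle(2)[OF x(1,2)] in auto)
        ultimately show "norm (of_real (arc_unit_deriv s) * E (Suc j) s) \<le> - e * arc_unit_deriv s"
          using mult_left_mono[of "cmod (E (Suc j) s)" e "- arc_unit_deriv s"] by (simp add: norm_mult mult.commute)
      qed
      also have "\<dots> \<le> e * (1 - x)"
        using arc_unit_bounds(2)[of \<theta>] e arc_angle(3)[OF x(1,2)] by (simp add: algebra_simps)
      finally have "norm (E j ?t - E j \<theta>) \<le> e * (1 - x)" .
      moreover have "E j ?t = poly ((pderiv ^^ j) Q) (of_real x)"
        by (simp add: E_def r0[OF x(4)] arc_angle(3)[OF x(1,2)])
      ultimately show ?thesis using norm_triangle_ineq2[of "E j \<theta>" "E j ?t"] by (simp add: norm_minus_commute)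
    qed
    have lim: "((\<lambda>x. e * (1 - x) + cmod (poly ((pderiv ^^ j) Q) (of_real x))) \<longlongrightarrow>
        e * (1 - 0) + cmod (poly ((pderiv ^^ j) Q) (of_real 0))) (at_right 0)"
      by (intro tendsto_intros tendsto_poly)
    have at: "filterlim (\<lambda>x. ((1 - x) / x) ^ 4) at_top (at_right (0::real))" by real_asymp
    have "((\<lambda>x. 2 * arctan (((1 - x) / x) ^ 4)) \<longlongrightarrow> 2 * (pi / 2)) (at_right 0)"
      by (intro tendsto_intros filterlim_compose[OF tendsto_arctan_at_top at])
    then have ang: "(arc_angle \<longlongrightarrow> pi) (at_right 0)" by (simp add: arc_angle_def[abs_def])
    have e1: "\<forall>\<^sub>F x in at_right 0. arc_angle x > \<theta>" using order_tendstoD(1)[OF ang] step.prems by blast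
    have "((\<lambda>x. sin (arc_angle x)) \<longlongrightarrow> sin pi) (at_right 0)" by (intro tendsto_intros ang)
    then have e2: "\<forall>\<^sub>F x in at_right 0. sin (arc_angle x) < a" using order_tendstoD(2) a by fastforce
    have e3: "\<forall>\<^sub>F x in at_right (0::real). 0 < x \<and> x < 1"
      unfolding eventually_at_right_field by (intro exI[of _ 1]) auto
    have "\<forall>\<^sub>F x in at_right 0. cmod (E j \<theta>) \<le> e * (1 - x) + cmod (poly ((pderiv ^^ j) Q) (of_real x))"
      using e1 e2 e3 by eventually_elim (auto intro: bd)
    from tendsto_lowerbound[OF lim this] show ?case using Q(2)[OF step.hyps(2)] by simp
  qed
  then show ?thesis unfolding E_def by blast
qed

text \<open>Dividing \<open>f\<close> by \<open>arc_weight\<close> and sin(\<theta>)^(d-1) leaves a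
  function of \<omega> to be approximated by polynomials together with its \<omega>-derivatives; the
  bounded coefficients \<open>c\<close> carry this back to \<theta>-derivatives.\<close>

lemma nice_approximation:
  assumes f: "f \<in> smooth_circle" and supp: "circle_supp f \<subseteq> upper_interval"
  shows "\<exists>q. \<forall>N. (\<lambda>n. C_norm N (\<lambda>z. nice d (q n) 0 z - f z)) \<longlonglongrightarrow> 0"
proof -
  let ?s = "\<lambda>m \<theta>. complex_of_real (sin \<theta>) powi m"
  obtain a where a: "a > 0" "a < 1" and f0: "\<And>\<theta> j. sin \<theta> < a \<Longrightarrow> circle_deriv j f \<theta> = 0"
    using supp_upper_gap[OF f supp] by blast
  have fz: "f z = 0" if "Im (of_circle z) \<le> 0" for z
  proof -
    have "Im (of_circle z) = sin (Arg (of_circle z))"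
      using arg_cong[OF of_circle_cis[of "Arg (of_circle z)"], of Im] by simp
    then show ?thesis using f0[of "Arg (of_circle z)" 0] that a by (simp add: circle_deriv_0)
  qed
  have "(\<lambda>\<theta>. inverse (arc_weight \<theta>) * ?s (- (int d - 1)) \<theta> * circle_deriv 0 f \<theta>) \<in> quotients f"
    by (intro quotients.base sin_powi_coeffs)
  from quotient_sequence[OF f this] obtain r where
    r0: "r 0 = (\<lambda>\<theta>. inverse (arc_weight \<theta>) * ?s (- (int d - 1)) \<theta> * circle_deriv 0 f \<theta>)" and
    rq: "\<And>j. r j \<in> quotients f" and
    rd: "\<And>j \<theta>. sin \<theta> > 0 \<Longrightarrow> (r j has_vector_derivative of_real (arc_unit_deriv \<theta>) * r (Suc j) \<theta>) (at \<theta>)"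
    by (elim exE conjE) blast
  have rz: "r j \<theta> = 0" if "sin \<theta> < a" for j \<theta> by (rule quotients_zero[OF rq f0[OF that]])
  from weighted_chain_coefficients[OF sin_powi_coeffs[of "int d - 1"]] obtain c B where
    B: "\<And>n j. 0 \<le> B n j" "\<And>n j \<theta>. sin \<theta> > 0 \<Longrightarrow> cmod (c n j \<theta>) \<le> B n j" and
    c0: "\<And>\<theta>. c 0 0 \<theta> = arc_weight \<theta> * ?s (int d - 1) \<theta>" and
    c: "\<forall>r. (\<forall>j \<theta>. sin \<theta> > 0 \<longrightarrow> (r j has_vector_derivative of_real (arc_unit_deriv \<theta>) * r (Suc j) \<theta>) (at \<theta>)) \<longrightarrow>
      (\<forall>n \<theta>. sin \<theta> > 0 \<longrightarrow> ((\<lambda>\<theta>. \<Sum>j\<le>n. c n j \<theta> * r j \<theta>) has_vector_derivative (\<Sum>j\<le>Suc n. c (Suc n) j \<theta> * r j \<theta>)) (at \<theta>))"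
    by (elim exE conjE) blast
  \<comment> \<open>A diagonal choice: the N-th polynomial handles N derivatives within 1/(N + 1),
    so one sequence converges in all C^N norms.\<close>
  have "\<forall>N. \<exists>Q. \<forall>j\<le>N. \<forall>\<theta>. 0 < \<theta> \<and> \<theta> < pi \<longrightarrow>
      cmod (poly ((pderiv ^^ j) Q) (of_real (arc_unit \<theta>)) - r j \<theta>) \<le> 1 / real (Suc N)"
    by (rule allI, rule chain_approximation[of r a, OF _ a]) (use rd rz in auto)
  from choice[OF this] obtain q where q: "\<And>N j \<theta>. j \<le> N \<Longrightarrow> 0 < \<theta> \<Longrightarrow> \<theta> < pi \<Longrightarrow>
      cmod (poly ((pderiv ^^ j) (q N)) (of_real (arc_unit \<theta>)) - r j \<theta>) \<le> 1 / real (Suc N)" by blast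
  have \<tau>: "0 \<in> tau_strip" using pi_gt_zero by (simp add: tau_strip_def)
  have bd: "C_norm N (\<lambda>z. nice d (q M) 0 z - f z) \<le> (\<Sum>n\<le>N. \<Sum>j\<le>n. B n j) * (1 / real (Suc M))" if NM: "N \<le> M" for N M
  proof -
    let ?g = "\<lambda>z. nice d (q M) 0 z - f z"
    have g: "?g \<in> smooth_circle" by (intro smooth_circle_diff nice_smooth \<tau> f)
    define E where "E j \<theta> = poly ((pderiv ^^ j) (q M)) (of_real (arc_unit \<theta>)) - r j \<theta>" for j \<theta>
    have Ed: "(E j has_vector_derivative of_real (arc_unit_deriv \<theta>) * E (Suc j) \<theta>) (at \<theta>)" if s: "sin \<theta> > 0" for j \<theta>
    proof -
      have "((\<lambda>\<theta>. poly ((pderiv ^^ j) (q M)) (of_real (arc_unit \<theta>))) has_vector_derivative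
          of_real (arc_unit_deriv \<theta>) * poly (pderiv ((pderiv ^^ j) (q M))) (of_real (arc_unit \<theta>))) (at \<theta>)"
        using field_vector_diff_chain_at[OF has_vector_derivative_of_real_fun[OF arc_unit_has_deriv[OF s]] poly_DERIV]
        by (simp add: o_def)
      from has_vector_derivative_diff[OF this rd[OF s, of j]] show ?thesis
        unfolding E_def[abs_def] by (simp add: right_diff_distrib)
    qed
    define D where "D n \<theta> = (\<Sum>j\<le>n. c n j \<theta> * E j \<theta>)" for n \<theta>
    have Dd: "(D n has_vector_derivative D (Suc n) \<theta>) (at \<theta>)" if "sin \<theta> > 0" for n \<theta>
      unfolding D_def[abs_def] by (rule c[rule_format]) (use Ed that in auto)
    have D0: "?g (circle_cis \<theta>) = D 0 \<theta>" if s: "sin \<theta> > 0" for \<theta>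
    proof -
      have "arc_weight \<theta> * ?s (int d - 1) \<theta> * (inverse (arc_weight \<theta>) * ?s (- (int d - 1)) \<theta> * f (circle_cis \<theta>)) = f (circle_cis \<theta>)"
      proof -
        have "?s (int d - 1) \<theta> * ?s (- (int d - 1)) \<theta> = 1"
          using s by (simp add: power_int_add[symmetric])
        moreover have "arc_weight \<theta> * inverse (arc_weight \<theta>) = 1" by (simp add: arc_weight_def)
        ultimately show ?thesis by (metis (no_types, lifting) mult.assoc mult.commute mult_1)
      qed
      then show ?thesis
        using nice_circle_cis[OF s, of d "q M"] by (simp add: D_def c0 E_def r0 circle_deriv_0 right_diff_distrib)
    qed
    have "C_norm N ?g \<le> (\<Sum>n\<le>N. (\<Sum>j\<le>n. B n j) * (1 / real (Suc M)))"
    proof (rule C_norm_le)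
      fix n \<theta> assume n: "n \<le> N"
      have nn: "0 \<le> (\<Sum>j\<le>n. B n j) * (1 / real (Suc M))" using B by (intro mult_nonneg_nonneg sum_nonneg) auto
      show "cmod (circle_deriv n ?g \<theta>) \<le> (\<Sum>j\<le>n. B n j) * (1 / real (Suc M))"
      proof (cases "sin \<theta> > 0")
        case False
        have "circle_deriv n ?g \<theta> = 0"
          by (rule circle_deriv_eq_0[OF g]) (use False fz nice_zero in auto)
        then show ?thesis using nn by simp
      next
        case True
        define \<alpha> where "\<alpha> = arccos (cos \<theta>)"
        have \<alpha>: "0 < \<alpha>" "\<alpha> < pi" "cis \<alpha> = cis \<theta>" unfolding \<alpha>_def using arccos_upper[OF True] by auto
        have s\<alpha>: "sin \<alpha> > 0" using \<alpha> by (intro sin_gt_zero)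
        have "circle_deriv n ?g \<theta> = circle_deriv n ?g \<alpha>" by (rule circle_deriv_cong[OF g]) (simp add: \<alpha>)
        also have "\<dots> = D n \<alpha>"
          by (rule circle_deriv_local[OF g open_sin_pos, of D]) (use D0 Dd s\<alpha> in auto)
        also have "cmod \<dots> \<le> (\<Sum>j\<le>n. B n j * (1 / real (Suc M)))"
          unfolding D_def
        proof (rule order_trans[OF norm_sum], rule sum_mono)
          fix j assume "j \<in> {..n}"
          then have "cmod (E j \<alpha>) \<le> 1 / real (Suc M)"
            unfolding E_def using n NM by (intro q \<alpha>) auto
          then show "cmod (c n j \<alpha> * E j \<alpha>) \<le> B n j * (1 / real (Suc M))"
            unfolding norm_mult using B s\<alpha> by (intro mult_mono) auto
        qed
        finally show ?thesis by (simp only: sum_distrib_right)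
      qed
    qed
    then show ?thesis by (simp only: sum_distrib_right)
  qed
  have "(\<lambda>M. C_norm N (\<lambda>z. nice d (q M) 0 z - f z)) \<longlonglongrightarrow> 0" for N
  proof (rule tendsto_sandwich[OF _ _ tendsto_const])
    show "\<forall>\<^sub>F M in sequentially. 0 \<le> C_norm N (\<lambda>z. nice d (q M) 0 z - f z)"
      by (intro always_eventually allI C_norm_nonneg smooth_circle_diff nice_smooth \<tau> f)
    show "\<forall>\<^sub>F M in sequentially. C_norm N (\<lambda>z. nice d (q M) 0 z - f z) \<le> (\<Sum>n\<le>N. \<Sum>j\<le>n. B n j) * (1 / real (Suc M))"
      using eventually_ge_at_top[of N] by eventually_elim (rule bd)
    have "(\<lambda>M. 1 / real (Suc M)) \<longlonglongrightarrow> 0" using LIMSEQ_inverse_real_of_nat by (simp add: inverse_eq_divide)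
    then show "(\<lambda>M. (\<Sum>n\<le>N. \<Sum>j\<le>n. B n j) * (1 / real (Suc M))) \<longlonglongrightarrow> 0"
      by (rule tendsto_mult_right_zero)
  qed
  then show ?thesis by blast
qed

section \<open>Functions on the strip\<close>

definition pi_strip :: "complex set" where
  "pi_strip = {z. 0 \<le> Im z \<and> Im z \<le> pi}"

lemma strip_i_pi: "strip (\<i> * pi) = pi_strip"
proof
  show "strip (\<i> * pi) \<subseteq> pi_strip" by (auto simp: strip_def pi_strip_def)
  show "pi_strip \<subseteq> strip (\<i> * pi)"
  proof
    fix z assume "z \<in> pi_strip"
    then have "z = of_real (Re z) + of_real (Im z / pi) * (\<i> * pi)" "0 \<le> Im z / pi" "Im z / pi \<le> 1"
      by (auto simp: pi_strip_def complex_eq_iff)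
    then show "z \<in> strip (\<i> * pi)" unfolding strip_def by blast
  qed
qed

lemma strip_minus: "z \<in> strip (- \<tau>) \<longleftrightarrow> - z \<in> strip \<tau>"
proof -
  have "z = of_real t + of_real s * (- \<tau>) \<longleftrightarrow> - z = of_real (- t) + of_real s * \<tau>" for t s
    by (auto simp: algebra_simps)
  then have "z \<in> strip (- \<tau>) \<longleftrightarrow> (\<exists>t s. - z = of_real (- t) + of_real s * \<tau> \<and> 0 \<le> s \<and> s \<le> 1)"
    unfolding strip_def by simp
  also have "\<dots> \<longleftrightarrow> (\<exists>t s. - z = of_real t + of_real s * \<tau> \<and> 0 \<le> s \<and> s \<le> 1)"
    by (metis minus_minus)
  finally show ?thesis unfolding strip_def by simp
qed

lemma interior_pi_strip: "interior pi_strip = {z. 0 < Im z \<and> Im z < pi}"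
proof
  have "open {z. 0 < Im z \<and> Im z < pi}"
    by (intro open_Collect_conj open_Collect_less continuous_intros)
  then show "{z. 0 < Im z \<and> Im z < pi} \<subseteq> interior pi_strip"
    by (intro interior_maximal) (auto simp: pi_strip_def)
  show "interior pi_strip \<subseteq> {z. 0 < Im z \<and> Im z < pi}"
  proof
    fix z assume "z \<in> interior pi_strip"
    then obtain e where e: "e > 0" "ball z e \<subseteq> pi_strip" unfolding mem_interior by blast
    have "z + \<i> * of_real (e / 2) \<in> ball z e" "z - \<i> * of_real (e / 2) \<in> ball z e"
      using e(1) by (auto simp: dist_norm norm_mult)
    then have "z + \<i> * of_real (e / 2) \<in> pi_strip" "z - \<i> * of_real (e / 2) \<in> pi_strip" using e(2) by auto
    then show "z \<in> {z. 0 < Im z \<and> Im z < pi}" using e(1) by (auto simp: pi_strip_def)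
  qed
qed

lemma pi_strip_tau_strip: "pi_strip \<subseteq> tau_strip"
proof
  fix z assume "z \<in> pi_strip"
  then have "0 \<le> Im z" "Im z \<le> pi" by (auto simp: pi_strip_def)
  then have "\<bar>Im z - pi / 2\<bar> < 5 * pi / 8" using pi_gt_zero by linarith
  then show "z \<in> tau_strip" by (simp add: tau_strip_def)
qed

text \<open>The real line lies on the boundary of the domain of holomorphy, so the identity theorem
  applies only after Schwarz reflection, for which the zero boundary values are real. The top line
  follows by continuity.\<close>

lemma strip_zero_unique:
  assumes D: "continuous_on pi_strip D" "D holomorphic_on interior pi_strip"
    and zero: "\<And>t::real. D (of_real t) = 0" and z: "z \<in> pi_strip"
  shows "D z = 0"
proof -
  let ?S = "{z. \<bar>Im z\<bar> < pi}"
  define E where "E z = (if 0 \<le> Im z then D z else cnj (D (cnj z)))" for z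
  have hol: "E holomorphic_on ?S"
    unfolding E_def
  proof (rule Schwarz_reflection)
    show "open ?S" by (rule open_strip)
    show "cnj ` ?S \<subseteq> ?S" by auto
    show "D holomorphic_on (?S \<inter> {z. 0 < Im z})"
      by (rule holomorphic_on_subset[OF D(2)]) (auto simp: interior_pi_strip)
    show "continuous_on (?S \<inter> {z. 0 \<le> Im z}) D"
      by (rule continuous_on_subset[OF D(1)]) (auto simp: pi_strip_def)
    show "D z \<in> \<real>" if "z \<in> ?S" "z \<in> \<real>" for z using that zero by (auto elim!: Reals_cases)
  qed
  have conn: "connected ?S"
  proof -
    have "?S = {w. Im w < pi} \<inter> {w. Im w > - pi}" by auto
    then show ?thesis by (simp add: convex_connected convex_Int convex_halfspace_Im_lt convex_halfspace_Im_gt)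
  qed
  have "E w = 0" if "w \<in> ?S" for w
  proof (rule analytic_continuation[OF hol open_strip conn, of "range complex_of_real" 0 w])
    show "range complex_of_real \<subseteq> ?S" by auto
    show "0 \<in> ?S" by simp
    have "(0::complex) islimpt range complex_of_real"
    proof (rule islimptI)
      fix T assume T: "0 \<in> T" "open (T::complex set)"
      then obtain e where e: "e > 0" "ball 0 e \<subseteq> T" using openE by blast
      then show "\<exists>y\<in>range complex_of_real. y \<in> T \<and> y \<noteq> 0"
        by (intro bexI[of _ "complex_of_real (e / 2)"] rangeI) (auto simp: dist_norm subset_iff)
    qed
    then show "(0::complex) islimpt range complex_of_real" .
    show "E x = 0" if "x \<in> range complex_of_real" for x using that zero by (auto simp: E_def)
  qed (use that in auto)
  then have inner: "D w = 0" if "0 \<le> Im w" "Im w < pi" for w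
    using that pi_gt_zero E_def[of w] by (metis (no_types, lifting) abs_of_nonneg mem_Collect_eq)
  show ?thesis
  proof (cases "Im z < pi")
    case True
    then show ?thesis using inner z by (auto simp: pi_strip_def)
  next
    case False
    then have z: "Im z = pi" using z by (simp add: pi_strip_def)
    let ?w = "\<lambda>n. z - \<i> * of_real (1 / real (Suc n))"
    have w: "0 \<le> Im (?w n) \<and> Im (?w n) < pi" for n
    proof -
      have "1 / (1 + real n) \<le> 1" by simp
      then have "1 / (1 + real n) \<le> pi" using pi_gt3 by linarith
      then show ?thesis by (simp add: z)
    qed
    have "(\<lambda>n. 1 / real (Suc n)) \<longlonglongrightarrow> 0" using LIMSEQ_inverse_real_of_nat by (simp add: inverse_eq_divide)
    then have "?w \<longlonglongrightarrow> z - \<i> * of_real 0" by (intro tendsto_intros)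
    then have "(\<lambda>n. D (?w n)) \<longlonglongrightarrow> D z"
      by (intro continuous_on_tendsto_compose[OF D(1)]) (use w z in \<open>auto simp: pi_strip_def less_imp_le intro!: always_eventually\<close>)
    moreover have "(\<lambda>n. D (?w n)) = (\<lambda>n. 0)" using inner w by auto
    ultimately show ?thesis using LIMSEQ_unique tendsto_const by metis
  qed
qed

text \<open>The Gaussian factor in the growth hypothesis makes \<open>D\<close> smaller than any
  \<epsilon> on the vertical sides of a long rectangle, so the ordinary maximum principle
  suffices.\<close>

lemma strip_maximum:
  assumes D: "D holomorphic_on tau_strip"
    and growth: "\<And>z. z \<in> pi_strip \<Longrightarrow> cmod (D z) \<le> C * exp (K * \<bar>Re z\<bar> - (Re z)\<^sup>2)"
    and bd: "\<And>t::real. cmod (D (of_real t)) \<le> B" "\<And>t::real. cmod (D (\<i> * pi + of_real t)) \<le> B"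
    and z: "z \<in> pi_strip"
  shows "cmod (D z) \<le> B"
proof (rule field_le_epsilon)
  fix \<epsilon> :: real assume \<epsilon>: "\<epsilon> > 0"
  have B: "0 \<le> B" by (rule order_trans[OF norm_ge_zero bd(1)])
  have "((\<lambda>x. \<bar>C\<bar> * exp (K * x - x\<^sup>2)) \<longlongrightarrow> 0) at_top"
    by (rule tendsto_mult_right_zero) real_asymp
  then have "\<forall>\<^sub>F x in at_top. \<bar>C\<bar> * exp (K * x - x\<^sup>2) < \<epsilon>" using order_tendstoD(2) \<epsilon> by blast
  then obtain R0 where R0: "\<And>x. x \<ge> R0 \<Longrightarrow> \<bar>C\<bar> * exp (K * x - x\<^sup>2) < \<epsilon>"
    unfolding eventually_at_top_linorder by blast
  define R where "R = max R0 (\<bar>Re z\<bar> + 1)"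
  let ?S = "cbox (Complex (- R) 0) (Complex R pi)"
  have S: "?S \<subseteq> pi_strip" by (auto simp: in_cbox_complex_iff pi_strip_def)
  have R: "R > 0" "\<bar>Re z\<bar> \<le> R" "R \<ge> R0" unfolding R_def by auto
  show "cmod (D z) \<le> B + \<epsilon>"
  proof (rule maximum_modulus_frontier[of D ?S])
    show "D holomorphic_on interior ?S"
      using holomorphic_on_subset[OF D] S pi_strip_tau_strip interior_subset by blast
    show "continuous_on (closure ?S) D"
      using S pi_strip_tau_strip by (intro holomorphic_on_imp_continuous_on[OF holomorphic_on_subset[OF D]]) (auto simp: closure_closed)
    show "bounded ?S" by simp
    show "z \<in> ?S" using R z by (auto simp: in_cbox_complex_iff pi_strip_def abs_le_iff)
    fix w assume "w \<in> frontier ?S"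
    then have w: "w \<in> ?S" "w \<notin> box (Complex (- R) 0) (Complex R pi)" by (auto simp: frontier_cbox)
    then consider "Im w = 0" | "Im w = pi" | "\<bar>Re w\<bar> = R"
      using R by (fastforce simp: in_cbox_complex_iff in_box_complex_iff)
    then show "cmod (D w) \<le> B + \<epsilon>"
    proof cases
      case 1
      then have "w = of_real (Re w)" by (simp add: complex_eq_iff)
      then show ?thesis using bd(1)[of "Re w"] \<epsilon> by simp
    next
      case 2
      then have "w = \<i> * pi + of_real (Re w)" by (simp add: complex_eq_iff)
      then show ?thesis using bd(2)[of "Re w"] \<epsilon> by simp
    next
      case 3
      have "cmod (D w) \<le> C * exp (K * \<bar>Re w\<bar> - (Re w)\<^sup>2)" using growth w S by blast
      also have "\<dots> \<le> \<bar>C\<bar> * exp (K * R - R\<^sup>2)"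
        unfolding 3[symmetric] by (simp add: mult_right_mono)
      also have "\<dots> < \<epsilon>" by (rule R0[OF R(3)])
      finally show ?thesis using B by simp
    qed
  qed
qed

text \<open>After multiplication by exp(-z^2) the boundary errors \<delta> exp(t^2) become uniform,
  and the maximum principle makes the products uniformly Cauchy on the closed strip. The growth
  constants may depend on \<open>n\<close>: they justify the maximum principle but do not enter its
  bound.\<close>

lemma strip_limit:
  fixes G :: "nat \<Rightarrow> complex \<Rightarrow> complex" and b0 b1 :: "real \<Rightarrow> complex"
  assumes G: "\<And>n. G n holomorphic_on tau_strip"
    and growth: "\<And>n. \<exists>C K. \<forall>z\<in>pi_strip. cmod (G n z) \<le> C * exp (K * \<bar>Re z\<bar>)"
    and b0: "\<And>n t. cmod (G n (of_real t) - b0 t) \<le> \<delta> n * exp (t\<^sup>2)"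
    and b1: "\<And>n t. cmod (G n (\<i> * pi + of_real t) - b1 t) \<le> \<delta> n * exp (t\<^sup>2)"
    and \<delta>: "\<delta> \<longlonglongrightarrow> 0"
  shows "\<exists>g. continuous_on pi_strip g \<and> g holomorphic_on interior pi_strip \<and>
    (\<forall>t::real. g (of_real t) = b0 t) \<and> (\<forall>t::real. g (\<i> * pi + of_real t) = b1 t)"
proof -
  define H where "H n z = exp (- (z * z)) * G n z" for n z
  \<comment> \<open>|exp(-z^2)| = exp((Im z)^2 - (Re z)^2), and Im z is at most \<pi> on the
    strip.\<close>
  define E where "E = exp (pi\<^sup>2)"
  have E: "E \<ge> 1" by (simp add: E_def)
  have ex: "cmod (exp (- (z * z))) \<le> E * exp (- (Re z)\<^sup>2)" if "z \<in> pi_strip" for z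
  proof -
    have "(Im z)\<^sup>2 \<le> pi\<^sup>2" using that by (intro power_mono) (auto simp: pi_strip_def)
    then show ?thesis by (simp add: E_def norm_exp_eq_Re exp_add[symmetric] power2_eq_square)
  qed
  have \<delta>0: "\<delta> n \<ge> 0" for n
    using order_trans[OF norm_ge_zero b0[of n 0]] by simp
  have Hhol: "H n holomorphic_on tau_strip" for n
    unfolding H_def by (intro holomorphic_intros G)
  have diff: "cmod (H n z - H m z) \<le> E * (\<delta> n + \<delta> m)" if z: "z \<in> pi_strip" for n m z
  proof -
    obtain C K where CK: "\<And>z. z \<in> pi_strip \<Longrightarrow> cmod (G n z) \<le> C * exp (K * \<bar>Re z\<bar>)" using growth by blast
    obtain C' K' where CK': "\<And>z. z \<in> pi_strip \<Longrightarrow> cmod (G m z) \<le> C' * exp (K' * \<bar>Re z\<bar>)" using growth by blast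
    have bdd: "cmod (H n w - H m w) \<le> E * (\<delta> n + \<delta> m)"
      if w: "w \<in> pi_strip" and "cmod (G n w - b) \<le> \<delta> n * exp ((Re w)\<^sup>2)" "cmod (G m w - b) \<le> \<delta> m * exp ((Re w)\<^sup>2)" for w b
    proof -
      have "(G n w - b) - (G m w - b) = G n w - G m w" by simp
      then have "cmod (H n w - H m w) = cmod (exp (- (w * w))) * cmod ((G n w - b) - (G m w - b))"
        by (simp only: H_def right_diff_distrib[symmetric] norm_mult)
      also have "\<dots> \<le> (E * exp (- (Re w)\<^sup>2)) * (\<delta> n * exp ((Re w)\<^sup>2) + \<delta> m * exp ((Re w)\<^sup>2))"
        by (intro mult_mono ex[OF w] order_trans[OF norm_triangle_ineq4] add_mono that) (use E in auto)
      also have "\<dots> = E * (\<delta> n + \<delta> m)" by (simp add: exp_minus field_simps)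
      finally show ?thesis .
    qed
    show ?thesis
    proof (rule strip_maximum[of "\<lambda>z. H n z - H m z" "E * (\<bar>C\<bar> + \<bar>C'\<bar>)" "max \<bar>K\<bar> \<bar>K'\<bar>"])
      show "(\<lambda>z. H n z - H m z) holomorphic_on tau_strip" by (intro holomorphic_intros Hhol)
      show "z \<in> pi_strip" by (rule z)
      show "cmod (H n (of_real t) - H m (of_real t)) \<le> E * (\<delta> n + \<delta> m)" for t
        by (rule bdd[where b = "b0 t"]) (use b0[of _ t] in \<open>auto simp: pi_strip_def\<close>)
      show "cmod (H n (\<i> * pi + of_real t) - H m (\<i> * pi + of_real t)) \<le> E * (\<delta> n + \<delta> m)" for t
        by (rule bdd[where b = "b1 t"]) (use b1[of _ t] in \<open>auto simp: pi_strip_def\<close>)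
      fix w assume w: "w \<in> pi_strip"
      let ?M = "max \<bar>K\<bar> \<bar>K'\<bar>"
      have 1: "cmod (G n w) \<le> \<bar>C\<bar> * exp (?M * \<bar>Re w\<bar>)"
        by (rule order_trans[OF CK[OF w]]) (intro mult_mono, auto intro!: mult_right_mono)
      have 2: "cmod (G m w) \<le> \<bar>C'\<bar> * exp (?M * \<bar>Re w\<bar>)"
        by (rule order_trans[OF CK'[OF w]]) (intro mult_mono, auto intro!: mult_right_mono)
      have "cmod (H n w - H m w) = cmod (exp (- (w * w))) * cmod (G n w - G m w)"
        by (simp only: H_def right_diff_distrib[symmetric] norm_mult)
      also have "\<dots> \<le> (E * exp (- (Re w)\<^sup>2)) * (\<bar>C\<bar> * exp (?M * \<bar>Re w\<bar>) + \<bar>C'\<bar> * exp (?M * \<bar>Re w\<bar>))"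
        by (intro mult_mono ex[OF w] order_trans[OF norm_triangle_ineq4] add_mono 1 2) (use E in auto)
      also have "\<dots> = E * (\<bar>C\<bar> + \<bar>C'\<bar>) * exp (?M * \<bar>Re w\<bar> - (Re w)\<^sup>2)"
        by (simp add: exp_diff exp_minus field_simps)
      finally show "cmod (H n w - H m w) \<le> E * (\<bar>C\<bar> + \<bar>C'\<bar>) * exp (?M * \<bar>Re w\<bar> - (Re w)\<^sup>2)" .
    qed
  qed
  have "uniformly_Cauchy_on pi_strip H"
    unfolding uniformly_Cauchy_on_def
  proof (intro allI impI)
    fix e :: real assume e: "e > 0"
    have "\<forall>\<^sub>F n in sequentially. \<delta> n < e / (2 * E)"
      using order_tendstoD(2)[OF \<delta>, of "e / (2 * E)"] e E by simp
    then obtain M where M: "\<And>n. n \<ge> M \<Longrightarrow> \<delta> n < e / (2 * E)" unfolding eventually_sequentially by blast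
    show "\<exists>M. \<forall>x\<in>pi_strip. \<forall>m\<ge>M. \<forall>n\<ge>M. dist (H m x) (H n x) < e"
    proof (intro exI ballI allI impI)
      fix x m n assume x: "x \<in> pi_strip" and "M \<le> m" "M \<le> n"
      then have "\<delta> m + \<delta> n < e / (2 * E) + e / (2 * E)" using M by (intro add_strict_mono) auto
      then have "E * (\<delta> m + \<delta> n) < E * (e / (2 * E) + e / (2 * E))"
        using E by (intro mult_strict_left_mono) auto
      also have "\<dots> = e" using E by (simp add: field_simps)
      finally show "dist (H m x) (H n x) < e" using diff[OF x, of m n] by (simp add: dist_norm)
    qed
  qed
  then obtain h where h: "uniform_limit pi_strip H h sequentially"
    using Cauchy_uniformly_convergent uniformly_convergent_on_def by blast
  have hc: "continuous_on pi_strip h"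
    by (rule uniform_limit_theorem[OF _ h])
      (use holomorphic_on_imp_continuous_on[OF holomorphic_on_subset[OF Hhol pi_strip_tau_strip]] in \<open>auto intro!: always_eventually\<close>)
  have hh: "h holomorphic_on interior pi_strip"
  proof (rule holomorphic_uniform_sequence)
    show "open (interior pi_strip)" by simp
    show "H n holomorphic_on interior pi_strip" for n
      by (rule holomorphic_on_subset[OF Hhol]) (use interior_subset pi_strip_tau_strip in blast)
    fix x assume "x \<in> interior pi_strip"
    then obtain d where d: "d > 0" "cball x d \<subseteq> interior pi_strip"
      using open_contains_cball[of "interior pi_strip"] by auto
    then have "uniform_limit (cball x d) H h sequentially"
      using uniform_limit_on_subset[OF h] interior_subset[of pi_strip] by blast
    then show "\<exists>d>0. cball x d \<subseteq> interior pi_strip \<and> uniform_limit (cball x d) H h sequentially"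
      using d by blast
  qed
  have val: "exp (z * z) * h z = b"
    if z: "z \<in> pi_strip" and lim: "\<And>n. cmod (G n z - b) \<le> \<delta> n * exp ((Re z)\<^sup>2)" for z b
  proof -
    have "(\<lambda>n. H n z) \<longlonglongrightarrow> h z" by (rule tendsto_uniform_limitI[OF h z])
    then have "(\<lambda>n. exp (z * z) * H n z) \<longlonglongrightarrow> exp (z * z) * h z" by (intro tendsto_intros)
    moreover have "exp (z * z) * H n z = G n z" for n
      unfolding H_def by (simp add: mult.assoc[symmetric] exp_add[symmetric])
    ultimately have 1: "(\<lambda>n. G n z) \<longlonglongrightarrow> exp (z * z) * h z" by simp
    have "(\<lambda>n. G n z - b) \<longlonglongrightarrow> 0"
      by (rule Lim_null_comparison[of _ "\<lambda>n. \<delta> n * exp ((Re z)\<^sup>2)"])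
        (use lim tendsto_mult_left_zero[OF \<delta>] in auto)
    then have "(\<lambda>n. G n z) \<longlonglongrightarrow> b" by (simp add: LIM_zero_iff)
    with 1 show ?thesis by (rule LIMSEQ_unique)
  qed
  show ?thesis
  proof (intro exI[of _ "\<lambda>z. exp (z * z) * h z"] conjI allI)
    show "continuous_on pi_strip (\<lambda>z. exp (z * z) * h z)" by (intro continuous_intros hc)
    show "(\<lambda>z. exp (z * z) * h z) holomorphic_on interior pi_strip" by (intro holomorphic_intros hh)
    show "exp (of_real t * of_real t) * h (of_real t) = b0 t" for t
      by (rule val) (use b0 in \<open>auto simp: pi_strip_def\<close>)
    show "exp ((\<i> * pi + of_real t) * (\<i> * pi + of_real t)) * h (\<i> * pi + of_real t) = b1 t" for t
      by (rule val) (use b1 in \<open>auto simp: pi_strip_def\<close>)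
  qed
qed

section \<open>Rotations of test functions\<close>

lemma assumes f: "f \<in> smooth_circle"
  shows smooth_circle_rotation: "(\<lambda>z. f (rotation a z)) \<in> smooth_circle"
    and circle_deriv_rotation: "circle_deriv n (\<lambda>z. f (rotation a z)) \<theta> = circle_deriv n f (a + \<theta>)"
proof -
  let ?D = "\<lambda>n \<theta>. circle_deriv n f (a + \<theta>)"
  have 0: "?D 0 \<theta> = f (rotation a (circle_cis \<theta>))" for \<theta>
    by (simp add: circle_deriv_0 rotation_circle_cis)
  have *: "(?D n has_vector_derivative ?D (Suc n) \<theta>) (at \<theta>)" for n \<theta>
  proof -
    have "((\<lambda>\<theta>. a + \<theta>) has_vector_derivative 1) (at \<theta>)" by (auto intro!: derivative_eq_intros)
    from vector_diff_chain_at[OF this circle_deriv_has_vector_derivative[OF f, of n]]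
    show ?thesis by (simp add: o_def)
  qed
  show "(\<lambda>z. f (rotation a z)) \<in> smooth_circle" by (rule smooth_circleI[of ?D, OF 0 *])
  show "circle_deriv n (\<lambda>z. f (rotation a z)) \<theta> = ?D n \<theta>"
    using circle_deriv_eqI[of ?D, OF 0 *] by simp
qed

lemma C_norm_rotation:
  assumes f: "f \<in> smooth_circle"
  shows "C_norm N (\<lambda>z. f (rotation a z)) = C_norm N f"
proof (rule antisym)
  have *: "C_norm N (\<lambda>z. g (rotation b z)) \<le> C_norm N g" if g: "g \<in> smooth_circle" for g b
  proof -
    have "C_norm N (\<lambda>z. g (rotation b z)) \<le> (\<Sum>j\<le>N. SUP \<theta>. cmod (circle_deriv j g \<theta>))"
      by (rule C_norm_le, subst circle_deriv_rotation[OF g]) (simp add: circle_deriv_le_SUP[OF g])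
    then show ?thesis by (simp add: C_norm_def)
  qed
  show "C_norm N (\<lambda>z. f (rotation a z)) \<le> C_norm N f" by (rule *[OF f])
  show "C_norm N f \<le> C_norm N (\<lambda>z. f (rotation a z))"
    using *[OF smooth_circle_rotation[OF f, of a], of "- a"] by (simp add: rotation_comp rotation_0)
qed

lemma continuous_map_rotation:
  "continuous_map smooth_topology smooth_topology (\<lambda>f z. f (rotation a z))"
proof -
  let ?B = "{{g \<in> smooth_circle. C_norm N (\<lambda>z. g z - f z) < \<epsilon>} | f N \<epsilon>. f \<in> smooth_circle \<and> \<epsilon> > 0}"
  have "continuous_map smooth_topology (topology_generated_by ?B) (\<lambda>f z. f (rotation a z))"
  proof (rule continuous_on_generated_topo)
    fix W assume "W \<in> ?B"
    then obtain f N \<epsilon> where f: "f \<in> smooth_circle" "\<epsilon> > 0"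
      and W: "W = {g \<in> smooth_circle. C_norm N (\<lambda>z. g z - f z) < \<epsilon>}" by blast
    let ?f = "\<lambda>z. f (rotation (- a) z)"
    have f': "?f \<in> smooth_circle" by (rule smooth_circle_rotation[OF f(1)])
    have "C_norm N (\<lambda>z. g (rotation a z) - f z) = C_norm N (\<lambda>z. g z - ?f z)" if "g \<in> smooth_circle" for g
      using C_norm_rotation[OF smooth_circle_diff[OF that f'], of N a] by (simp add: rotation_comp rotation_0)
    then have "(\<lambda>f z. f (rotation a z)) -` W \<inter> topspace smooth_topology =
        {g \<in> smooth_circle. C_norm N (\<lambda>z. g z - ?f z) < \<epsilon>}"
      unfolding W topspace_smooth_topology using smooth_circle_rotation by auto
    then show "openin smooth_topology ((\<lambda>f z. f (rotation a z)) -` W \<inter> topspace smooth_topology)"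
      using openin_smooth_ball[OF f' f(2)] by simp
  next
    have "smooth_circle \<subseteq> \<Union>?B"
      using topspace_smooth_topology unfolding smooth_topology_def topology_generated_by_topspace by blast
    then show "(\<lambda>f z. f (rotation a z)) ` topspace smooth_topology \<subseteq> \<Union>?B"
      unfolding topspace_smooth_topology using smooth_circle_rotation by blast
  qed
  then show ?thesis unfolding smooth_topology_def .
qed

lemma of_circle_rotation_pi: "of_circle (rotation pi z) = - of_circle z"
  by (simp add: rotation.rep_eq)

text \<open>The rotation by \<pi> exchanges the two fixed points 1 and -1 of the boosts and so
  conjugates each boost to its inverse.\<close>

lemma rotation_pi_boost: "rotation pi \<circ> boost t = boost (- t) \<circ> rotation pi"
proof
  fix z show "(rotation pi \<circ> boost t) z = (boost (- t) \<circ> rotation pi) z"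
    unfolding o_apply
  proof (rule of_circle_eqI)
    have "of_circle (boost (- t) (rotation pi z)) =
        - (cosh (t / 2) * of_circle z - sinh (t / 2)) / (- sinh (t / 2) * of_circle z + cosh (t / 2))"
      by (simp add: of_circle_boost of_circle_rotation_pi)
    then show "of_circle (rotation pi (boost t z)) = of_circle (boost (- t) (rotation pi z))"
      by (simp only: of_circle_rotation_pi of_circle_boost minus_divide_left of_real_minus)
  qed
qed

lemma rotation_pi_inverse: "circle_inverse (rotation pi z) = rotation pi (circle_inverse z)"
  by (rule of_circle_eqI) (simp add: rotation.rep_eq circle_inverse.rep_eq)

lemma rotation_pi_twice: "rotation pi (rotation pi z) = z"
  by (rule of_circle_eqI) (simp add: of_circle_rotation_pi)

lemma circle_supp_rotation_pi:
  assumes "circle_supp f \<subseteq> lower_interval"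
  shows "circle_supp (\<lambda>z. f (rotation pi z)) \<subseteq> upper_interval"
proof -
  have "of_circle ` {z. f (rotation pi z) \<noteq> 0} \<subseteq> uminus ` (of_circle ` {z. f z \<noteq> 0})"
  proof
    fix w assume "w \<in> of_circle ` {z. f (rotation pi z) \<noteq> 0}"
    then obtain z where z: "w = of_circle z" "f (rotation pi z) \<noteq> 0" by blast
    then have "w = - of_circle (rotation pi z)" by (simp add: of_circle_rotation_pi)
    then show "w \<in> uminus ` (of_circle ` {z. f z \<noteq> 0})" using z by blast
  qed
  then have "of_circle ` {z. f (rotation pi z) \<noteq> 0} \<subseteq> uminus ` circle_supp f"
    unfolding circle_supp_def using image_mono[OF closure_subset] by (rule order_trans)
  then have "circle_supp (\<lambda>z. f (rotation pi z)) \<subseteq> uminus ` circle_supp f"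
    unfolding circle_supp_def by (intro closure_minimal closed_negations closed_closure)
  also have "\<dots> \<subseteq> upper_interval"
    using assms by (force simp: lower_interval_def upper_interval_def)
  finally show ?thesis .
qed

lemma field_product_rev:
  "field_product \<phi> f (rev [0..<k]) \<Phi> = field_product (\<lambda>j. \<phi> (k - 1 - j)) (\<lambda>j. f (k - 1 - j)) [0..<k] \<Phi>"
proof -
  have map: "field_product \<phi> f (map h js) \<Phi> = field_product (\<lambda>j. \<phi> (h j)) (\<lambda>j. f (h j)) js \<Phi>" for h js
    by (induction js) auto
  have "rev [0..<k] = map (\<lambda>j. k - 1 - j) [0..<k]"
    by (rule nth_equalityI) (auto simp: rev_nth)
  then show ?thesis by (simp add: map)
qed

context wightman_CFT
begin

section \<open>Continuation of products of fields\<close>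

text \<open>Covariance moves the boost into the test functions, where its growth is exponential;
  difference and size bounds of the product are then taken in one C^N norm.\<close>

lemma boost_product_diff_bound:
  assumes l: "l \<in> compatible_dual scaleC F"
    and \<phi>: "\<And>j. j < k \<Longrightarrow> \<phi> j \<in> F \<and> conformal_dimension U (\<phi> j) (d j)"
  shows "\<exists>C K N. 0 \<le> C \<and> (\<forall>t f g A \<delta>. 0 \<le> A \<longrightarrow> 0 \<le> \<delta> \<longrightarrow> (\<forall>j<k. f j \<in> smooth_circle \<and> g j \<in> smooth_circle \<and>
      C_norm N (f j) \<le> A \<and> C_norm N (g j) \<le> A \<and> C_norm N (\<lambda>z. f j z - g j z) \<le> \<delta>) \<longrightarrow>
    cmod (l (U (boost t) (field_product \<phi> f [0..<k] \<Omega>)) - l (U (boost t) (field_product \<phi> g [0..<k] \<Omega>)))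
      \<le> C * (A ^ (k - 1) * \<delta>) * exp (K * \<bar>t\<bar>))"
proof -
  obtain N C where C: "0 < C" and diff: "\<And>f g A \<delta>. 0 \<le> \<delta> \<Longrightarrow> (\<And>j. j < k \<Longrightarrow> f j \<in> smooth_circle \<and> g j \<in> smooth_circle \<and>
      C_norm N (f j) \<le> A \<and> C_norm N (g j) \<le> A \<and> C_norm N (\<lambda>z. f j z - g j z) \<le> \<delta>) \<Longrightarrow>
    cmod (l (field_product \<phi> f [0..<k] \<Omega>) - l (field_product \<phi> g [0..<k] \<Omega>)) \<le> C * (A ^ (k - 1) * \<delta>)"
    using dual_field_product_diff_bound[of l k \<phi> \<Omega>, OF l] \<phi> by blast
  have "\<forall>j. \<exists>c L. 0 \<le> c \<and> 0 \<le> L \<and> (\<forall>t. \<forall>f\<in>smooth_circle. moebius_beta (d j) (boost t) f \<in> smooth_circle \<and>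
    C_norm N (moebius_beta (d j) (boost t) f) \<le> c * exp (L * \<bar>t\<bar>) * C_norm N f)"
    using moebius_beta_boost_bound by blast
  then obtain c L where c: "\<And>j. 0 \<le> c j" "\<And>j. 0 \<le> L j"
    and beta: "\<And>j t f. f \<in> smooth_circle \<Longrightarrow> moebius_beta (d j) (boost t) f \<in> smooth_circle"
      "\<And>j t f. f \<in> smooth_circle \<Longrightarrow> C_norm N (moebius_beta (d j) (boost t) f) \<le> c j * exp (L j * \<bar>t\<bar>) * C_norm N f"
    by metis
  define B where "B = (\<Sum>j<k. c j)"
  define M where "M = (\<Sum>j<k. L j)"
  have B: "0 \<le> B" unfolding B_def by (intro sum_nonneg c)
  have le: "C_norm N (moebius_beta (d j) (boost t) f) \<le> B * exp (M * \<bar>t\<bar>) * x"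
    if "j < k" "f \<in> smooth_circle" "C_norm N f \<le> x" for j t f x
  proof -
    have "c j \<le> B" "L j \<le> M"
      unfolding B_def M_def using that(1) c by (auto intro!: member_le_sum)
    moreover from this have "exp (L j * \<bar>t\<bar>) \<le> exp (M * \<bar>t\<bar>)" by (auto intro!: mult_right_mono)
    ultimately have "c j * exp (L j * \<bar>t\<bar>) \<le> B * exp (M * \<bar>t\<bar>)"
      by (intro mult_mono B) auto
    then have "c j * exp (L j * \<bar>t\<bar>) * C_norm N f \<le> B * exp (M * \<bar>t\<bar>) * x"
      using that(3) C_norm_nonneg[OF that(2), of N] B by - (rule mult_mono, simp_all)
    then show ?thesis using beta(2)[OF that(2), of j t] by linarith
  qed
  \<comment> \<open>Each of the \<open>k - 1\<close> factors of size \<open>A\<close> and the one of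
    size \<delta> picks up one exponential. Writing \<open>Suc (k - 1)\<close> keeps this correct
    for \<open>k = 0\<close>, where the subtraction truncates.\<close>
  let ?C = "C * (B ^ (k - 1) * B)" and ?K = "real (Suc (k - 1)) * M"
  have "cmod (l (U (boost t) (field_product \<phi> f [0..<k] \<Omega>)) - l (U (boost t) (field_product \<phi> g [0..<k] \<Omega>)))
      \<le> ?C * (A ^ (k - 1) * \<delta>) * exp (?K * \<bar>t\<bar>)"
    if "0 \<le> A" "0 \<le> \<delta>" and fg: "\<forall>j<k. f j \<in> smooth_circle \<and> g j \<in> smooth_circle \<and>
      C_norm N (f j) \<le> A \<and> C_norm N (g j) \<le> A \<and> C_norm N (\<lambda>z. f j z - g j z) \<le> \<delta>" for t f g A \<delta>
  proof -
    let ?b = "\<lambda>f j. moebius_beta (d j) (boost t) (f j)"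
    let ?E = "B * exp (M * \<bar>t\<bar>)"
    have U: "U (boost t) (field_product \<phi> f [0..<k] \<Omega>) = field_product \<phi> (?b f) [0..<k] \<Omega>"
      "U (boost t) (field_product \<phi> g [0..<k] \<Omega>) = field_product \<phi> (?b g) [0..<k] \<Omega>"
      using fg \<phi> by (auto intro!: U_boost_product)
    have "cmod (l (field_product \<phi> (?b f) [0..<k] \<Omega>) - l (field_product \<phi> (?b g) [0..<k] \<Omega>))
        \<le> C * ((?E * A) ^ (k - 1) * (?E * \<delta>))"
    proof (rule diff)
      show "0 \<le> ?E * \<delta>" using B that(2) by simp
      fix j assume j: "j < k"
      have "(\<lambda>z. ?b f j z - ?b g j z) = moebius_beta (d j) (boost t) (\<lambda>z. f j z - g j z)"
        by (simp add: moebius_beta_def fun_eq_iff right_diff_distrib)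
      then show "?b f j \<in> smooth_circle \<and> ?b g j \<in> smooth_circle \<and>
          C_norm N (?b f j) \<le> ?E * A \<and> C_norm N (?b g j) \<le> ?E * A \<and>
          C_norm N (\<lambda>z. ?b f j z - ?b g j z) \<le> ?E * \<delta>"
        using fg j by (auto intro!: beta(1) le smooth_circle_diff)
    qed
    also have "\<dots> = ?C * (A ^ (k - 1) * \<delta>) * (exp (M * \<bar>t\<bar>) ^ Suc (k - 1))"
      by (simp add: power_mult_distrib mult_ac)
    also have "exp (M * \<bar>t\<bar>) ^ Suc (k - 1) = exp (?K * \<bar>t\<bar>)"
      by (simp only: exp_of_nat_mult[symmetric] mult.assoc)
    finally show ?thesis unfolding U .
  qed
  moreover have "0 \<le> ?C" using C B by simp
  ultimately show ?thesis by blast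
qed

text \<open>Puts the error into the form required by \<open>strip_limit\<close>: K|t| \<le> K^2 +
  t^2 trades the exponential for exp(t^2) at the cost of a constant.\<close>

lemma boost_product_limit:
  assumes l: "l \<in> compatible_dual scaleC F"
    and \<phi>: "\<And>j. j < k \<Longrightarrow> \<phi> j \<in> F \<and> conformal_dimension U (\<phi> j) (d j)"
    and f: "\<And>n j. j < k \<Longrightarrow> f n j \<in> smooth_circle" and g: "\<And>j. j < k \<Longrightarrow> g j \<in> smooth_circle"
    and lim: "\<And>j N. j < k \<Longrightarrow> (\<lambda>n. C_norm N (\<lambda>z. f n j z - g j z)) \<longlonglongrightarrow> 0"
  shows "\<exists>\<delta>. \<delta> \<longlonglongrightarrow> 0 \<and> (\<forall>n t. cmod (l (U (boost t) (field_product \<phi> (f n) [0..<k] \<Omega>))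
    - l (U (boost t) (field_product \<phi> g [0..<k] \<Omega>))) \<le> \<delta> n * exp (t\<^sup>2))"
proof -
  obtain C K N where C: "0 \<le> C" and bd: "\<And>t f g A \<delta>. 0 \<le> A \<Longrightarrow> 0 \<le> \<delta> \<Longrightarrow> (\<And>j. j < k \<Longrightarrow> f j \<in> smooth_circle \<and> g j \<in> smooth_circle \<and>
      C_norm N (f j) \<le> A \<and> C_norm N (g j) \<le> A \<and> C_norm N (\<lambda>z. f j z - g j z) \<le> \<delta>) \<Longrightarrow>
    cmod (l (U (boost t) (field_product \<phi> f [0..<k] \<Omega>)) - l (U (boost t) (field_product \<phi> g [0..<k] \<Omega>)))
      \<le> C * (A ^ (k - 1) * \<delta>) * exp (K * \<bar>t\<bar>)"
    using boost_product_diff_bound[of l k \<phi> d, OF l \<phi>] by blast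
  define \<epsilon> where "\<epsilon> n = (\<Sum>j<k. C_norm N (\<lambda>z. f n j z - g j z))" for n
  have \<epsilon>: "\<epsilon> \<longlonglongrightarrow> 0" unfolding \<epsilon>_def by (intro tendsto_null_sum lim) auto
  then have "Bseq \<epsilon>" using convergent_imp_Bseq convergent_def by blast
  then obtain M where "\<And>n. norm (\<epsilon> n) \<le> M" unfolding Bseq_def by blast
  then have M: "\<epsilon> n \<le> M" for n by (metis abs_le_D1 real_norm_def)
  have le: "C_norm N (\<lambda>z. f n j z - g j z) \<le> \<epsilon> n" if "j < k" for n j
    unfolding \<epsilon>_def
    by (rule member_le_sum[of j "{..<k}" "\<lambda>j. C_norm N (\<lambda>z. f n j z - g j z)"])
      (use that in \<open>auto intro!: C_norm_nonneg smooth_circle_diff f g\<close>)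
  have \<epsilon>0: "0 \<le> \<epsilon> n" for n
    unfolding \<epsilon>_def by (intro sum_nonneg C_norm_nonneg smooth_circle_diff f g) auto
  define A where "A = M + (\<Sum>j<k. C_norm N (g j))"
  have gle: "C_norm N (g j) \<le> (\<Sum>j<k. C_norm N (g j))" if "j < k" for j
    by (rule member_le_sum) (use that in \<open>auto intro!: C_norm_nonneg g\<close>)
  have "0 \<le> M" using order_trans[OF \<epsilon>0 M] .
  moreover have "0 \<le> (\<Sum>j<k. C_norm N (g j))" by (intro sum_nonneg C_norm_nonneg g) auto
  ultimately have A: "0 \<le> A" "M \<le> A" unfolding A_def by auto
  have gA: "C_norm N (g j) \<le> A" if "j < k" for j
    using gle[OF that] \<open>0 \<le> M\<close> unfolding A_def by simp
  have fA: "C_norm N (f n j) \<le> A" if "j < k" for n j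
    using C_norm_diff_triangle[OF f[OF that, of n] g[OF that], of N] le[OF that, of n] M[of n] gle[OF that]
    unfolding A_def by linarith
  let ?\<delta> = "\<lambda>n. C * (A ^ (k - 1) * \<epsilon> n) * exp (K\<^sup>2)"
  have "?\<delta> \<longlonglongrightarrow> 0" using \<epsilon> by (auto intro!: tendsto_eq_intros)
  moreover have "cmod (l (U (boost t) (field_product \<phi> (f n) [0..<k] \<Omega>))
    - l (U (boost t) (field_product \<phi> g [0..<k] \<Omega>))) \<le> ?\<delta> n * exp (t\<^sup>2)" for n t
  proof -
    have "K * \<bar>t\<bar> \<le> K\<^sup>2 + t\<^sup>2"
      using sum_squares_bound[of K "\<bar>t\<bar>"] sum_power2_ge_zero[of K t] unfolding power2_abs by linarith
    then have "exp (K * \<bar>t\<bar>) \<le> exp (K\<^sup>2) * exp (t\<^sup>2)" by (simp add: exp_add[symmetric])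
    then have "C * (A ^ (k - 1) * \<epsilon> n) * exp (K * \<bar>t\<bar>) \<le> C * (A ^ (k - 1) * \<epsilon> n) * (exp (K\<^sup>2) * exp (t\<^sup>2))"
      using C A \<epsilon>0[of n] by (intro mult_left_mono) auto
    moreover have "cmod (l (U (boost t) (field_product \<phi> (f n) [0..<k] \<Omega>))
      - l (U (boost t) (field_product \<phi> g [0..<k] \<Omega>))) \<le> C * (A ^ (k - 1) * \<epsilon> n) * exp (K * \<bar>t\<bar>)"
      by (rule bd[OF A(1) \<epsilon>0]) (use f g fA gA le in auto)
    ultimately show ?thesis by (simp add: mult.assoc)
  qed
  ultimately show ?thesis by blast
qed

text \<open>For products of nice functions both boundary values are known exactly: real translation
  is the boost, and on the upper line there is the reflection formula. The approximants of
  \<open>f\<close> converge on both lines, and \<open>strip_limit\<close> produces the continuation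
  with the limiting boundary values.\<close>

lemma product_continuation:
  assumes "\<forall>j<k. \<phi> j \<in> F \<and> conformal_dimension U (\<phi> j) (d j) \<and>
    f j \<in> smooth_circle \<and> circle_supp (f j) \<subseteq> upper_interval"
  shows "boost_continuation scaleC F U (\<i> * pi) (field_product \<phi> f [0..<k] \<Omega>)
    (scaleC ((-1) ^ (\<Sum>j<k. d j)) (field_product \<phi> (\<lambda>j. f j \<circ> circle_inverse) (rev [0..<k]) \<Omega>))"
  unfolding boost_continuation_def strip_i_pi
proof
  fix l assume l: "l \<in> compatible_dual scaleC F"
  have \<phi>: "\<phi> j \<in> F \<and> conformal_dimension U (\<phi> j) (d j)" and f: "f j \<in> smooth_circle"
    and supp: "circle_supp (f j) \<subseteq> upper_interval" if "j < k" for j using assms that by auto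
  have "\<exists>q. \<forall>j. j < k \<longrightarrow> (\<forall>N. (\<lambda>n. C_norm N (\<lambda>z. nice (d j) (q j n) 0 z - f j z)) \<longlonglongrightarrow> 0)"
    by (intro choice allI) (use nice_approximation[OF f supp] in blast)
  then obtain q where q: "\<And>j N. j < k \<Longrightarrow> (\<lambda>n. C_norm N (\<lambda>z. nice (d j) (q j n) 0 z - f j z)) \<longlonglongrightarrow> 0"
    by blast
  let ?s = "(-1) ^ (\<Sum>j<k. d j) :: complex"
  let ?n = "\<lambda>n \<tau> j. nice (d j) (q j n) \<tau>"
  define G where "G n \<tau> = l (field_product \<phi> (?n n \<tau>) [0..<k] \<Omega>)" for n \<tau>
  have 0: "0 \<in> tau_strip" "of_real t \<in> tau_strip" for t using pi_gt_zero by (auto simp: tau_strip_def)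
  have smooth0: "?n n 0 j \<in> smooth_circle" for n j by (rule nice_smooth[OF 0(1)])
  have translate: "moebius_beta (d j) (boost t) (?n n 0 j) = ?n n (of_real t) j" for t n j
    by (simp add: moebius_beta_nice)
  have G0: "G n (of_real t) = l (U (boost t) (field_product \<phi> (?n n 0) [0..<k] \<Omega>))" for n t
    using U_boost_product[of "[0..<k]" \<phi> d "?n n 0" t] \<phi> smooth0 by (simp add: G_def translate)
  let ?i = "\<lambda>f j. f j \<circ> circle_inverse"
  let ?R = "\<lambda>f. field_product \<phi> (?i f) (rev [0..<k]) \<Omega>"
  have lin: "l (U (boost t) (scaleC ?s x)) = ?s * l (U (boost t) x)" for t x
    by (simp add: linear_scale[OF U_linear[OF boost_Mob]] linear_scale[OF dual_linear[OF l]])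
  have G1: "G n (\<i> * pi + of_real t) = ?s * l (U (boost t) (?R (?n n 0)))" for n t
  proof -
    have "G n (\<i> * pi + of_real t) = ?s * l (?R (?n n (of_real t)))"
      unfolding G_def by (subst nice_product_reflection) (use \<phi> in \<open>auto simp: linear_scale[OF dual_linear[OF l]]\<close>)
    also have "?R (?n n (of_real t)) = U (boost t) (?R (?n n 0))"
      using U_boost_product[of "rev [0..<k]" \<phi> d "?i (?n n 0)" t] \<phi> smooth_circle_inverse[OF smooth0]
      by (simp add: moebius_beta_boost_inverse translate)
    finally show ?thesis .
  qed
  obtain \<delta>0 where \<delta>0: "\<delta>0 \<longlonglongrightarrow> 0" "\<And>n t. cmod (l (U (boost t) (field_product \<phi> (?n n 0) [0..<k] \<Omega>))
    - l (U (boost t) (field_product \<phi> f [0..<k] \<Omega>))) \<le> \<delta>0 n * exp (t\<^sup>2)"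
    using boost_product_limit[of l k \<phi> d "\<lambda>n. ?n n 0" f, OF l \<phi> smooth0 f q] by blast
  \<comment> \<open>The reversed product is rewritten as an ordinary one with index
    \<open>k - 1 - j\<close>, the form in which \<open>boost_product_limit\<close> is
    stated.\<close>
  have "\<exists>\<delta>. \<delta> \<longlonglongrightarrow> 0 \<and> (\<forall>n t. cmod (l (U (boost t) (?R (?n n 0))) - l (U (boost t) (?R f))) \<le> \<delta> n * exp (t\<^sup>2))"
    unfolding field_product_rev
  proof (rule boost_product_limit[where d = "\<lambda>j. d (k - 1 - j)", OF l])
    fix j assume "j < k"
    then have j: "k - 1 - j < k" by simp
    show "\<phi> (k - 1 - j) \<in> F \<and> conformal_dimension U (\<phi> (k - 1 - j)) (d (k - 1 - j))" by (rule \<phi>[OF j])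
    show "?i (?n n 0) (k - 1 - j) \<in> smooth_circle" for n by (rule smooth_circle_inverse[OF smooth0])
    show "?i f (k - 1 - j) \<in> smooth_circle" by (rule smooth_circle_inverse[OF f[OF j]])
    fix N
    show "(\<lambda>n. C_norm N (\<lambda>z. ?i (?n n 0) (k - 1 - j) z - ?i f (k - 1 - j) z)) \<longlonglongrightarrow> 0"
    proof (rule tendsto_sandwich[OF _ _ tendsto_const q[OF j, of N]])
      have s: "(\<lambda>z. ?n n 0 (k - 1 - j) z - f (k - 1 - j) z) \<in> smooth_circle" for n
        by (rule smooth_circle_diff[OF smooth0 f[OF j]])
      have eq: "(\<lambda>z. ?i (?n n 0) (k - 1 - j) z - ?i f (k - 1 - j) z) =
          (\<lambda>z. ?n n 0 (k - 1 - j) z - f (k - 1 - j) z) \<circ> circle_inverse" for n by auto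
      show "\<forall>\<^sub>F n in sequentially. 0 \<le> C_norm N (\<lambda>z. ?i (?n n 0) (k - 1 - j) z - ?i f (k - 1 - j) z)"
        unfolding eq by (intro always_eventually allI C_norm_nonneg smooth_circle_inverse s)
      show "\<forall>\<^sub>F n in sequentially. C_norm N (\<lambda>z. ?i (?n n 0) (k - 1 - j) z - ?i f (k - 1 - j) z)
          \<le> C_norm N (\<lambda>z. ?n n 0 (k - 1 - j) z - f (k - 1 - j) z)"
        unfolding eq by (intro always_eventually allI C_norm_inverse_le s)
    qed
  qed
  then obtain \<delta>1 where \<delta>1: "\<delta>1 \<longlonglongrightarrow> 0"
    "\<And>n t. cmod (l (U (boost t) (?R (?n n 0))) - l (U (boost t) (?R f))) \<le> \<delta>1 n * exp (t\<^sup>2)" by blast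
  let ?\<delta> = "\<lambda>n. \<bar>\<delta>0 n\<bar> + \<bar>\<delta>1 n\<bar>"
  have \<delta>: "\<delta>0 n * exp (t\<^sup>2) \<le> ?\<delta> n * exp (t\<^sup>2)" "\<delta>1 n * exp (t\<^sup>2) \<le> ?\<delta> n * exp (t\<^sup>2)" for n t
    by (auto intro!: mult_right_mono)
  have "\<exists>g. continuous_on pi_strip g \<and> g holomorphic_on interior pi_strip \<and>
    (\<forall>t::real. g (of_real t) = l (U (boost t) (field_product \<phi> f [0..<k] \<Omega>))) \<and>
    (\<forall>t::real. g (\<i> * pi + of_real t) = l (U (boost t) (scaleC ?s (?R f))))"
  proof (rule strip_limit[of G _ ?\<delta>])
    show "G n holomorphic_on tau_strip" for n
      unfolding G_def using nice_product_holomorphic[of l k \<phi> d "\<lambda>j. q j n" \<Omega>, OF l] \<phi> by blast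
    show "cmod (G n (of_real t) - l (U (boost t) (field_product \<phi> f [0..<k] \<Omega>))) \<le> ?\<delta> n * exp (t\<^sup>2)" for n t
      unfolding G0 by (rule order_trans[OF \<delta>0(2) \<delta>(1)])
    show "cmod (G n (\<i> * pi + of_real t) - l (U (boost t) (scaleC ?s (?R f)))) \<le> ?\<delta> n * exp (t\<^sup>2)" for n t
      unfolding G1 lin right_diff_distrib[symmetric] norm_mult norm_power
      using order_trans[OF \<delta>1(2) \<delta>(2), of t n] by simp
    show "?\<delta> \<longlonglongrightarrow> 0" using tendsto_add[OF tendsto_rabs[OF \<delta>0(1)] tendsto_rabs[OF \<delta>1(1)]] by simp
    fix n
    \<comment> \<open>The qualitative growth bound for fixed \<open>n\<close>: every factor grows at
      most like exp((N + 1)|Re \<tau>|) on the strip.\<close>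
    obtain N C where C: "0 < C" and bd: "\<And>f. (\<And>j. j < k \<Longrightarrow> f j \<in> smooth_circle) \<Longrightarrow>
        cmod (l (field_product \<phi> f [0..<k] \<Omega>)) \<le> C * (\<Prod>j<k. C_norm N (f j))"
      using dual_field_product_bound[of l k \<phi> \<Omega>, OF l] \<phi> by auto
    have "\<forall>j. \<exists>c\<ge>0. \<forall>\<tau>\<in>tau_strip. C_norm N (?n n \<tau> j) \<le> c * exp (real (Suc N) * \<bar>Re \<tau>\<bar>)"
      using nice_growth by blast
    then obtain c where c: "\<And>j. 0 \<le> c j"
      "\<And>j \<tau>. \<tau> \<in> tau_strip \<Longrightarrow> C_norm N (?n n \<tau> j) \<le> c j * exp (real (Suc N) * \<bar>Re \<tau>\<bar>)" by metis
    have "cmod (G n \<tau>) \<le> C * (\<Prod>j<k. c j) * exp (real k * real (Suc N) * \<bar>Re \<tau>\<bar>)" if "\<tau> \<in> pi_strip" for \<tau>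
    proof -
      have \<tau>: "\<tau> \<in> tau_strip" using that pi_strip_tau_strip by blast
      have "cmod (G n \<tau>) \<le> C * (\<Prod>j<k. C_norm N (?n n \<tau> j))"
        unfolding G_def by (rule bd) (rule nice_smooth[OF \<tau>])
      also have "\<dots> \<le> C * (\<Prod>j<k. c j * exp (real (Suc N) * \<bar>Re \<tau>\<bar>))"
        using C by (intro mult_left_mono prod_mono conjI c(2)[OF \<tau>] C_norm_nonneg nice_smooth[OF \<tau>]) auto
      also have "\<dots> = C * (\<Prod>j<k. c j) * exp (real (Suc N) * \<bar>Re \<tau>\<bar>) ^ k"
        by (simp only: prod.distrib prod_constant card_lessThan mult.assoc)
      also have "exp (real (Suc N) * \<bar>Re \<tau>\<bar>) ^ k = exp (real k * real (Suc N) * \<bar>Re \<tau>\<bar>)"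
        by (simp only: exp_of_nat_mult[symmetric] mult.assoc)
      finally show ?thesis .
    qed
    then show "\<exists>C K. \<forall>z\<in>pi_strip. cmod (G n z) \<le> C * exp (K * \<bar>Re z\<bar>)" by blast
  qed
  then show "\<exists>G. continuous_on pi_strip G \<and> G holomorphic_on interior pi_strip \<and>
      (\<forall>t. G (complex_of_real t) = l (U (boost t) (field_product \<phi> f [0..<k] \<Omega>))) \<and>
      (\<forall>t. G (\<i> * complex_of_real pi + complex_of_real t) = l (U (boost t) (scaleC ?s (?R f))))"
    by simp
qed

subsection \<open>Reflection to the lower interval\<close>

text \<open>Covariance passes the rotation through all fields onto the test functions, where it acts
  continuously; the vector at the right end is merely replaced by its rotated image.\<close>

lemma dual_rotation:
  assumes l: "l \<in> compatible_dual scaleC F"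
  shows "l \<circ> U (rotation a) \<in> compatible_dual scaleC F"
  unfolding compatible_dual_def
proof (intro CollectI conjI allI impI)
  show "Vector_Spaces.linear scaleC (*) (l \<circ> U (rotation a))"
    by (rule Vector_Spaces.linear_compose[OF U_linear[OF rotation_Mob] dual_linear[OF l]])
  fix k :: nat and \<phi> \<Phi> assume \<phi>: "\<forall>j<k. \<phi> j \<in> F"
  let ?T = "product_topology (\<lambda>_. smooth_topology) {..<k}"
  let ?\<rho> = "\<lambda>f z. f (rotation (- a) z) :: complex"
  let ?R = "\<lambda>f. \<lambda>j\<in>{..<k}. ?\<rho> (f j)"
  have "continuous_map ?T smooth_topology (\<lambda>f. ?\<rho> (f j))" if "j < k" for j
    using continuous_map_compose[OF continuous_map_product_projection[of j "{..<k}" "\<lambda>_. smooth_topology"]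
      continuous_map_rotation[of "- a"]] that by (simp add: o_def)
  then have R: "continuous_map ?T ?T ?R"
    by (auto simp: continuous_map_componentwise)
  have "continuous_map ?T euclidean (\<lambda>f. l (field_product \<phi> f [0..<k] (U (rotation a) \<Phi>)))"
    using l \<phi> by (simp add: compatible_dual_def)
  from continuous_map_compose[OF R this]
  show "continuous_map ?T euclidean (\<lambda>f. (l \<circ> U (rotation a)) (field_product \<phi> f [0..<k] \<Phi>))"
  proof (rule continuous_map_eq)
    fix f assume "f \<in> topspace ?T"
    then have f: "f j \<in> smooth_circle" if "j < k" for j using that by (auto simp: PiE_def Pi_def)
    have "U (rotation a) (field_product \<phi> f js \<Phi>) = field_product \<phi> (\<lambda>j. ?\<rho> (f j)) js (U (rotation a) \<Phi>)"
      if "set js \<subseteq> {..<k}" for js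
      using that
    proof (induction js)
      case (Cons j js)
      then have "j < k" by simp
      then obtain e where "conformal_dimension U (\<phi> j) e" using covariance \<phi> by blast
      then show ?case using U_rotation_covariant[of "\<phi> j" e "f j"] f[OF \<open>j < k\<close>] Cons by simp
    qed simp
    moreover have "field_product \<phi> (\<lambda>j. ?\<rho> (f j)) [0..<k] \<Psi> = field_product \<phi> (?R f) [0..<k] \<Psi>" for \<Psi>
      by (rule field_product_cong) simp
    ultimately show "((\<lambda>f. l (field_product \<phi> f [0..<k] (U (rotation a) \<Phi>))) \<circ> ?R) f =
        (l \<circ> U (rotation a)) (field_product \<phi> f [0..<k] \<Phi>)"
      by (simp add: subset_iff)
  qed
qed

text \<open>As the rotation by \<pi> inverts the boosts, a continuation \<open>G\<close> for the
  functional l \<circ> U(rotation) becomes one for \<open>l\<close> by z \<mapsto> -z, which also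
  reflects the strip.\<close>

lemma boost_continuation_rotation_pi:
  assumes "boost_continuation scaleC F U \<tau> \<Phi> \<Psi>"
  shows "boost_continuation scaleC F U (- \<tau>) (U (rotation pi) \<Phi>) (U (rotation pi) \<Psi>)"
  unfolding boost_continuation_def
proof
  fix l assume "l \<in> compatible_dual scaleC F"
  from bspec[OF assms[unfolded boost_continuation_def] dual_rotation[OF this, of pi]]
  obtain G where G: "continuous_on (strip \<tau>) G" "G holomorphic_on interior (strip \<tau>)"
    "\<And>t::real. G (of_real t) = l (U (rotation pi) (U (boost t) \<Phi>))"
    "\<And>t::real. G (\<tau> + of_real t) = l (U (rotation pi) (U (boost t) \<Psi>))"
    unfolding o_apply by blast
  have comm: "U (rotation pi) (U (boost t) x) = U (boost (- t)) (U (rotation pi) x)" for t x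
    using U_comp[OF rotation_Mob boost_Mob, of pi t] U_comp[OF boost_Mob rotation_Mob, of "- t" pi]
    by (simp add: rotation_pi_boost fun_eq_iff)
  have strip: "strip (- \<tau>) = uminus ` strip \<tau>" by (force simp: strip_minus image_iff)
  show "\<exists>G. continuous_on (strip (- \<tau>)) G \<and> G holomorphic_on interior (strip (- \<tau>)) \<and>
      (\<forall>t. G (complex_of_real t) = l (U (boost t) (U (rotation pi) \<Phi>))) \<and>
      (\<forall>t. G (- \<tau> + complex_of_real t) = l (U (boost t) (U (rotation pi) \<Psi>)))"
  proof (intro exI[of _ "\<lambda>z. G (- z)"] conjI allI)
    show "continuous_on (strip (- \<tau>)) (\<lambda>z. G (- z))"
      by (rule continuous_on_compose2[OF G(1)]) (auto simp: strip intro!: continuous_intros)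
    show "(\<lambda>z. G (- z)) holomorphic_on interior (strip (- \<tau>))"
      using holomorphic_on_compose_gen[OF holomorphic_on_minus[OF holomorphic_on_ident] G(2), of "interior (strip (- \<tau>))"]
      by (simp add: strip interior_negations o_def image_image)
    show "G (- of_real t) = l (U (boost t) (U (rotation pi) \<Phi>))" for t
      using G(3)[of "- t"] by (simp add: comm)
    show "G (- (- \<tau> + of_real t)) = l (U (boost t) (U (rotation pi) \<Psi>))" for t
      using G(4)[of "- t"] by (simp add: comm)
  qed
qed

section \<open>Uniqueness of the continued vector and the lower interval\<close>

lemma U_rotation_pi_twice: "U (rotation pi) (U (rotation pi) x) = x"
proof -
  have "rotation pi \<circ> rotation pi = id" by (simp add: fun_eq_iff rotation_pi_twice)
  then have "U (rotation pi) \<circ> U (rotation pi) = id" using U_comp[OF rotation_Mob rotation_Mob, of pi pi] U_id by simp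
  then show ?thesis by (metis comp_apply id_apply)
qed

text \<open>The two continuations agree on the real line, hence on the whole strip; the boundary
  value at t = 0 gives equality under every functional of a separating family.
  \<open>V_tilde\<close> is a definite description and depends on this.\<close>

lemma boost_continuation_unique_i_pi:
  assumes "boost_continuation scaleC F U (\<i> * pi) \<Phi> \<Psi>" "boost_continuation scaleC F U (\<i> * pi) \<Phi> \<Psi>'"
  shows "\<Psi> = \<Psi>'"
proof (rule dual_separates)
  fix l assume l: "l \<in> compatible_dual scaleC F"
  obtain G where G: "continuous_on pi_strip G" "G holomorphic_on interior pi_strip"
    "\<And>t::real. G (of_real t) = l (U (boost t) \<Phi>)" "\<And>t::real. G (\<i> * pi + of_real t) = l (U (boost t) \<Psi>)"
    using assms(1) l unfolding boost_continuation_def strip_i_pi by blast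
  obtain H where H: "continuous_on pi_strip H" "H holomorphic_on interior pi_strip"
    "\<And>t::real. H (of_real t) = l (U (boost t) \<Phi>)" "\<And>t::real. H (\<i> * pi + of_real t) = l (U (boost t) \<Psi>')"
    using assms(2) l unfolding boost_continuation_def strip_i_pi by blast
  have "G (\<i> * pi) - H (\<i> * pi) = 0"
  proof (rule strip_zero_unique[of "\<lambda>z. G z - H z"])
    show "\<i> * pi \<in> pi_strip" by (simp add: pi_strip_def)
  qed (auto intro!: continuous_intros holomorphic_intros G(1,2) H(1,2) simp: G(3) H(3))
  moreover have "boost 0 = id" by (auto simp: boost_0)
  ultimately show "l \<Psi> = l \<Psi>'" using G(4)[of 0] H(4)[of 0] by (simp add: U_id)
qed

lemma boost_continuation_unique:
  assumes "\<tau> = \<i> * pi \<or> \<tau> = - \<i> * pi"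
    and "boost_continuation scaleC F U \<tau> \<Phi> \<Psi>" "boost_continuation scaleC F U \<tau> \<Phi> \<Psi>'"
  shows "\<Psi> = \<Psi>'"
  using assms(1)
proof
  assume "\<tau> = \<i> * pi"
  then show ?thesis using assms boost_continuation_unique_i_pi by blast
next
  assume "\<tau> = - \<i> * pi"
  then have "U (rotation pi) \<Psi> = U (rotation pi) \<Psi>'"
    using boost_continuation_rotation_pi[OF assms(2)] boost_continuation_rotation_pi[OF assms(3)]
    by (intro boost_continuation_unique_i_pi) auto
  then show ?thesis by (metis U_rotation_pi_twice)
qed

text \<open>Rotating by \<pi> moves the supports to the upper arc, and rotating back changes the
  sign of \<tau>. Inversion of the circle commutes with this rotation, and rotation by -\<pi> equals
  rotation by \<pi>, so the reflected test functions come out as stated.\<close>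

lemma product_continuation_lower:
  assumes "\<forall>j<k. \<phi> j \<in> F \<and> conformal_dimension U (\<phi> j) (d j) \<and>
    f j \<in> smooth_circle \<and> circle_supp (f j) \<subseteq> lower_interval"
  shows "boost_continuation scaleC F U (- \<i> * pi) (field_product \<phi> f [0..<k] \<Omega>)
    (scaleC ((-1) ^ (\<Sum>j<k. d j)) (field_product \<phi> (\<lambda>j. f j \<circ> circle_inverse) (rev [0..<k]) \<Omega>))"
proof -
  let ?r = "\<lambda>f j z. f j (rotation pi z) :: complex"
  have "- pi + 2 * pi = pi" by simp
  then have minus: "rotation (- pi) z = rotation pi z" for z
    by (intro of_circle_eqI) (simp add: rotation.rep_eq complex_eq_iff)
  have rot: "U (rotation pi) (field_product \<phi> g js \<Omega>) = field_product \<phi> (?r g) js \<Omega>"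
    if "\<And>j. j \<in> set js \<Longrightarrow> j < k \<and> g j \<in> smooth_circle" for g js
    using that
  proof (induction js)
    case Nil
    then show ?case by (simp add: vacuum_invariant[OF rotation_Mob])
  next
    case (Cons j js)
    then have "conformal_dimension U (\<phi> j) (d j)" "g j \<in> smooth_circle" using assms by auto
    then show ?case using U_rotation_covariant[of "\<phi> j" "d j" "g j" pi] Cons by (simp add: minus)
  qed
  have "boost_continuation scaleC F U (\<i> * pi) (field_product \<phi> (?r f) [0..<k] \<Omega>)
    (scaleC ((-1) ^ (\<Sum>j<k. d j)) (field_product \<phi> (\<lambda>j. ?r f j \<circ> circle_inverse) (rev [0..<k]) \<Omega>))"
    by (rule product_continuation) (use assms smooth_circle_rotation circle_supp_rotation_pi in auto)
  from boost_continuation_rotation_pi[OF this]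
  have "boost_continuation scaleC F U (- \<i> * pi) (U (rotation pi) (field_product \<phi> (?r f) [0..<k] \<Omega>))
    (scaleC ((-1) ^ (\<Sum>j<k. d j)) (U (rotation pi) (field_product \<phi> (\<lambda>j. ?r f j \<circ> circle_inverse) (rev [0..<k]) \<Omega>)))"
    by (simp add: linear_scale[OF U_linear[OF rotation_Mob]])
  moreover have "U (rotation pi) (field_product \<phi> (?r f) [0..<k] \<Omega>) = field_product \<phi> f [0..<k] \<Omega>"
    by (subst rot) (use assms smooth_circle_rotation in \<open>auto simp: rotation_pi_twice\<close>)
  moreover have "U (rotation pi) (field_product \<phi> (\<lambda>j. ?r f j \<circ> circle_inverse) (rev [0..<k]) \<Omega>) =
      field_product \<phi> (\<lambda>j. f j \<circ> circle_inverse) (rev [0..<k]) \<Omega>"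
    by (subst rot) (use assms smooth_circle_inverse[OF smooth_circle_rotation] in
      \<open>auto simp: rotation_pi_twice rotation_pi_inverse o_def\<close>)
  ultimately show ?thesis by simp
qed

subsection \<open>The local algebras\<close>

lemma V_domain_subspace: "subspace (V_domain scaleC F U \<tau>)"
proof (rule subspaceI)
  have 0: "l (U (boost t) 0) = 0" if "l \<in> compatible_dual scaleC F" for l t
    by (simp add: linear_zero[OF U_linear[OF boost_Mob]] linear_zero[OF dual_linear[OF that]])
  have "boost_continuation scaleC F U \<tau> 0 0"
    unfolding boost_continuation_def by (intro ballI exI[of _ "\<lambda>z. 0"]) (simp add: 0)
  then show "0 \<in> V_domain scaleC F U \<tau>" unfolding V_domain_def by blast
next
  fix x y assume "x \<in> V_domain scaleC F U \<tau>" "y \<in> V_domain scaleC F U \<tau>"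
  then obtain x' y' where xy: "boost_continuation scaleC F U \<tau> x x'" "boost_continuation scaleC F U \<tau> y y'"
    unfolding V_domain_def by blast
  have add: "l (U (boost t) (u + v)) = l (U (boost t) u) + l (U (boost t) v)"
    if "l \<in> compatible_dual scaleC F" for l t u v
    by (simp add: linear_add[OF U_linear[OF boost_Mob]] linear_add[OF dual_linear[OF that]])
  have "boost_continuation scaleC F U \<tau> (x + y) (x' + y')"
    unfolding boost_continuation_def
  proof
    fix l assume l: "l \<in> compatible_dual scaleC F"
    obtain G where "continuous_on (strip \<tau>) G" "G holomorphic_on interior (strip \<tau>)"
      "\<forall>t::real. G (of_real t) = l (U (boost t) x)" "\<forall>t::real. G (\<tau> + of_real t) = l (U (boost t) x')"
      using xy(1) l unfolding boost_continuation_def by blast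
    moreover obtain H where "continuous_on (strip \<tau>) H" "H holomorphic_on interior (strip \<tau>)"
      "\<forall>t::real. H (of_real t) = l (U (boost t) y)" "\<forall>t::real. H (\<tau> + of_real t) = l (U (boost t) y')"
      using xy(2) l unfolding boost_continuation_def by blast
    ultimately show "\<exists>G. continuous_on (strip \<tau>) G \<and> G holomorphic_on interior (strip \<tau>) \<and>
        (\<forall>t::real. G (of_real t) = l (U (boost t) (x + y))) \<and>
        (\<forall>t::real. G (\<tau> + of_real t) = l (U (boost t) (x' + y')))"
      by (intro exI[of _ "\<lambda>z. G z + H z"] conjI continuous_on_add holomorphic_on_add)
        (simp_all add: add[OF l])
  qed
  then show "x + y \<in> V_domain scaleC F U \<tau>" unfolding V_domain_def by blast
next
  fix c x assume "x \<in> V_domain scaleC F U \<tau>"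
  then obtain x' where x: "boost_continuation scaleC F U \<tau> x x'" unfolding V_domain_def by blast
  have scale: "l (U (boost t) (scaleC c u)) = c * l (U (boost t) u)"
    if "l \<in> compatible_dual scaleC F" for l t u
    by (simp add: linear_scale[OF U_linear[OF boost_Mob]] linear_scale[OF dual_linear[OF that]])
  have "boost_continuation scaleC F U \<tau> (scaleC c x) (scaleC c x')"
    unfolding boost_continuation_def
  proof
    fix l assume l: "l \<in> compatible_dual scaleC F"
    obtain G where "continuous_on (strip \<tau>) G" "G holomorphic_on interior (strip \<tau>)"
      "\<forall>t::real. G (of_real t) = l (U (boost t) x)" "\<forall>t::real. G (\<tau> + of_real t) = l (U (boost t) x')"
      using x l unfolding boost_continuation_def by blast
    then show "\<exists>G. continuous_on (strip \<tau>) G \<and> G holomorphic_on interior (strip \<tau>) \<and>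
        (\<forall>t::real. G (of_real t) = l (U (boost t) (scaleC c x))) \<and>
        (\<forall>t::real. G (\<tau> + of_real t) = l (U (boost t) (scaleC c x')))"
      by (intro exI[of _ "\<lambda>z. c * G z"] conjI continuous_on_mult_left holomorphic_on_mult holomorphic_on_const)
        (simp_all add: scale[OF l])
  qed
  then show "scaleC c x \<in> V_domain scaleC F U \<tau>" unfolding V_domain_def by blast
qed

text \<open>Membership of A \<Omega> alone is not inductive for products of operators; the induction
  shows that each element of the algebra leaves the entire span invariant.\<close>

lemma local_algebra_vacuum:
  assumes "A \<in> local_algebra scaleC F I"
  shows "A \<Omega> \<in> span {field_product \<phi> f [0..<k] \<Omega> | k \<phi> f.
    \<forall>j<k. \<phi> j \<in> F \<and> f j \<in> smooth_circle \<and> circle_supp (f j) \<subseteq> I}"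
proof -
  let ?B = "{field_product \<phi> f [0..<k] \<Omega> | k \<phi> f.
    \<forall>j<k. \<phi> j \<in> F \<and> f j \<in> smooth_circle \<and> circle_supp (f j) \<subseteq> I}"
  have "\<forall>x\<in>span ?B. A x \<in> span ?B"
    using assms
  proof induction
    case (field \<psi> g)
    have lin: "Vector_Spaces.linear scaleC scaleC (\<psi> g)" by (rule field_linear[OF field(1,2)])
    have B: "\<psi> g x \<in> ?B" if x_B: "x \<in> ?B" for x
    proof -
      obtain k \<phi> f where x: "x = field_product \<phi> f [0..<k] \<Omega>"
        and f: "\<forall>j<k. \<phi> j \<in> F \<and> f j \<in> smooth_circle \<and> circle_supp (f j) \<subseteq> I" using x_B by blast
      \<comment> \<open>Puts the new field at index 0 and shifts the others, so that the result is
        again a product over an initial segment.\<close>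
      let ?\<phi> = "case_nat \<psi> \<phi>" and ?f = "case_nat g f"
      have "field_product ?\<phi> ?f (map Suc js) \<Omega> = field_product \<phi> f js \<Omega>" for js
        by (induction js) auto
      moreover have "[0..<Suc k] = 0 # map Suc [0..<k]" by (simp add: upt_conv_Cons map_Suc_upt del: upt_Suc)
      ultimately have "\<psi> g x = field_product ?\<phi> ?f [0..<Suc k] \<Omega>" unfolding x by simp
      moreover have "\<forall>j<Suc k. ?\<phi> j \<in> F \<and> ?f j \<in> smooth_circle \<and> circle_supp (?f j) \<subseteq> I"
        using f field by (auto split: nat.split)
      ultimately show ?thesis by (intro CollectI exI conjI)
    qed
    have "subspace {x. \<psi> g x \<in> span ?B}"
      by (rule subspaceI)
        (simp_all add: linear_zero[OF lin] linear_add[OF lin] linear_scale[OF lin] span_zero span_add span_scale)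
    then have "span ?B \<subseteq> {x. \<psi> g x \<in> span ?B}"
      by (intro span_minimal subsetI) (rule CollectI, rule span_base, erule B)
    then show ?case by blast
  qed (simp_all add: span_add span_scale)
  moreover have "\<Omega> \<in> ?B"
    by (rule CollectI, rule exI[of _ 0]) simp
  ultimately show ?thesis by (rule bspec[OF _ span_base])
qed

text \<open>Common to both intervals: the continuation of products gives the formula by uniqueness,
  and its extension from products to the algebra uses that the domain is a subspace. For the domain
  statement the dimensions are chosen by the covariance axiom.\<close>

lemma V_domain_V_tilde:
  assumes \<tau>: "\<tau> = \<i> * pi \<or> \<tau> = - \<i> * pi"
    and cont: "\<And>k \<phi> d f. \<forall>j<k. \<phi> j \<in> F \<and> conformal_dimension U (\<phi> j) (d j) \<and>
        f j \<in> smooth_circle \<and> circle_supp (f j) \<subseteq> I \<Longrightarrow>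
      boost_continuation scaleC F U \<tau> (field_product \<phi> f [0..<k] \<Omega>)
        (scaleC ((-1) ^ (\<Sum>j<k. d j)) (field_product \<phi> (\<lambda>j. f j \<circ> circle_inverse) (rev [0..<k]) \<Omega>))"
  shows "(\<forall>A\<in>local_algebra scaleC F I. A \<Omega> \<in> V_domain scaleC F U \<tau>) \<and>
    (\<forall>k \<phi> d f. (\<forall>j<k. \<phi> j \<in> F \<and> conformal_dimension U (\<phi> j) (d j) \<and>
          f j \<in> smooth_circle \<and> circle_supp (f j) \<subseteq> I) \<longrightarrow>
       V_tilde scaleC F U \<tau> (field_product \<phi> f [0..<k] \<Omega>) =
         scaleC ((-1) ^ (\<Sum>j<k. d j))
           (field_product \<phi> (\<lambda>j. f j \<circ> circle_inverse) (rev [0..<k]) \<Omega>))"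
proof (intro conjI ballI allI impI)
  fix A assume A: "A \<in> local_algebra scaleC F I"
  let ?B = "{field_product \<phi> f [0..<k] \<Omega> | k \<phi> f.
    \<forall>j<k. \<phi> j \<in> F \<and> f j \<in> smooth_circle \<and> circle_supp (f j) \<subseteq> I}"
  have "?B \<subseteq> V_domain scaleC F U \<tau>"
  proof clarify
    fix k :: nat and \<phi> f assume *: "\<forall>j<k. \<phi> j \<in> F \<and> f j \<in> smooth_circle \<and> circle_supp (f j) \<subseteq> I"
    have "\<forall>j. \<exists>d. j < k \<longrightarrow> conformal_dimension U (\<phi> j) d" using covariance * by blast
    then obtain d where d: "\<And>j. j < k \<Longrightarrow> conformal_dimension U (\<phi> j) (d j)" by metis
    show "field_product \<phi> f [0..<k] \<Omega> \<in> V_domain scaleC F U \<tau>"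
      unfolding V_domain_def using cont[of k \<phi> d f] * d by blast
  qed
  then show "A \<Omega> \<in> V_domain scaleC F U \<tau>"
    using local_algebra_vacuum[OF A] span_minimal[OF _ V_domain_subspace] by blast
next
  fix k :: nat and \<phi> d f assume "\<forall>j<k. \<phi> j \<in> F \<and> conformal_dimension U (\<phi> j) (d j) \<and>
    f j \<in> smooth_circle \<and> circle_supp (f j) \<subseteq> I"
  note * = cont[OF this]
  show "V_tilde scaleC F U \<tau> (field_product \<phi> f [0..<k] \<Omega>) =
      scaleC ((-1) ^ (\<Sum>j<k. d j)) (field_product \<phi> (\<lambda>j. f j \<circ> circle_inverse) (rev [0..<k]) \<Omega>)"
    unfolding V_tilde_def by (rule the_equality, rule *) (rule boost_continuation_unique[OF \<tau> _ *])
qed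

end

theorem theorem1:
  fixes scaleC :: "complex \<Rightarrow> 'v::ab_group_add \<Rightarrow> 'v"
    and F :: "'v distribution set"
    and U :: "(circle \<Rightarrow> circle) \<Rightarrow> 'v \<Rightarrow> 'v"
    and \<Omega> :: 'v
  assumes "wightman_CFT scaleC F U \<Omega>"
  shows "((\<forall>A\<in>local_algebra scaleC F upper_interval. A \<Omega> \<in> V_domain scaleC F U (\<i> * pi)) \<and>
      (\<forall>k \<phi> d f. (\<forall>j<k. \<phi> j \<in> F \<and> conformal_dimension U (\<phi> j) (d j) \<and>
            f j \<in> smooth_circle \<and> circle_supp (f j) \<subseteq> upper_interval) \<longrightarrow>
         V_tilde scaleC F U (\<i> * pi) (field_product \<phi> f [0..<k] \<Omega>) =
           scaleC ((-1) ^ (\<Sum>j<k. d j))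
             (field_product \<phi> (\<lambda>j. f j \<circ> circle_inverse) (rev [0..<k]) \<Omega>)))
    \<and> ((\<forall>A\<in>local_algebra scaleC F lower_interval. A \<Omega> \<in> V_domain scaleC F U (- \<i> * pi)) \<and>
      (\<forall>k \<phi> d f. (\<forall>j<k. \<phi> j \<in> F \<and> conformal_dimension U (\<phi> j) (d j) \<and>
            f j \<in> smooth_circle \<and> circle_supp (f j) \<subseteq> lower_interval) \<longrightarrow>
         V_tilde scaleC F U (- \<i> * pi) (field_product \<phi> f [0..<k] \<Omega>) =
           scaleC ((-1) ^ (\<Sum>j<k. d j))
             (field_product \<phi> (\<lambda>j. f j \<circ> circle_inverse) (rev [0..<k]) \<Omega>)))"
proof -
  interpret wightman_CFT scaleC F U \<Omega> by (rule assms)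
  show ?thesis
    using V_domain_V_tilde[OF disjI1[OF refl] product_continuation]
      V_domain_V_tilde[OF disjI2[OF refl] product_continuation_lower] by (rule conjI)
qed

end
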